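(* Let $\sigma_0>0$, $\alpha_0\in\mathbb{R}$. The capillary two-dimensional drop equations with constant vorticity $\alpha_0$, $$\partial_t\xi=e^{-2\xi}\Big[G(\xi)\chi+\frac{\alpha_0}{2}e^{2\xi}\xi'\Big],$$ $$\partial_t\chi=e^{-2\xi}\Big[\frac12\Big(\frac{G(\xi)\chi+\xi'\chi'}{\sqrt{1+\xi'^2}}\Big)^2-\frac12\chi'^2+\sigma_0e^{\xi}\Big(\Big(\frac{\xi'}{\sqrt{1+\xi'^2}}\Big)'-\frac1{\sqrt{1+\xi'^2}}\Big)\Big]+\frac{\alpha_0}{2}\chi'+\frac{\alpha_0^2}{8}e^{2\xi}+\alpha_0K(\xi)\chi+\sigma_0-\frac{\alpha_0^2}{8},$$ for $(t,\theta)\in\mathbb{R}\times\mathbb{T}^1$, where $\chi$ (and hence the second equation) is considered modulo functions independent of $\theta$, can be written as $$\partial_t\begin{pmatrix}\xi\\\chi\end{pmatrix}=J_{\alpha_0}(\xi)\nabla\mathcal{H}(\xi,\chi),\qquad J_{\alpha_0}(\xi):=\begin{pmatrix}0&e^{-2\xi}\\-e^{-2\xi}&\alpha_0\partial_\theta^{-1}\Pi_0^\perp\end{pmatrix},$$ where $$\mathcal{H}(\xi,\chi)=\frac12\int_{\mathbb{T}^1}\chi\,G(\xi)\chi\,d\theta+\sigma_0\int_{\mathbb{T}^1}e^{\xi}\sqrt{1+\xi'^2}\,d\theta-\Big(\sigma_0-\frac{\alpha_0^2}{8}\Big)\frac12\int_{\mathbb{T}^1}e^{2\xi}\,d\thet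a-\frac{\alpha_0}{4}\int_{\mathbb{T}^1}e^{2\xi}\chi'\,d\theta+\frac{\alpha_0^2}{32}\int_{\mathbb{T}^1}e^{4\xi}\,d\theta.$$
   Context: $\mathbb{T}^1=\mathbb{R}/2\pi\mathbb{Z}$; prime is $\partial_\theta$; all functions are smooth enough. $\nabla$ is the $L^2(\mathbb{T}^1)\times L^2(\mathbb{T}^1)$ gradient. $\Pi_0^\perp$ is the $L^2$-projector onto zero-average functions and $\partial_\theta^{-1}$ the indefinite integral operator on zero-average functions (with zero-average output). $G(\xi)\chi(\theta)=(\partial_\rho\tilde\Phi-\xi'\partial_\theta\tilde\Phi)(\xi(\theta),\theta)$, where $\tilde\Phi$ is harmonic in $\{(\rho,\theta):\theta\in\mathbb{T}^1,\rho<\xi(\theta)\}$, $\tilde\Phi(\xi(\theta),\theta)=\chi(\theta)$, $\partial_\rho\tilde\Phi\to0$ as $\rho\to-\infty$. With $\mathcal{J}=\begin{pmatrix}0&-1\\1&0\end{pmatrix}$ and $\Phi(e^\rho\cos\theta,e^\rho\sin\theta)=\tilde\Phi(\rho,\theta)$, let $\Psi$ satisfy $\nabla\Psi=\mathcal{J}\nabla\Phi$; then $K(\xi)\chi(\theta):=\Psi(e^{\xi(\theta)}\cos\theta,e^{\xi(\theta)}\sin\theta)$, normalized by $\int_{\mathbb{T}^1}K(\xi)\chi\,d\theta=0$. It satisfies $(K(\xi)\chi)'=G(\xi)\chi$. *)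

theory Defs
  imports "HOL-Analysis.Analysis"
begin

text \<open>
  Functions on the circle of length \<open>2\<pi>\<close> are represented by \<open>2\<pi>\<close>-periodic functions on the real
  line, and their integrals by integrals over \<open>[0, 2\<pi>]\<close>.
  The surface elevation is \<open>\<xi>\<close>. The trace of the potential, usually called chi, is written \<open>\<psi>\<close>
  because the letter chi is a binder in \<^theory>\<open>HOL-Analysis.Finite_Cartesian_Product\<close>; the stream
  function is \<open>\<Psi>\<close>.
\<close>

definition periodic :: "(real \<Rightarrow> real) \<Rightarrow> bool" where
  "periodic f \<longleftrightarrow> (\<forall>\<theta>. f (\<theta> + 2 * pi) = f \<theta>)"

definition smooth_circle :: "(real \<Rightarrow> real) set" where
  "smooth_circle = {f. periodic f \<and> (\<forall>n \<theta>. (deriv ^^ n) f differentiable at \<theta>)}"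

definition circle_integral :: "(real \<Rightarrow> real) \<Rightarrow> real" where
  "circle_integral f = integral {0..2 * pi} f"

definition zero_mean_proj :: "(real \<Rightarrow> real) \<Rightarrow> real \<Rightarrow> real" where
  "zero_mean_proj f = (\<lambda>\<theta>. f \<theta> - circle_integral f / (2 * pi))"

definition inv_deriv :: "(real \<Rightarrow> real) \<Rightarrow> real \<Rightarrow> real" where
  "inv_deriv f = (THE F. periodic F \<and> (\<forall>\<theta>. (F has_real_derivative f \<theta>) (at \<theta>))
                         \<and> circle_integral F = 0)"


section \<open>The operators \<open>G\<close> and \<open>K\<close>\<close>

definition harmonic_on :: "(real \<times> real \<Rightarrow> real) \<Rightarrow> (real \<times> real) set \<Rightarrow> bool" where
  "harmonic_on u S \<longleftrightarrow> open S \<and>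
     (\<exists>g g1 g2. continuous_on S g1 \<and> continuous_on S g2 \<and>
        (\<forall>p\<in>S. GDERIV u p :> g p \<and>
               GDERIV (\<lambda>q. fst (g q)) p :> g1 p \<and>
               GDERIV (\<lambda>q. snd (g q)) p :> g2 p \<and>
               fst (g1 p) + snd (g2 p) = 0))"

text \<open>The fluid domain and its closure in the coordinates \<open>(\<rho>, \<theta>)\<close>.\<close>

definition fluid :: "(real \<Rightarrow> real) \<Rightarrow> (real \<times> real) set" where
  "fluid \<xi> = {(\<rho>, \<theta>). \<rho> < \<xi> \<theta>}"

definition fluid_closed :: "(real \<Rightarrow> real) \<Rightarrow> (real \<times> real) set" where
  "fluid_closed \<xi> = {(\<rho>, \<theta>). \<rho> \<le> \<xi> \<theta>}"

text \<open>
  \<open>P\<close> is the harmonic potential with boundary value \<open>\<psi>\<close>. Its gradient \<open>g\<close> on the fluid domain is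
  required to be continuous up to the boundary, which gives a meaning to the first derivatives of
  \<open>P\<close> at boundary points. The decay of \<open>\<partial>\<^sub>\<rho> P\<close> is uniform in \<open>\<theta>\<close>: decay along each line
  \<open>\<theta> = const\<close> separately would not determine \<open>P\<close>, since there are nonzero entire functions of
  \<open>exp (- (\<rho> + i \<theta>))\<close> which tend to \<open>0\<close> along every ray.
\<close>

definition potential ::
  "(real \<Rightarrow> real) \<Rightarrow> (real \<Rightarrow> real) \<Rightarrow> (real \<times> real \<Rightarrow> real) \<Rightarrow> (real \<times> real \<Rightarrow> real \<times> real) \<Rightarrow> bool"
where
  "potential \<xi> \<psi> P g \<longleftrightarrow>
     (\<forall>\<rho> \<theta>. P (\<rho>, \<theta> + 2 * pi) = P (\<rho>, \<theta>)) \<and>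
     harmonic_on P (fluid \<xi>) \<and>
     continuous_on (fluid_closed \<xi>) P \<and>
     (\<forall>p\<in>fluid \<xi>. GDERIV P p :> g p) \<and>
     continuous_on (fluid_closed \<xi>) g \<and>
     (\<forall>\<theta>. P (\<xi> \<theta>, \<theta>) = \<psi> \<theta>) \<and>
     uniform_limit UNIV (\<lambda>\<rho> \<theta>. fst (g (\<rho>, \<theta>))) (\<lambda>\<theta>. 0) at_bot"

definition G_op :: "(real \<Rightarrow> real) \<Rightarrow> (real \<Rightarrow> real) \<Rightarrow> real \<Rightarrow> real" where
  "G_op \<xi> \<psi> = (THE w. \<exists>P g. potential \<xi> \<psi> P g \<and>
     w = (\<lambda>\<theta>. fst (g (\<xi> \<theta>, \<theta>)) - deriv \<xi> \<theta> * snd (g (\<xi> \<theta>, \<theta>))))"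

definition polar :: "real \<times> real \<Rightarrow> real \<times> real" where
  "polar = (\<lambda>(\<rho>, \<theta>). (exp \<rho> * cos \<theta>, exp \<rho> * sin \<theta>))"

definition rot :: "real \<times> real \<Rightarrow> real \<times> real" where
  "rot = (\<lambda>(a, b). (- b, a))"

text \<open>
  \<open>polar ` fluid \<xi>\<close> is the drop without the origin. The values \<open>\<Psi> (polar (\<xi> \<theta>, \<theta>))\<close> are boundary
  values, hence the continuity up to the boundary.
\<close>

definition K_op :: "(real \<Rightarrow> real) \<Rightarrow> (real \<Rightarrow> real) \<Rightarrow> real \<Rightarrow> real" where
  "K_op \<xi> \<psi> = (THE w. \<exists>P g \<Phi> \<Psi>. potential \<xi> \<psi> P g \<and>
     (\<forall>p\<in>fluid_closed \<xi>. \<Phi> (polar p) = P p) \<and>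
     (\<forall>z\<in>polar ` fluid \<xi>. \<exists>d. GDERIV \<Phi> z :> d \<and> GDERIV \<Psi> z :> rot d) \<and>
     continuous_on (polar ` fluid_closed \<xi>) \<Psi> \<and>
     w = (\<lambda>\<theta>. \<Psi> (polar (\<xi> \<theta>, \<theta>))) \<and>
     circle_integral w = 0)"


section \<open>The drop equations\<close>

text \<open>
  A vector field maps a state \<open>(\<xi>, \<psi>)\<close> to the pair of right-hand sides.
\<close>

definition drop_field ::
  "real \<Rightarrow> real \<Rightarrow> (real \<Rightarrow> real) \<Rightarrow> (real \<Rightarrow> real) \<Rightarrow> (real \<Rightarrow> real) \<times> (real \<Rightarrow> real)"
where
  "drop_field \<sigma> \<alpha> \<xi> \<psi> =
    (\<lambda>\<theta>. exp (- 2 * \<xi> \<theta>) * (G_op \<xi> \<psi> \<theta> + \<alpha> / 2 * exp (2 * \<xi> \<theta>) * deriv \<xi> \<theta>),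
     \<lambda>\<theta>. exp (- 2 * \<xi> \<theta>) *
           (1 / 2 * ((G_op \<xi> \<psi> \<theta> + deriv \<xi> \<theta> * deriv \<psi> \<theta>) / sqrt (1 + (deriv \<xi> \<theta>)\<^sup>2))\<^sup>2
            - 1 / 2 * (deriv \<psi> \<theta>)\<^sup>2
            + \<sigma> * exp (\<xi> \<theta>) *
                (deriv (\<lambda>\<phi>. deriv \<xi> \<phi> / sqrt (1 + (deriv \<xi> \<phi>)\<^sup>2)) \<theta>
                 - 1 / sqrt (1 + (deriv \<xi> \<theta>)\<^sup>2)))
         + \<alpha> / 2 * deriv \<psi> \<theta> + \<alpha>\<^sup>2 / 8 * exp (2 * \<xi> \<theta>) + \<alpha> * K_op \<xi> \<psi> \<theta>
         + \<sigma> - \<alpha>\<^sup>2 / 8)"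

text \<open>
  The second component is considered modulo functions independent of \<open>\<theta>\<close>; for an evolution
  equation this is a function \<open>c\<close> of time.
\<close>

definition eq_mod_const ::
  "(real \<Rightarrow> real) \<times> (real \<Rightarrow> real) \<Rightarrow> (real \<Rightarrow> real) \<times> (real \<Rightarrow> real) \<Rightarrow> bool"
where
  "eq_mod_const X Y \<longleftrightarrow> (\<forall>\<theta>. fst X \<theta> = fst Y \<theta>) \<and> (\<exists>c. \<forall>\<theta>. snd X \<theta> = snd Y \<theta> + c)"

definition evolves_by ::
  "((real \<Rightarrow> real) \<Rightarrow> (real \<Rightarrow> real) \<Rightarrow> (real \<Rightarrow> real) \<times> (real \<Rightarrow> real))
   \<Rightarrow> (real \<Rightarrow> real \<Rightarrow> real) \<Rightarrow> (real \<Rightarrow> real \<Rightarrow> real) \<Rightarrow> bool"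
where
  "evolves_by X \<xi> \<psi> \<longleftrightarrow> (\<exists>c :: real \<Rightarrow> real. \<forall>t \<theta>.
     ((\<lambda>s. \<xi> s \<theta>) has_real_derivative fst (X (\<xi> t) (\<psi> t)) \<theta>) (at t) \<and>
     ((\<lambda>s. \<psi> s \<theta>) has_real_derivative snd (X (\<xi> t) (\<psi> t)) \<theta> + c t) (at t))"


section \<open>The Hamiltonian structure\<close>

definition hamiltonian :: "real \<Rightarrow> real \<Rightarrow> (real \<Rightarrow> real) \<Rightarrow> (real \<Rightarrow> real) \<Rightarrow> real" where
  "hamiltonian \<sigma> \<alpha> \<xi> \<psi> =
     1 / 2 * circle_integral (\<lambda>\<theta>. \<psi> \<theta> * G_op \<xi> \<psi> \<theta>)
     + \<sigma> * circle_integral (\<lambda>\<theta>. exp (\<xi> \<theta>) * sqrt (1 + (deriv \<xi> \<theta>)\<^sup>2))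
     - (\<sigma> - \<alpha>\<^sup>2 / 8) * (1 / 2) * circle_integral (\<lambda>\<theta>. exp (2 * \<xi> \<theta>))
     - \<alpha> / 4 * circle_integral (\<lambda>\<theta>. exp (2 * \<xi> \<theta>) * deriv \<psi> \<theta>)
     + \<alpha>\<^sup>2 / 32 * circle_integral (\<lambda>\<theta>. exp (4 * \<xi> \<theta>))"

text \<open>
  The continuous periodic functions \<open>u\<close>, \<open>v\<close> represent the differential of \<open>H\<close> at \<open>(\<xi>, \<psi>)\<close> with
  respect to the scalar product of \<open>L\<^sup>2 \<times> L\<^sup>2\<close>; continuity makes them unique as functions.
\<close>

definition has_L2_gradient ::
  "((real \<Rightarrow> real) \<Rightarrow> (real \<Rightarrow> real) \<Rightarrow> real) \<Rightarrow> (real \<Rightarrow> real) \<Rightarrow> (real \<Rightarrow> real)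
   \<Rightarrow> (real \<Rightarrow> real) \<times> (real \<Rightarrow> real) \<Rightarrow> bool"
where
  "has_L2_gradient H \<xi> \<psi> = (\<lambda>(u, v).
     periodic u \<and> continuous_on UNIV u \<and> periodic v \<and> continuous_on UNIV v \<and>
     (\<forall>h\<in>smooth_circle. \<forall>k\<in>smooth_circle.
        ((\<lambda>\<epsilon>. H (\<lambda>\<theta>. \<xi> \<theta> + \<epsilon> * h \<theta>) (\<lambda>\<theta>. \<psi> \<theta> + \<epsilon> * k \<theta>))
           has_real_derivative circle_integral (\<lambda>\<theta>. u \<theta> * h \<theta> + v \<theta> * k \<theta>)) (at 0)))"

definition L2_gradient ::
  "((real \<Rightarrow> real) \<Rightarrow> (real \<Rightarrow> real) \<Rightarrow> real) \<Rightarrow> (real \<Rightarrow> real) \<Rightarrow> (real \<Rightarrow> real)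
   \<Rightarrow> (real \<Rightarrow> real) \<times> (real \<Rightarrow> real)"
where
  "L2_gradient H \<xi> \<psi> = (THE w. has_L2_gradient H \<xi> \<psi> w)"

definition J_op ::
  "real \<Rightarrow> (real \<Rightarrow> real) \<Rightarrow> (real \<Rightarrow> real) \<times> (real \<Rightarrow> real) \<Rightarrow> (real \<Rightarrow> real) \<times> (real \<Rightarrow> real)"
where
  "J_op \<alpha> \<xi> = (\<lambda>(u, v).
     (\<lambda>\<theta>. exp (- 2 * \<xi> \<theta>) * v \<theta>,
      \<lambda>\<theta>. - exp (- 2 * \<xi> \<theta>) * u \<theta> + \<alpha> * inv_deriv (zero_mean_proj v) \<theta>))"

end

theory Submission
  imports Defs "HOL-Complex_Analysis.Complex_Analysis"
begin

text \<open>
  The theorem amounts to computing the \<open>L\<^sup>2\<close> gradient of the Hamiltonian, and the only term that is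
  not elementary is the kinetic energy \<open>E = \<integral> \<psi> G(\<xi>)\<psi> / 2\<close>.

  The potential is the real part of a function \<open>A\<close> that is analytic in the drop bounded by
  \<open>\<gamma>(\<theta>) = exp (\<xi>(\<theta>) + i \<theta>)\<close>, and the stream function is its imaginary part. \<open>A\<close> is the Cauchy
  integral of a real density that solves the second-kind integral equation of the double-layer
  potential. The kernel of this equation is smooth, the Fredholm alternative reduces solvability to
  injectivity, and injectivity follows from the maximum principle inside and outside the drop.
  The density is then twice differentiable, so that \<open>A'\<close> extends continuously to the boundary.

  The coordinates \<open>(r, \<theta>) \<mapsto> r \<gamma>(\<theta>)\<close> turn every drop into the same strip. There the Dirichlet
  principle bounds \<open>E\<close> from above by the energy of any trial potential, and the dual principle bounds
  it from below by means of any trial stream function. Using the potential and the stream function at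
  \<open>\<epsilon> = 0\<close> as trial functions for the perturbed data gives two explicit functions of \<open>\<epsilon>\<close> that enclose
  \<open>E\<close> and agree with it at \<open>\<epsilon> = 0\<close>. Hence \<open>E\<close> is differentiable and no shape derivative of \<open>G\<close>
  is needed.
\<close>


section \<open>The maximum principle in the fluid domain\<close>

text \<open>\<open>G_op\<close>, \<open>K_op\<close>, \<open>inv_deriv\<close> and
  \<open>L2_gradient\<close> are definite descriptions: each needs existence and uniqueness before
  anything can be computed with it, hence the large share of classical potential theory. The energy
  on the strip arises as follows. At the point r \<gamma>(\<theta>), of modulus R = r exp \<xi>, one
  has R dP/dR = r x, and the angular derivative at fixed R is r (y - \<xi>' x), where x = dP/dr and
  r y = dP/d\<theta>. The Dirichlet integrand becomes r (x^2 + (y - \<xi>' x)^2). The surface enters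
  only as the coefficient \<xi>', so for fixed trial functions the energy is a polynomial in
  \<epsilon>. Its \<epsilon>-derivative is an interior integral against h', whereas an L2 gradient
  must be paired with h on the boundary; a conservation law for the analytic function converts one
  into the other. Working modulo functions of time absorbs a single discrepancy:
  \<open>inv_deriv\<close> also removes the mean of \<alpha>/4 exp (2 \<xi>), whereas in the drop
  equation only \<open>K_op\<close> is normalised to mean zero.\<close>

lemma periodic_int:
  assumes "periodic f"
  shows "f (\<theta> + 2 * pi * of_int n) = f \<theta>"
proof -
  have nat: "f (\<theta> + 2 * pi * real m) = f \<theta>" for m \<theta>
  proof (induction m)
    case (Suc m)
    have "f (\<theta> + 2 * pi * real (Suc m)) = f ((\<theta> + 2 * pi * real m) + 2 * pi)"
      by (simp add: algebra_simps)
    also have "\<dots> = f \<theta>" using assms Suc by (simp add: periodic_def)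
    finally show ?case .
  qed simp
  show ?thesis
  proof (cases "n \<ge> 0")
    case True
    then show ?thesis using nat[of \<theta> "nat n"] by simp
  next
    case False
    then show ?thesis using nat[of "\<theta> + 2 * pi * of_int n" "nat (- n)"] by simp
  qed
qed

lemma angle_reduce:
  obtains n :: int where "\<bar>x - 2 * pi * of_int n\<bar> \<le> pi"
proof
  define n where "n = round (x / (2 * pi))"
  have "\<bar>of_int n - x / (2 * pi)\<bar> \<le> 1 / 2"
    unfolding n_def by (rule of_int_round_abs_le)
  then have "(2 * pi) * \<bar>of_int n - x / (2 * pi)\<bar> \<le> 2 * pi * (1 / 2)"
    by (rule mult_left_mono) simp
  moreover have "(2 * pi) * \<bar>of_int n - x / (2 * pi)\<bar> = \<bar>(2 * pi) * (of_int n - x / (2 * pi))\<bar>"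
    by (simp add: abs_mult)
  moreover have "(2 * pi) * (of_int n - x / (2 * pi)) = 2 * pi * of_int n - x"
    by (simp add: field_simps)
  ultimately show "\<bar>x - 2 * pi * of_int n\<bar> \<le> pi" by (simp add: abs_minus_commute)
qed

text \<open>If \<open>c\<close> were positive, then \<open>f'\<close>, which vanishes at the
  maximum, would be positive just to the right of \<open>x0\<close>, and the mean value theorem
  would give a larger value of \<open>f\<close> there.\<close>

lemma second_derivative_at_max:
  fixes f :: "real \<Rightarrow> real"
  assumes e: "e > 0"
    and f: "\<And>x. \<bar>x - x0\<bar> < e \<Longrightarrow> (f has_real_derivative f' x) (at x)"
    and f': "(f' has_real_derivative c) (at x0)"
    and max: "\<And>x. \<bar>x - x0\<bar> < e \<Longrightarrow> f x \<le> f x0"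
  shows "c \<le> 0"
proof (rule ccontr)
  assume "\<not> c \<le> 0"
  then have "c > 0" by simp
  have z: "f' x0 = 0"
    by (rule DERIV_local_max[OF f[of x0] e]) (use e max in \<open>auto simp: abs_minus_commute\<close>)
  obtain d where d: "d > 0" "\<And>h. h > 0 \<Longrightarrow> h < d \<Longrightarrow> f' x0 < f' (x0 + h)"
    using DERIV_pos_inc_right[OF f' \<open>c > 0\<close>] by auto
  define h where "h = min d e / 2"
  have h: "h > 0" "h < d" "h < e" using d e by (auto simp: h_def)
  obtain y where y: "y > x0" "y < x0 + h" "f (x0 + h) - f x0 = (x0 + h - x0) * f' y"
    using MVT2[of x0 "x0 + h" f f'] f h by force
  have "f' y > 0" using d(2)[of "y - x0"] y h z by auto
  then have "h * f' y > 0" using h by simp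
  then have "f (x0 + h) > f x0" using y(3) by simp
  moreover have "f (x0 + h) \<le> f x0" using max[of "x0 + h"] h by auto
  ultimately show False by simp
qed

lemma GDERIV_partials:
  fixes u :: "real \<times> real \<Rightarrow> real"
  assumes "GDERIV u (\<rho>, \<theta>) :> d"
  shows "((\<lambda>x. u (x, \<theta>)) has_real_derivative fst d) (at \<rho>)"
    and "((\<lambda>x. u (\<rho>, x)) has_real_derivative snd d) (at \<theta>)"
proof -
  have u: "(u has_derivative (\<lambda>h. inner h d)) (at (\<rho>, \<theta>))"
    using assms by (simp add: gderiv_def)
  have "((\<lambda>x. u (x, \<theta>)) has_derivative (\<lambda>h. inner (h, 0) d)) (at \<rho>)"
    by (rule has_derivative_compose[of "\<lambda>x. (x, \<theta>)", OF _ u]) (auto intro!: derivative_eq_intros)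
  then show "((\<lambda>x. u (x, \<theta>)) has_real_derivative fst d) (at \<rho>)"
    by (simp add: has_field_derivative_def inner_prod_def mult.commute[of _ "fst d"])
  have "((\<lambda>x. u (\<rho>, x)) has_derivative (\<lambda>h. inner (0, h) d)) (at \<theta>)"
    by (rule has_derivative_compose[of "\<lambda>x. (\<rho>, x)", OF _ u]) (auto intro!: derivative_eq_intros)
  then show "((\<lambda>x. u (\<rho>, x)) has_real_derivative snd d) (at \<theta>)"
    by (simp add: has_field_derivative_def inner_prod_def mult.commute[of _ "snd d"])
qed

lemma periodic_bounded:
  assumes "periodic f" "continuous_on UNIV f"
  obtains M where "M > 0" "\<And>x. \<bar>f x\<bar> \<le> M"
proof -
  have "compact (f ` {-pi..pi})"
    by (intro compact_continuous_image continuous_on_subset[OF assms(2)]) auto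
  then have "bounded (f ` {-pi..pi})" by (rule compact_imp_bounded)
  then obtain M where M: "M > 0" "\<And>x. x \<in> {-pi..pi} \<Longrightarrow> \<bar>f x\<bar> \<le> M"
    by (auto simp: bounded_pos)
  show thesis
  proof
    fix x
    obtain n where "\<bar>x - 2 * pi * of_int n\<bar> \<le> pi" by (rule angle_reduce)
    then have "\<bar>f (x - 2 * pi * of_int n)\<bar> \<le> M" by (intro M) auto
    then show "\<bar>f x\<bar> \<le> M" using periodic_int[OF assms(1), of x "- n"] by simp
  qed fact
qed

text \<open>
  Adding \<open>\<epsilon> (\<rho> + exp \<rho>)\<close> makes the Laplacian positive, which excludes interior maxima, and makes the
  function tend to \<open>-\<infinity>\<close> as \<open>\<rho> \<rightarrow> -\<infinity>\<close>, so that a maximum is attained.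
\<close>

lemma maximum_principle:
  assumes \<xi>: "periodic \<xi>" "continuous_on UNIV \<xi>"
    and harm: "harmonic_on u (fluid \<xi>)"
    and cont: "continuous_on (fluid_closed \<xi>) u"
    and per: "\<And>\<rho> \<theta>. u (\<rho>, \<theta> + 2 * pi) = u (\<rho>, \<theta>)"
    and bdry: "\<And>\<theta>. u (\<xi> \<theta>, \<theta>) \<le> 0"
    and growth: "\<And>\<delta>. \<delta> > 0 \<Longrightarrow> \<exists>R. \<forall>\<rho>\<le>R. \<forall>\<theta>. u (\<rho>, \<theta>) \<le> \<delta> * (- \<rho>)"
    and p0: "\<rho>0 \<le> \<xi> \<theta>0"
  shows "u (\<rho>0, \<theta>0) \<le> 0"
proof -
  obtain M where M: "M > 0" "\<And>x. \<bar>\<xi> x\<bar> \<le> M" using periodic_bounded[OF \<xi>] by blast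
  have peru: "u (\<rho>, \<theta> + 2 * pi * of_int n) = u (\<rho>, \<theta>)" for \<rho> \<theta> n
    using periodic_int[of "\<lambda>\<theta>. u (\<rho>, \<theta>)"] per by (simp add: periodic_def)
  have key: "u (\<rho>0, \<theta>0) + \<epsilon> * (\<rho>0 + exp \<rho>0) \<le> \<epsilon> * (M + exp M)" if \<epsilon>: "\<epsilon> > 0" for \<epsilon>
  proof (rule ccontr)
    define v where "v p = u p + \<epsilon> * (fst p + exp (fst p))" for p
    define c where "c = \<epsilon> * (M + exp M)"
    assume "\<not> u (\<rho>0, \<theta>0) + \<epsilon> * (\<rho>0 + exp \<rho>0) \<le> \<epsilon> * (M + exp M)"
    then have big: "v (\<rho>0, \<theta>0) > c" by (simp add: v_def c_def)
    obtain R where R: "\<And>\<rho> \<theta>. \<rho> \<le> R \<Longrightarrow> u (\<rho>, \<theta>) \<le> \<epsilon> * (- \<rho>)" using growth[OF \<epsilon>] by blast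
    \<comment> \<open>At depth \<open>N\<close> the growth bound with \<delta> = \<epsilon> cancels
      the linear part of the added term; what remains is \<open>\<epsilon> * exp N\<close>, which is
      at most \<open>c\<close>.\<close>
    define N where "N = min R (min 0 \<rho>0)"
    have vN: "v (N, \<theta>) \<le> c" for \<theta>
    proof -
      have "u (N, \<theta>) \<le> \<epsilon> * (- N)" by (rule R) (simp add: N_def)
      then have "v (N, \<theta>) \<le> \<epsilon> * exp N" by (simp add: v_def algebra_simps)
      also have "\<dots> \<le> c" unfolding c_def using \<epsilon> M(1) by (intro mult_left_mono) (auto simp: N_def intro!: add_increasing)
      finally show ?thesis .
    qed
    have vb: "v (\<xi> \<theta>, \<theta>) \<le> c" for \<theta>
    proof -
      have "\<epsilon> * (\<xi> \<theta> + exp (\<xi> \<theta>)) \<le> c" unfolding c_def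
        using \<epsilon> M(2)[of \<theta>] by (intro mult_left_mono add_mono) auto
      then show ?thesis using bdry[of \<theta>] by (simp add: v_def)
    qed
    have perv: "v (\<rho>, \<theta> + 2 * pi * of_int n) = v (\<rho>, \<theta>)" for \<rho> \<theta> n
      by (simp add: v_def peru)
    \<comment> \<open>One period, cut off at depth \<open>N\<close>. By periodicity a maximum over
      this compact set is a maximum over all points between depth \<open>N\<close> and the surface,
      so it can be compared with neighbours beyond the edge of the period.\<close>
    define K where "K = {p. N \<le> fst p \<and> fst p \<le> \<xi> (snd p)} \<inter> cbox (N, -pi) (M, pi)"
    have cK: "compact K"
      unfolding K_def
      by (intro closed_Int_compact closed_Collect_conj closed_Collect_le continuous_intros
            continuous_on_compose2[OF \<xi>(2)]) auto
    have Kred: "\<exists>p\<in>K. v (\<rho>, \<theta>) = v p" if "N \<le> \<rho>" "\<rho> \<le> \<xi> \<theta>" for \<rho> \<theta>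
    proof -
      obtain n where n: "\<bar>\<theta> - 2 * pi * of_int n\<bar> \<le> pi" by (rule angle_reduce)
      have "\<xi> (\<theta> - 2 * pi * of_int n) = \<xi> \<theta>" using periodic_int[OF \<xi>(1), of \<theta> "-n"] by simp
      then have "(\<rho>, \<theta> - 2 * pi * of_int n) \<in> K"
        using that n M(2)[of \<theta>] by (auto simp: K_def)
      moreover have "v (\<rho>, \<theta>) = v (\<rho>, \<theta> - 2 * pi * of_int n)" using perv[of \<rho> \<theta> "-n"] by simp
      ultimately show ?thesis by blast
    qed
    have "N \<le> \<rho>0" by (simp add: N_def)
    then obtain p where p: "p \<in> K" "v (\<rho>0, \<theta>0) = v p" using Kred p0 by blast
    have "continuous_on K v" unfolding v_def
      by (intro continuous_intros continuous_on_subset[OF cont]) (auto simp: K_def fluid_closed_def)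
    then obtain p1 where p1: "p1 \<in> K" "\<And>q. q \<in> K \<Longrightarrow> v q \<le> v p1"
      using continuous_attains_sup[OF cK] p(1) by blast
    obtain \<rho>1 \<theta>1 where p1_eq: "p1 = (\<rho>1, \<theta>1)" by (cases p1)
    have gmax: "v (\<rho>, \<theta>) \<le> v (\<rho>1, \<theta>1)" if "N \<le> \<rho>" "\<rho> \<le> \<xi> \<theta>" for \<rho> \<theta>
      using Kred[OF that] p1 p1_eq by auto
    have "v (\<rho>1, \<theta>1) > c" using p1(2)[OF p(1)] p(2) big p1_eq by simp
    then have int: "N < \<rho>1" "\<rho>1 < \<xi> \<theta>1"
      using vN[of \<theta>1] vb[of \<theta>1] p1(1) by (auto simp: K_def p1_eq order.order_iff_strict)
    from harm obtain g g1 g2 where op: "open (fluid \<xi>)" and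
      G: "\<And>p. p \<in> fluid \<xi> \<Longrightarrow> GDERIV u p :> g p"
         "\<And>p. p \<in> fluid \<xi> \<Longrightarrow> GDERIV (\<lambda>q. fst (g q)) p :> g1 p"
         "\<And>p. p \<in> fluid \<xi> \<Longrightarrow> GDERIV (\<lambda>q. snd (g q)) p :> g2 p"
         "\<And>p. p \<in> fluid \<xi> \<Longrightarrow> fst (g1 p) + snd (g2 p) = 0"
      unfolding harmonic_on_def by blast
    have opS: "open (fluid \<xi> \<inter> {p. N < fst p})"
      by (intro open_Int op open_Collect_less continuous_intros)
    have "(\<rho>1, \<theta>1) \<in> fluid \<xi> \<inter> {p. N < fst p}" using int by (auto simp: fluid_def)
    with opS obtain e where e: "e > 0" "ball (\<rho>1, \<theta>1) e \<subseteq> fluid \<xi> \<inter> {p. N < fst p}"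
      using open_contains_ball by blast
    have inr: "(\<rho>, \<theta>1) \<in> fluid \<xi>" "N < \<rho>" if "\<bar>\<rho> - \<rho>1\<bar> < e" for \<rho>
    proof -
      have "(\<rho>, \<theta>1) \<in> ball (\<rho>1, \<theta>1) e" using that by (simp add: dist_Pair_Pair dist_real_def abs_minus_commute)
      then show "(\<rho>, \<theta>1) \<in> fluid \<xi>" "N < \<rho>" using e by auto
    qed
    have int': "(\<rho>1, \<theta>) \<in> fluid \<xi>" if "\<bar>\<theta> - \<theta>1\<bar> < e" for \<theta>
    proof -
      have "(\<rho>1, \<theta>) \<in> ball (\<rho>1, \<theta>1) e" using that by (simp add: dist_Pair_Pair dist_real_def abs_minus_commute)
      then show ?thesis using e by auto
    qed
    have in1: "(\<rho>1, \<theta>1) \<in> fluid \<xi>" using int by (simp add: fluid_def)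
    have "fst (g1 (\<rho>1, \<theta>1)) + \<epsilon> * exp \<rho>1 \<le> 0"
    proof (rule second_derivative_at_max[OF e(1), of \<rho>1 "\<lambda>\<rho>. v (\<rho>, \<theta>1)"])
      show "((\<lambda>\<rho>. v (\<rho>, \<theta>1)) has_real_derivative fst (g (\<rho>, \<theta>1)) + \<epsilon> * (1 + exp \<rho>)) (at \<rho>)"
        if "\<bar>\<rho> - \<rho>1\<bar> < e" for \<rho>
        unfolding v_def fst_conv
        by (rule DERIV_add[OF GDERIV_partials(1)[OF G(1)[OF inr(1)[OF that]]]])
          (auto intro!: derivative_eq_intros simp: algebra_simps)
      show "((\<lambda>\<rho>. fst (g (\<rho>, \<theta>1)) + \<epsilon> * (1 + exp \<rho>)) has_real_derivative fst (g1 (\<rho>1, \<theta>1)) + \<epsilon> * exp \<rho>1) (at \<rho>1)"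
        by (auto intro!: derivative_eq_intros GDERIV_partials(1)[OF G(2)] in1)
      show "v (\<rho>, \<theta>1) \<le> v (\<rho>1, \<theta>1)" if "\<bar>\<rho> - \<rho>1\<bar> < e" for \<rho>
        by (rule gmax) (use inr[OF that] in \<open>auto simp: fluid_def\<close>)
    qed
    moreover have "snd (g2 (\<rho>1, \<theta>1)) \<le> 0"
    proof (rule second_derivative_at_max[OF e(1), of \<theta>1 "\<lambda>\<theta>. v (\<rho>1, \<theta>)"])
      show "((\<lambda>\<theta>. v (\<rho>1, \<theta>)) has_real_derivative snd (g (\<rho>1, \<theta>))) (at \<theta>)"
        if "\<bar>\<theta> - \<theta>1\<bar> < e" for \<theta>
        unfolding v_def fst_conv
        by (auto intro!: derivative_eq_intros GDERIV_partials(2)[OF G(1)] int' that)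
      show "((\<lambda>\<theta>. snd (g (\<rho>1, \<theta>))) has_real_derivative snd (g2 (\<rho>1, \<theta>1))) (at \<theta>1)"
        by (rule GDERIV_partials(2)[OF G(3)[OF in1]])
      show "v (\<rho>1, \<theta>) \<le> v (\<rho>1, \<theta>1)" if "\<bar>\<theta> - \<theta>1\<bar> < e" for \<theta>
        by (rule gmax) (use int int'[OF that] in \<open>auto simp: fluid_def\<close>)
    qed
    ultimately have "\<epsilon> * exp \<rho>1 \<le> 0" using G(4)[OF in1] by simp
    then show False using \<epsilon> by (simp add: mult_le_0_iff)
  qed
  \<comment> \<open>Now \<epsilon> tends to 0: \<open>key\<close> bounds \<open>u\<close> by
    \<epsilon> times a constant that does not depend on \<epsilon>.\<close>
  define C where "C = M + exp M - (\<rho>0 + exp \<rho>0)"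
  have "C \<ge> 0" using M(2)[of \<theta>0] p0 by (simp add: C_def add_mono)
  have "u (\<rho>0, \<theta>0) \<le> 0 + \<epsilon>" if "\<epsilon> > 0" for \<epsilon>
  proof -
    define d where "d = \<epsilon> / (C + 1)"
    have "d > 0" using that \<open>C \<ge> 0\<close> by (simp add: d_def)
    from key[OF this] have "u (\<rho>0, \<theta>0) \<le> d * C"
      by (simp add: C_def algebra_simps)
    also have "\<dots> = (\<epsilon> / (C + 1)) * C" by (simp add: d_def)
    also have "\<dots> \<le> \<epsilon>" using that \<open>C \<ge> 0\<close> by (simp add: field_simps)
    finally show ?thesis by simp
  qed
  then show ?thesis by (rule field_le_epsilon)
qed


section \<open>Uniqueness of the potential\<close>

text \<open>The Cauchy-Riemann equations in gradient form: the second gradient is \<open>rot\<close>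
  of the first, which is the relation that defines the stream function in
  \<open>K_op\<close>.\<close>

lemma GDERIV_Re_Im:
  assumes "(f has_field_derivative d) (at (Complex \<rho> \<theta>))"
  shows "GDERIV (\<lambda>p. Re (f (Complex (fst p) (snd p)))) (\<rho>, \<theta>) :> (Re d, - Im d)"
    and "GDERIV (\<lambda>p. Im (f (Complex (fst p) (snd p)))) (\<rho>, \<theta>) :> (Im d, Re d)"
proof -
  have 1: "((\<lambda>p. Complex (fst p) (snd p)) has_derivative (\<lambda>h. Complex (fst h) (snd h))) (at (\<rho>, \<theta>))"
    unfolding Complex_eq by (auto intro!: derivative_eq_intros)
  have "(f has_derivative (\<lambda>h. d * h)) (at (Complex (fst (\<rho>, \<theta>)) (snd (\<rho>, \<theta>))))"
    using assms by (simp add: has_field_derivative_def)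
  from has_derivative_compose[OF 1 this]
  have 2: "((\<lambda>p. f (Complex (fst p) (snd p))) has_derivative (\<lambda>h. d * Complex (fst h) (snd h))) (at (\<rho>, \<theta>))" .
  show "GDERIV (\<lambda>p. Re (f (Complex (fst p) (snd p)))) (\<rho>, \<theta>) :> (Re d, - Im d)"
    unfolding gderiv_def by (rule has_derivative_eq_rhs[OF has_derivative_Re[OF 2]]) (auto simp: inner_prod_def algebra_simps)
  show "GDERIV (\<lambda>p. Im (f (Complex (fst p) (snd p)))) (\<rho>, \<theta>) :> (Im d, Re d)"
    unfolding gderiv_def by (rule has_derivative_eq_rhs[OF has_derivative_Im[OF 2]]) (auto simp: inner_prod_def algebra_simps)
qed

lemma GDERIV_transform:
  assumes "GDERIV f x :> d" "open S" "x \<in> S" "\<And>y. y \<in> S \<Longrightarrow> f y = g y"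
  shows "GDERIV g x :> d"
  using has_derivative_transform_within_open[OF assms(1)[unfolded gderiv_def] assms(2-4)]
  by (simp add: gderiv_def)

lemma GDERIV_unique_gradient:
  assumes "GDERIV f x :> d" "GDERIV f x :> e"
  shows "d = e"
proof -
  have "(\<lambda>h. inner h d) = (\<lambda>h. inner h e)"
    using assms unfolding gderiv_def by (rule has_derivative_unique)
  then have "\<forall>h. inner h d = inner h e" by (simp add: fun_eq_iff)
  then show ?thesis by (simp only: vector_eq_ldot)
qed

text \<open>The fluid domain in the logarithmic coordinate \<rho> + i \<theta>; \<open>exp\<close>
  maps it onto the drop without the origin.\<close>

definition cfluid :: "(real \<Rightarrow> real) \<Rightarrow> complex set" where
  "cfluid \<xi> = {w. Re w < \<xi> (Im w)}"

lemma Complex_in_cfluid [simp]: "Complex \<rho> \<theta> \<in> cfluid \<xi> \<longleftrightarrow> (\<rho>, \<theta>) \<in> fluid \<xi>"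
  by (simp add: cfluid_def fluid_def)

lemma open_fluid:
  assumes "continuous_on UNIV \<xi>"
  shows "open (fluid \<xi>)"
proof -
  have "open {p. fst p < \<xi> (snd p)}"
    by (intro open_Collect_less continuous_intros continuous_on_compose2[OF assms]) auto
  then show ?thesis by (simp add: fluid_def case_prod_unfold)
qed

lemma open_cfluid:
  assumes "continuous_on UNIV \<xi>"
  shows "open (cfluid \<xi>)"
  unfolding cfluid_def
  by (intro open_Collect_less continuous_intros continuous_on_compose2[OF assms]) auto

lemma connected_fluid:
  assumes "continuous_on UNIV \<xi>"
  shows "connected (fluid \<xi>)"
proof -
  have "fluid \<xi> = (\<lambda>p. (\<xi> (snd p) + fst p, snd p)) ` ({..<0} \<times> UNIV)"
  proof (intro equalityI subsetI)
    fix p assume "p \<in> fluid \<xi>"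
    then show "p \<in> (\<lambda>p. (\<xi> (snd p) + fst p, snd p)) ` ({..<0} \<times> UNIV)"
      by (intro image_eqI[of _ _ "(fst p - \<xi> (snd p), snd p)"]) (auto simp: fluid_def)
  qed (auto simp: fluid_def)
  also have "connected \<dots>"
    by (intro connected_continuous_image continuous_intros continuous_on_compose2[OF assms]
          convex_connected convex_Times) auto
  finally show ?thesis .
qed

lemma connected_cfluid:
  assumes "continuous_on UNIV \<xi>"
  shows "connected (cfluid \<xi>)"
proof -
  have "cfluid \<xi> = (\<lambda>p. Complex (fst p) (snd p)) ` fluid \<xi>"
  proof (intro equalityI subsetI)
    fix w assume "w \<in> cfluid \<xi>"
    then show "w \<in> (\<lambda>p. Complex (fst p) (snd p)) ` fluid \<xi>"
      by (intro image_eqI[of _ _ "(Re w, Im w)"]) (auto simp: fluid_def cfluid_def)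
  qed auto
  also have "connected \<dots>"
    unfolding Complex_eq
    by (intro connected_continuous_image continuous_intros connected_fluid assms)
  finally show ?thesis .
qed

text \<open>Up to sign the components of the gradient are the real and imaginary parts of f', so the
  second derivatives come from f'' and the Cauchy-Riemann equations cancel the trace.\<close>

lemma harmonic_Re:
  assumes \<xi>: "continuous_on UNIV \<xi>" and f: "f holomorphic_on cfluid \<xi>"
  shows "harmonic_on (\<lambda>p. Re (f (Complex (fst p) (snd p)))) (fluid \<xi>)"
proof -
  let ?W = "\<lambda>p. Complex (fst p) (snd p)"
  have op: "open (cfluid \<xi>)" by (rule open_cfluid[OF \<xi>])
  have f': "deriv f holomorphic_on cfluid \<xi>" by (rule holomorphic_deriv[OF f op])
  have f'': "deriv (deriv f) holomorphic_on cfluid \<xi>" by (rule holomorphic_deriv[OF f' op])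
  have D: "(f has_field_derivative deriv f w) (at w)" "(deriv f has_field_derivative deriv (deriv f) w) (at w)"
    if "w \<in> cfluid \<xi>" for w
    using holomorphic_derivI[OF f op that] holomorphic_derivI[OF f' op that] by auto
  have cW: "continuous_on (fluid \<xi>) (\<lambda>p. deriv (deriv f) (?W p))"
    by (rule continuous_on_compose2[OF holomorphic_on_imp_continuous_on[OF f'']])
      (auto simp: fluid_def cfluid_def Complex_eq intro!: continuous_intros)
  show ?thesis
    unfolding harmonic_on_def
  proof (intro conjI exI ballI open_fluid[OF \<xi>])
    show "continuous_on (fluid \<xi>) (\<lambda>p. (Re (deriv (deriv f) (?W p)), - Im (deriv (deriv f) (?W p))))"
      by (intro continuous_intros cW)
    show "continuous_on (fluid \<xi>) (\<lambda>p. (- Im (deriv (deriv f) (?W p)), - Re (deriv (deriv f) (?W p))))"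
      by (intro continuous_intros cW)
    fix p assume p: "p \<in> fluid \<xi>"
    then have w: "?W p \<in> cfluid \<xi>" by simp
    show "GDERIV (\<lambda>p. Re (f (?W p))) p :> (Re (deriv f (?W p)), - Im (deriv f (?W p)))"
      using GDERIV_Re_Im(1)[OF D(1)[OF w]] by simp
    show "GDERIV (\<lambda>q. fst (Re (deriv f (?W q)), - Im (deriv f (?W q)))) p :>
        (Re (deriv (deriv f) (?W p)), - Im (deriv (deriv f) (?W p)))"
      using GDERIV_Re_Im(1)[OF D(2)[OF w]] by simp
    have "GDERIV (\<lambda>q. - Im (deriv f (?W q))) p :> - (Im (deriv (deriv f) (?W p)), Re (deriv (deriv f) (?W p)))"
      using GDERIV_minus[OF GDERIV_Re_Im(2)[OF D(2)[OF w]]] by simp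
    then show "GDERIV (\<lambda>q. snd (Re (deriv f (?W q)), - Im (deriv f (?W q)))) p :>
        (- Im (deriv (deriv f) (?W p)), - Re (deriv (deriv f) (?W p)))"
      by simp
  qed simp
qed

lemma harmonic_diff:
  assumes "harmonic_on u S" "harmonic_on v S"
  shows "harmonic_on (\<lambda>p. u p - v p) S"
proof -
  from assms(1) obtain g g1 g2 where op: "open S" and c: "continuous_on S g1" "continuous_on S g2" and
      G: "\<And>p. p \<in> S \<Longrightarrow> GDERIV u p :> g p"
         "\<And>p. p \<in> S \<Longrightarrow> GDERIV (\<lambda>q. fst (g q)) p :> g1 p"
         "\<And>p. p \<in> S \<Longrightarrow> GDERIV (\<lambda>q. snd (g q)) p :> g2 p"
         "\<And>p. p \<in> S \<Longrightarrow> fst (g1 p) + snd (g2 p) = 0"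
    unfolding harmonic_on_def by blast
  from assms(2) obtain h h1 h2 where c': "continuous_on S h1" "continuous_on S h2" and
      H: "\<And>p. p \<in> S \<Longrightarrow> GDERIV v p :> h p"
         "\<And>p. p \<in> S \<Longrightarrow> GDERIV (\<lambda>q. fst (h q)) p :> h1 p"
         "\<And>p. p \<in> S \<Longrightarrow> GDERIV (\<lambda>q. snd (h q)) p :> h2 p"
         "\<And>p. p \<in> S \<Longrightarrow> fst (h1 p) + snd (h2 p) = 0"
    unfolding harmonic_on_def by blast
  show ?thesis
    unfolding harmonic_on_def
  proof (intro conjI exI ballI op)
    show "continuous_on S (\<lambda>p. g1 p - h1 p)" "continuous_on S (\<lambda>p. g2 p - h2 p)"
      by (intro continuous_intros c c')+
    fix p assume p: "p \<in> S"
    show "GDERIV (\<lambda>p. u p - v p) p :> g p - h p" by (intro GDERIV_diff G H p)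
    show "GDERIV (\<lambda>q. fst (g q - h q)) p :> g1 p - h1 p"
      unfolding fst_diff by (intro GDERIV_diff G H p)
    show "GDERIV (\<lambda>q. snd (g q - h q)) p :> g2 p - h2 p"
      unfolding snd_diff by (intro GDERIV_diff G H p)
    show "fst (g1 p - h1 p) + snd (g2 p - h2 p) = 0" using G(4)[OF p] H(4)[OF p] by simp
  qed
qed

text \<open>The surface point is approached from below along \<theta> = const. This carries
  identities from the open domain, where derivatives exist, to the surface, where
  \<open>G_op\<close> and \<open>K_op\<close> are evaluated.\<close>

lemma boundary_limit:
  fixes u v :: "real \<times> real \<Rightarrow> 'a::t2_space"
  assumes "continuous_on (fluid_closed \<xi>) u" "continuous_on (fluid_closed \<xi>) v"
    and eq: "\<And>p. p \<in> fluid \<xi> \<Longrightarrow> u p = v p"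
  shows "u (\<xi> \<theta>, \<theta>) = v (\<xi> \<theta>, \<theta>)"
proof -
  have 1: "((\<lambda>\<rho>. (\<rho>, \<theta>)) \<longlongrightarrow> (\<xi> \<theta>, \<theta>)) (at_left (\<xi> \<theta>))"
    by (intro tendsto_intros)
  have ev: "\<forall>\<^sub>F \<rho> in at_left (\<xi> \<theta>). \<rho> < \<xi> \<theta>"
    by (simp add: eventually_at_filter)
  have lim: "((\<lambda>\<rho>. f (\<rho>, \<theta>)) \<longlongrightarrow> f (\<xi> \<theta>, \<theta>)) (at_left (\<xi> \<theta>))"
    if "continuous_on (fluid_closed \<xi>) f" for f :: "real \<times> real \<Rightarrow> 'a"
    by (rule continuous_on_tendsto_compose[OF that 1])
      (use ev in \<open>auto simp: fluid_closed_def elim!: eventually_mono\<close>)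
  have "((\<lambda>\<rho>. v (\<rho>, \<theta>)) \<longlongrightarrow> u (\<xi> \<theta>, \<theta>)) (at_left (\<xi> \<theta>))"
    by (rule Lim_transform_eventually[OF lim[OF assms(1)]])
      (use ev in \<open>auto simp: fluid_def eq elim!: eventually_mono\<close>)
  then show ?thesis
    using lim[OF assms(2)] by (rule tendsto_unique[OF trivial_limit_at_left_real])
qed

text \<open>Uniform decay of both \<rho>-derivatives makes the difference grow more slowly than any
  multiple of |\<rho>|, which is the growth condition of \<open>maximum_principle\<close>.
  Exchanging the two potentials later gives equality.\<close>

lemma potential_le:
  assumes \<xi>: "periodic \<xi>" "continuous_on UNIV \<xi>"
    and pot: "potential \<xi> \<psi> P1 g1" "potential \<xi> \<psi> P2 g2"
    and le: "\<rho>0 \<le> \<xi> \<theta>0"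
  shows "P1 (\<rho>0, \<theta>0) \<le> P2 (\<rho>0, \<theta>0)"
proof -
  obtain M where M: "M > 0" "\<And>x. \<bar>\<xi> x\<bar> \<le> M" using periodic_bounded[OF \<xi>] by blast
  define u where "u p = P1 p - P2 p" for p
  have "u (\<rho>0, \<theta>0) \<le> 0"
  proof (rule maximum_principle[OF \<xi> _ _ _ _ _ le])
    show "harmonic_on u (fluid \<xi>)" using pot by (auto simp: u_def[abs_def] potential_def intro: harmonic_diff)
    show cu: "continuous_on (fluid_closed \<xi>) u"
      unfolding u_def using pot by (auto simp: potential_def intro!: continuous_intros)
    show pu: "u (\<rho>, \<theta> + 2 * pi) = u (\<rho>, \<theta>)" for \<rho> \<theta>
      using pot by (simp add: u_def potential_def)
    show "u (\<xi> \<theta>, \<theta>) \<le> 0" for \<theta> using pot by (simp add: u_def potential_def)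
    show "\<exists>R. \<forall>\<rho>\<le>R. \<forall>\<theta>. u (\<rho>, \<theta>) \<le> \<delta> * (- \<rho>)" if "\<delta> > 0" for \<delta>
    proof -
      \<comment> \<open>A quarter for each potential bounds the derivative of the difference by
        \<open>\<delta> / 2\<close>; the other half of \<delta> absorbs the bound \<open>B\<close>
        at depth \<open>R0\<close> once \<rho> is low enough, which determines
        \<open>R3\<close>.\<close>
      have "\<exists>R. \<forall>\<rho>\<le>R. \<forall>\<theta>. \<bar>fst (g (\<rho>, \<theta>))\<bar> < \<delta> / 4" if "potential \<xi> \<psi> P g" for P g
      proof -
        have "uniform_limit UNIV (\<lambda>\<rho> \<theta>. fst (g (\<rho>, \<theta>))) (\<lambda>\<theta>. 0) at_bot"
          using that by (simp add: potential_def)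
        then have "\<forall>\<^sub>F \<rho> in at_bot. \<forall>\<theta>. dist (fst (g (\<rho>, \<theta>))) 0 < \<delta> / 4"
          by (drule_tac uniform_limitD[of _ _ _ _ "\<delta> / 4"]) (use \<open>\<delta> > 0\<close> in auto)
        then show ?thesis by (simp add: eventually_at_bot_linorder)
      qed
      from this[OF pot(1)] this[OF pot(2)] obtain R1 R2
        where R: "\<And>\<rho> \<theta>. \<rho> \<le> R1 \<Longrightarrow> \<bar>fst (g1 (\<rho>, \<theta>))\<bar> < \<delta> / 4" "\<And>\<rho> \<theta>. \<rho> \<le> R2 \<Longrightarrow> \<bar>fst (g2 (\<rho>, \<theta>))\<bar> < \<delta> / 4"
        by blast
      define R0 where "R0 = min (min R1 R2) (- M - 1)"
      have R0: "R0 \<le> R1" "R0 \<le> R2" "R0 < \<xi> \<theta>" for \<theta> using M(2)[of \<theta>] M(1) by (auto simp: R0_def)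
      have "periodic (\<lambda>\<theta>. u (R0, \<theta>))" using pu by (simp add: periodic_def)
      moreover have "continuous_on UNIV (\<lambda>\<theta>. u (R0, \<theta>))"
        by (rule continuous_on_compose2[OF cu]) (use R0(3) in \<open>auto intro!: continuous_intros simp: fluid_closed_def less_imp_le\<close>)
      ultimately obtain B where B: "B > 0" "\<And>\<theta>. \<bar>u (R0, \<theta>)\<bar> \<le> B" using periodic_bounded by blast
      have lin: "u (\<rho>, \<theta>) \<le> B + \<delta> / 2 * (R0 - \<rho>)" if less: "\<rho> < R0" for \<rho> \<theta>
      proof -
        have d: "((\<lambda>x. u (x, \<theta>)) has_real_derivative fst (g1 (x, \<theta>)) - fst (g2 (x, \<theta>))) (at x)" if "x \<le> R0" for x
        proof -
          have "(x, \<theta>) \<in> fluid \<xi>" using that R0(3)[of \<theta>] by (simp add: fluid_def)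
          then have "GDERIV P1 (x, \<theta>) :> g1 (x, \<theta>)" "GDERIV P2 (x, \<theta>) :> g2 (x, \<theta>)"
            using pot by (auto simp: potential_def)
          then show ?thesis unfolding u_def by (intro DERIV_diff GDERIV_partials)
        qed
        obtain z where z: "\<rho> < z" "z < R0" "u (R0, \<theta>) - u (\<rho>, \<theta>) = (R0 - \<rho>) * (fst (g1 (z, \<theta>)) - fst (g2 (z, \<theta>)))"
          using MVT2[where f = "\<lambda>x. u (x, \<theta>)" and f' = "\<lambda>x. fst (g1 (x, \<theta>)) - fst (g2 (x, \<theta>))", OF less] d
          by blast
        have "fst (g1 (z, \<theta>)) - fst (g2 (z, \<theta>)) \<ge> - (\<delta> / 2)"
          using R(1)[of z \<theta>] R(2)[of z \<theta>] z R0(1,2) by auto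
        then have "(R0 - \<rho>) * (fst (g1 (z, \<theta>)) - fst (g2 (z, \<theta>))) \<ge> (R0 - \<rho>) * (- (\<delta> / 2))"
          using that by (intro mult_left_mono) auto
        then show ?thesis using z(3) B(2)[of \<theta>] by (simp add: algebra_simps abs_le_iff)
      qed
      define R3 where "R3 = min (R0 - 1) (- (2 / \<delta>) * (B + \<delta> / 2 * R0))"
      have "u (\<rho>, \<theta>) \<le> \<delta> * (- \<rho>)" if "\<rho> \<le> R3" for \<rho> \<theta>
      proof -
        have "\<rho> \<le> - (2 / \<delta>) * (B + \<delta> / 2 * R0)" using that by (simp add: R3_def)
        then have "\<delta> / 2 * \<rho> \<le> \<delta> / 2 * (- (2 / \<delta>) * (B + \<delta> / 2 * R0))"
          using \<open>\<delta> > 0\<close> by (intro mult_left_mono) auto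
        moreover have "\<delta> / 2 * (- (2 / \<delta>) * X) = - X" for X using \<open>\<delta> > 0\<close> by simp
        ultimately have "\<delta> / 2 * \<rho> \<le> - (B + \<delta> / 2 * R0)" by metis
        moreover have "u (\<rho>, \<theta>) \<le> B + \<delta> / 2 * (R0 - \<rho>)" using that by (intro lin) (simp add: R3_def)
        ultimately show ?thesis by (simp add: field_simps)
      qed
      then show ?thesis by blast
    qed
  qed
  then show ?thesis by (simp add: u_def)
qed

text \<open>Equal values on the open domain force equal gradients there, and continuity up to the
  boundary extends this to the surface. Above the surface \<open>potential\<close> determines
  nothing, hence the restriction of \<open>p\<close>.\<close>

lemma potential_unique:
  assumes \<xi>: "periodic \<xi>" "continuous_on UNIV \<xi>"
    and pot: "potential \<xi> \<psi> P1 g1" "potential \<xi> \<psi> P2 g2"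
    and p: "p \<in> fluid_closed \<xi>"
  shows "P1 p = P2 p" "g1 p = g2 p"
proof -
  have P: "P1 p = P2 p" if "p \<in> fluid_closed \<xi>" for p
    using that potential_le[OF \<xi> pot] potential_le[OF \<xi> pot(2,1)]
    by (cases p) (auto simp: fluid_closed_def intro: antisym)
  have g: "g1 p = g2 p" if "p \<in> fluid \<xi>" for p
  proof (rule GDERIV_unique_gradient)
    show "GDERIV P1 p :> g1 p" using pot that by (simp add: potential_def)
    have "GDERIV P2 p :> g2 p" using pot that by (simp add: potential_def)
    then show "GDERIV P1 p :> g2 p"
      by (rule GDERIV_transform[OF _ open_fluid[OF \<xi>(2)] that])
        (use P in \<open>auto simp: fluid_def fluid_closed_def\<close>)
  qed
  show "P1 p = P2 p" by (rule P[OF p])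
  have "g1 (\<xi> \<theta>, \<theta>) = g2 (\<xi> \<theta>, \<theta>)" for \<theta>
    by (rule boundary_limit[of \<xi> g1 g2]) (use pot g in \<open>auto simp: potential_def\<close>)
  with g p show "g1 p = g2 p" by (cases p) (auto simp: fluid_def fluid_closed_def le_less)
qed


section \<open>The operators for a potential given by an analytic function\<close>

lemma harmonic_cong:
  assumes "harmonic_on u S" and eq: "\<And>p. p \<in> S \<Longrightarrow> u p = v p"
  shows "harmonic_on v S"
proof -
  from assms(1) obtain g g1 g2 where op: "open S" and c: "continuous_on S g1" "continuous_on S g2" and
      G: "\<And>p. p \<in> S \<Longrightarrow> GDERIV u p :> g p"
         "\<And>p. p \<in> S \<Longrightarrow> GDERIV (\<lambda>q. fst (g q)) p :> g1 p"
         "\<And>p. p \<in> S \<Longrightarrow> GDERIV (\<lambda>q. snd (g q)) p :> g2 p"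
         "\<And>p. p \<in> S \<Longrightarrow> fst (g1 p) + snd (g2 p) = 0"
    unfolding harmonic_on_def by blast
  have "GDERIV v p :> g p" if "p \<in> S" for p
    by (rule GDERIV_transform[OF G(1)[OF that] op that eq])
  then show ?thesis unfolding harmonic_on_def using op c G(2-4) by blast
qed

text \<open>The curve \<gamma> of the overview.\<close>

definition bdry :: "(real \<Rightarrow> real) \<Rightarrow> real \<Rightarrow> complex" where
  "bdry \<xi> \<theta> = exp (Complex (\<xi> \<theta>) \<theta>)"

text \<open>
  \<open>a (r, \<theta>)\<close> and \<open>b (r, \<theta>)\<close> are the values of \<open>A\<close> and \<open>A'\<close> at \<open>r \<gamma>(\<theta>)\<close>. They are separate functions because
  at the boundary \<open>r = 1\<close> they stand for limits from inside.
\<close>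

definition conj_potential ::
  "(real \<Rightarrow> real) \<Rightarrow> (real \<Rightarrow> real) \<Rightarrow> (complex \<Rightarrow> complex) \<Rightarrow> (real \<times> real \<Rightarrow> complex) \<Rightarrow> (real \<times> real \<Rightarrow> complex) \<Rightarrow> bool"
where
  "conj_potential \<xi> \<psi> A a b \<longleftrightarrow>
     (\<forall>r \<theta>. 0 \<le> r \<longrightarrow> r < 1 \<longrightarrow> A analytic_on {of_real r * bdry \<xi> \<theta>} \<and>
        a (r, \<theta>) = A (of_real r * bdry \<xi> \<theta>) \<and> b (r, \<theta>) = deriv A (of_real r * bdry \<xi> \<theta>)) \<and>
     continuous_on ({0..1} \<times> UNIV) a \<and> continuous_on ({0..1} \<times> UNIV) b \<and>
     (\<forall>r \<theta>. a (r, \<theta> + 2 * pi) = a (r, \<theta>)) \<and> (\<forall>r \<theta>. b (r, \<theta> + 2 * pi) = b (r, \<theta>)) \<and>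
     (\<forall>\<theta>. Re (a (1, \<theta>)) = \<psi> \<theta>)"

text \<open>\<open>Arg\<close> jumps across the negative real axis. There it is replaced by
  \<open>Arg (- z) + pi\<close>, which is continuous and differs from it by a multiple of 2 pi, a
  change that the periodic \<open>q\<close> does not see.\<close>

lemma continuous_on_angle:
  fixes q :: "real \<times> real \<Rightarrow> 'a::topological_space"
  assumes q: "continuous_on (S \<times> UNIV) q" and per: "\<And>r \<theta>. r \<in> S \<Longrightarrow> q (r, \<theta> + 2 * pi) = q (r, \<theta>)"
    and R: "continuous_on T R" "\<And>z. z \<in> T \<Longrightarrow> R z \<in> S" and T: "0 \<notin> T"
  shows "continuous_on T (\<lambda>z. q (R z, Arg z))"
  unfolding continuous_on_def
proof
  fix z0 assume z0: "z0 \<in> T"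
  have perq: "q (r, \<theta> + 2 * pi * of_int n) = q (r, \<theta>)" if "r \<in> S" for r \<theta> n
  proof -
    have nat: "q (r, \<theta> + 2 * pi * real m) = q (r, \<theta>)" for m \<theta>
    proof (induction m)
      case (Suc m)
      have "q (r, \<theta> + 2 * pi * real (Suc m)) = q (r, (\<theta> + 2 * pi * real m) + 2 * pi)"
        by (simp add: algebra_simps)
      then show ?case using per[OF that] Suc by simp
    qed simp
    show ?thesis
    proof (cases "n \<ge> 0")
      case True
      then show ?thesis using nat[of \<theta> "nat n"] by simp
    next
      case False
      then show ?thesis using nat[of "\<theta> + 2 * pi * of_int n" "nat (- n)"] by simp
    qed
  qed
  have Rl: "(R \<longlongrightarrow> R z0) (at z0 within T)" using R(1) z0 by (simp add: continuous_on_def)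
  show "((\<lambda>z. q (R z, Arg z)) \<longlongrightarrow> q (R z0, Arg z0)) (at z0 within T)"
  proof (cases "z0 \<in> \<real>\<^sub>\<le>\<^sub>0")
    case False
    have "(Arg \<longlongrightarrow> Arg z0) (at z0 within T)"
      using continuous_at_imp_continuous_at_within[OF continuous_at_Arg[OF False]]
      by (simp only: continuous_within)
    with Rl have "((\<lambda>z. (R z, Arg z)) \<longlongrightarrow> (R z0, Arg z0)) (at z0 within T)"
      by (rule tendsto_Pair)
    then show ?thesis
      by (rule continuous_on_tendsto_compose[OF q])
        (use R z0 in \<open>auto simp: eventually_at_filter\<close>)
  next
    case True
    have eq: "q (R z, Arg z) = q (R z, Arg (- z) + pi)" if "z \<in> T" for z
    proof -
      have "z \<noteq> 0" using that T by auto
      have "exp (\<i> * of_real (Arg (- z) + pi)) = exp (\<i> * of_real (Arg (- z))) * exp (\<i> * of_real pi)"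
        by (simp add: distrib_left exp_add)
      also have "\<dots> = - exp (\<i> * of_real (Arg (- z)))" by simp
      also have "\<dots> = z / of_real (norm z)" using \<open>z \<noteq> 0\<close> by (simp add: cis_Arg cis_conv_exp[symmetric] sgn_div_norm scaleR_conv_of_real field_simps)
      also have "\<dots> = exp (\<i> * of_real (Arg z))" using \<open>z \<noteq> 0\<close> by (simp add: cis_Arg cis_conv_exp[symmetric] sgn_div_norm scaleR_conv_of_real field_simps)
      finally obtain n :: int where "\<i> * of_real (Arg (- z) + pi) = \<i> * of_real (Arg z) + of_real (of_int (2 * n) * pi) * \<i>"
        unfolding exp_eq by auto
      then have "\<i> * of_real (Arg (- z) + pi) = \<i> * of_real (Arg z + 2 * pi * of_int n)"
        by (simp add: algebra_simps)
      then have "complex_of_real (Arg (- z) + pi) = of_real (Arg z + 2 * pi * of_int n)"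
        by simp
      then have "Arg (- z) + pi = Arg z + 2 * pi * of_int n" by (simp only: of_real_eq_iff)
      then show ?thesis using perq[OF R(2)[OF that], of "Arg z" n] by simp
    qed
    have "z0 \<noteq> 0" using z0 T by auto
    with True have n: "- z0 \<notin> \<real>\<^sub>\<le>\<^sub>0" by (auto simp: complex_nonpos_Reals_iff complex_eq_iff)
    have "((\<lambda>z. Arg (- z)) \<longlongrightarrow> Arg (- z0)) (at z0 within T)"
      by (rule isCont_tendsto_compose[OF continuous_at_Arg[OF n]]) (intro tendsto_intros)
    then have "((\<lambda>z. (R z, Arg (- z) + pi)) \<longlongrightarrow> (R z0, Arg (- z0) + pi)) (at z0 within T)"
      by (intro tendsto_Pair Rl tendsto_add tendsto_const)
    then have "((\<lambda>z. q (R z, Arg (- z) + pi)) \<longlongrightarrow> q (R z0, Arg (- z0) + pi)) (at z0 within T)"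
      by (rule continuous_on_tendsto_compose[OF q])
        (use R z0 in \<open>auto simp: eventually_at_filter\<close>)
    then show ?thesis
      unfolding eq[OF z0]
      by (rule Lim_transform_eventually) (use eq in \<open>auto simp: eventually_at_filter\<close>)
  qed
qed

lemma bdry_nonzero [simp]: "bdry \<xi> \<theta> \<noteq> 0"
  by (simp add: bdry_def)

text \<open>The dictionary between the two coordinate systems: r =
  \<open>exp (\<rho> - \<xi> \<theta>)\<close>, so that the surface is r = 1 and \<rho>
  \<rightarrow> -\<infinity> corresponds to r \<rightarrow> 0.\<close>

lemma bdry_scaled: "of_real (exp (\<rho> - \<xi> \<theta>)) * bdry \<xi> \<theta> = exp (Complex \<rho> \<theta>)"
proof -
  have "of_real (exp (\<rho> - \<xi> \<theta>)) * bdry \<xi> \<theta> = exp (of_real (\<rho> - \<xi> \<theta>) + Complex (\<xi> \<theta>) \<theta>)"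
    by (simp only: bdry_def exp_add exp_of_real)
  also have "of_real (\<rho> - \<xi> \<theta>) + Complex (\<xi> \<theta>) \<theta> = Complex \<rho> \<theta>"
    by (simp add: complex_eq_iff)
  finally show ?thesis .
qed

lemma bounded_strip:
  fixes b :: "real \<times> real \<Rightarrow> 'a::real_normed_vector"
  assumes b: "continuous_on ({0..1} \<times> UNIV) b" and per: "\<And>r \<theta>. b (r, \<theta> + 2 * pi) = b (r, \<theta>)"
  obtains B where "B > 0" "\<And>r \<theta>. 0 \<le> r \<Longrightarrow> r \<le> 1 \<Longrightarrow> norm (b (r, \<theta>)) \<le> B"
proof -
  have "compact (b ` ({0..1} \<times> {-pi..pi}))"
    by (intro compact_continuous_image compact_Times continuous_on_subset[OF b]) auto
  then have "bounded (b ` ({0..1} \<times> {-pi..pi}))" by (rule compact_imp_bounded)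
  then obtain B where B: "B > 0" "\<And>p. p \<in> {0..1} \<times> {-pi..pi} \<Longrightarrow> norm (b p) \<le> B"
    unfolding bounded_pos by blast
  show thesis
  proof
    fix r \<theta> :: real assume r: "0 \<le> r" "r \<le> 1"
    obtain n where n: "\<bar>\<theta> - 2 * pi * of_int n\<bar> \<le> pi" by (rule angle_reduce)
    have "periodic (\<lambda>\<theta>. norm (b (r, \<theta>)))" using per by (simp add: periodic_def)
    from periodic_int[OF this, of \<theta> "- n"] have "norm (b (r, \<theta> - 2 * pi * of_int n)) = norm (b (r, \<theta>))" by simp
    then show "norm (b (r, \<theta>)) \<le> B" using B(2)[of "(r, \<theta> - 2 * pi * of_int n)"] r n by (auto simp: abs_le_iff)
  qed fact
qed

context
  fixes \<xi> \<psi> A a b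
  assumes \<xi>: "periodic \<xi>" "continuous_on UNIV \<xi>"
    and cp: "conj_potential \<xi> \<psi> A a b"
begin

text \<open>The minimum with 1 keeps points above the surface inside the strip on which
  \<open>a\<close> and \<open>b\<close> are continuous, so that the composed functions are
  continuous on the whole plane.\<close>

abbreviation "rad p \<equiv> min 1 (exp (fst p - \<xi> (snd p)))"

lemma holo_exp: "(\<lambda>w. A (exp w)) holomorphic_on cfluid \<xi>"
  and deriv_exp: "w \<in> cfluid \<xi> \<Longrightarrow> ((\<lambda>w. A (exp w)) has_field_derivative deriv A (exp w) * exp w) (at w)"
proof -
  have *: "((\<lambda>w. A (exp w)) has_field_derivative deriv A (exp w) * exp w) (at w)" if w: "w \<in> cfluid \<xi>" for w
  proof -
    have "A analytic_on {of_real (exp (Re w - \<xi> (Im w))) * bdry \<xi> (Im w)}"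
      using cp w by (auto simp: conj_potential_def cfluid_def)
    then have "A analytic_on {exp w}" unfolding bdry_scaled by simp
    then have "(A has_field_derivative deriv A (exp w)) (at (exp w))"
      using analytic_on_imp_differentiable_at[of A "{exp w}"] by (auto simp: DERIV_deriv_iff_field_differentiable)
    from DERIV_chain2[OF this DERIV_exp] show ?thesis .
  qed
  show "w \<in> cfluid \<xi> \<Longrightarrow> ((\<lambda>w. A (exp w)) has_field_derivative deriv A (exp w) * exp w) (at w)" by (rule *)
  show "(\<lambda>w. A (exp w)) holomorphic_on cfluid \<xi>"
    unfolding holomorphic_on_open[OF open_cfluid[OF \<xi>(2)]] using * by blast
qed

lemma ab_fluid:
  assumes "p \<in> fluid \<xi>"
  shows "a (rad p, snd p) = A (exp (Complex (fst p) (snd p)))"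
    and "b (rad p, snd p) = deriv A (exp (Complex (fst p) (snd p)))"
proof -
  have "rad p = exp (fst p - \<xi> (snd p))" "exp (fst p - \<xi> (snd p)) < 1"
    using assms by (auto simp: fluid_def)
  then show "a (rad p, snd p) = A (exp (Complex (fst p) (snd p)))"
     "b (rad p, snd p) = deriv A (exp (Complex (fst p) (snd p)))"
    using cp bdry_scaled[of "fst p" \<xi> "snd p"] by (simp_all add: conj_potential_def)
qed

lemma continuous_rad:
  assumes "continuous_on ({0..1} \<times> UNIV) c"
  shows "continuous_on UNIV (\<lambda>p. c (rad p, snd p))"
  by (rule continuous_on_compose2[OF assms])
    (auto intro!: continuous_intros continuous_on_compose2[OF \<xi>(2)])

text \<open>By the chain rule the complex derivative of A(exp w) is A'(exp w) exp w. Since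
  \<open>b\<close> is bounded on the strip, the gradient is of order exp \<rho>, which yields the
  decay uniformly in \<theta>.\<close>

lemma conj_potential_potential:
  "potential \<xi> \<psi> (\<lambda>p. Re (a (rad p, snd p)))
     (\<lambda>p. (Re (b (rad p, snd p) * exp (Complex (fst p) (snd p))), - Im (b (rad p, snd p) * exp (Complex (fst p) (snd p)))))"
proof -
  have ca: "continuous_on ({0..1} \<times> UNIV) a" and cb: "continuous_on ({0..1} \<times> UNIV) b"
    using cp by (auto simp: conj_potential_def)
  have pa: "\<And>r \<theta>. a (r, \<theta> + 2 * pi) = a (r, \<theta>)" and pb: "\<And>r \<theta>. b (r, \<theta> + 2 * pi) = b (r, \<theta>)"
    using cp by (auto simp: conj_potential_def)
  have pxi: "\<xi> (\<theta> + 2 * pi) = \<xi> \<theta>" for \<theta> using \<xi>(1) by (simp add: periodic_def)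
  note ca' = continuous_rad[OF ca] and cb' = continuous_rad[OF cb]
  have op: "open (fluid \<xi>)" by (rule open_fluid[OF \<xi>(2)])
  have cexp: "continuous_on S (\<lambda>p. exp (Complex (fst p) (snd p)))" for S :: "(real \<times> real) set"
    unfolding Complex_eq by (intro continuous_intros)
  show ?thesis
    unfolding potential_def
  proof (intro conjI allI ballI)
    fix \<rho> \<theta>
    show "Re (a (rad (\<rho>, \<theta> + 2 * pi), snd (\<rho>, \<theta> + 2 * pi))) = Re (a (rad (\<rho>, \<theta>), snd (\<rho>, \<theta>)))"
      by (simp add: pa pxi)
  next
    have h: "harmonic_on (\<lambda>p. Re (A (exp (Complex (fst p) (snd p))))) (fluid \<xi>)"
      by (rule harmonic_Re[OF \<xi>(2) holo_exp])
    then show "harmonic_on (\<lambda>p. Re (a (rad p, snd p))) (fluid \<xi>)"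
      by (rule harmonic_cong) (simp only: ab_fluid(1))
  next
    show "continuous_on (fluid_closed \<xi>) (\<lambda>p. Re (a (rad p, snd p)))"
      by (intro continuous_intros continuous_on_subset[OF ca']) auto
    show "continuous_on (fluid_closed \<xi>) (\<lambda>p. (Re (b (rad p, snd p) * exp (Complex (fst p) (snd p))),
         - Im (b (rad p, snd p) * exp (Complex (fst p) (snd p)))))"
      by (intro continuous_intros cexp continuous_on_subset[OF cb']) auto
  next
    fix p assume p: "p \<in> fluid \<xi>"
    then have "Complex (fst p) (snd p) \<in> cfluid \<xi>" by simp
    from GDERIV_Re_Im(1)[OF deriv_exp[OF this]]
    have "GDERIV (\<lambda>p. Re (A (exp (Complex (fst p) (snd p))))) p :>
        (Re (deriv A (exp (Complex (fst p) (snd p))) * exp (Complex (fst p) (snd p))),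
       - Im (deriv A (exp (Complex (fst p) (snd p))) * exp (Complex (fst p) (snd p))))" by simp
    then show "GDERIV (\<lambda>p. Re (a (rad p, snd p))) p :> (Re (b (rad p, snd p) * exp (Complex (fst p) (snd p))),
         - Im (b (rad p, snd p) * exp (Complex (fst p) (snd p))))"
      unfolding ab_fluid(2)[OF p]
      by (rule GDERIV_transform[OF _ op p]) (simp only: ab_fluid(1))
  next
    fix \<theta>
    show "Re (a (rad (\<xi> \<theta>, \<theta>), snd (\<xi> \<theta>, \<theta>))) = \<psi> \<theta>"
      using cp by (simp add: conj_potential_def)
  next
    obtain B where B: "B > 0" "\<And>r \<theta>. 0 \<le> r \<Longrightarrow> r \<le> 1 \<Longrightarrow> norm (b (r, \<theta>)) \<le> B"
      using bounded_strip[OF cb pb] by blast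
    show "uniform_limit UNIV (\<lambda>\<rho> \<theta>. fst (Re (b (rad (\<rho>, \<theta>), snd (\<rho>, \<theta>)) * exp (Complex (fst (\<rho>, \<theta>)) (snd (\<rho>, \<theta>)))),
         - Im (b (rad (\<rho>, \<theta>), snd (\<rho>, \<theta>)) * exp (Complex (fst (\<rho>, \<theta>)) (snd (\<rho>, \<theta>)))))) (\<lambda>\<theta>. 0) at_bot"
    proof (rule uniform_limitI)
      fix e :: real assume e: "e > 0"
      have "((\<lambda>\<rho>. B * exp \<rho>) \<longlongrightarrow> B * 0) at_bot" by (intro tendsto_intros exp_at_bot)
      then have "\<forall>\<^sub>F \<rho> in at_bot. B * exp \<rho> < e" using e by (intro order_tendstoD(2)) auto
      then show "\<forall>\<^sub>F \<rho> in at_bot. \<forall>\<theta>\<in>UNIV. dist (fst (Re (b (rad (\<rho>, \<theta>), snd (\<rho>, \<theta>)) * exp (Complex (fst (\<rho>, \<theta>)) (snd (\<rho>, \<theta>)))),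
         - Im (b (rad (\<rho>, \<theta>), snd (\<rho>, \<theta>)) * exp (Complex (fst (\<rho>, \<theta>)) (snd (\<rho>, \<theta>)))))) 0 < e"
      proof (rule eventually_mono, intro ballI)
        fix \<rho> \<theta> :: real assume le: "B * exp \<rho> < e"
        have "\<bar>Re (b (rad (\<rho>, \<theta>), \<theta>) * exp (Complex \<rho> \<theta>))\<bar> \<le> norm (b (rad (\<rho>, \<theta>), \<theta>)) * norm (exp (Complex \<rho> \<theta>))"
          using abs_Re_le_cmod norm_mult by metis
        also have "\<dots> \<le> B * exp \<rho>" by (intro mult_mono B) (use B(1) in auto)
        finally show "dist (fst (Re (b (rad (\<rho>, \<theta>), snd (\<rho>, \<theta>)) * exp (Complex (fst (\<rho>, \<theta>)) (snd (\<rho>, \<theta>)))),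
         - Im (b (rad (\<rho>, \<theta>), snd (\<rho>, \<theta>)) * exp (Complex (fst (\<rho>, \<theta>)) (snd (\<rho>, \<theta>)))))) 0 < e"
          using le by (simp add: dist_real_def)
      qed
    qed
  qed
qed

text \<open>Put z = A' \<gamma> on the curve. The gradient there is (Re z, - Im z), so the
  expression in \<open>G_op\<close> is Re z + \<xi>' Im z = Im (z (\<xi>' + i)): the tangential
  derivative of the stream function.\<close>

lemma G_op_eq: "G_op \<xi> \<psi> = (\<lambda>\<theta>. Im (b (1, \<theta>) * bdry \<xi> \<theta> * Complex (deriv \<xi> \<theta>) 1))"
proof -
  let ?P = "\<lambda>p. Re (a (rad p, snd p))"
  let ?g = "\<lambda>p. (Re (b (rad p, snd p) * exp (Complex (fst p) (snd p))), - Im (b (rad p, snd p) * exp (Complex (fst p) (snd p))))"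
  show ?thesis
    unfolding G_op_def
  proof (rule the_equality)
    show "\<exists>P g. potential \<xi> \<psi> P g \<and> (\<lambda>\<theta>. Im (b (1, \<theta>) * bdry \<xi> \<theta> * Complex (deriv \<xi> \<theta>) 1)) =
        (\<lambda>\<theta>. fst (g (\<xi> \<theta>, \<theta>)) - deriv \<xi> \<theta> * snd (g (\<xi> \<theta>, \<theta>)))"
      by (rule exI[of _ ?P], rule exI[of _ ?g], rule conjI[OF conj_potential_potential])
        (auto simp: bdry_def algebra_simps)
    fix w assume "\<exists>P g. potential \<xi> \<psi> P g \<and> w = (\<lambda>\<theta>. fst (g (\<xi> \<theta>, \<theta>)) - deriv \<xi> \<theta> * snd (g (\<xi> \<theta>, \<theta>)))"
    then obtain P g where P: "potential \<xi> \<psi> P g" and w: "w = (\<lambda>\<theta>. fst (g (\<xi> \<theta>, \<theta>)) - deriv \<xi> \<theta> * snd (g (\<xi> \<theta>, \<theta>)))"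
      by blast
    have "g (\<xi> \<theta>, \<theta>) = ?g (\<xi> \<theta>, \<theta>)" for \<theta>
      by (rule potential_unique(2)[OF \<xi> P conj_potential_potential]) (simp add: fluid_closed_def)
    then show "w = (\<lambda>\<theta>. Im (b (1, \<theta>) * bdry \<xi> \<theta> * Complex (deriv \<xi> \<theta>) 1))"
      unfolding w by (auto simp: bdry_def algebra_simps)
  qed
qed


lemma continuous_on_zeta_Arg: "continuous_on (- {0}) (\<lambda>z. \<xi> (Arg z))"
  using continuous_on_angle[of UNIV "\<lambda>p. \<xi> (snd p)" "- {0}" "\<lambda>z. 0"] \<xi>(1)
  by (simp add: periodic_def continuous_on_compose2[OF \<xi>(2)] continuous_intros)

text \<open>The stream function is Im A up to a constant. Two admissible stream functions belong to
  potentials that agree on the drop, hence have the same gradient; as the drop without the origin is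
  connected, they differ by a constant, which the zero mean fixes.\<close>

lemma K_op_eq:
  "K_op \<xi> \<psi> = (\<lambda>\<theta>. Im (a (1, \<theta>)) - circle_integral (\<lambda>\<theta>. Im (a (1, \<theta>))) / (2 * pi))"
proof -
  define m where "m = circle_integral (\<lambda>\<theta>. Im (a (1, \<theta>))) / (2 * pi)"
  let ?Z = "\<lambda>p. Complex (fst p) (snd p)"
  have ca: "continuous_on ({0..1} \<times> UNIV) a" and pa: "\<And>r \<theta>. a (r, \<theta> + 2 * pi) = a (r, \<theta>)"
    using cp by (auto simp: conj_potential_def)
  \<comment> \<open>\<open>a\<close> transported to the punctured plane: the first argument is the
    radius r of z relative to the curve, cut off at 1. Unlike \<open>A\<close>, this function is
    continuous up to the curve.\<close>
  define H where "H z = a (min 1 (norm z * exp (- \<xi> (Arg z))), Arg z)" for z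
  have cH: "continuous_on (- {0}) H"
    unfolding H_def
    by (rule continuous_on_angle[OF ca]) (auto simp: pa intro!: continuous_intros continuous_on_zeta_Arg)
  have Zpolar: "?Z (polar p) = exp (?Z p)" for p
    by (cases p) (simp add: polar_def complex_eq_iff Re_exp Im_exp)
  have Hexp: "H (exp (?Z p)) = a (rad p, snd p)" for p
  proof -
    have "exp (Ln (exp (?Z p))) = exp (?Z p)" by (rule exp_Ln) simp
    then obtain n :: int where "Ln (exp (?Z p)) = ?Z p + (of_int (2 * n) * pi) * \<i>"
      unfolding exp_eq by blast
    then have "Arg (exp (?Z p)) = snd p + 2 * pi * of_int n"
      by (simp add: Arg_def)
    moreover have "periodic \<xi>" by (rule \<xi>)
    ultimately have "\<xi> (Arg (exp (?Z p))) = \<xi> (snd p)" and A: "Arg (exp (?Z p)) = snd p + 2 * pi * of_int n"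
      by (simp_all add: periodic_int)
    then have "H (exp (?Z p)) = a (rad p, snd p + 2 * pi * of_int n)"
      by (simp add: H_def exp_diff exp_minus field_simps)
    also have "Re \<dots> = Re (a (rad p, snd p))"
      by (rule periodic_int[of "\<lambda>\<theta>. Re (a (rad p, \<theta>))"]) (simp add: periodic_def pa)
    moreover have "Im (a (rad p, snd p + 2 * pi * of_int n)) = Im (a (rad p, snd p))"
      by (rule periodic_int[of "\<lambda>\<theta>. Im (a (rad p, \<theta>))"]) (simp add: periodic_def pa)
    ultimately show ?thesis by (simp add: complex_eq_iff)
  qed
  define U where "U = polar ` fluid \<xi>"
  \<comment> \<open>Derivatives can be transferred between functions that agree on the drop only if
    it is open; the open mapping theorem for \<open>exp\<close> provides this.\<close>
  have opE: "open (exp ` cfluid \<xi>)"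
  proof (rule open_mapping_thm[of exp "cfluid \<xi>"])
    show "\<not> exp constant_on cfluid \<xi>"
    proof
      assume "exp constant_on cfluid \<xi>"
      then obtain c where c: "\<And>w. w \<in> cfluid \<xi> \<Longrightarrow> exp w = c" by (auto simp: constant_on_def)
      have "exp (of_real (\<xi> 0 - 1)) = exp (of_real (\<xi> 0 - 2) :: complex)"
        using c[of "of_real (\<xi> 0 - 1)"] c[of "of_real (\<xi> 0 - 2)"] by (simp add: cfluid_def)
      then show False unfolding exp_of_real of_real_eq_iff by simp
    qed
  qed (auto intro!: holomorphic_intros open_cfluid connected_cfluid \<xi>)
  have U_eq: "U = {p. ?Z p \<in> exp ` cfluid \<xi>}"
  proof (intro equalityI subsetI)
    fix p assume "p \<in> U"
    then obtain q where "q \<in> fluid \<xi>" "p = polar q" by (auto simp: U_def)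
    then show "p \<in> {p. ?Z p \<in> exp ` cfluid \<xi>}" by (auto simp: Zpolar intro!: imageI)
  next
    fix p assume "p \<in> {p. ?Z p \<in> exp ` cfluid \<xi>}"
    then obtain w where w: "w \<in> cfluid \<xi>" "?Z p = exp w" by auto
    then have "?Z p = ?Z (polar (Re w, Im w))" by (simp add: Zpolar)
    then have "p = polar (Re w, Im w)" by (simp add: prod_eq_iff)
    moreover have "(Re w, Im w) \<in> fluid \<xi>" using w by (simp add: cfluid_def fluid_def)
    ultimately show "p \<in> U" by (simp add: U_def)
  qed
  have opU: "open U"
  proof -
    have "continuous_on UNIV ?Z" unfolding Complex_eq by (intro continuous_intros)
    from open_vimage[OF opE this] show ?thesis by (simp add: U_eq vimage_def)
  qed
  have cpolar: "continuous_on S polar" for S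
    unfolding polar_def case_prod_unfold by (intro continuous_intros)
  have conU: "connected U"
    unfolding U_def by (intro connected_continuous_image cpolar connected_fluid \<xi>)
  have HA: "H (?Z z) = A (?Z z)" if "z \<in> U" for z
  proof -
    from that obtain p where p: "p \<in> fluid \<xi>" "z = polar p" by (auto simp: U_def)
    show ?thesis unfolding p(2) Zpolar Hexp ab_fluid(1)[OF p(1)] ..
  qed
  have dH: "\<exists>d. GDERIV (\<lambda>z. Re (H (?Z z))) z :> d \<and> GDERIV (\<lambda>z. Im (H (?Z z))) z :> rot d" if z: "z \<in> U" for z
  proof -
    from z obtain p where p: "p \<in> fluid \<xi>" "z = polar p" by (auto simp: U_def)
    define w where "w = ?Z p"
    have w: "w \<in> cfluid \<xi>" using p by (simp add: w_def)
    have "A analytic_on {of_real (exp (Re w - \<xi> (Im w))) * bdry \<xi> (Im w)}"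
      using cp w by (auto simp: conj_potential_def cfluid_def)
    then have "A analytic_on {exp w}" unfolding bdry_scaled by simp
    then have "(A has_field_derivative deriv A (exp w)) (at (exp w))"
      using analytic_on_imp_differentiable_at[of A "{exp w}"] by (auto simp: DERIV_deriv_iff_field_differentiable)
    then have D: "(A has_field_derivative deriv A (exp w)) (at (Complex (fst z) (snd z)))"
      using Zpolar[of p] by (simp add: p w_def)
    from GDERIV_Re_Im[OF this]
    have "GDERIV (\<lambda>z. Re (A (?Z z))) z :> (Re (deriv A (exp w)), - Im (deriv A (exp w)))"
      "GDERIV (\<lambda>z. Im (A (?Z z))) z :> (Im (deriv A (exp w)), Re (deriv A (exp w)))" by simp_all
    from this[THEN GDERIV_transform, OF opU z]
    have "GDERIV (\<lambda>z. Re (H (?Z z))) z :> (Re (deriv A (exp w)), - Im (deriv A (exp w)))"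
      "GDERIV (\<lambda>z. Im (H (?Z z))) z :> (Im (deriv A (exp w)), Re (deriv A (exp w)))"
      using HA by simp_all
    then show ?thesis
      by (intro exI[of _ "(Re (deriv A (exp w)), - Im (deriv A (exp w)))"]) (simp add: rot_def)
  qed
  have nz: "?Z (polar p) \<noteq> 0" for p unfolding Zpolar by simp
  have cHp: "continuous_on (polar ` S) (\<lambda>z. H (?Z z))" for S
    by (rule continuous_on_compose2[OF cH]) (use nz in \<open>auto simp: Complex_eq intro!: continuous_intros\<close>)
  have H1: "H (?Z (polar (\<xi> \<theta>, \<theta>))) = a (1, \<theta>)" for \<theta>
    unfolding Zpolar Hexp by simp
  have ca1: "continuous_on S (\<lambda>\<theta>. a (1, \<theta>))" for S
    by (rule continuous_on_compose2[OF ca]) (auto intro!: continuous_intros)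
  have ci: "circle_integral (\<lambda>\<theta>. Im (a (1, \<theta>)) + c) = 2 * pi * (m + c)" for c
    unfolding circle_integral_def m_def
    by (subst integral_add) (auto intro!: integrable_continuous_interval continuous_intros ca1 simp: field_simps)
  let ?k = "\<lambda>\<theta>. Im (a (1, \<theta>)) - m"
  let ?g = "\<lambda>p. (Re (b (rad p, snd p) * exp (Complex (fst p) (snd p))), - Im (b (rad p, snd p) * exp (Complex (fst p) (snd p))))"
  have "K_op \<xi> \<psi> = ?k"
    unfolding K_op_def
  proof (rule the_equality)
    show "\<exists>P g \<Phi> \<Psi>. potential \<xi> \<psi> P g \<and> (\<forall>p\<in>fluid_closed \<xi>. \<Phi> (polar p) = P p) \<and>
        (\<forall>z\<in>polar ` fluid \<xi>. \<exists>d. GDERIV \<Phi> z :> d \<and> GDERIV \<Psi> z :> rot d) \<and>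
        continuous_on (polar ` fluid_closed \<xi>) \<Psi> \<and> ?k = (\<lambda>\<theta>. \<Psi> (polar (\<xi> \<theta>, \<theta>))) \<and> circle_integral ?k = 0"
    proof (rule exI[of _ "\<lambda>p. Re (a (rad p, snd p))"], rule exI[of _ ?g],
        rule exI[of _ "\<lambda>z. Re (H (?Z z))"], rule exI[of _ "\<lambda>z. Im (H (?Z z)) - m"], intro conjI)
      show "potential \<xi> \<psi> (\<lambda>p. Re (a (rad p, snd p))) ?g" by (rule conj_potential_potential)
      show "\<forall>p\<in>fluid_closed \<xi>. Re (H (?Z (polar p))) = Re (a (rad p, snd p))"
        unfolding Zpolar Hexp by simp
      show "continuous_on (polar ` fluid_closed \<xi>) (\<lambda>z. Im (H (?Z z)) - m)"
        by (intro continuous_intros cHp)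
      show "?k = (\<lambda>\<theta>. Im (H (?Z (polar (\<xi> \<theta>, \<theta>)))) - m)" unfolding H1 ..
      show "circle_integral ?k = 0" using ci[of "- m"] by simp
      show "\<forall>z\<in>polar ` fluid \<xi>. \<exists>d. GDERIV (\<lambda>z. Re (H (?Z z))) z :> d \<and> GDERIV (\<lambda>z. Im (H (?Z z)) - m) z :> rot d"
      proof
        fix z assume "z \<in> polar ` fluid \<xi>"
        then obtain d where d: "GDERIV (\<lambda>z. Re (H (?Z z))) z :> d" "GDERIV (\<lambda>z. Im (H (?Z z))) z :> rot d"
          using dH unfolding U_def by blast
        have "GDERIV (\<lambda>z. Im (H (?Z z)) - m) z :> rot d"
          using GDERIV_diff[OF d(2) GDERIV_const[of m]] by simp
        with d(1) show "\<exists>d. GDERIV (\<lambda>z. Re (H (?Z z))) z :> d \<and> GDERIV (\<lambda>z. Im (H (?Z z)) - m) z :> rot d"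
          by blast
      qed
    qed
    fix w assume "\<exists>P g \<Phi> \<Psi>. potential \<xi> \<psi> P g \<and> (\<forall>p\<in>fluid_closed \<xi>. \<Phi> (polar p) = P p) \<and>
        (\<forall>z\<in>polar ` fluid \<xi>. \<exists>d. GDERIV \<Phi> z :> d \<and> GDERIV \<Psi> z :> rot d) \<and>
        continuous_on (polar ` fluid_closed \<xi>) \<Psi> \<and> w = (\<lambda>\<theta>. \<Psi> (polar (\<xi> \<theta>, \<theta>))) \<and> circle_integral w = 0"
    then obtain P g \<Phi> \<Psi> where P: "potential \<xi> \<psi> P g" and \<Phi>: "\<And>p. p \<in> fluid_closed \<xi> \<Longrightarrow> \<Phi> (polar p) = P p"
      and D: "\<And>z. z \<in> U \<Longrightarrow> \<exists>d. GDERIV \<Phi> z :> d \<and> GDERIV \<Psi> z :> rot d"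
      and c\<Psi>: "continuous_on (polar ` fluid_closed \<xi>) \<Psi>" and w: "w = (\<lambda>\<theta>. \<Psi> (polar (\<xi> \<theta>, \<theta>)))"
      and w0: "circle_integral w = 0"
      unfolding U_def by blast
    have \<Phi>H: "\<Phi> z = Re (H (?Z z))" if "z \<in> U" for z
    proof -
      from that obtain p where p: "p \<in> fluid \<xi>" "z = polar p" by (auto simp: U_def)
      then have pc: "p \<in> fluid_closed \<xi>" by (auto simp: fluid_def fluid_closed_def)
      show ?thesis
        unfolding p(2) \<Phi>[OF pc] Zpolar Hexp by (rule potential_unique(1)[OF \<xi> P conj_potential_potential pc])
    qed
    \<comment> \<open>Both gradients are \<open>rot\<close> of the gradient of one and the same
      potential.\<close>
    have zero: "((\<lambda>z. \<Psi> z - Im (H (?Z z))) has_derivative (\<lambda>h. 0)) (at z)" if z: "z \<in> U" for z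
    proof -
      obtain d where d: "GDERIV \<Phi> z :> d" "GDERIV \<Psi> z :> rot d" using D[OF z] by blast
      obtain e where e: "GDERIV (\<lambda>z. Re (H (?Z z))) z :> e" "GDERIV (\<lambda>z. Im (H (?Z z))) z :> rot e"
        using dH[OF z] by blast
      have "GDERIV (\<lambda>z. Re (H (?Z z))) z :> d" by (rule GDERIV_transform[OF d(1) opU z \<Phi>H])
      then have "d = e" using e(1) by (rule GDERIV_unique_gradient)
      with GDERIV_diff[OF d(2) e(2)] show ?thesis by (simp add: gderiv_def)
    qed
    define z0 where "z0 = polar (\<xi> 0 - 1, 0)"
    have "z0 \<in> U" by (auto simp: U_def z0_def fluid_def)
    define c where "c = \<Psi> z0 - Im (H (?Z z0))"
    have c: "\<Psi> z - Im (H (?Z z)) = c" if "z \<in> U" for z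
      unfolding c_def by (rule has_derivative_zero_unique_connected[OF opU conU zero that \<open>z0 \<in> U\<close>])
    have "\<Psi> (polar (\<xi> \<theta>, \<theta>)) - Im (H (?Z (polar (\<xi> \<theta>, \<theta>)))) = c" for \<theta>
    proof (rule boundary_limit[of \<xi> "\<lambda>p. \<Psi> (polar p) - Im (H (?Z (polar p)))" "\<lambda>p. c"])
      have "continuous_on (polar ` fluid_closed \<xi>) (\<lambda>z. \<Psi> z - Im (H (?Z z)))"
        by (intro continuous_intros c\<Psi> cHp)
      then show "continuous_on (fluid_closed \<xi>) (\<lambda>p. \<Psi> (polar p) - Im (H (?Z (polar p))))"
        by (rule continuous_on_compose2[OF _ cpolar]) simp
    qed (auto simp: c U_def intro: continuous_on_const)
    then have w': "w = (\<lambda>\<theta>. Im (a (1, \<theta>)) + c)" unfolding w H1 by (auto simp: fun_eq_iff algebra_simps)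
    with w0 ci[of c] have "c = - m" by simp
    then show "w = ?k" unfolding w' by simp
  qed
  then show ?thesis by (simp add: m_def)
qed

end


section \<open>The Fredholm alternative for continuous kernels\<close>

text \<open>Dimension count. \<open>B\<close> may be dependent, so a maximal independent subset
  \<open>C\<close> is used; its image is independent and equally large, and a vector
  \<open>y\<close> outside the span of the image would give more independent vectors than
  \<open>span C\<close> can hold.\<close>

lemma injective_imp_surjective_on_span:
  fixes L :: "'a::real_vector \<Rightarrow> 'a"
  assumes L: "linear L" and B: "finite B" and sub: "L ` span B \<subseteq> span B"
    and inj: "\<And>v. v \<in> span B \<Longrightarrow> L v = 0 \<Longrightarrow> v = 0" and y: "y \<in> span B"
  shows "\<exists>v\<in>span B. L v = y"
proof -
  obtain C where C: "C \<subseteq> B" "independent C" "B \<subseteq> span C"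
    using maximal_independent_subset by blast
  have sp: "span C = span B"
    using C by (metis span_mono span_minimal subspace_span subset_antisym)
  have fin: "finite C" using C(1) B by (rule finite_subset)
  have injC: "inj_on L (span C)"
    unfolding linear_inj_on_iff_eq_0[OF L subspace_span] using inj sp by simp
  have ind: "independent (L ` C)" by (rule linear_independent_injective_image[OF L C(2) injC])
  have "L ` C \<subseteq> L ` span C" by (intro image_mono span_superset)
  also have LC: "\<dots> \<subseteq> span C" using sub sp by simp
  finally have LC: "L ` C \<subseteq> span C" .
  have card: "card (L ` C) = card C"
    by (rule card_image) (rule inj_on_subset[OF injC span_superset])
  have "y \<in> span (L ` C)"
  proof (rule ccontr)
    assume n: "y \<notin> span (L ` C)"
    then have "independent (insert y (L ` C))" using ind by (rule independent_insertI)
    moreover have "insert y (L ` C) \<subseteq> span C" using LC y sp by auto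
    ultimately have "card (insert y (L ` C)) \<le> card C" using independent_span_bound[OF fin] by simp
    moreover have "y \<notin> L ` C" using n span_base[of y "L ` C"] by metis
    ultimately show False using fin card by simp
  qed
  then have "y \<in> L ` span C" by (simp add: linear_span_image[OF L])
  then show ?thesis using sp by auto
qed

text \<open>Identity plus \<open>R\<close> has a linear inverse \<open>S\<close> by Banach's fixed
  point theorem. With x = S (y - v) the equation turns into v + F (S v) = F (S y), a problem in the
  finite-dimensional space \<open>span B\<close>, where injectivity implies solvability.\<close>

lemma fredholm_alternative:
  fixes R F :: "'a::{real_normed_vector,complete_space} \<Rightarrow> 'a"
  assumes R: "linear R" "\<And>x. norm (R x) \<le> norm x / 2"
    and F: "linear F" "finite B" "\<And>x. F x \<in> span B"
    and inj: "\<And>x. x + R x + F x = 0 \<Longrightarrow> x = 0"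
  shows "\<exists>x. x + R x + F x = y"
proof -
  have ex1: "\<exists>!x. x + R x = y" for y
  proof -
    have "\<exists>!x. y - R x = x"
    proof (rule banach_fix_type[of "1 / 2"])
      show "\<forall>u v. dist (y - R u) (y - R v) \<le> 1 / 2 * dist u v"
      proof (intro allI)
        show "dist (y - R u) (y - R v) \<le> 1 / 2 * dist u v" for u v
          using R(2)[of "v - u"] by (simp add: dist_norm linear_diff[OF R(1)] norm_minus_commute)
      qed
    qed auto
    moreover have "y - R x = x \<longleftrightarrow> x + R x = y" for x by (auto simp: algebra_simps)
    ultimately show ?thesis by simp
  qed
  define S where "S y = (THE x. x + R x = y)" for y
  have S: "S y + R (S y) = y" for y unfolding S_def by (rule theI'[OF ex1])
  have S_eq: "x = S y" if "x + R x = y" for x y using ex1 S that by blast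
  have linS: "linear S"
  proof (rule linearI)
    show "S (x + y) = S x + S y" for x y
      by (rule S_eq[symmetric]) (use S[of x] S[of y] in \<open>simp add: linear_add[OF R(1)] algebra_simps\<close>)
    show "S (c *\<^sub>R x) = c *\<^sub>R S x" for c x
      by (rule S_eq[symmetric]) (use S[of x] in \<open>simp add: linear_scale[OF R(1)] scaleR_add_right[symmetric]\<close>)
  qed
  have "\<exists>v\<in>span B. v + F (S v) = F (S y)"
  proof (rule injective_imp_surjective_on_span[OF _ F(2)])
    show "linear (\<lambda>v. v + F (S v))"
      by (intro linear_compose_add linear_ident linear_compose[OF linS F(1), unfolded o_def])
    show "(\<lambda>v. v + F (S v)) ` span B \<subseteq> span B" using F(3) by (auto intro: span_add)
    show "F (S y) \<in> span B" by (rule F)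
    fix v assume v: "v + F (S v) = 0"
    then have "S v + R (S v) + F (S v) = 0" by (simp add: S)
    then have "S v = 0" by (rule inj)
    then show "v = 0" using S[of v] linear_0[OF R(1)] by simp
  qed
  then obtain v where v: "v + F (S v) = F (S y)" by blast
  have "F (S (y - v)) = v"
    using v by (simp add: linear_diff[OF linS] linear_diff[OF F(1)] algebra_simps)
  then have "S (y - v) + R (S (y - v)) + F (S (y - v)) = y" by (simp add: S)
  then show ?thesis by blast
qed

text \<open>Degenerate kernels, the finite sums of products. Their integral operators have finite
  rank, and polynomial kernels are among them.\<close>

inductive separable :: "(real \<Rightarrow> real \<Rightarrow> real) \<Rightarrow> bool" where
  product: "continuous_on UNIV p \<Longrightarrow> continuous_on UNIV q \<Longrightarrow> separable (\<lambda>t s. p t * q s)"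
| sum: "separable h \<Longrightarrow> separable k \<Longrightarrow> separable (\<lambda>t s. h t s + k t s)"

lemma separable_mult: 
  assumes "separable h" "separable k"
  shows "separable (\<lambda>t s. h t s * k t s)"
  using assms(1)
proof induction
  case (product p q)
  note pq = product
  from assms(2) show ?case
  proof induction
    case (product p' q')
    have "separable (\<lambda>t s. (p t * p' t) * (q s * q' s))"
      by (rule separable.product[of "\<lambda>t. p t * p' t" "\<lambda>s. q s * q' s"])
        (intro continuous_intros pq product)+
    then show ?case by (simp add: mult_ac)
  next
    case (sum h k)
    then show ?case using separable.sum[OF sum.IH] by (simp add: distrib_left)
  qed
next
  case (sum h k)
  then show ?case using separable.sum[OF sum.IH] by (simp add: distrib_right)
qed

lemma separable_polynomial:
  assumes "real_polynomial_function g"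
  shows "separable (\<lambda>t s. g (t, s))"
  using assms
proof induction
  case (linear f)
  then have l: "linear f" by (rule bounded_linear.linear)
  have "f (t, s) = t * f (1, 0) + f (0, 1) * s" for t s
  proof -
    have "(t, s) = t *\<^sub>R (1, 0) + s *\<^sub>R (0, 1)" by simp
    then have "f (t, s) = f (t *\<^sub>R (1, 0) + s *\<^sub>R (0, 1))" by simp
    also have "\<dots> = t * f (1, 0) + s * f (0, 1)" by (simp only: linear_add[OF l] linear_scale[OF l] real_scaleR_def)
    finally show ?thesis by simp
  qed
  moreover have "separable (\<lambda>t s. t * f (1, 0) + f (0, 1) * s)"
  proof -
    have "continuous_on UNIV (\<lambda>t::real. t)" by (rule continuous_on_id)
    moreover have "continuous_on UNIV (\<lambda>t::real. c::real)" for c by (rule continuous_on_const)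
    ultimately have "separable (\<lambda>t s. t * f (1, 0))" "separable (\<lambda>t s. f (0, 1) * s)"
      by (simp_all add: separable.product)
    then show ?thesis by (rule separable.sum)
  qed
  moreover have "(\<lambda>t s. f (t, s)) = (\<lambda>t s. t * f (1, 0) + f (0, 1) * s)"
    using calculation(1) by (intro ext)
  ultimately show ?case by argo
next
  case (const c)
  have "separable (\<lambda>t s. c * 1)"
    by (rule separable.product[of "\<lambda>t. c" "\<lambda>s. 1"])
      (rule continuous_on_const)+
  then show ?case by simp
next
  case (add f g)
  show ?case by (rule separable.sum[OF add.IH])
next
  case (mult f g)
  show ?case by (rule separable_mult[OF mult.IH])
qed

lemma separable_continuous:
  assumes "separable h"
  shows "continuous_on S (\<lambda>p. h (fst p) (snd p))"
  using assms
proof induction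
  case (product p q)
  show ?case
    by (intro continuous_intros continuous_on_compose2[OF product(1)] continuous_on_compose2[OF product(2)]) auto
next
  case (sum h k)
  then show ?case by (intro continuous_on_add)
qed

text \<open>
  The argument \<open>t\<close> is clamped to \<open>[a, b]\<close> because the type of bounded continuous functions, which
  supplies completeness, consists of functions on the whole line.
\<close>

definition kernel_op :: "real \<Rightarrow> real \<Rightarrow> (real \<Rightarrow> real \<Rightarrow> real) \<Rightarrow> (real \<Rightarrow>\<^sub>C real) \<Rightarrow> (real \<Rightarrow>\<^sub>C real)" where
  "kernel_op a b h m = Bcontfun (\<lambda>t. integral {a..b} (\<lambda>s. h (max a (min b t)) s * apply_bcontfun m s))"

lemma bcontfun_clamp:
  fixes f :: "real \<Rightarrow> real"
  assumes "a \<le> b" "continuous_on {a..b} f"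
  shows "(\<lambda>t. f (max a (min b t))) \<in> bcontfun"
proof -
  have "continuous_on UNIV (\<lambda>t. f (max a (min b t)))"
    by (rule continuous_on_compose2[OF assms(2)]) (use assms(1) in \<open>auto intro!: continuous_intros\<close>)
  moreover have "bounded (f ` {a..b})"
    by (intro compact_imp_bounded compact_continuous_image assms) auto
  then have "bounded (range (\<lambda>t. f (max a (min b t))))"
    by (rule bounded_subset) (use assms(1) in auto)
  ultimately show ?thesis by (simp add: bcontfun_def)
qed

lemma continuous_kernel_integral:
  fixes h :: "real \<Rightarrow> real \<Rightarrow> real"
  assumes "continuous_on ({a..b} \<times> {a..b}) (\<lambda>p. h (fst p) (snd p))" "continuous_on {a..b} m"
  shows "continuous_on {a..b} (\<lambda>t. integral {a..b} (\<lambda>s. h t s * m s))"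
  unfolding cbox_interval[symmetric]
  by (rule integral_continuous_on_param, unfold case_prod_unfold,
      intro continuous_on_mult continuous_on_compose2[OF assms(2)] continuous_on_snd continuous_on_id)
    (use assms(1) in auto)

lemma apply_kernel_op:
  assumes "a \<le> b" "continuous_on ({a..b} \<times> {a..b}) (\<lambda>p. h (fst p) (snd p))"
  shows "apply_bcontfun (kernel_op a b h m) t = integral {a..b} (\<lambda>s. h (max a (min b t)) s * apply_bcontfun m s)"
  unfolding kernel_op_def
  by (subst Bcontfun_inverse)
    (auto intro!: bcontfun_clamp[where f = "\<lambda>t. integral {a..b} (\<lambda>s. h t s * apply_bcontfun m s)"] assms
       continuous_kernel_integral continuous_on_apply_bcontfun)

lemma integrable_kernel:
  fixes h :: "real \<Rightarrow> real \<Rightarrow> real"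
  assumes "continuous_on ({a..b} \<times> {a..b}) (\<lambda>p. h (fst p) (snd p))" "continuous_on {a..b} m" "t \<in> {a..b}"
  shows "(\<lambda>s. h t s * m s) integrable_on {a..b}"
proof -
  have "continuous_on {a..b} (\<lambda>s. h (fst (t, s)) (snd (t, s)))"
    by (rule continuous_on_compose2[OF assms(1)]) (use assms(3) in \<open>auto intro!: continuous_intros\<close>)
  then show ?thesis by (intro integrable_continuous_interval continuous_intros assms) simp
qed

text \<open>Stone-Weierstrass writes \<open>k\<close> as a polynomial, whose operator has finite
  rank, plus a uniformly small remainder. This is the splitting that
  \<open>fredholm_alternative\<close> asks for.\<close>

lemma fredholm_kernel:
  fixes k :: "real \<Rightarrow> real \<Rightarrow> real"
  assumes ab: "a < b" and k: "continuous_on ({a..b} \<times> {a..b}) (\<lambda>p. k (fst p) (snd p))"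
    and inj: "\<And>m t. continuous_on {a..b} m \<Longrightarrow>
       (\<And>t. t \<in> {a..b} \<Longrightarrow> m t + integral {a..b} (\<lambda>s. k t s * m s) = 0) \<Longrightarrow> t \<in> {a..b} \<Longrightarrow> m t = 0"
    and f: "continuous_on {a..b} f"
  shows "\<exists>m. continuous_on {a..b} m \<and> (\<forall>t\<in>{a..b}. m t + integral {a..b} (\<lambda>s. k t s * m s) = f t)"
proof -
  \<comment> \<open>A remainder below \<open>e\<close> on an interval of length b - a has operator
    norm at most e (b - a) = 1/2.\<close>
  define e where "e = 1 / (2 * (b - a))"
  have e: "e > 0" using ab by (simp add: e_def)
  obtain g where g: "real_polynomial_function g"
    and ge: "\<And>p. p \<in> {a..b} \<times> {a..b} \<Longrightarrow> \<bar>k (fst p) (snd p) - g p\<bar> < e"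
    using Stone_Weierstrass_real_polynomial_function[OF _ k e] by (auto intro: compact_Times)
  define h where "h t s = g (t, s)" for t s
  define r where "r t s = k t s - h t s" for t s
  have sep: "separable h" unfolding h_def[abs_def] by (rule separable_polynomial[OF g])
  have ch: "continuous_on ({a..b} \<times> {a..b}) (\<lambda>p. h (fst p) (snd p))" by (rule separable_continuous[OF sep])
  have cr: "continuous_on ({a..b} \<times> {a..b}) (\<lambda>p. r (fst p) (snd p))"
    unfolding r_def by (intro continuous_intros k ch)
  have ab': "a \<le> b" using ab by simp
  have cl: "max a (min b t) \<in> {a..b}" for t using ab by auto
  note int = integrable_kernel[OF _ continuous_on_apply_bcontfun cl]
  have lin: "linear (kernel_op a b h)" if c: "continuous_on ({a..b} \<times> {a..b}) (\<lambda>p. h (fst p) (snd p))" for h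
    by (rule linearI; rule bcontfun_eqI)
      (simp_all add: apply_kernel_op[OF ab' c] distrib_left integral_add[OF int[OF c] int[OF c]] mult.left_commute)
  have nr: "norm (kernel_op a b r m) \<le> norm m / 2" for m
  proof (rule norm_bound)
    fix t
    let ?t = "max a (min b t)"
    have "norm (integral {a..b} (\<lambda>s. r ?t s * apply_bcontfun m s)) \<le> (e * norm m) * (b - a)"
    proof (rule integral_bound[OF ab'])
      show "continuous_on {a..b} (\<lambda>s. r ?t s * apply_bcontfun m s)"
      proof (intro continuous_on_mult continuous_on_apply_bcontfun)
        have "continuous_on {a..b} (\<lambda>s. r (fst (?t, s)) (snd (?t, s)))"
          by (rule continuous_on_compose2[OF cr]) (use cl in \<open>auto intro!: continuous_intros\<close>)
        then show "continuous_on {a..b} (\<lambda>s. r ?t s)" by simp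
      qed
      fix s assume s: "s \<in> {a..b}"
      have "\<bar>r ?t s\<bar> \<le> e" using ge[of "(?t, s)"] cl[of t] s by (simp add: r_def h_def)
      then show "norm (r ?t s * apply_bcontfun m s) \<le> e * norm m"
        unfolding norm_mult by (intro mult_mono norm_bounded) auto
    qed
    also have "\<dots> = norm m / 2" using ab by (simp add: e_def field_simps)
    finally show "norm (apply_bcontfun (kernel_op a b r m) t) \<le> norm m / 2"
      by (simp add: apply_kernel_op[OF ab' cr])
  qed
  have "\<exists>B. finite B \<and> (\<forall>m. kernel_op a b h m \<in> span B)"
    using sep
  proof induction
    case (product p q)
    have c: "continuous_on ({a..b} \<times> {a..b}) (\<lambda>x. p (fst x) * q (snd x))"
      using separable_continuous[OF separable.product[OF product]] by simp
    define B where "B = Bcontfun (\<lambda>t. p (max a (min b t)))"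
    have B: "apply_bcontfun B t = p (max a (min b t))" for t
      unfolding B_def by (subst Bcontfun_inverse) (auto intro!: bcontfun_clamp ab' continuous_on_subset[OF product(1)])
    have "kernel_op a b (\<lambda>t s. p t * q s) m = integral {a..b} (\<lambda>s. q s * apply_bcontfun m s) *\<^sub>R B" for m
      by (rule bcontfun_eqI) (simp add: apply_kernel_op[OF ab' c] B mult.assoc)
    then show ?case by (intro exI[of _ "{B}"]) (auto intro: span_scale span_base)
  next
    case (sum h1 h2)
    then obtain B1 B2 where B: "finite B1" "\<And>m. kernel_op a b h1 m \<in> span B1"
       "finite B2" "\<And>m. kernel_op a b h2 m \<in> span B2" by blast
    note c1 = separable_continuous[OF sum(1), of "{a..b} \<times> {a..b}"] and c2 = separable_continuous[OF sum(2), of "{a..b} \<times> {a..b}"]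
    have "kernel_op a b (\<lambda>t s. h1 t s + h2 t s) m = kernel_op a b h1 m + kernel_op a b h2 m" for m
      by (rule bcontfun_eqI) (simp add: apply_kernel_op[OF ab'] c1 c2 continuous_on_add distrib_right integral_add[OF int[OF c1] int[OF c2]])
    moreover have "kernel_op a b h1 m + kernel_op a b h2 m \<in> span (B1 \<union> B2)" for m
      using B(2,4) span_mono[of B1 "B1 \<union> B2"] span_mono[of B2 "B1 \<union> B2"] by (intro span_add) auto
    ultimately show ?case using B by (intro exI[of _ "B1 \<union> B2"]) auto
  qed
  then obtain B where B: "finite B" "\<And>m. kernel_op a b h m \<in> span B" by blast
  have total: "apply_bcontfun (m + kernel_op a b r m + kernel_op a b h m) t =
      apply_bcontfun m t + integral {a..b} (\<lambda>s. k (max a (min b t)) s * apply_bcontfun m s)" for m t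
  proof -
    have "integral {a..b} (\<lambda>s. r (max a (min b t)) s * apply_bcontfun m s) +
        integral {a..b} (\<lambda>s. h (max a (min b t)) s * apply_bcontfun m s) =
        integral {a..b} (\<lambda>s. k (max a (min b t)) s * apply_bcontfun m s)"
      unfolding integral_add[OF int[OF cr] int[OF ch], symmetric] by (simp add: r_def algebra_simps)
    then show ?thesis by (simp add: apply_kernel_op[OF ab' cr] apply_kernel_op[OF ab' ch])
  qed
  define y where "y = Bcontfun (\<lambda>t. f (max a (min b t)))"
  have y: "apply_bcontfun y t = f (max a (min b t))" for t
    unfolding y_def by (subst Bcontfun_inverse) (auto intro!: bcontfun_clamp ab' f)
  have "\<exists>m. m + kernel_op a b r m + kernel_op a b h m = y"
  proof (rule fredholm_alternative[OF lin[OF cr] nr lin[OF ch] B])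
    fix m assume m: "m + kernel_op a b r m + kernel_op a b h m = 0"
    have eq: "apply_bcontfun m t + integral {a..b} (\<lambda>s. k (max a (min b t)) s * apply_bcontfun m s) = 0" for t
      using total[of m t] m by simp
    have z: "apply_bcontfun m t = 0" if "t \<in> {a..b}" for t
    proof (rule inj[OF _ _ that])
      show "continuous_on {a..b} (apply_bcontfun m)" by (rule continuous_on_apply_bcontfun)
      show "apply_bcontfun m t + integral {a..b} (\<lambda>s. k t s * apply_bcontfun m s) = 0" if "t \<in> {a..b}" for t
        using eq[of t] that by (simp add: max_def min_def split: if_splits)
    qed
    \<comment> \<open>The hypothesis gives \<open>m = 0\<close> on the interval only. Outside it the
      equation expresses \<open>m\<close> by an integral over the interval, which is now
      zero.\<close>
    show "m = 0"
    proof (rule bcontfun_eqI)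
      fix t
      have "integral {a..b} (\<lambda>s. k (max a (min b t)) s * apply_bcontfun m s) = integral {a..b} (\<lambda>s. 0)"
        by (rule integral_cong) (simp add: z)
      then show "apply_bcontfun m t = apply_bcontfun 0 t" using eq[of t] by simp
    qed
  qed
  then obtain m where m: "m + kernel_op a b r m + kernel_op a b h m = y" by blast
  show ?thesis
  proof (intro exI conjI ballI)
    show "continuous_on {a..b} (apply_bcontfun m)" by (rule continuous_on_apply_bcontfun)
    fix t assume t: "t \<in> {a..b}"
    then have "max a (min b t) = t" by (simp add: max_def min_def)
    then show "apply_bcontfun m t + integral {a..b} (\<lambda>s. k t s * apply_bcontfun m s) = f t"
      using total[of m t] m y[of t] by simp
  qed
qed


section \<open>The double-layer kernel of the boundary\<close>

lemma periodic_deriv: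
  assumes "periodic f" "\<And>x. (f has_real_derivative f' x) (at x)"
  shows "periodic f'"
  unfolding periodic_def
proof
  fix \<theta>
  have "((\<lambda>x. f (x + 2 * pi)) has_real_derivative f' (\<theta> + 2 * pi)) (at \<theta>)"
    using assms(2)[of "\<theta> + 2 * pi"] by (simp add: DERIV_shift)
  then have "(f has_real_derivative f' (\<theta> + 2 * pi)) (at \<theta>)"
    using assms(1) by (simp add: periodic_def)
  then show "f' (\<theta> + 2 * pi) = f' \<theta>" using assms(2) by (rule DERIV_unique)
qed

lemma smooth_circleD:
  assumes "f \<in> smooth_circle"
  shows "((deriv ^^ n) f has_real_derivative (deriv ^^ Suc n) f x) (at x)"
    and "continuous_on S ((deriv ^^ n) f)"
    and "periodic ((deriv ^^ n) f)"
proof -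
  have D: "((deriv ^^ n) f has_real_derivative (deriv ^^ Suc n) f x) (at x)" for n x
    using assms by (simp add: smooth_circle_def DERIV_deriv_iff_real_differentiable)
  then show "((deriv ^^ n) f has_real_derivative (deriv ^^ Suc n) f x) (at x)" .
  show "continuous_on S ((deriv ^^ n) f)"
    by (rule DERIV_continuous_on) (rule has_field_derivative_at_within[OF D])
  show "periodic ((deriv ^^ n) f)"
  proof (induction n)
    case 0
    then show ?case using assms by (simp add: smooth_circle_def)
  next
    case (Suc n)
    then show ?case by (rule periodic_deriv[OF _ D])
  qed
qed

text \<open>As a function of \<open>c\<close> the left side has derivative f(c + 2 pi) - f(c) = 0.
  The number \<open>L\<close> is large enough for all endpoints in question to lie where a single
  primitive \<open>F\<close> is available.\<close>

lemma integral_periodic_shift: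
  fixes f :: "real \<Rightarrow> 'a::banach"
  assumes f: "continuous_on UNIV f" and per: "\<And>x. f (x + 2 * pi) = f x"
  shows "integral {c..c + 2 * pi} f = integral {0..2 * pi} f"
proof -
  define L where "L = \<bar>c\<bar> + 4 * pi"
  define F where "F x = integral {-L..x} f" for x
  have F: "(F has_vector_derivative f x) (at x)" if "-L < x" "x < L" for x
  proof -
    have "(F has_vector_derivative f x) (at x within {-L..L})"
      unfolding F_def by (rule integral_has_vector_derivative) (use that in \<open>auto intro: continuous_on_subset[OF f]\<close>)
    then show ?thesis using that by (simp add: at_within_Icc_at)
  qed
  have diff: "integral {x..x + 2 * pi} f = F (x + 2 * pi) - F x" if x: "-L < x" "x < L - 2 * pi" for x
  proof -
    have "(f has_integral (F (x + 2 * pi) - F x)) {x..x + 2 * pi}"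
    proof (rule fundamental_theorem_of_calculus)
      show "(F has_vector_derivative f y) (at y within {x..x + 2 * pi})" if "y \<in> {x..x + 2 * pi}" for y
      proof (rule has_vector_derivative_at_within[OF F])
        show "-L < y" "y < L" using that x by simp_all
      qed
    qed simp
    then show ?thesis by (rule integral_unique)
  qed
  have bounds: "- L < c" "c < L - 2 * pi" "- L < 0" "0 < L - 2 * pi"
    using pi_gt_zero unfolding L_def by linarith+
  have "F (c + 2 * pi) - F c = F (0 + 2 * pi) - F 0"
  proof (rule has_derivative_zero_unique_connected[of "{-L<..<L - 2 * pi}" "\<lambda>x. F (x + 2 * pi) - F x"])
    fix x assume x: "x \<in> {-L<..<L - 2 * pi}"
    have "((\<lambda>x. F (x + 2 * pi)) has_vector_derivative 1 *\<^sub>R f (x + 2 * pi)) (at x)"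
    proof (rule vector_diff_chain_at[of "\<lambda>x. x + 2 * pi" 1 x F "f (x + 2 * pi)", unfolded o_def])
      show "((\<lambda>x. x + 2 * pi) has_vector_derivative 1) (at x)"
        by (auto intro!: derivative_eq_intros)
      show "(F has_vector_derivative f (x + 2 * pi)) (at (x + 2 * pi))"
      proof (rule F)
        show "-L < x + 2 * pi" "x + 2 * pi < L"
          using x pi_gt_zero unfolding greaterThanLessThan_iff by linarith+
      qed
    qed
    moreover have "(F has_vector_derivative f x) (at x)"
    proof (rule F)
      show "-L < x" "x < L" using x pi_gt_zero unfolding greaterThanLessThan_iff by linarith+
    qed
    ultimately have "((\<lambda>x. F (x + 2 * pi) - F x) has_vector_derivative 1 *\<^sub>R f (x + 2 * pi) - f x) (at x)"
      by (rule has_vector_derivative_diff)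
    then show "((\<lambda>x. F (x + 2 * pi) - F x) has_derivative (\<lambda>h. 0)) (at x)"
      by (simp add: per has_vector_derivative_def)
  qed (use bounds in auto)
  then show ?thesis using diff[of c] diff[of 0] bounds by simp
qed

text \<open>
  Averages along a segment express difference quotients as integrals of smooth functions, so that no
  division by \<open>s - t\<close> has to be differentiated.
\<close>

definition avg :: "(real \<Rightarrow> real) \<Rightarrow> (real \<Rightarrow> complex) \<Rightarrow> real \<Rightarrow> real \<Rightarrow> complex" where
  "avg c g t s = integral {0..1} (\<lambda>u. of_real (c u) * g (t + u * (s - t)))"

lemma avg_continuous:
  assumes "continuous_on UNIV c" "continuous_on UNIV g"
  shows "continuous_on S (\<lambda>p. avg c g (fst p) (snd p))"
  unfolding avg_def cbox_interval[symmetric]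
  by (rule integral_continuous_on_param)
    (auto simp: case_prod_unfold intro!: continuous_intros continuous_on_compose2[OF assms(1)] continuous_on_compose2[OF assms(2)])

text \<open>The extra weight 1 - u is the derivative of t + u (s - t) with respect to t.\<close>

lemma avg_deriv:
  assumes c: "continuous_on UNIV c" and g: "\<And>x. (g has_vector_derivative g' x) (at x)" and g': "continuous_on UNIV g'"
  shows "((\<lambda>t. avg c g t s) has_vector_derivative avg (\<lambda>u. c u * (1 - u)) g' t s) (at t)"
proof -
  have cg: "continuous_on UNIV g"
    by (rule continuous_on_vector_derivative) (rule has_vector_derivative_at_within[OF g])
  have "((\<lambda>t. integral (cbox 0 1) (\<lambda>u. of_real (c u) * g (t + u * (s - t)))) has_vector_derivative
     integral (cbox 0 1) (\<lambda>u. of_real (c u * (1 - u)) * g' (t + u * (s - t)))) (at t within UNIV)"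
  proof (rule leibniz_rule_vector_derivative)
    fix t u :: real
    have "((\<lambda>t. g (t + u * (s - t))) has_vector_derivative (1 - u) *\<^sub>R g' (t + u * (s - t))) (at t)"
      by (rule vector_diff_chain_at[of "\<lambda>t. t + u * (s - t)" "1 - u" t g, unfolded o_def])
        (auto intro!: derivative_eq_intros g simp: algebra_simps)
    from has_vector_derivative_mult_right[OF this, of "of_real (c u)"]
    show "((\<lambda>t. of_real (c u) * g (t + u * (s - t))) has_vector_derivative of_real (c u * (1 - u)) * g' (t + u * (s - t))) (at t within UNIV)"
      by (simp add: scaleR_conv_of_real mult_ac)
  next
    show "(\<lambda>u. of_real (c u) * g (t + u * (s - t))) integrable_on cbox 0 1" for t
      unfolding cbox_interval
      by (intro integrable_continuous_interval)
        (auto intro!: continuous_intros continuous_on_compose2[OF c] continuous_on_compose2[OF cg])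
    show "continuous_on (UNIV \<times> cbox 0 1) (\<lambda>(t, u). of_real (c u * (1 - u)) * g' (t + u * (s - t)))"
      by (auto simp: case_prod_unfold intro!: continuous_intros continuous_on_compose2[OF c] continuous_on_compose2[OF g'])
  qed auto
  then show ?thesis by (simp add: avg_def[abs_def])
qed

text \<open>\<open>bdry1\<close> to \<open>bdry4\<close> are the derivatives of \<gamma> = exp w
  with w' = \<xi>' + i; the factors after \<open>bdry\<close> are the complete Bell polynomials in
  w', w'', .... Order four occurs because the kernel contains averages of \<gamma>'' and is
  differentiated twice.\<close>

definition bdry1 :: "(real \<Rightarrow> real) \<Rightarrow> real \<Rightarrow> complex" where
  "bdry1 \<xi> s = bdry \<xi> s * Complex (deriv \<xi> s) 1"

definition bdry2 :: "(real \<Rightarrow> real) \<Rightarrow> real \<Rightarrow> complex" where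
  "bdry2 \<xi> s = bdry \<xi> s * ((Complex (deriv \<xi> s) 1)\<^sup>2 + of_real ((deriv ^^ 2) \<xi> s))"

definition bdry3 :: "(real \<Rightarrow> real) \<Rightarrow> real \<Rightarrow> complex" where
  "bdry3 \<xi> s = bdry \<xi> s * ((Complex (deriv \<xi> s) 1) ^ 3 + 3 * Complex (deriv \<xi> s) 1 * of_real ((deriv ^^ 2) \<xi> s)
     + of_real ((deriv ^^ 3) \<xi> s))"

definition bdry4 :: "(real \<Rightarrow> real) \<Rightarrow> real \<Rightarrow> complex" where
  "bdry4 \<xi> s = bdry \<xi> s * ((Complex (deriv \<xi> s) 1) ^ 4 + 6 * (Complex (deriv \<xi> s) 1)\<^sup>2 * of_real ((deriv ^^ 2) \<xi> s)
     + 3 * (of_real ((deriv ^^ 2) \<xi> s))\<^sup>2 + 4 * Complex (deriv \<xi> s) 1 * of_real ((deriv ^^ 3) \<xi> s)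
     + of_real ((deriv ^^ 4) \<xi> s))"

lemma has_vector_derivative_Complex_id:
  assumes "(f has_real_derivative f') (at s)"
  shows "((\<lambda>s. Complex (f s) s) has_vector_derivative Complex f' 1) (at s)"
  unfolding has_vector_derivative_complex_iff using assms by (auto intro: derivative_eq_intros)

lemma bdry_deriv:
  assumes "(\<xi> has_real_derivative deriv \<xi> s) (at s)"
  shows "(bdry \<xi> has_vector_derivative bdry1 \<xi> s) (at s)"
  using field_vector_diff_chain_at[OF has_vector_derivative_Complex_id[OF assms] DERIV_exp]
  by (simp add: bdry_def[abs_def] bdry1_def o_def mult.commute)

lemma bdry_derivs:
  assumes "\<xi> \<in> smooth_circle"
  shows "(bdry \<xi> has_vector_derivative bdry1 \<xi> s) (at s)"
    and "(bdry1 \<xi> has_vector_derivative bdry2 \<xi> s) (at s)"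
    and "(bdry2 \<xi> has_vector_derivative bdry3 \<xi> s) (at s)"
    and "(bdry3 \<xi> has_vector_derivative bdry4 \<xi> s) (at s)"
    and "continuous_on S (bdry4 \<xi>)"
proof -
  note D = smooth_circleD(1)[OF assms]
  have d1: "(\<xi> has_real_derivative deriv \<xi> s) (at s)" using D[of 0] by simp
  have d2: "(deriv \<xi> has_real_derivative (deriv ^^ 2) \<xi> s) (at s)" using D[of 1 s] by (simp add: numeral_2_eq_2)
  have d3: "((deriv ^^ 2) \<xi> has_real_derivative (deriv ^^ 3) \<xi> s) (at s)" using D[of 2 s] by (simp add: numeral_3_eq_3 numeral_2_eq_2)
  have d4: "((deriv ^^ 3) \<xi> has_real_derivative (deriv ^^ 4) \<xi> s) (at s)" using D[of 3 s] by (simp add: eval_nat_numeral)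
  have w: "((\<lambda>s. Complex (deriv \<xi> s) 1) has_vector_derivative of_real ((deriv ^^ 2) \<xi> s)) (at s)"
    unfolding has_vector_derivative_complex_iff using d2 by (auto intro: derivative_eq_intros)
  have r: "((\<lambda>s. complex_of_real ((deriv ^^ 2) \<xi> s)) has_vector_derivative of_real ((deriv ^^ 3) \<xi> s)) (at s)"
    "((\<lambda>s. complex_of_real ((deriv ^^ 3) \<xi> s)) has_vector_derivative of_real ((deriv ^^ 4) \<xi> s)) (at s)"
    using d3 d4 by (auto intro!: has_vector_derivative_of_real)
  show b: "(bdry \<xi> has_vector_derivative bdry1 \<xi> s) (at s)" by (rule bdry_deriv[OF d1])
  have p2: "((\<lambda>s. (Complex (deriv \<xi> s) 1)\<^sup>2) has_vector_derivative 2 * Complex (deriv \<xi> s) 1 * of_real ((deriv ^^ 2) \<xi> s)) (at s)"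
    using has_vector_derivative_mult[OF w w] by (simp add: power2_eq_square algebra_simps)
  have p3: "((\<lambda>s. (Complex (deriv \<xi> s) 1) ^ 3) has_vector_derivative 3 * (Complex (deriv \<xi> s) 1)\<^sup>2 * of_real ((deriv ^^ 2) \<xi> s)) (at s)"
    using has_vector_derivative_mult[OF w p2] by (simp add: power2_eq_square power3_eq_cube algebra_simps)
  show "(bdry1 \<xi> has_vector_derivative bdry2 \<xi> s) (at s)"
    unfolding bdry1_def[abs_def]
    by (rule has_vector_derivative_eq_rhs[OF has_vector_derivative_mult[OF b w]])
      (simp add: bdry1_def bdry2_def power2_eq_square algebra_simps)
  show "(bdry2 \<xi> has_vector_derivative bdry3 \<xi> s) (at s)"
    unfolding bdry2_def[abs_def]
    by (rule has_vector_derivative_eq_rhs[OF has_vector_derivative_mult[OF b has_vector_derivative_add[OF p2 r(1)]]])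
      (simp add: bdry1_def bdry3_def power2_eq_square power3_eq_cube algebra_simps)
  have "((\<lambda>s. 3 * (Complex (deriv \<xi> s) 1 * of_real ((deriv ^^ 2) \<xi> s))) has_vector_derivative
     3 * (Complex (deriv \<xi> s) 1 * of_real ((deriv ^^ 3) \<xi> s) + of_real ((deriv ^^ 2) \<xi> s) * of_real ((deriv ^^ 2) \<xi> s))) (at s)"
    by (rule has_vector_derivative_mult_right[OF has_vector_derivative_mult[OF w r(1)]])
  from has_vector_derivative_mult[OF b has_vector_derivative_add[OF has_vector_derivative_add[OF p3 this] r(2)]]
  have "((\<lambda>s. bdry \<xi> s * ((Complex (deriv \<xi> s) 1) ^ 3 + 3 * (Complex (deriv \<xi> s) 1 * of_real ((deriv ^^ 2) \<xi> s))
     + of_real ((deriv ^^ 3) \<xi> s))) has_vector_derivative bdry4 \<xi> s) (at s)"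
    by (rule has_vector_derivative_eq_rhs)
      (simp add: bdry1_def bdry4_def power2_eq_square power3_eq_cube power4_eq_xxxx algebra_simps)
  then show "(bdry3 \<xi> has_vector_derivative bdry4 \<xi> s) (at s)"
    by (simp add: bdry3_def[abs_def] mult.assoc)
  have c: "continuous_on S \<xi>" "continuous_on S (deriv \<xi>)" "continuous_on S ((deriv ^^ 2) \<xi>)" "continuous_on S ((deriv ^^ 3) \<xi>)"
     "continuous_on S ((deriv ^^ 4) \<xi>)"
    using smooth_circleD(2)[OF assms, of S 0] smooth_circleD(2)[OF assms, of S 1] smooth_circleD(2)[OF assms] by simp_all
  show "continuous_on S (bdry4 \<xi>)"
    unfolding bdry4_def bdry_def Complex_eq by (intro continuous_intros c)
qed


lemma has_vector_derivative_divide: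
  fixes f g :: "real \<Rightarrow> complex"
  assumes f: "(f has_vector_derivative f') (at x)" and g: "(g has_vector_derivative g') (at x)" and nz: "g x \<noteq> 0"
  shows "((\<lambda>x. f x / g x) has_vector_derivative (f' * g x - f x * g') / (g x)\<^sup>2) (at x)"
proof -
  have "((\<lambda>x. inverse (g x)) has_vector_derivative g' * (- (inverse (g x) ^ 2))) (at x)"
    using field_vector_diff_chain_at[OF g DERIV_inverse[OF nz]] by (simp add: o_def numeral_2_eq_2)
  from has_vector_derivative_mult[OF f this] show ?thesis
    using nz by (simp add: divide_inverse power2_eq_square algebra_simps)
qed

lemma periodic_bdry:
  assumes "\<xi> \<in> smooth_circle"
  shows "bdry \<xi> (s + 2 * pi) = bdry \<xi> s" "bdry1 \<xi> (s + 2 * pi) = bdry1 \<xi> s" "bdry2 \<xi> (s + 2 * pi) = bdry2 \<xi> s"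
proof -
  have p: "(deriv ^^ n) \<xi> (s + 2 * pi) = (deriv ^^ n) \<xi> s" for n
    using smooth_circleD(3)[OF assms, of n] by (simp add: periodic_def)
  have "Complex (\<xi> (s + 2 * pi)) (s + 2 * pi) = Complex (\<xi> s) s + 2 * of_real pi * \<i>"
    using p[of 0] by (simp add: complex_eq_iff)
  then show b: "bdry \<xi> (s + 2 * pi) = bdry \<xi> s" by (simp add: bdry_def exp_add)
  show "bdry1 \<xi> (s + 2 * pi) = bdry1 \<xi> s" "bdry2 \<xi> (s + 2 * pi) = bdry2 \<xi> s"
    using p[of 1] p[of 2] by (simp_all add: bdry1_def bdry2_def b)
qed

lemma bdry_inj:
  assumes "bdry \<xi> s = bdry \<xi> t" "\<bar>s - t\<bar> < 2 * pi"
  shows "s = t"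
proof -
  obtain n :: int where "Complex (\<xi> s) s = Complex (\<xi> t) t + (of_int (2 * n) * pi) * \<i>"
    using assms(1) unfolding bdry_def exp_eq by blast
  then have s: "s = t + 2 * pi * of_int n" by (auto simp: complex_eq_iff)
  then have "2 * pi * \<bar>of_int n\<bar> < 2 * pi * 1" using assms(2) by (simp add: abs_mult)
  then have "\<bar>of_int n :: real\<bar> < 1" by (simp only: mult_less_cancel_left_pos pi_gt_zero zero_less_mult_iff zero_less_numeral simp_thms)
  then have "n = 0" by linarith
  then show ?thesis using s by simp
qed

lemma bdry1_nonzero [simp]: "bdry1 \<xi> s \<noteq> 0"
proof -
  have "Complex (deriv \<xi> s) 1 \<noteq> 0" by (simp add: complex_eq_iff)
  then show ?thesis by (simp add: bdry1_def)
qed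

text \<open>
  Twice the kernel of the double-layer potential: its integral equation reads \<open>\<mu> + K \<mu> = 2 \<psi>\<close>. The
  value on the diagonal is the limit.
\<close>

definition dkernel :: "(real \<Rightarrow> real) \<Rightarrow> real \<Rightarrow> real \<Rightarrow> real" where
  "dkernel \<xi> t s = (if bdry \<xi> s = bdry \<xi> t then Im (bdry2 \<xi> t / bdry1 \<xi> t) / (2 * pi)
     else Im (bdry1 \<xi> s / (bdry \<xi> s - bdry \<xi> t)) / pi)"

context
  fixes \<xi> assumes \<xi>: "\<xi> \<in> smooth_circle"
begin

text \<open>For s \<noteq> t, \<open>chordQ\<close> is the difference quotient Q of \<gamma> and
  \<open>chordR\<close> is (\<gamma>'(s) - Q) / (s - t). The suffixes 1 and 2 count derivatives with
  respect to t.\<close>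

abbreviation "chordQ t s \<equiv> avg (\<lambda>u. 1) (bdry1 \<xi>) t s"
abbreviation "chordQ1 t s \<equiv> avg (\<lambda>u. 1 * (1 - u)) (bdry2 \<xi>) t s"
abbreviation "chordQ2 t s \<equiv> avg (\<lambda>u. 1 * (1 - u) * (1 - u)) (bdry3 \<xi>) t s"
abbreviation "chordR t s \<equiv> avg (\<lambda>u. u) (bdry2 \<xi>) t s"
abbreviation "chordR1 t s \<equiv> avg (\<lambda>u. u * (1 - u)) (bdry3 \<xi>) t s"
abbreviation "chordR2 t s \<equiv> avg (\<lambda>u. u * (1 - u) * (1 - u)) (bdry4 \<xi>) t s"

lemma bdry_continuous:
  "continuous_on S (bdry \<xi>)" "continuous_on S (bdry1 \<xi>)" "continuous_on S (bdry2 \<xi>)" "continuous_on S (bdry3 \<xi>)"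
  by (rule continuous_on_vector_derivative, rule has_vector_derivative_at_within, rule bdry_derivs[OF \<xi>])+

lemma chord: "of_real (s - t) * chordQ t s = bdry \<xi> s - bdry \<xi> t"
proof -
  have "((\<lambda>u. of_real (s - t) * (of_real 1 * bdry1 \<xi> (t + u * (s - t)))) has_integral
      bdry \<xi> (t + 1 * (s - t)) - bdry \<xi> (t + 0 * (s - t))) {0..1}"
  proof (rule fundamental_theorem_of_calculus)
    fix u :: real
    have "((\<lambda>u. bdry \<xi> (t + u * (s - t))) has_vector_derivative (s - t) *\<^sub>R bdry1 \<xi> (t + u * (s - t))) (at u)"
      by (rule vector_diff_chain_at[of "\<lambda>u. t + u * (s - t)" "s - t" u "bdry \<xi>", unfolded o_def])
        (auto intro!: derivative_eq_intros bdry_derivs \<xi>)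
    then show "((\<lambda>u. bdry \<xi> (t + u * (s - t))) has_vector_derivative of_real (s - t) * (of_real 1 * bdry1 \<xi> (t + u * (s - t)))) (at u within {0..1})"
      by (simp add: scaleR_conv_of_real has_vector_derivative_at_within)
  qed simp
  from integral_unique[OF this] show ?thesis by (simp add: avg_def)
qed

text \<open>The function u \<gamma>'(t + u (s - t)) increases by \<gamma>'(s) over [0, 1], and its
  derivative in u splits into the integrands of \<open>chordQ\<close> and
  \<open>(s - t) * chordR\<close>.\<close>

lemma chord1: "of_real (s - t) * chordR t s = bdry1 \<xi> s - chordQ t s"
proof -
  have c: "continuous_on {0..1} (\<lambda>u. bdry1 \<xi> (t + u * (s - t)))" "continuous_on {0..1} (\<lambda>u. bdry2 \<xi> (t + u * (s - t)))"
    by (auto intro!: continuous_intros continuous_on_compose2[OF bdry_continuous(2)[of UNIV]] continuous_on_compose2[OF bdry_continuous(3)[of UNIV]])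
  have "((\<lambda>u. bdry1 \<xi> (t + u * (s - t)) + of_real (s - t) * (of_real u * bdry2 \<xi> (t + u * (s - t)))) has_integral
      of_real 1 * bdry1 \<xi> (t + 1 * (s - t)) - of_real 0 * bdry1 \<xi> (t + 0 * (s - t))) {0..1}"
  proof (rule fundamental_theorem_of_calculus)
    fix u :: real
    have "((\<lambda>u. bdry1 \<xi> (t + u * (s - t))) has_vector_derivative (s - t) *\<^sub>R bdry2 \<xi> (t + u * (s - t))) (at u)"
      by (rule vector_diff_chain_at[of "\<lambda>u. t + u * (s - t)" "s - t" u "bdry1 \<xi>", unfolded o_def])
        (auto intro!: derivative_eq_intros bdry_derivs \<xi>)
    then have 1: "((\<lambda>u. bdry1 \<xi> (t + u * (s - t))) has_vector_derivative of_real (s - t) * bdry2 \<xi> (t + u * (s - t))) (at u)"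
      by (simp add: scaleR_conv_of_real)
    have 2: "((\<lambda>u. complex_of_real u) has_vector_derivative of_real 1) (at u)"
      by (intro has_vector_derivative_of_real) (auto intro: derivative_eq_intros)
    show "((\<lambda>u. of_real u * bdry1 \<xi> (t + u * (s - t))) has_vector_derivative
       bdry1 \<xi> (t + u * (s - t)) + of_real (s - t) * (of_real u * bdry2 \<xi> (t + u * (s - t)))) (at u within {0..1})"
      using has_vector_derivative_at_within[OF has_vector_derivative_mult[OF 2 1]] by (simp add: algebra_simps)
  qed simp
  from integral_unique[OF this]
  have "integral {0..1} (\<lambda>u. bdry1 \<xi> (t + u * (s - t)) + of_real (s - t) * (of_real u * bdry2 \<xi> (t + u * (s - t)))) = bdry1 \<xi> s"
    by simp
  moreover have "integral {0..1} (\<lambda>u. bdry1 \<xi> (t + u * (s - t)) + of_real (s - t) * (of_real u * bdry2 \<xi> (t + u * (s - t)))) =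
     chordQ t s + of_real (s - t) * chordR t s"
    unfolding avg_def
    by (subst integral_add) (auto intro!: integrable_continuous_interval continuous_intros c)
  ultimately show ?thesis by (simp add: algebra_simps)
qed

lemma avg_diagonal: "chordQ t t = bdry1 \<xi> t" "chordR t t = bdry2 \<xi> t / 2"
proof -
  show "chordQ t t = bdry1 \<xi> t" by (simp add: avg_def)
  have "((\<lambda>u. of_real u * bdry2 \<xi> t) has_integral (of_real (1\<^sup>2 / 2) * bdry2 \<xi> t - of_real (0\<^sup>2 / 2) * bdry2 \<xi> t)) {0..1}"
  proof (rule fundamental_theorem_of_calculus)
    fix u :: real
    have "((\<lambda>u. complex_of_real (u\<^sup>2 / 2)) has_vector_derivative of_real u) (at u)"
      by (intro has_vector_derivative_of_real) (auto intro!: derivative_eq_intros)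
    then show "((\<lambda>u. of_real (u\<^sup>2 / 2) * bdry2 \<xi> t) has_vector_derivative of_real u * bdry2 \<xi> t) (at u within {0..1})"
      by (rule has_vector_derivative_at_within[OF has_vector_derivative_mult_left])
  qed simp
  from integral_unique[OF this] show "chordR t t = bdry2 \<xi> t / 2" by (simp add: avg_def)
qed

text \<open>The curve does not intersect itself and \<gamma>' has no zero. The range is the largest
  possible, since the chord vanishes after a full period.\<close>

lemma Q_nonzero:
  assumes "\<bar>s - t\<bar> < 2 * pi" shows "chordQ t s \<noteq> 0"
proof (cases "s = t")
  case True
  then show ?thesis by (simp add: avg_diagonal)
next
  case False
  then show ?thesis using chord[of s t] bdry_inj[OF _ assms] by auto
qed

text \<open>R / Q is \<gamma>'(s) / (\<gamma>(s) - \<gamma>(t)) minus the pole 1 / (s - t). The pole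
  is real, so taking imaginary parts removes the singularity of the kernel.\<close>

lemma dkernel_local:
  assumes "\<bar>s - t\<bar> < 2 * pi"
  shows "dkernel \<xi> t s = Im (chordR t s / chordQ t s) / pi"
proof (cases "s = t")
  case True
  have "bdry2 \<xi> t / 2 / bdry1 \<xi> t = (bdry2 \<xi> t / bdry1 \<xi> t) / 2" by simp
  then show ?thesis using True by (simp only: dkernel_def avg_diagonal Im_divide_numeral) simp
next
  case False
  then have ne: "bdry \<xi> s \<noteq> bdry \<xi> t" using bdry_inj assms by blast
  have nz: "complex_of_real (s - t) \<noteq> 0" using False by simp
  have "chordR t s / chordQ t s = (of_real (s - t) * chordR t s) / (of_real (s - t) * chordQ t s)" using nz by simp
  also have "\<dots> = (bdry1 \<xi> s - chordQ t s) / (of_real (s - t) * chordQ t s)" by (simp only: chord1)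
  also have "\<dots> = bdry1 \<xi> s / (bdry \<xi> s - bdry \<xi> t) - 1 / of_real (s - t)"
    using Q_nonzero[OF assms] by (simp add: chord[symmetric] diff_divide_distrib)
  also have "Im \<dots> = Im (bdry1 \<xi> s / (bdry \<xi> s - bdry \<xi> t))"
  proof -
    have "1 / complex_of_real (s - t) = of_real (1 / (s - t))" by simp
    then show ?thesis by (simp only: minus_complex.sel Im_complex_of_real diff_zero)
  qed
  finally show ?thesis using ne by (simp add: dkernel_def)
qed

lemma dkernel_periodic: "dkernel \<xi> (t + 2 * pi) s = dkernel \<xi> t s" "dkernel \<xi> t (s + 2 * pi) = dkernel \<xi> t s"
  by (simp_all add: dkernel_def periodic_bdry[OF \<xi>])

lemma continuous_R_Q:
  "continuous_on S (\<lambda>p. chordQ (fst p) (snd p))" "continuous_on S (\<lambda>p. chordQ1 (fst p) (snd p))" "continuous_on S (\<lambda>p. chordQ2 (fst p) (snd p))"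
  "continuous_on S (\<lambda>p. chordR (fst p) (snd p))" "continuous_on S (\<lambda>p. chordR1 (fst p) (snd p))" "continuous_on S (\<lambda>p. chordR2 (fst p) (snd p))"
  by (intro avg_continuous continuous_intros bdry_continuous bdry_derivs(5) \<xi>)+

text \<open>The local formula covers |s - t| < 2 pi; near any other point a shift of s by a multiple
  of 2 pi, under which the kernel is invariant, leads back to this range.\<close>

lemma continuous_dkernel: "continuous_on UNIV (\<lambda>p. dkernel \<xi> (fst p) (snd p))"
  unfolding continuous_on_eq_continuous_at[OF open_UNIV]
proof
  fix p0 :: "real \<times> real"
  obtain t0 s0 where p0: "p0 = (t0, s0)" by (cases p0)
  obtain n where n: "\<bar>(s0 - t0) - 2 * pi * of_int n\<bar> \<le> pi" by (rule angle_reduce)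
  define S where "S = {p. \<bar>(snd p - fst p) - 2 * pi * of_int n\<bar> < 2 * pi}"
  have op: "open S" unfolding S_def by (intro open_Collect_less continuous_intros)
  have "\<bar>(s0 - t0) - 2 * pi * of_int n\<bar> < 2 * pi" using n pi_gt_zero by linarith
  then have p0S: "p0 \<in> S" by (simp add: S_def p0)
  let ?f = "\<lambda>p. Im (chordR (fst p) (snd p - 2 * pi * of_int n) / chordQ (fst p) (snd p - 2 * pi * of_int n)) / pi"
  have cp: "continuous_on S (\<lambda>p. (fst p, snd p - 2 * pi * of_int n))" by (intro continuous_intros)
  have c: "continuous_on S (\<lambda>p. chordQ (fst p) (snd p - 2 * pi * of_int n))" "continuous_on S (\<lambda>p. chordR (fst p) (snd p - 2 * pi * of_int n))"
    using continuous_on_compose2[OF continuous_R_Q(1)[of UNIV], of S "\<lambda>p. (fst p, snd p - 2 * pi * of_int n)"]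
      continuous_on_compose2[OF continuous_R_Q(4)[of UNIV], of S "\<lambda>p. (fst p, snd p - 2 * pi * of_int n)"]
    by (simp_all add: cp)
  have "continuous_on S ?f"
    by (intro continuous_intros c ballI Q_nonzero) (auto simp: S_def algebra_simps)
  then have "continuous_on S (\<lambda>p. dkernel \<xi> (fst p) (snd p))"
  proof (rule continuous_on_eq)
    fix p assume p: "p \<in> S"
    have "dkernel \<xi> (fst p) (snd p) = dkernel \<xi> (fst p) (snd p - 2 * pi * of_int n)"
      using periodic_int[of "dkernel \<xi> (fst p)" "snd p" "- n"] dkernel_periodic(2) by (simp add: periodic_def)
    also have "\<dots> = ?f p" by (rule dkernel_local) (use p in \<open>simp add: S_def algebra_simps\<close>)
    finally show "?f p = dkernel \<xi> (fst p) (snd p)" by simp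
  qed
  then show "isCont (\<lambda>p. dkernel \<xi> (fst p) (snd p)) p0"
    using op p0S continuous_on_eq_continuous_at by blast
qed


text \<open>\<open>kk0\<close> is the kernel in its singularity-free form, \<open>kk1\<close> and
  \<open>kk2\<close> are its t-derivatives, left as the quotient rule produces them.\<close>

abbreviation "kk0 t s \<equiv> Im (chordR t s / chordQ t s) / pi"
abbreviation "kk1 t s \<equiv> Im ((chordR1 t s * chordQ t s - chordR t s * chordQ1 t s) / (chordQ t s)\<^sup>2) / pi"
abbreviation "kk2 t s \<equiv> Im (((chordR2 t s * chordQ t s + chordR1 t s * chordQ1 t s - (chordR1 t s * chordQ1 t s + chordR t s * chordQ2 t s)) * (chordQ t s)\<^sup>2
   - (chordR1 t s * chordQ t s - chordR t s * chordQ1 t s) * (chordQ1 t s * chordQ t s + chordQ t s * chordQ1 t s)) / ((chordQ t s)\<^sup>2)\<^sup>2) / pi"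

lemma R_Q_derivs:
  "((\<lambda>t. chordQ t s) has_vector_derivative chordQ1 t s) (at t)" "((\<lambda>t. chordQ1 t s) has_vector_derivative chordQ2 t s) (at t)"
  "((\<lambda>t. chordR t s) has_vector_derivative chordR1 t s) (at t)" "((\<lambda>t. chordR1 t s) has_vector_derivative chordR2 t s) (at t)"
  by (intro avg_deriv continuous_intros bdry_derivs bdry_continuous \<xi>)+

lemma kk_derivs:
  assumes "\<bar>s - t\<bar> < 2 * pi"
  shows "((\<lambda>t. kk0 t s) has_real_derivative kk1 t s) (at t)" "((\<lambda>t. kk1 t s) has_real_derivative kk2 t s) (at t)"
proof -
  note nz = Q_nonzero[OF assms]
  have Im: "((\<lambda>t. Im (f t) / pi) has_real_derivative Im f' / pi) (at t)" if "(f has_vector_derivative f') (at t)" for f f'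
    using that unfolding has_vector_derivative_complex_iff by (intro DERIV_cdivide) simp
  show "((\<lambda>t. kk0 t s) has_real_derivative kk1 t s) (at t)"
    by (rule Im[OF has_vector_derivative_divide[OF R_Q_derivs(3) R_Q_derivs(1) nz]])
  have sq: "((\<lambda>t. (chordQ t s)\<^sup>2) has_vector_derivative chordQ t s * chordQ1 t s + chordQ1 t s * chordQ t s) (at t)"
    unfolding power2_eq_square by (rule has_vector_derivative_mult[OF R_Q_derivs(1) R_Q_derivs(1)])
  have num: "((\<lambda>t. chordR1 t s * chordQ t s - chordR t s * chordQ1 t s) has_vector_derivative
      (chordR1 t s * chordQ1 t s + chordR2 t s * chordQ t s) - (chordR t s * chordQ2 t s + chordR1 t s * chordQ1 t s)) (at t)"
    by (intro has_vector_derivative_diff has_vector_derivative_mult R_Q_derivs)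
  have "(chordQ t s)\<^sup>2 \<noteq> 0" using nz by simp
  from Im[OF has_vector_derivative_divide[OF num sq this]]
  show "((\<lambda>t. kk1 t s) has_real_derivative kk2 t s) (at t)" by (simp only: add.commute)
qed

lemma continuous_kk:
  assumes "\<And>p. p \<in> S \<Longrightarrow> \<bar>snd p - fst p\<bar> < 2 * pi"
  shows "continuous_on S (\<lambda>p. kk0 (fst p) (snd p))" "continuous_on S (\<lambda>p. kk1 (fst p) (snd p))"
    "continuous_on S (\<lambda>p. kk2 (fst p) (snd p))"
  by (intro continuous_intros continuous_R_Q ballI; simp add: Q_nonzero assms)+

text \<open>Since \<open>kk0\<close> represents the kernel only for |s - t| < 2 pi, the period of
  integration is centred at \<open>c\<close> and t stays within pi of \<open>c\<close>.
  Differentiation then falls on the kernel alone, so that a merely continuous \<open>m\<close> gains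
  two derivatives.\<close>

lemma dkernel_operator_C2:
  fixes m :: "real \<Rightarrow> real"
  assumes m: "continuous_on UNIV m" "periodic m"
  shows "\<exists>M1 M2. (\<forall>t. ((\<lambda>t. integral {0..2 * pi} (\<lambda>s. dkernel \<xi> t s * m s)) has_real_derivative M1 t) (at t)) \<and>
    (\<forall>t. (M1 has_real_derivative M2 t) (at t)) \<and> continuous_on UNIV M2"
proof -
  let ?T = "\<lambda>t. integral {0..2 * pi} (\<lambda>s. dkernel \<xi> t s * m s)"
  define I where "I f c t = integral {c - pi..c + pi} (\<lambda>s. f t s * m s)" for f :: "real \<Rightarrow> real \<Rightarrow> real" and c t
  have strip: "\<bar>s - t\<bar> < 2 * pi" if "\<bar>t - c\<bar> < pi" "s \<in> {c - pi..c + pi}" for s t c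
    using that unfolding atLeastAtMost_iff by arith
  have U: "t \<in> {c - pi<..<c + pi} \<longleftrightarrow> \<bar>t - c\<bar> < pi" for t c by auto
  have cI: "continuous_on {c - pi<..<c + pi} (\<lambda>t. I f c t)"
    if f: "\<And>S. (\<And>p. p \<in> S \<Longrightarrow> \<bar>snd p - fst p\<bar> < 2 * pi) \<Longrightarrow> continuous_on S (\<lambda>p. f (fst p) (snd p))" for f c
    unfolding I_def cbox_interval[symmetric]
  proof (rule integral_continuous_on_param)
    have "continuous_on ({c - pi<..<c + pi} \<times> {c - pi..c + pi}) (\<lambda>p. f (fst p) (snd p))"
      by (rule f) (use strip in \<open>auto simp: U\<close>)
    then show "continuous_on ({c - pi<..<c + pi} \<times> cbox (c - pi) (c + pi)) (\<lambda>(t, s). f t s * m s)"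
      unfolding case_prod_unfold cbox_interval
      by (intro continuous_on_mult continuous_on_compose2[OF m(1)] continuous_on_snd continuous_on_id) auto
  qed
  have dI: "((\<lambda>t. I f c t) has_real_derivative I f' c t) (at t)"
    if f: "\<And>S. (\<And>p. p \<in> S \<Longrightarrow> \<bar>snd p - fst p\<bar> < 2 * pi) \<Longrightarrow> continuous_on S (\<lambda>p. f (fst p) (snd p))"
      and f': "\<And>S. (\<And>p. p \<in> S \<Longrightarrow> \<bar>snd p - fst p\<bar> < 2 * pi) \<Longrightarrow> continuous_on S (\<lambda>p. f' (fst p) (snd p))"
      and d: "\<And>t s. \<bar>s - t\<bar> < 2 * pi \<Longrightarrow> ((\<lambda>t. f t s) has_real_derivative f' t s) (at t)"
      and t: "\<bar>t - c\<bar> < pi" for f f' c t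
  proof -
    have "((\<lambda>t. I f c t) has_real_derivative I f' c t) (at t within {c - pi<..<c + pi})"
      unfolding I_def cbox_interval[symmetric]
    proof (rule leibniz_rule_field_derivative)
      fix x s assume x: "x \<in> {c - pi<..<c + pi}" and s: "s \<in> cbox (c - pi) (c + pi)"
      have "((\<lambda>t. f t s) has_real_derivative f' x s) (at x)"
        by (rule d, rule strip) (use x s in \<open>auto simp: U\<close>)
      then show "((\<lambda>x. f x s * m s) has_real_derivative f' x s * m s) (at x within {c - pi<..<c + pi})"
        by (rule has_field_derivative_at_within[OF DERIV_cmult_right])
    next
      fix x assume x: "x \<in> {c - pi<..<c + pi}"
      have "continuous_on {c - pi..c + pi} (\<lambda>s. f (fst (x, s)) (snd (x, s)))"
        by (rule continuous_on_compose2[OF f[of "{x} \<times> {c - pi..c + pi}"]])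
          (use strip x in \<open>auto simp: U intro!: continuous_intros\<close>)
      then show "(\<lambda>s. f x s * m s) integrable_on cbox (c - pi) (c + pi)"
        unfolding cbox_interval by (intro integrable_continuous_interval continuous_intros continuous_on_subset[OF m(1)]) auto
    next
      have "continuous_on ({c - pi<..<c + pi} \<times> {c - pi..c + pi}) (\<lambda>p. f' (fst p) (snd p))"
        by (rule f') (use strip in \<open>auto simp: U\<close>)
      then show "continuous_on ({c - pi<..<c + pi} \<times> cbox (c - pi) (c + pi)) (\<lambda>(t, s). f' t s * m s)"
        unfolding case_prod_unfold cbox_interval
        by (intro continuous_on_mult continuous_on_compose2[OF m(1)] continuous_on_snd continuous_on_id) auto
    qed (use t in \<open>auto simp: U\<close>)
    moreover have "at t within {c - pi<..<c + pi} = at t"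
      by (rule at_within_open[OF _ open_greaterThanLessThan]) (simp only: U t)
    ultimately show ?thesis by simp
  qed
  note kk = continuous_kk
  have T: "?T t = I kk0 c t" if t: "\<bar>t - c\<bar> < pi" for t c
  proof -
    have "continuous_on UNIV (\<lambda>s. dkernel \<xi> (fst (t, s)) (snd (t, s)))"
      by (rule continuous_on_compose2[OF continuous_dkernel]) (auto intro!: continuous_intros)
    then have "?T t = integral {c - pi..(c - pi) + 2 * pi} (\<lambda>s. dkernel \<xi> t s * m s)"
      by (intro integral_periodic_shift[symmetric] continuous_intros m)
        (use m(2) in \<open>simp_all add: dkernel_periodic periodic_def\<close>)
    also have "(c - pi) + 2 * pi = c + pi" by simp
    also have "integral {c - pi..c + pi} (\<lambda>s. dkernel \<xi> t s * m s) = I kk0 c t"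
      unfolding I_def by (rule integral_cong) (simp add: dkernel_local strip[OF t])
    finally show ?thesis .
  qed
  have d1: "(?T has_real_derivative I kk1 c t) (at t)" if t: "\<bar>t - c\<bar> < pi" for t c
  proof -
    have "((\<lambda>t. I kk0 c t) has_real_derivative I kk1 c t) (at t)"
      by (rule dI[OF kk(1) kk(2) kk_derivs(1) t])
    then show ?thesis
    proof (rule has_field_derivative_transform_within_open[of _ _ _ "{c - pi<..<c + pi}"])
      show "t \<in> {c - pi<..<c + pi}" using t by (simp only: U)
      show "I kk0 c x = ?T x" if "x \<in> {c - pi<..<c + pi}" for x
        using T[symmetric] that by (simp only: U)
    qed simp
  qed
  \<comment> \<open>Every centre \<open>c\<close> gives a formula for the derivative near
    \<open>c\<close>; the choice c = t yields one global function, and uniqueness of derivatives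
    identifies it with all the local formulas.\<close>
  define M1 where "M1 t = I kk1 t t" for t
  have M1: "M1 t = I kk1 c t" if "\<bar>t - c\<bar> < pi" for t c
    unfolding M1_def by (rule DERIV_unique[OF d1 d1[OF that]]) simp
  have d2: "(M1 has_real_derivative I kk2 c t) (at t)" if t: "\<bar>t - c\<bar> < pi" for t c
  proof -
    have "((\<lambda>t. I kk1 c t) has_real_derivative I kk2 c t) (at t)"
      by (rule dI[OF kk(2) kk(3) kk_derivs(2) t])
    then show ?thesis
    proof (rule has_field_derivative_transform_within_open[of _ _ _ "{c - pi<..<c + pi}"])
      show "t \<in> {c - pi<..<c + pi}" using t by (simp only: U)
      show "I kk1 c x = M1 x" if "x \<in> {c - pi<..<c + pi}" for x
        using M1[symmetric] that by (simp only: U)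
    qed simp
  qed
  define M2 where "M2 t = I kk2 t t" for t
  have M2: "M2 t = I kk2 c t" if "\<bar>t - c\<bar> < pi" for t c
    unfolding M2_def by (rule DERIV_unique[OF d2 d2[OF that]]) simp
  have "isCont M2 c" for c
  proof -
    have "continuous_on {c - pi<..<c + pi} M2"
    proof (rule continuous_on_eq[OF cI[OF kk(3), of c]])
      show "I kk2 c x = M2 x" if "x \<in> {c - pi<..<c + pi}" for x
        using M2[symmetric] that by (simp only: U)
    qed
    moreover have "c \<in> {c - pi<..<c + pi}" by simp
    ultimately show ?thesis using continuous_on_eq_continuous_at[OF open_greaterThanLessThan] by blast
  qed
  then have "continuous_on UNIV M2" by (simp add: continuous_on_eq_continuous_at)
  moreover have "(?T has_real_derivative M1 t) (at t)" "(M1 has_real_derivative M2 t) (at t)" for t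
    unfolding M1_def[of t] M2_def[of t] by (rule d1 d2; simp)+
  ultimately show ?thesis by blast
qed


text \<open>
  The integral is the variation of \<open>arg (\<gamma>(s) - \<gamma>(t)) / \<pi>\<close> over a period centred at \<open>t\<close>. After division
  by \<open>(s - t) exp ((w(s) + w(t)) / 2)\<close>, where \<open>\<gamma> = exp w\<close>, the chord stays in the upper half plane and
  takes the same value at both ends, so that only the factor \<open>exp (w(s) / 2)\<close> contributes.
\<close>

lemma dkernel_integral: "integral {0..2 * pi} (\<lambda>s. dkernel \<xi> t s) = 1"
proof -
  define w where "w s = Complex (\<xi> s) s" for s
  define E where "E s = exp (- ((w s + w t) / 2))" for s
  define Z where "Z s = chordQ t s * E s" for s
  define d where "d s = (w s - w t) / 2" for s
  have \<xi>c: "continuous_on S \<xi>" for S using smooth_circleD(2)[OF \<xi>, of S 0] by simp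
  have \<xi>d: "(\<xi> has_real_derivative deriv \<xi> s) (at s)" for s using smooth_circleD(1)[OF \<xi>, of 0] by simp
  have \<xi>p: "\<xi> (s + 2 * pi) = \<xi> s" for s using smooth_circleD(3)[OF \<xi>, of 0] by (simp add: periodic_def)
  have cw: "continuous_on S w" for S unfolding w_def Complex_eq by (intro continuous_intros \<xi>c)
  have cQ: "continuous_on S (\<lambda>s. chordQ t s)" for S
    using continuous_on_compose2[OF continuous_R_Q(1)[of UNIV], of S "\<lambda>s. (t, s)"] by (simp add: continuous_intros)
  have cZ: "continuous_on S Z" for S
    unfolding Z_def E_def by (intro continuous_intros cQ cw) simp
  \<comment> \<open>The symmetric factor \<open>E\<close> turns the chord into 2 sinh d, whose real
    and imaginary parts are easy to control.\<close>
  have sZ: "of_real (s - t) * Z s = exp (d s) - exp (- d s)" for s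
  proof -
    have "of_real (s - t) * Z s = (exp (w s) - exp (w t)) * E s"
      using chord[of s t] by (simp add: Z_def bdry_def w_def flip: mult.assoc)
    also have "\<dots> = exp (w s - (w s + w t) / 2) - exp (w t - (w s + w t) / 2)"
      by (simp add: E_def left_diff_distrib exp_add[symmetric])
    also have "w s - (w s + w t) / 2 = d s" by (simp add: d_def field_simps)
    also have "w t - (w s + w t) / 2 = - d s" by (simp add: d_def field_simps)
    finally show ?thesis .
  qed
  have dReIm: "Re (d s) = (\<xi> s - \<xi> t) / 2" "Im (d s) = (s - t) / 2" for s
    by (simp_all add: d_def w_def)
  \<comment> \<open>The imaginary part of 2 sinh (x + i y) is 2 cosh x sin y. Here y = (s - t) / 2
    lies in (-pi, pi), so its sign is that of s - t.\<close>
  have ImZ: "Im (Z s) > 0" if "\<bar>s - t\<bar> < 2 * pi" for s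
  proof (cases "s = t")
    case True
    have "Z t = Complex (deriv \<xi> t) 1"
      by (simp add: Z_def E_def avg_diagonal bdry1_def bdry_def w_def exp_minus)
    then show ?thesis using True by simp
  next
    case False
    have "(s - t) * Im (Z s) = Im (of_real (s - t) * Z s)" by simp
    also have "\<dots> = (exp (Re (d s)) + exp (- Re (d s))) * sin ((s - t) / 2)"
      unfolding sZ by (simp add: Im_exp dReIm algebra_simps)
    finally have eq: "(s - t) * Im (Z s) = (exp (Re (d s)) + exp (- Re (d s))) * sin ((s - t) / 2)" .
    have pos: "exp (Re (d s)) + exp (- Re (d s)) > 0" by (simp add: add_pos_pos)
    show ?thesis
    proof (cases "s > t")
      case True
      then have "sin ((s - t) / 2) > 0" using that by (intro sin_gt_zero) auto
      then have "(s - t) * Im (Z s) > 0" unfolding eq using pos by simp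
      then show ?thesis using True by (simp add: zero_less_mult_iff)
    next
      case f: False
      then have "s < t" using False by simp
      then have "sin ((t - s) / 2) > 0" using that by (intro sin_gt_zero) auto
      moreover have "sin ((s - t) / 2) = - sin ((t - s) / 2)"
        by (simp flip: sin_minus add: diff_divide_distrib)
      ultimately have "(s - t) * Im (Z s) < 0" unfolding eq using pos by (simp add: mult_less_0_iff)
      then show ?thesis using \<open>s < t\<close> by (simp add: mult_less_0_iff)
    qed
  qed
  have win: "\<bar>s - t\<bar> < 2 * pi" if "s \<in> {t - pi..t + pi}" for s
    using that pi_gt_zero unfolding atLeastAtMost_iff by arith
  have nonpos: "Z s \<notin> \<real>\<^sub>\<le>\<^sub>0" if "s \<in> {t - pi..t + pi}" for s
    using ImZ[OF win[OF that]] by (auto simp: complex_nonpos_Reals_iff)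
  \<comment> \<open>The summand \<open>s / 2\<close> restores the argument that \<open>E\<close> has
    removed, so that \<open>L\<close> differs by a constant from a continuous branch of the argument
    of the chord divided by s - t.\<close>
  define L where "L s = Im (Ln (Z s)) + s / 2" for s
  have "((\<lambda>s. pi * dkernel \<xi> t s) has_integral (L (t + pi) - L (t - pi))) {t - pi..t + pi}"
  \<comment> \<open>The computation of the derivative divides by s - t; the point s = t may be
    exempted because \<open>L\<close> is continuous there.\<close>
  proof (rule fundamental_theorem_of_calculus_interior_strong[of "{t}"])
    show "continuous_on {t - pi..t + pi} L"
      unfolding L_def by (intro continuous_intros cZ) (use nonpos in auto)
    fix s assume s: "s \<in> {t - pi<..<t + pi} - {t}"
    then have sw: "\<bar>s - t\<bar> < 2 * pi" and "s \<noteq> t" and smem: "s \<in> {t - pi..t + pi}" using win[of s] by auto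
    have nz: "complex_of_real (s - t) \<noteq> 0" using \<open>s \<noteq> t\<close> by simp
    have ne: "bdry \<xi> s \<noteq> bdry \<xi> t" using bdry_inj sw \<open>s \<noteq> t\<close> by blast
    define N where "N s = (bdry \<xi> s - bdry \<xi> t) / of_real (s - t)" for s
    have NQ: "N s = chordQ t s" if "s \<noteq> t" for s
      using that unfolding N_def chord[symmetric] by simp
    have dN: "(N has_vector_derivative (bdry1 \<xi> s * of_real (s - t) - (bdry \<xi> s - bdry \<xi> t) * 1) / (of_real (s - t))\<^sup>2) (at s)"
      unfolding N_def
    proof (rule has_vector_derivative_divide)
      show "((\<lambda>s. bdry \<xi> s - bdry \<xi> t) has_vector_derivative bdry1 \<xi> s) (at s)"
        using has_vector_derivative_diff[OF bdry_derivs(1)[OF \<xi>] has_vector_derivative_const] by simp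
      have "((\<lambda>s. complex_of_real (s - t)) has_vector_derivative of_real 1) (at s)"
        by (rule has_vector_derivative_of_real) (auto intro!: derivative_eq_intros)
      then show "((\<lambda>s. complex_of_real (s - t)) has_vector_derivative 1) (at s)" by simp
    qed (use nz in simp)
    have dw: "(w has_vector_derivative Complex (deriv \<xi> s) 1) (at s)"
      unfolding w_def by (rule has_vector_derivative_Complex_id[OF \<xi>d])
    have "((\<lambda>s. - ((w s + w t) / 2)) has_vector_derivative - (Complex (deriv \<xi> s) 1 / 2)) (at s)"
      using has_vector_derivative_minus[OF has_vector_derivative_divide[OF has_vector_derivative_add[OF dw has_vector_derivative_const[of "w t"]]
         has_vector_derivative_const[of 2]]] by (simp add: power2_eq_square)
    from field_vector_diff_chain_at[OF this DERIV_exp]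
    have dE: "(E has_vector_derivative - (Complex (deriv \<xi> s) 1 / 2) * E s) (at s)"
      by (simp add: E_def[abs_def] o_def)
    have "((\<lambda>s. N s * E s) has_vector_derivative N s * (- (Complex (deriv \<xi> s) 1 / 2) * E s) +
        (bdry1 \<xi> s * of_real (s - t) - (bdry \<xi> s - bdry \<xi> t) * 1) / (of_real (s - t))\<^sup>2 * E s) (at s)"
      by (rule has_vector_derivative_mult[OF dN dE])
    then have dZ: "(Z has_vector_derivative N s * (- (Complex (deriv \<xi> s) 1 / 2) * E s) +
        (bdry1 \<xi> s * of_real (s - t) - (bdry \<xi> s - bdry \<xi> t) * 1) / (of_real (s - t))\<^sup>2 * E s) (at s)"
      by (rule has_vector_derivative_transform_within_open[of _ _ _ "- {t}"])
        (use \<open>s \<noteq> t\<close> NQ in \<open>auto simp: Z_def\<close>)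
    have Zs: "Z s = N s * E s" using NQ[OF \<open>s \<noteq> t\<close>] by (simp add: Z_def)
    have "((\<lambda>s. Ln (Z s)) has_vector_derivative (N s * (- (Complex (deriv \<xi> s) 1 / 2) * E s) +
        (bdry1 \<xi> s * of_real (s - t) - (bdry \<xi> s - bdry \<xi> t) * 1) / (of_real (s - t))\<^sup>2 * E s) * inverse (Z s)) (at s)"
      using field_vector_diff_chain_at[OF dZ has_field_derivative_Ln[OF nonpos[OF smem]]] by (simp add: o_def)
    moreover have "(N s * (- (Complex (deriv \<xi> s) 1 / 2) * E s) +
        (bdry1 \<xi> s * of_real (s - t) - (bdry \<xi> s - bdry \<xi> t) * 1) / (of_real (s - t))\<^sup>2 * E s) * inverse (Z s)
       = bdry1 \<xi> s / (bdry \<xi> s - bdry \<xi> t) - of_real (1 / (s - t)) - Complex (deriv \<xi> s) 1 / 2"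
    proof -
      have "E s \<noteq> 0" by (simp add: E_def)
      then show ?thesis
        unfolding Zs N_def of_real_divide of_real_1 using nz ne
        by (simp add: divide_simps power2_eq_square del: of_real_diff) (simp add: algebra_simps)
    qed
    ultimately have "((\<lambda>s. Ln (Z s)) has_vector_derivative
       bdry1 \<xi> s / (bdry \<xi> s - bdry \<xi> t) - of_real (1 / (s - t)) - Complex (deriv \<xi> s) 1 / 2) (at s)" by simp
    then have "((\<lambda>s. Im (Ln (Z s))) has_real_derivative Im (bdry1 \<xi> s / (bdry \<xi> s - bdry \<xi> t)) - 1 / 2) (at s)"
      unfolding has_vector_derivative_complex_iff by simp
    then have "(L has_real_derivative Im (bdry1 \<xi> s / (bdry \<xi> s - bdry \<xi> t)) - 1 / 2 + 1 / 2) (at s)"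
      unfolding L_def by (rule DERIV_add) (auto intro!: derivative_eq_intros)
    then show "(L has_vector_derivative pi * dkernel \<xi> t s) (at s)"
      using ne by (simp add: dkernel_def has_real_derivative_iff_has_vector_derivative)
  qed (use pi_gt_zero in auto)
  \<comment> \<open>At the two ends \<open>d\<close> has the same real part x and the imaginary
    parts pi/2 and -pi/2. Thus 2 sinh d = 2 i cosh x or its negative, and the sign cancels against
    that of s - t.\<close>
  moreover have "Z (t + pi) = Z (t - pi)"
  proof -
    have \<xi>eq: "\<xi> (t - pi) = \<xi> (t + pi)" using \<xi>p[of "t - pi"] by (simp add: add.commute)
    define x where "x = (\<xi> (t + pi) - \<xi> t) / 2"
    have d1: "d (t + pi) = of_real x + \<i> * of_real (pi / 2)" and d2: "d (t - pi) = of_real x - \<i> * of_real (pi / 2)"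
      by (simp_all add: complex_eq_iff dReIm x_def \<xi>eq)
    have e: "exp (\<i> * of_real (pi / 2)) = \<i>" "exp (- (\<i> * of_real (pi / 2))) = - \<i>"
      by (simp_all add: complex_eq_iff Re_exp Im_exp)
    have "of_real pi * Z (t + pi) = exp (of_real x) * \<i> - exp (- of_real x) * (- \<i>)"
      using sZ[of "t + pi"] unfolding d1
      by (simp only: add_diff_cancel_left' minus_add exp_add e) (simp add: mult.commute)
    moreover have "of_real (- pi) * Z (t - pi) = exp (of_real x) * (- \<i>) - exp (- of_real x) * \<i>"
    proof -
      have "exp (d (t - pi)) = exp (of_real x) * (- \<i>)"
        unfolding d2 unfolding diff_conv_add_uminus exp_add e ..
      moreover have "exp (- d (t - pi)) = exp (- of_real x) * \<i>"
        unfolding d2 unfolding minus_diff_eq unfolding diff_conv_add_uminus exp_add e by (rule mult.commute)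
      moreover have "t - pi - t = - pi" by simp
      ultimately show ?thesis using sZ[of "t - pi"] by (simp only:)
    qed
    ultimately have "of_real pi * Z (t + pi) = of_real pi * Z (t - pi)" by (simp add: algebra_simps)
    then show ?thesis by simp
  qed
  ultimately have "((\<lambda>s. pi * dkernel \<xi> t s) has_integral pi) {t - pi..t + pi}" by (simp add: L_def field_simps)
  then have "((\<lambda>s. (1 / pi) * (pi * dkernel \<xi> t s)) has_integral (1 / pi) * pi) {t - pi..t + pi}"
    by (rule has_integral_mult_right)
  then have I: "integral {t - pi..t + pi} (\<lambda>s. dkernel \<xi> t s) = 1" by (simp add: integral_unique)
  have "continuous_on UNIV (\<lambda>s. dkernel \<xi> (fst (t, s)) (snd (t, s)))"
    by (rule continuous_on_compose2[OF continuous_dkernel]) (auto intro!: continuous_intros)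
  then have "integral {t - pi..(t - pi) + 2 * pi} (\<lambda>s. dkernel \<xi> t s) = integral {0..2 * pi} (\<lambda>s. dkernel \<xi> t s)"
    by (intro integral_periodic_shift) (simp_all add: dkernel_periodic)
  moreover have "(t - pi) + 2 * pi = t + pi" by simp
  ultimately show ?thesis using I by simp
qed

end


section \<open>Cauchy integrals up to the boundary\<close>

text \<open>Crude but sufficient. With y = |x| / 2: on [0, pi/3] the cosine is at least 1/2, hence y
  \<le> 2 sin y; on [pi/3, pi/2] one has sin y \<ge> 1/2 and y < 2, hence y \<le> 4 sin y.\<close>

lemma abs_le_sin_half:
  fixes x :: real
  assumes "\<bar>x\<bar> \<le> pi"
  shows "\<bar>x\<bar> \<le> 8 * \<bar>sin (x / 2)\<bar>"
proof -
  have pos: "y \<le> 4 * sin y" if "0 \<le> y" "y \<le> pi / 2" for y :: real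
  proof (cases "y \<le> pi / 3")
    case True
    show ?thesis
    proof (cases "y = 0")
      case False
      then have "0 < y" using that by simp
      then obtain z where z: "0 < z" "z < y" "sin y - sin 0 = (y - 0) * cos z"
        using MVT2[of 0 y sin cos] by (auto intro: DERIV_sin)
      have "cos (pi / 3) \<le> cos z" using z True by (intro cos_monotone_0_pi_le) auto
      then have "1 / 2 \<le> cos z" by (simp add: cos_60)
      then have "y * (1 / 2) \<le> y * cos z" using that by (intro mult_left_mono) auto
      then show ?thesis using z(3) that by simp
    qed simp
  next
    case False
    have "sin (pi / 6) \<le> sin y" using that False by (intro sin_monotone_2pi_le) auto
    then have "1 / 2 \<le> sin y" by (simp add: sin_30)
    then show ?thesis using that pi_less_4 by linarith
  qed
  show ?thesis
  proof (cases "x \<ge> 0")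
    case True
    then show ?thesis using pos[of "x / 2"] assms by simp
  next
    case False
    have "- x / 2 \<le> 4 * sin (- x / 2)" using False assms by (intro pos) auto
    then show ?thesis using False by simp
  qed
qed

text \<open>The ordinary Lipschitz estimate for the representative of s nearest to t. The sine is
  the periodic substitute for |s - t|, chosen because \<open>bdry_distance\<close> bounds the
  denominator of the Cauchy kernel by the same sine.\<close>

lemma periodic_lipschitz_sin:
  fixes \<nu> :: "real \<Rightarrow> complex"
  assumes d: "\<And>s. (\<nu> has_vector_derivative \<nu>' s) (at s)" and c: "continuous_on UNIV \<nu>'"
    and per: "\<And>s. \<nu> (s + 2 * pi) = \<nu> s"
  obtains C where "C > 0" "\<And>s t. norm (\<nu> s - \<nu> t) \<le> C * \<bar>sin ((s - t) / 2)\<bar>"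
proof -
  have "(\<nu> has_vector_derivative \<nu>' (s + 2 * pi)) (at s)" for s
  proof -
    have "((\<lambda>s. \<nu> (s + 2 * pi)) has_vector_derivative 1 *\<^sub>R \<nu>' (s + 2 * pi)) (at s)"
      by (rule vector_diff_chain_at[of "\<lambda>s. s + 2 * pi" 1 s \<nu>, unfolded o_def])
        (auto intro!: derivative_eq_intros d)
    then show ?thesis by (simp add: per)
  qed
  then have per': "\<nu>' (s + 2 * pi) = \<nu>' s" for s using d by (rule vector_derivative_unique_at)
  have pn: "periodic (\<lambda>s. norm (\<nu>' s))" by (simp add: periodic_def per')
  have "continuous_on UNIV (\<lambda>s. norm (\<nu>' s))" by (intro continuous_intros c)
  from periodic_bounded[OF pn this] obtain M where M: "M > 0" "\<And>s. norm (\<nu>' s) \<le> M" by auto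
  show thesis
  proof
    show "8 * M > 0" using M by simp
    fix s t
    obtain n where n: "\<bar>(s - t) - 2 * pi * of_int n\<bar> \<le> pi" by (rule angle_reduce)
    define s' where "s' = s - 2 * pi * of_int n"
    have pr: "periodic (\<lambda>s. Re (\<nu> s))" "periodic (\<lambda>s. Im (\<nu> s))" by (simp_all add: periodic_def per)
    have "\<nu> s' = \<nu> s"
      using periodic_int[OF pr(1), of s "- n"] periodic_int[OF pr(2), of s "- n"]
      by (simp add: s'_def complex_eq_iff)
    moreover have "norm (\<nu> s' - \<nu> t) \<le> M * norm (s' - t)"
    proof (rule differentiable_bound[of UNIV \<nu> "\<lambda>s h. h *\<^sub>R \<nu>' s"])
      show "(\<nu> has_derivative (\<lambda>h. h *\<^sub>R \<nu>' s)) (at s within UNIV)" for s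
        using d[of s] by (simp add: has_vector_derivative_def)
      show "onorm (\<lambda>h. h *\<^sub>R \<nu>' s) \<le> M" for s
        by (rule onorm_le) (use mult_right_mono[OF M(2)[of s] abs_ge_zero] in \<open>simp add: mult.commute\<close>)
    qed auto
    moreover have "\<bar>s' - t\<bar> \<le> 8 * \<bar>sin ((s' - t) / 2)\<bar>"
      by (rule abs_le_sin_half) (use n in \<open>simp add: s'_def algebra_simps\<close>)
    moreover have "\<bar>sin ((s' - t) / 2)\<bar> = \<bar>sin ((s - t) / 2)\<bar>"
    proof -
      have e: "(s' - t) / 2 = (s - t) / 2 - pi * of_int n" by (simp add: s'_def field_simps)
      show ?thesis unfolding e by (simp add: sin_diff abs_mult)
    qed
    ultimately have 1: "norm (\<nu> s - \<nu> t) \<le> M * \<bar>s' - t\<bar>" and 2: "\<bar>s' - t\<bar> \<le> 8 * \<bar>sin ((s - t) / 2)\<bar>" by simp_all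
    note 1
    also have "M * \<bar>s' - t\<bar> \<le> M * (8 * \<bar>sin ((s - t) / 2)\<bar>)"
      by (rule mult_left_mono[OF 2]) (use M(1) in simp)
    finally show "norm (\<nu> s - \<nu> t) \<le> 8 * M * \<bar>sin ((s - t) / 2)\<bar>" by (simp only: mult_ac)
  qed
qed

text \<open>With moduli A = exp (\<xi> s) and B = r exp (\<xi> t), the law of cosines gives the
  squared distance as (A - B)^2 + 4 A B sin^2 ((s - t) / 2); the first square is dropped.\<close>

lemma bdry_distance:
  assumes r: "r \<ge> 0"
  shows "norm (bdry \<xi> s - of_real r * bdry \<xi> t) \<ge> 2 * sqrt (r * exp (\<xi> s) * exp (\<xi> t)) * \<bar>sin ((s - t) / 2)\<bar>"
proof -
  define A where "A = exp (\<xi> s)"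
  define B where "B = r * exp (\<xi> t)"
  have AB: "A \<ge> 0" "B \<ge> 0" using r by (simp_all add: A_def B_def)
  have "(norm (bdry \<xi> s - of_real r * bdry \<xi> t))\<^sup>2 = (A * cos s - B * cos t)\<^sup>2 + (A * sin s - B * sin t)\<^sup>2"
    by (simp add: cmod_power2 bdry_def Re_exp Im_exp A_def B_def mult.assoc)
  also have "\<dots> = A\<^sup>2 * ((cos s)\<^sup>2 + (sin s)\<^sup>2) + B\<^sup>2 * ((cos t)\<^sup>2 + (sin t)\<^sup>2) - 2 * A * B * (cos s * cos t + sin s * sin t)"
    by algebra
  also have "\<dots> = A\<^sup>2 + B\<^sup>2 - 2 * A * B * cos (s - t)"
    by (simp only: sin_cos_squared_add2 cos_diff mult_1_right)
  also have "cos (s - t) = 1 - 2 * (sin ((s - t) / 2))\<^sup>2"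
  proof -
    have e: "2 * ((s - t) / 2) = s - t" by simp
    show ?thesis using cos_double_sin[of "(s - t) / 2"] unfolding e .
  qed
  also have "A\<^sup>2 + B\<^sup>2 - 2 * A * B * (1 - 2 * (sin ((s - t) / 2))\<^sup>2) = (A - B)\<^sup>2 + 4 * (A * B) * (sin ((s - t) / 2))\<^sup>2"
    by (simp add: power2_eq_square algebra_simps)
  finally have "4 * (A * B) * (sin ((s - t) / 2))\<^sup>2 \<le> (norm (bdry \<xi> s - of_real r * bdry \<xi> t))\<^sup>2" by simp
  moreover have "(2 * sqrt (A * B) * \<bar>sin ((s - t) / 2)\<bar>)\<^sup>2 = 4 * (A * B) * (sin ((s - t) / 2))\<^sup>2"
    using AB by (simp add: power_mult_distrib)
  ultimately have "2 * sqrt (A * B) * \<bar>sin ((s - t) / 2)\<bar> \<le> norm (bdry \<xi> s - of_real r * bdry \<xi> t)"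
    by (intro power2_le_imp_le[of "2 * sqrt (A * B) * \<bar>sin ((s - t) / 2)\<bar>"]) simp_all
  then show ?thesis by (simp add: A_def B_def mult_ac)
qed

lemma bdry_eq_scaled:
  assumes "bdry \<xi> s = of_real r * bdry \<xi> t" "r \<ge> 0" "periodic \<xi>"
  shows "r = 1" "\<exists>n::int. s = t + 2 * pi * of_int n"
proof -
  have "r \<noteq> 0" using assms(1) by auto
  then have r: "r > 0" using assms(2) by simp
  have "exp (Complex (\<xi> s) s) = exp (of_real (ln r) + Complex (\<xi> t) t)"
    using assms(1) r by (simp add: bdry_def exp_add exp_of_real)
  then obtain n :: int where "Complex (\<xi> s) s = of_real (ln r) + Complex (\<xi> t) t + (of_int (2 * n) * pi) * \<i>"
    unfolding exp_eq by blast
  then have n: "s = t + 2 * pi * of_int n" "\<xi> s = ln r + \<xi> t" by (auto simp: complex_eq_iff)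
  then show "\<exists>n::int. s = t + 2 * pi * of_int n" by blast
  have "\<xi> s = \<xi> t" using n(1) periodic_int[OF assms(3)] by simp
  then show "r = 1" using n(2) r by simp
qed

section \<open>The Cauchy integral and its jump across the curve\<close>

definition cauchy :: "(real \<Rightarrow> real) \<Rightarrow> (real \<Rightarrow> complex) \<Rightarrow> complex \<Rightarrow> complex" where
  "cauchy \<xi> \<nu> z = integral {0..2 * pi} (\<lambda>s. \<nu> s * bdry1 \<xi> s / (bdry \<xi> s - z)) / (2 * pi * \<i>)"

text \<open>
  Subtracting \<open>\<nu>(t)\<close> bounds the integrand uniformly as \<open>r \<gamma>(t)\<close> approaches the curve, from either side.
\<close>

definition reg :: "(real \<Rightarrow> real) \<Rightarrow> (real \<Rightarrow> complex) \<Rightarrow> real \<times> real \<Rightarrow> complex" where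
  "reg \<xi> \<nu> p = integral {0..2 * pi} (\<lambda>s. (\<nu> s - \<nu> (snd p)) * bdry1 \<xi> s / (bdry \<xi> s - of_real (fst p) * bdry \<xi> (snd p))) / (2 * pi * \<i>)"

context
  fixes \<xi> assumes \<xi>: "\<xi> \<in> smooth_circle"
begin

lemma curve_facts:
  shows "continuous_on S (bdry \<xi>)" "continuous_on S (bdry1 \<xi>)" "continuous_on S \<xi>" "periodic \<xi>"
    "(\<xi> has_real_derivative deriv \<xi> s) (at s)"
  using bdry_continuous[OF \<xi>] smooth_circleD(1)[OF \<xi>, of 0] smooth_circleD(2)[OF \<xi>, of S 0] smooth_circleD(3)[OF \<xi>, of 0] by auto

lemma off_curve: "r \<ge> 0 \<Longrightarrow> r \<noteq> 1 \<Longrightarrow> of_real r * bdry \<xi> t \<notin> range (bdry \<xi>)"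
  using bdry_eq_scaled(1)[OF _ _ curve_facts(4)] by (metis image_iff)

lemma range_bdry: "range (bdry \<xi>) = bdry \<xi> ` {-pi..pi}"
proof -
  have "bdry \<xi> s \<in> bdry \<xi> ` {-pi..pi}" for s
  proof -
    obtain n where n: "\<bar>s - 2 * pi * of_int n\<bar> \<le> pi" by (rule angle_reduce)
    have "periodic (\<lambda>s. Re (bdry \<xi> s))" "periodic (\<lambda>s. Im (bdry \<xi> s))"
      by (simp_all add: periodic_def periodic_bdry[OF \<xi>])
    from periodic_int[OF this(1), of s "- n"] periodic_int[OF this(2), of s "- n"]
    have "bdry \<xi> s = bdry \<xi> (s - 2 * pi * of_int n)" by (simp add: complex_eq_iff)
    moreover have "s - 2 * pi * of_int n \<in> {-pi..pi}" using n by (auto simp: abs_le_iff)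
    ultimately show ?thesis by blast
  qed
  then show ?thesis by blast
qed

lemma closed_curve: "closed (range (bdry \<xi>))"
  unfolding range_bdry by (intro compact_imp_closed compact_continuous_image curve_facts) simp

text \<open>Differentiation under the integral produces a double pole, which integration by parts
  along the closed curve reduces to a simple one. The derivative is thus again a Cauchy integral,
  with density d\<nu>/d\<gamma>, and its boundary behaviour needs no separate theory.\<close>

lemma cauchy_deriv:
  assumes d: "\<And>s. (\<nu> has_vector_derivative \<nu>' s) (at s)" and c: "continuous_on UNIV \<nu>'"
    and per: "\<And>s. \<nu> (s + 2 * pi) = \<nu> s" and z: "z \<notin> range (bdry \<xi>)"
  shows "(cauchy \<xi> \<nu> has_field_derivative cauchy \<xi> (\<lambda>s. \<nu>' s / bdry1 \<xi> s) z) (at z)"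
proof -
  have c\<nu>: "continuous_on S \<nu>" for S
    by (rule continuous_on_vector_derivative) (rule has_vector_derivative_at_within[OF d])
  have op: "open (- range (bdry \<xi>))" using closed_curve by (simp add: open_Compl)
  then obtain e where e: "e > 0" "ball z e \<subseteq> - range (bdry \<xi>)"
    by (rule openE[of "- range (bdry \<xi>)" z]) (use z in auto)
  have ne: "bdry \<xi> s - x \<noteq> 0" if "x \<in> ball z e" for x s using e(2) that by auto
  have zb: "z \<in> ball z e" using e by simp
  have cont: "continuous_on {0..2 * pi} (\<lambda>s. f s / (bdry \<xi> s - z))" "continuous_on {0..2 * pi} (\<lambda>s. f s / (bdry \<xi> s - z)\<^sup>2)"
    if "continuous_on {0..2 * pi} f" for f
    using ne[OF zb] by (auto intro!: continuous_intros that curve_facts)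
  have "((\<lambda>x. integral (cbox 0 (2 * pi)) (\<lambda>s. \<nu> s * bdry1 \<xi> s / (bdry \<xi> s - x))) has_field_derivative
      integral (cbox 0 (2 * pi)) (\<lambda>s. \<nu> s * bdry1 \<xi> s / (bdry \<xi> s - z)\<^sup>2)) (at z within ball z e)"
  proof (rule leibniz_rule_field_derivative[OF _ _ _ zb convex_ball])
    fix x s assume x: "x \<in> ball z e"
    have "((\<lambda>x. \<nu> s * bdry1 \<xi> s / (bdry \<xi> s - x)) has_field_derivative \<nu> s * bdry1 \<xi> s / (bdry \<xi> s - x)\<^sup>2) (at x)"
      using ne[OF x] by (auto intro!: derivative_eq_intros simp: power2_eq_square)
    then show "((\<lambda>x. \<nu> s * bdry1 \<xi> s / (bdry \<xi> s - x)) has_field_derivative \<nu> s * bdry1 \<xi> s / (bdry \<xi> s - x)\<^sup>2) (at x within ball z e)"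
      by (rule has_field_derivative_at_within)
  next
    show "(\<lambda>s. \<nu> s * bdry1 \<xi> s / (bdry \<xi> s - x)) integrable_on cbox 0 (2 * pi)" if "x \<in> ball z e" for x
      unfolding cbox_interval using ne[OF that]
      by (intro integrable_continuous_interval continuous_intros c\<nu> curve_facts) auto
    show "continuous_on (ball z e \<times> cbox 0 (2 * pi)) (\<lambda>(x, s). \<nu> s * bdry1 \<xi> s / (bdry \<xi> s - x)\<^sup>2)"
      unfolding case_prod_unfold
      by (intro continuous_intros continuous_on_compose2[OF c\<nu>[of UNIV]] continuous_on_compose2[OF curve_facts(1)[of UNIV]]
          continuous_on_compose2[OF curve_facts(2)[of UNIV]]) (use ne in auto)
  qed
  then have D: "((\<lambda>x. integral {0..2 * pi} (\<lambda>s. \<nu> s * bdry1 \<xi> s / (bdry \<xi> s - x))) has_field_derivative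
      integral {0..2 * pi} (\<lambda>s. \<nu> s * bdry1 \<xi> s / (bdry \<xi> s - z)\<^sup>2)) (at z)"
    using at_within_open[OF zb open_ball] by (simp add: cbox_interval)
  \<comment> \<open>The integrand is the derivative of \<nu> / (\<gamma> - z), which returns to its
    initial value after a period.\<close>
  have "((\<lambda>s. \<nu>' s / (bdry \<xi> s - z) - \<nu> s * bdry1 \<xi> s / (bdry \<xi> s - z)\<^sup>2) has_integral
      (\<nu> (2 * pi) / (bdry \<xi> (2 * pi) - z) - \<nu> 0 / (bdry \<xi> 0 - z))) {0..2 * pi}"
  proof (rule fundamental_theorem_of_calculus)
    fix s
    have "((\<lambda>s. bdry \<xi> s - z) has_vector_derivative bdry1 \<xi> s) (at s)"
      using has_vector_derivative_diff[OF bdry_derivs(1)[OF \<xi>] has_vector_derivative_const] by simp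
    from has_vector_derivative_divide[OF d this ne[OF zb]]
    have "((\<lambda>s. \<nu> s / (bdry \<xi> s - z)) has_vector_derivative \<nu>' s / (bdry \<xi> s - z) - \<nu> s * bdry1 \<xi> s / (bdry \<xi> s - z)\<^sup>2) (at s)"
      using ne[OF zb, of s] by (simp add: diff_divide_distrib power2_eq_square)
    then show "((\<lambda>s. \<nu> s / (bdry \<xi> s - z)) has_vector_derivative \<nu>' s / (bdry \<xi> s - z) - \<nu> s * bdry1 \<xi> s / (bdry \<xi> s - z)\<^sup>2) (at s within {0..2 * pi})"
      by (rule has_vector_derivative_at_within)
  qed simp
  moreover have "\<nu> (2 * pi) = \<nu> 0" "bdry \<xi> (2 * pi) = bdry \<xi> 0"
    using per[of 0] periodic_bdry(1)[OF \<xi>, of 0] by simp_all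
  ultimately have "integral {0..2 * pi} (\<lambda>s. \<nu>' s / (bdry \<xi> s - z) - \<nu> s * bdry1 \<xi> s / (bdry \<xi> s - z)\<^sup>2) = 0"
    by (simp add: integral_unique)
  moreover have "integral {0..2 * pi} (\<lambda>s. \<nu>' s / (bdry \<xi> s - z) - \<nu> s * bdry1 \<xi> s / (bdry \<xi> s - z)\<^sup>2) =
      integral {0..2 * pi} (\<lambda>s. \<nu>' s / (bdry \<xi> s - z)) - integral {0..2 * pi} (\<lambda>s. \<nu> s * bdry1 \<xi> s / (bdry \<xi> s - z)\<^sup>2)"
    by (intro integral_diff integrable_continuous_interval cont continuous_intros c\<nu> curve_facts continuous_on_subset[OF c]) simp
  ultimately have eq: "integral {0..2 * pi} (\<lambda>s. \<nu> s * bdry1 \<xi> s / (bdry \<xi> s - z)\<^sup>2) = integral {0..2 * pi} (\<lambda>s. \<nu>' s / (bdry \<xi> s - z))"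
    by simp
  have "((\<lambda>x. integral {0..2 * pi} (\<lambda>s. \<nu> s * bdry1 \<xi> s / (bdry \<xi> s - x)) / (2 * pi * \<i>)) has_field_derivative
      integral {0..2 * pi} (\<lambda>s. \<nu>' s / (bdry \<xi> s - z)) / (2 * pi * \<i>)) (at z)"
    by (rule DERIV_cdivide) (use D eq in simp)
  then show ?thesis by (simp add: cauchy_def[abs_def])
qed

lemma cauchy_bound:
  assumes "continuous_on UNIV \<nu>"
  obtains C M where "C > 0" "M > 0" "\<And>z. norm z \<ge> M \<Longrightarrow> norm (cauchy \<xi> \<nu> z) \<le> C / norm z"
proof -
  have "bounded ((\<lambda>s. \<nu> s * bdry1 \<xi> s) ` {0..2 * pi})" "bounded (bdry \<xi> ` {0..2 * pi})"
    by (intro compact_imp_bounded compact_continuous_image continuous_intros curve_facts continuous_on_subset[OF assms]; simp)+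
  then obtain B N where BN: "B > 0" "\<forall>x\<in>(\<lambda>s. \<nu> s * bdry1 \<xi> s) ` {0..2 * pi}. norm x \<le> B"
    "N > 0" "\<forall>x\<in>bdry \<xi> ` {0..2 * pi}. norm x \<le> N"
    unfolding bounded_pos by blast
  have B: "B > 0" "\<And>s. s \<in> {0..2 * pi} \<Longrightarrow> norm (\<nu> s * bdry1 \<xi> s) \<le> B"
    and N: "N > 0" "\<And>s. s \<in> {0..2 * pi} \<Longrightarrow> norm (bdry \<xi> s) \<le> N"
    using BN by (simp_all only: ball_simps)
  show thesis
  proof
    show "2 * B > 0" "2 * N > 0" using B N by simp_all
    fix z :: complex assume z: "norm z \<ge> 2 * N"
    have den: "norm (bdry \<xi> s - z) \<ge> norm z / 2" if "s \<in> {0..2 * pi}" for s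
      using norm_triangle_ineq2[of z "bdry \<xi> s"] N(2)[OF that] z by (simp add: norm_minus_commute)
    have zpos: "norm z > 0" using z N(1) by linarith
    have ne: "bdry \<xi> s - z \<noteq> 0" if "s \<in> {0..2 * pi}" for s using den[OF that] zpos by auto
    have "norm (integral {0..2 * pi} (\<lambda>s. \<nu> s * bdry1 \<xi> s / (bdry \<xi> s - z))) \<le> (B / (norm z / 2)) * (2 * pi - 0)"
    proof (rule integral_bound)
      show "continuous_on {0..2 * pi} (\<lambda>s. \<nu> s * bdry1 \<xi> s / (bdry \<xi> s - z))"
        by (intro continuous_intros curve_facts continuous_on_subset[OF assms] ballI ne) auto
      fix s assume s: "s \<in> {0..2 * pi}"
      show "norm (\<nu> s * bdry1 \<xi> s / (bdry \<xi> s - z)) \<le> B / (norm z / 2)"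
        unfolding norm_divide using zpos B(2)[OF s] den[OF s] B(1) by (intro frac_le) auto
    qed simp
    note le = this
    have "norm (cauchy \<xi> \<nu> z) = norm (integral {0..2 * pi} (\<lambda>s. \<nu> s * bdry1 \<xi> s / (bdry \<xi> s - z))) / (2 * pi)"
      by (simp add: cauchy_def norm_divide norm_mult)
    also have "\<dots> \<le> (B / (norm z / 2)) * (2 * pi - 0) / (2 * pi)"
      by (rule divide_right_mono[OF le]) simp
    also have "\<dots> = 2 * B / norm z" by simp
    finally show "norm (cauchy \<xi> \<nu> z) \<le> 2 * B / norm z" .
  qed
qed

text \<open>The winding number along a ray. By \<open>cauchy_deriv\<close> the derivative vanishes
  off the curve, so the value is constant for r < 1 and for r > 1. At r = 0 the integrand
  \<gamma>'/\<gamma> = \<xi>' + i integrates to 2 pi i; far out the decay of the Cauchy integral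
  forces 0.\<close>

lemma cauchy_one:
  assumes "r \<ge> 0" "r \<noteq> 1"
  shows "cauchy \<xi> (\<lambda>s. 1) (of_real r * bdry \<xi> t) = (if r < 1 then 1 else 0)"
proof -
  define f where "f x = cauchy \<xi> (\<lambda>s. 1) (of_real x * bdry \<xi> t)" for x
  have D: "(f has_derivative (\<lambda>h. 0)) (at x)" if "x \<ge> 0" "x \<noteq> 1" for x
  proof -
    have "(cauchy \<xi> (\<lambda>s. 1) has_field_derivative cauchy \<xi> (\<lambda>s. 0 / bdry1 \<xi> s) (of_real x * bdry \<xi> t)) (at (of_real x * bdry \<xi> t))"
      by (rule cauchy_deriv) (auto simp: off_curve[OF that])
    then have "(cauchy \<xi> (\<lambda>s. 1) has_field_derivative 0) (at (of_real x * bdry \<xi> t))" by (simp add: cauchy_def)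
    moreover have "((\<lambda>x. of_real x * bdry \<xi> t) has_vector_derivative bdry \<xi> t) (at x)"
      by (rule has_vector_derivative_eq_rhs[OF has_vector_derivative_mult_left[OF has_vector_derivative_of_real[of _ 1]]])
        (auto intro!: derivative_eq_intros)
    ultimately have "(f has_vector_derivative bdry \<xi> t * 0) (at x)"
      using field_vector_diff_chain_at[of "\<lambda>x. of_real x * bdry \<xi> t" "bdry \<xi> t" x "cauchy \<xi> (\<lambda>s. 1)" 0] by (simp add: f_def[abs_def] o_def)
    then show ?thesis by (simp add: has_vector_derivative_def)
  qed
  have f0: "f 0 = 1"
  proof -
    have "((\<lambda>s. bdry1 \<xi> s / bdry \<xi> s) has_integral (Complex (\<xi> (2 * pi)) (2 * pi) - Complex (\<xi> 0) 0)) {0..2 * pi}"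
    proof (rule fundamental_theorem_of_calculus)
      show "((\<lambda>s. Complex (\<xi> s) s) has_vector_derivative bdry1 \<xi> s / bdry \<xi> s) (at s within {0..2 * pi})" for s
        using has_vector_derivative_at_within[OF has_vector_derivative_Complex_id[OF curve_facts(5)]]
        by (simp add: bdry1_def)
    qed simp
    moreover have "\<xi> (2 * pi) = \<xi> 0" using periodic_int[OF curve_facts(4), of 0 1] by simp
    ultimately have "integral {0..2 * pi} (\<lambda>s. bdry1 \<xi> s / bdry \<xi> s) = Complex 0 (2 * pi)"
      by (simp add: integral_unique minus_complex.ctr)
    then have "integral {0..2 * pi} (\<lambda>s. bdry1 \<xi> s / bdry \<xi> s) = 2 * of_real pi * \<i>"
      by (simp add: complex_eq_iff)
    then show ?thesis by (simp add: f_def cauchy_def)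
  qed
  show ?thesis
  proof (cases "r < 1")
    case True
    have "f r = f 0"
    proof (rule has_derivative_zero_unique[of "{0..<1}" f])
      show "(f has_derivative (\<lambda>h. 0)) (at x within {0..<1})" if "x \<in> {0..<1}" for x
        by (rule has_derivative_at_withinI[OF D]) (use that in auto)
    qed (use True assms in auto)
    then show ?thesis using True f0 by (simp add: f_def)
  next
    case False
    then have "r > 1" using assms by simp
    have const: "f x = f r" if "x > 1" for x
    proof (rule has_derivative_zero_unique[of "{1<..}" f])
      show "(f has_derivative (\<lambda>h. 0)) (at x within {1<..})" if "x \<in> {1<..}" for x
        by (rule has_derivative_at_withinI[OF D]) (use that in auto)
    qed (use that \<open>r > 1\<close> in auto)
    obtain C M where CM: "C > 0" "M > 0" "\<And>z. norm z \<ge> M \<Longrightarrow> norm (cauchy \<xi> (\<lambda>s. 1) z) \<le> C / norm z"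
      using cauchy_bound[OF continuous_on_const[of UNIV "1::complex"]] by blast
    have le: "norm (f r) \<le> e" if e: "e > 0" for e
    proof -
      define k where "k = norm (bdry \<xi> t)"
      have k: "k > 0" by (simp add: k_def)
      \<comment> \<open>The three lower bounds place the point outside the curve, within the range
        of the decay estimate, and far enough for that estimate to be at most
        \<open>e\<close>.\<close>
      define x where "x = max 2 (max (M / k) (C / (e * k)))"
      have x: "x > 1" "x * k \<ge> M" "x * k \<ge> C / e"
      proof -
        show "x > 1" by (simp add: x_def)
        have "x \<ge> M / k" "x \<ge> C / (e * k)" by (simp_all add: x_def)
        then show "x * k \<ge> M" "x * k \<ge> C / e" using k e by (simp_all add: field_simps)
      qed
      have n: "norm (of_real x * bdry \<xi> t) = x * k" using x(1) by (simp add: norm_mult k_def)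
      have "norm (f x) \<le> C / (x * k)" using CM(3)[of "of_real x * bdry \<xi> t"] x n by (simp add: f_def)
      also have "\<dots> \<le> e" using x k e CM by (simp add: field_simps)
      finally show ?thesis using const[OF x(1)] by simp
    qed
    have "norm (f r) \<le> 0" by (rule field_le_epsilon) (use le in simp)
    then show ?thesis using False by (simp add: f_def)
  qed
qed


text \<open>The subtracted value \<nu>(t) is multiplied by the winding number. As \<open>reg\<close>
  is continuous across r = 1, this isolates the jump of the Cauchy integral: it equals
  \<nu>.\<close>

lemma cauchy_reg:
  assumes "continuous_on UNIV \<nu>" "r \<ge> 0" "r \<noteq> 1"
  shows "cauchy \<xi> \<nu> (of_real r * bdry \<xi> t) = reg \<xi> \<nu> (r, t) + (if r < 1 then \<nu> t else 0)"
proof -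
  let ?z = "of_real r * bdry \<xi> t"
  have ne: "bdry \<xi> s - ?z \<noteq> 0" for s
    using off_curve[OF assms(2,3), of t] by (metis rangeI right_minus_eq)
  have c: "continuous_on {0..2 * pi} (\<lambda>s. f s * bdry1 \<xi> s / (bdry \<xi> s - ?z))" if "continuous_on UNIV f" for f
    by (intro continuous_intros curve_facts continuous_on_subset[OF that] ballI ne) simp
  have "integral {0..2 * pi} (\<lambda>s. (\<nu> s - \<nu> t) * bdry1 \<xi> s / (bdry \<xi> s - ?z)) =
      integral {0..2 * pi} (\<lambda>s. \<nu> s * bdry1 \<xi> s / (bdry \<xi> s - ?z) - \<nu> t * (1 * bdry1 \<xi> s / (bdry \<xi> s - ?z)))"
    by (simp add: left_diff_distrib diff_divide_distrib)
  also have "\<dots> = integral {0..2 * pi} (\<lambda>s. \<nu> s * bdry1 \<xi> s / (bdry \<xi> s - ?z)) -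
      \<nu> t * integral {0..2 * pi} (\<lambda>s. 1 * bdry1 \<xi> s / (bdry \<xi> s - ?z))"
    unfolding integral_mult_right[symmetric]
    by (rule integral_diff[OF integrable_continuous_interval[OF c[OF assms(1)]]
          integrable_continuous_interval[OF continuous_on_mult[OF continuous_on_const c[OF continuous_on_const]]]])
  finally have "reg \<xi> \<nu> (r, t) = cauchy \<xi> \<nu> ?z - \<nu> t * cauchy \<xi> (\<lambda>s. 1) ?z"
    by (simp add: reg_def cauchy_def diff_divide_distrib)
  then show ?thesis using cauchy_one[OF assms(2,3), of t] by simp
qed

text \<open>Numerator and denominator are both compared with |sin ((s - t) / 2)|, which cancels. The
  lower bound for the denominator scales like the square root of r, hence \<open>r0 > 0\<close>; r =
  1 is included, so the bound is uniform up to the curve.\<close>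

lemma reg_integrand:
  assumes c: "continuous_on UNIV \<nu>" and C: "C > 0" "\<And>s t. norm (\<nu> s - \<nu> t) \<le> C * \<bar>sin ((s - t) / 2)\<bar>"
    and r0: "r0 > 0"
  obtains B where "\<And>r s t. r \<ge> r0 \<Longrightarrow> norm ((\<nu> s - \<nu> t) * bdry1 \<xi> s / (bdry \<xi> s - of_real r * bdry \<xi> t)) \<le> B"
    "\<And>r t. r \<ge> r0 \<Longrightarrow> (\<lambda>s. (\<nu> s - \<nu> t) * bdry1 \<xi> s / (bdry \<xi> s - of_real r * bdry \<xi> t)) integrable_on {0..2 * pi}"
proof -
  obtain M where M: "M > 0" "\<And>x. \<bar>\<xi> x\<bar> \<le> M" using periodic_bounded[OF curve_facts(4,3)] by blast
  have pn: "periodic (\<lambda>s. norm (bdry1 \<xi> s))" by (simp add: periodic_def periodic_bdry[OF \<xi>])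
  have "continuous_on UNIV (\<lambda>s. norm (bdry1 \<xi> s))" by (intro continuous_intros curve_facts)
  from periodic_bounded[OF pn this] obtain N where N: "N > 0" "\<And>s. norm (bdry1 \<xi> s) \<le> N" by auto
  define k where "k = 2 * sqrt (r0 * exp (- M) * exp (- M))"
  have k: "k > 0" using r0 by (simp add: k_def)
  define B where "B = C * N / k"
  have B0: "B \<ge> 0" using C N k by (simp add: B_def)
  have bd: "norm ((\<nu> s - \<nu> t) * bdry1 \<xi> s / (bdry \<xi> s - of_real r * bdry \<xi> t)) \<le> B" if r: "r \<ge> r0" for r s t
  proof (cases "sin ((s - t) / 2) = 0")
    case True
    then have "\<nu> s = \<nu> t" using C(2)[of s t] by simp
    then show ?thesis using B0 by simp
  next
    case False
    let ?S = "\<bar>sin ((s - t) / 2)\<bar>"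
    have S: "?S > 0" using False by simp
    have e: "exp (- M) \<le> exp (\<xi> x)" for x using M(2)[of x] by (simp add: abs_le_iff)
    have "r0 * exp (- M) * exp (- M) \<le> r * exp (\<xi> s) * exp (\<xi> t)"
      using r r0 e by (intro mult_mono) auto
    then have "k * ?S \<le> 2 * sqrt (r * exp (\<xi> s) * exp (\<xi> t)) * ?S"
      unfolding k_def by (intro mult_right_mono mult_left_mono real_sqrt_le_mono) auto
    also have "\<dots> \<le> norm (bdry \<xi> s - of_real r * bdry \<xi> t)" using r r0 by (intro bdry_distance) simp
    finally have den: "k * ?S \<le> norm (bdry \<xi> s - of_real r * bdry \<xi> t)" .
    have "norm ((\<nu> s - \<nu> t) * bdry1 \<xi> s) \<le> (C * ?S) * N"
      unfolding norm_mult using C N by (intro mult_mono) auto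
    then have "norm ((\<nu> s - \<nu> t) * bdry1 \<xi> s / (bdry \<xi> s - of_real r * bdry \<xi> t)) \<le> (C * ?S * N) / (k * ?S)"
      unfolding norm_divide using den k S C N by (intro frac_le) auto
    also have "\<dots> = B" using S by (simp add: B_def)
    finally show ?thesis .
  qed
  have int: "(\<lambda>s. (\<nu> s - \<nu> t) * bdry1 \<xi> s / (bdry \<xi> s - of_real r * bdry \<xi> t)) integrable_on {0..2 * pi}" if r: "r \<ge> r0" for r t
  proof (rule measurable_bounded_by_integrable_imp_integrable[of _ _ "\<lambda>s. B"])
    have "(\<lambda>s. (\<nu> s - \<nu> t) * bdry1 \<xi> s / (bdry \<xi> s - of_real r * bdry \<xi> t)) \<in> borel_measurable borel"
      by (intro borel_measurable_divide borel_measurable_times borel_measurable_diff borel_measurable_const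
          borel_measurable_continuous_onI c curve_facts)
    then have "(\<lambda>s. (\<nu> s - \<nu> t) * bdry1 \<xi> s / (bdry \<xi> s - of_real r * bdry \<xi> t)) \<in> borel_measurable lborel" by simp
    then show "(\<lambda>s. (\<nu> s - \<nu> t) * bdry1 \<xi> s / (bdry \<xi> s - of_real r * bdry \<xi> t)) \<in> borel_measurable (lebesgue_on {0..2 * pi})"
      by (intro measurable_restrict_space1 measurable_completion)
  qed (use bd[OF r] in auto)
  show thesis using that bd int by blast
qed

text \<open>Dominated convergence with the constant majorant of
  \<open>reg_integrand\<close>.\<close>

lemma reg_continuous:
  assumes c: "continuous_on UNIV \<nu>" and C: "C > 0" "\<And>s t. norm (\<nu> s - \<nu> t) \<le> C * \<bar>sin ((s - t) / 2)\<bar>"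
  shows "continuous_on ({0<..} \<times> UNIV) (reg \<xi> \<nu>)"
  unfolding continuous_on_sequentially
proof (intro allI ballI impI, elim conjE)
  fix x :: "nat \<Rightarrow> real \<times> real" and p
  assume p: "p \<in> {0<..} \<times> (UNIV :: real set)" and x: "\<forall>n. x n \<in> {0<..} \<times> UNIV" and lim: "x \<longlonglongrightarrow> p"
  obtain r t where rt: "p = (r, t)" "r > 0" using p by auto
  have fl: "(\<lambda>n. fst (x n)) \<longlonglongrightarrow> r" "(\<lambda>n. snd (x n)) \<longlonglongrightarrow> t"
    using tendsto_fst[OF lim] tendsto_snd[OF lim] by (simp_all add: rt)
  obtain B where B: "\<And>\<rho> s t. \<rho> \<ge> r / 2 \<Longrightarrow> norm ((\<nu> s - \<nu> t) * bdry1 \<xi> s / (bdry \<xi> s - of_real \<rho> * bdry \<xi> t)) \<le> B"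
    "\<And>\<rho> t. \<rho> \<ge> r / 2 \<Longrightarrow> (\<lambda>s. (\<nu> s - \<nu> t) * bdry1 \<xi> s / (bdry \<xi> s - of_real \<rho> * bdry \<xi> t)) integrable_on {0..2 * pi}"
    using reg_integrand[OF c C half_gt_zero[OF rt(2)]] by blast
  have "\<forall>\<^sub>F n in sequentially. fst (x n) > r / 2"
    using fl(1) by (rule order_tendstoD) (use rt in simp)
  then obtain n0 where n0: "\<And>n. n \<ge> n0 \<Longrightarrow> fst (x n) > r / 2" by (auto simp: eventually_sequentially)
  define f where "f p s = (\<nu> s - \<nu> (snd p)) * bdry1 \<xi> s / (bdry \<xi> s - of_real (fst p) * bdry \<xi> (snd p))" for p s
  \<comment> \<open>The parameters of the limiting curve point. There the denominator may vanish in
    the limit and pointwise convergence may fail, but the set is countable.\<close>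
  define N where "N = range (\<lambda>n::int. t + 2 * pi * of_int n)"
  have neg: "negligible N"
  proof -
    have "negligible (\<Union> (range (\<lambda>n::int. {t + 2 * pi * of_int n})))"
      by (rule negligible_countable_Union) auto
    then show ?thesis by (simp add: N_def UNION_singleton_eq_range)
  qed
  define F where "F n s = (if s \<in> N then 0 else f (x (n + n0)) s)" for n s
  have fint: "f (x (n + n0)) integrable_on {0..2 * pi}" for n
    unfolding f_def by (rule B(2)) (use n0[of "n + n0"] in simp)
  have Fint: "F n integrable_on {0..2 * pi}" for n
    by (rule integrable_spike[OF fint neg]) (simp add: F_def)
  have "(\<lambda>n. integral {0..2 * pi} (F n)) \<longlonglongrightarrow> integral {0..2 * pi} (\<lambda>s. if s \<in> N then 0 else f p s)"
  proof (rule dominated_convergence(2)[OF Fint, of "\<lambda>s. B"])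
    have "0 \<le> norm ((\<nu> 0 - \<nu> 0) * bdry1 \<xi> 0 / (bdry \<xi> 0 - of_real r * bdry \<xi> 0))" by (rule norm_ge_zero)
    also have "\<dots> \<le> B" by (rule B(1)) (use rt(2) in simp)
    finally have "B \<ge> 0" .
    then show "norm (F n s) \<le> B" for n s
      using B(1)[of "fst (x (n + n0))" s "snd (x (n + n0))"] n0[of "n + n0"] by (simp add: F_def f_def)
    fix s
    show "(\<lambda>n. F n s) \<longlonglongrightarrow> (if s \<in> N then 0 else f p s)"
    proof (cases "s \<in> N")
      case False
      have ne: "bdry \<xi> s - of_real r * bdry \<xi> t \<noteq> 0"
        using bdry_eq_scaled(2)[of \<xi> s r t] rt(2) curve_facts(4) False by (auto simp: N_def)
      have ic: "isCont \<nu> t" "isCont (bdry \<xi>) t"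
        using c curve_facts(1)[of UNIV] by (simp_all add: continuous_on_eq_continuous_at)
      have fl': "(\<lambda>n. fst (x (n + n0))) \<longlonglongrightarrow> r" "(\<lambda>n. snd (x (n + n0))) \<longlonglongrightarrow> t"
        using fl[THEN LIMSEQ_ignore_initial_segment] by simp_all
      have "(\<lambda>n. f (x (n + n0)) s) \<longlonglongrightarrow> (\<nu> s - \<nu> t) * bdry1 \<xi> s / (bdry \<xi> s - of_real r * bdry \<xi> t)"
        unfolding f_def
        by (intro tendsto_intros isCont_tendsto_compose[OF ic(1)] isCont_tendsto_compose[OF ic(2)] fl' ne)
      then show ?thesis using False by (simp add: F_def f_def rt)
    qed (simp add: F_def)
  qed (rule integrable_continuous_interval[OF continuous_on_const])
  moreover have "integral {0..2 * pi} (F n) = integral {0..2 * pi} (f (x (n + n0)))" for n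
    by (rule integral_spike[OF neg]) (simp add: F_def)
  moreover have "integral {0..2 * pi} (\<lambda>s. if s \<in> N then 0 else f p s) = integral {0..2 * pi} (f p)"
    by (rule integral_spike[OF neg]) simp
  ultimately have "(\<lambda>n. integral {0..2 * pi} (f (x (n + n0)))) \<longlonglongrightarrow> integral {0..2 * pi} (f p)" by simp
  then have "(\<lambda>n. integral {0..2 * pi} (f (x n))) \<longlonglongrightarrow> integral {0..2 * pi} (f p)"
    by (rule LIMSEQ_offset)
  then have "(\<lambda>n. integral {0..2 * pi} (f (x n)) / (2 * pi * \<i>)) \<longlonglongrightarrow> integral {0..2 * pi} (f p) / (2 * pi * \<i>)"
    by (intro tendsto_intros) auto
  then show "(reg \<xi> \<nu> \<circ> x) \<longlonglongrightarrow> reg \<xi> \<nu> p"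
    by (simp add: reg_def f_def[abs_def] o_def)
qed

lemma reg_periodic:
  assumes "\<And>s. \<nu> (s + 2 * pi) = \<nu> s"
  shows "reg \<xi> \<nu> (r, t + 2 * pi) = reg \<xi> \<nu> (r, t)"
  by (simp add: reg_def assms periodic_bdry[OF \<xi>])

text \<open>For a real density the real part of the Cauchy integral is the double-layer potential,
  and the total mass 1 of the kernel evaluates the subtracted term. Adding the inner jump
  \<open>\<mu> t\<close> gives the boundary value (\<mu> + T \<mu>) / 2 with T the kernel operator;
  this is why the integral equation has right-hand side 2 \<psi>.\<close>

lemma Re_reg:
  fixes \<mu> :: "real \<Rightarrow> real"
  assumes c: "continuous_on UNIV \<mu>" and per: "periodic \<mu>"
    and C: "C > 0" "\<And>s t. norm (complex_of_real (\<mu> s) - of_real (\<mu> t)) \<le> C * \<bar>sin ((s - t) / 2)\<bar>"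
  shows "Re (reg \<xi> (\<lambda>s. of_real (\<mu> s)) (1, t)) = (integral {0..2 * pi} (\<lambda>s. dkernel \<xi> t s * \<mu> s) - \<mu> t) / 2"
proof -
  let ?f = "\<lambda>s. (complex_of_real (\<mu> s) - of_real (\<mu> t)) * bdry1 \<xi> s / (bdry \<xi> s - of_real 1 * bdry \<xi> t)"
  have cc: "continuous_on UNIV (\<lambda>s. complex_of_real (\<mu> s))" by (intro continuous_intros c)
  have "?f integrable_on {0..2 * pi}"
    by (rule reg_integrand[OF cc C zero_less_one]) blast
  then have int: "Im (integral {0..2 * pi} ?f) = integral {0..2 * pi} (\<lambda>s. Im (?f s))"
    using integral_linear[OF _ bounded_linear_Im, of ?f "{0..2 * pi}"] by (simp only: o_def)
  have ck: "continuous_on S (\<lambda>s. dkernel \<xi> t s)" for S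
    using continuous_on_compose2[OF continuous_dkernel[OF \<xi>], of S "\<lambda>s. (t, s)"] by (simp add: continuous_intros)
  have "Im (?f s) = pi * (dkernel \<xi> t s * \<mu> s - \<mu> t * dkernel \<xi> t s)" for s
  proof (cases "bdry \<xi> s = bdry \<xi> t")
    case True
    then obtain n :: int where "s = t + 2 * pi * of_int n"
      using bdry_eq_scaled(2)[of \<xi> s 1 t] curve_facts(4) by auto
    then have "\<mu> s = \<mu> t" using periodic_int[OF per] by simp
    then show ?thesis by simp
  next
    case False
    have "?f s = of_real (\<mu> s - \<mu> t) * (bdry1 \<xi> s / (bdry \<xi> s - bdry \<xi> t))" by simp
    also have "Im \<dots> = (\<mu> s - \<mu> t) * Im (bdry1 \<xi> s / (bdry \<xi> s - bdry \<xi> t))"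
      by (simp only: times_complex.sel Re_complex_of_real Im_complex_of_real)
    finally show ?thesis using False by (simp add: dkernel_def algebra_simps)
  qed
  then have "Im (integral {0..2 * pi} ?f) = integral {0..2 * pi} (\<lambda>s. pi * (dkernel \<xi> t s * \<mu> s - \<mu> t * dkernel \<xi> t s))"
    unfolding int by (intro integral_cong)
  also have "\<dots> = pi * integral {0..2 * pi} (\<lambda>s. dkernel \<xi> t s * \<mu> s - \<mu> t * dkernel \<xi> t s)"
    by (rule integral_mult_right)
  also have "integral {0..2 * pi} (\<lambda>s. dkernel \<xi> t s * \<mu> s - \<mu> t * dkernel \<xi> t s) =
      integral {0..2 * pi} (\<lambda>s. dkernel \<xi> t s * \<mu> s) - \<mu> t * integral {0..2 * pi} (\<lambda>s. dkernel \<xi> t s)"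
  proof -
    have "(\<lambda>s. dkernel \<xi> t s * \<mu> s) integrable_on {0..2 * pi}" "(\<lambda>s. \<mu> t * dkernel \<xi> t s) integrable_on {0..2 * pi}"
      by (intro integrable_continuous_interval continuous_intros ck continuous_on_subset[OF c] subset_UNIV)+
    from integral_diff[OF this] show ?thesis by simp
  qed
  finally have "Im (integral {0..2 * pi} ?f) = pi * (integral {0..2 * pi} (\<lambda>s. dkernel \<xi> t s * \<mu> s) - \<mu> t)"
    by (simp add: dkernel_integral[OF \<xi>])
  moreover have "Re (reg \<xi> (\<lambda>s. of_real (\<mu> s)) (1, t)) = Im (integral {0..2 * pi} ?f) / (2 * pi)"
  proof -
    have "Re (X / (2 * pi * \<i>)) = Im X / (2 * pi)" for X
      by (simp add: Re_divide power2_eq_square field_simps)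
    then show ?thesis by (simp add: reg_def)
  qed
  ultimately show ?thesis by simp
qed

end


section \<open>Existence of the potential\<close>

text \<open>Boundedness far down satisfies the growth condition, so the maximum principle applies to
  both \<open>u\<close> and \<open>- u\<close> and gives Re f = 0. The Cauchy-Riemann equations then
  make f' vanish on a connected domain. \<open>u\<close> is kept apart from \<open>f\<close> because
  it also has boundary values.\<close>

lemma holomorphic_zero_boundary:
  assumes \<zeta>: "periodic \<zeta>" "continuous_on UNIV \<zeta>" and f: "f holomorphic_on cfluid \<zeta>"
    and u: "continuous_on (fluid_closed \<zeta>) u" "\<forall>p\<in>fluid \<zeta>. u p = Re (f (Complex (fst p) (snd p)))"
    and per: "\<And>\<rho> \<theta>. u (\<rho>, \<theta> + 2 * pi) = u (\<rho>, \<theta>)" and bdry: "\<And>\<theta>. u (\<zeta> \<theta>, \<theta>) = 0"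
    and bounded: "\<forall>\<rho>\<le>R. \<forall>\<theta>. \<bar>u (\<rho>, \<theta>)\<bar> \<le> B"
  shows "w \<in> cfluid \<zeta> \<Longrightarrow> Re (f w) = 0"
    and "w \<in> cfluid \<zeta> \<Longrightarrow> v \<in> cfluid \<zeta> \<Longrightarrow> f w = f v"
proof -
  have growth: "\<exists>R. \<forall>\<rho>\<le>R. \<forall>\<theta>. \<bar>u (\<rho>, \<theta>)\<bar> \<le> \<delta> * (- \<rho>)" if "\<delta> > 0" for \<delta>
  proof (intro exI allI impI)
    fix \<rho> \<theta> assume \<rho>: "\<rho> \<le> min R (- (B / \<delta>))"
    have "B = \<delta> * (B / \<delta>)" using that by simp
    also have "\<dots> \<le> \<delta> * (- \<rho>)" using \<rho> that by (intro mult_left_mono) auto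
    finally have "B \<le> \<delta> * (- \<rho>)" .
    moreover have "\<rho> \<le> R" using \<rho> by simp
    then have "\<bar>u (\<rho>, \<theta>)\<bar> \<le> B" using bounded by blast
    ultimately show "\<bar>u (\<rho>, \<theta>)\<bar> \<le> \<delta> * (- \<rho>)" by linarith
  qed
  have le: "s * u (\<rho>, \<theta>) \<le> 0" if s: "s = 1 \<or> s = - 1" and p: "\<rho> \<le> \<zeta> \<theta>" for s \<rho> \<theta>
  proof (rule maximum_principle[OF \<zeta> _ _ _ _ _ p, where u = "\<lambda>p. s * u p"])
    have "(\<lambda>w. of_real s * f w) holomorphic_on cfluid \<zeta>" by (intro holomorphic_intros f)
    from harmonic_Re[OF \<zeta>(2) this]
    show "harmonic_on (\<lambda>p. s * u p) (fluid \<zeta>)" by (rule harmonic_cong) (simp add: u(2))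
    show "continuous_on (fluid_closed \<zeta>) (\<lambda>p. s * u p)" by (intro continuous_intros u)
    show "\<exists>R. \<forall>\<rho>\<le>R. \<forall>\<theta>. s * u (\<rho>, \<theta>) \<le> \<delta> * (- \<rho>)" if \<delta>: "\<delta> > 0" for \<delta>
    proof -
      obtain R where "\<And>\<rho> \<theta>. \<rho> \<le> R \<Longrightarrow> \<bar>u (\<rho>, \<theta>)\<bar> \<le> \<delta> * (- \<rho>)" using growth[OF \<delta>] by blast
      then have "s * u (\<rho>, \<theta>) \<le> \<delta> * (- \<rho>)" if "\<rho> \<le> R" for \<rho> \<theta> using that s by (fastforce simp: abs_le_iff)
      then show ?thesis by blast
    qed
  qed (simp_all add: per bdry)
  have zero: "Re (f w) = 0" if "w \<in> cfluid \<zeta>" for w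
  proof -
    have p: "(Re w, Im w) \<in> fluid \<zeta>" using that by (simp add: cfluid_def fluid_def)
    then have "u (Re w, Im w) = 0" using le[of 1 "Re w" "Im w"] le[of "- 1" "Re w" "Im w"] by (simp add: fluid_def)
    then show ?thesis using bspec[OF u(2) p] by simp
  qed
  then show "w \<in> cfluid \<zeta> \<Longrightarrow> Re (f w) = 0" .
  have op: "open (cfluid \<zeta>)" by (rule open_cfluid[OF \<zeta>(2)])
  have D: "(f has_derivative (\<lambda>h. 0)) (at w)" if w: "w \<in> cfluid \<zeta>" for w
  proof -
    have d: "(f has_field_derivative deriv f w) (at (Complex (Re w) (Im w)))"
      using holomorphic_derivI[OF f op w] by simp
    have p: "(Re w, Im w) \<in> fluid \<zeta>" using w by (simp add: cfluid_def fluid_def)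
    have "GDERIV (\<lambda>p. 0) (Re w, Im w) :> (Re (deriv f w), - Im (deriv f w))"
      by (rule GDERIV_transform[OF GDERIV_Re_Im(1)[OF d] open_fluid[OF \<zeta>(2)] p]) (simp add: zero)
    from GDERIV_unique_gradient[OF this GDERIV_const] have "deriv f w = 0" by (simp add: complex_eq_iff zero_prod_def)
    then show ?thesis using d by (simp add: has_field_derivative_def lambda_zero)
  qed
  show "w \<in> cfluid \<zeta> \<Longrightarrow> v \<in> cfluid \<zeta> \<Longrightarrow> f w = f v"
    by (rule has_derivative_zero_unique_connected[OF op connected_cfluid[OF \<zeta>(2)] D])
qed

section \<open>Solving the integral equation\<close>

context
  fixes \<xi> assumes \<xi>: "\<xi> \<in> smooth_circle"
begin

lemma holomorphic_cauchy:
  assumes d: "\<And>s. (\<nu> has_vector_derivative \<nu>' s) (at s)" and c: "continuous_on UNIV \<nu>'"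
    and per: "\<And>s. \<nu> (s + 2 * pi) = \<nu> s"
  shows "cauchy \<xi> \<nu> holomorphic_on - range (bdry \<xi>)"
  using cauchy_deriv[OF \<xi> d c per] closed_curve[OF \<xi>]
  by (subst holomorphic_on_open) (auto simp: open_Compl)

lemma exp_off_curve: "Re w \<noteq> \<xi> (Im w) \<Longrightarrow> exp w \<notin> range (bdry \<xi>)"
  using off_curve[OF \<xi>, of "exp (Re w - \<xi> (Im w))" "Im w"] bdry_scaled[of "Re w" \<xi> "Im w"] by simp

text \<open>
  The Cauchy integral of \<open>m\<close> has vanishing real part on the inner side of the curve, so it is an
  imaginary constant inside. The jump \<open>m\<close> is real, so its imaginary part is constant on the outer side
  as well, and the decay at infinity makes it vanish outside. The map \<open>w \<mapsto> - w\<close> turns the exterior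
  into a domain of the same form.
\<close>

lemma dkernel_injective:
  fixes m :: "real \<Rightarrow> real"
  assumes m: "continuous_on UNIV m" "periodic m"
    and eq: "\<And>t. m t + integral {0..2 * pi} (\<lambda>s. dkernel \<xi> t s * m s) = 0"
  shows "m t = 0"
proof -
  note \<xi>f = curve_facts[OF \<xi>]
  obtain M1 M2 where M: "\<And>t. ((\<lambda>t. integral {0..2 * pi} (\<lambda>s. dkernel \<xi> t s * m s)) has_real_derivative M1 t) (at t)"
     "\<And>t. (M1 has_real_derivative M2 t) (at t)"
    using dkernel_operator_C2[OF \<xi> m] by blast
  \<comment> \<open>The homogeneous equation makes \<open>m\<close> differentiable, as minus its own
    image under a smoothing operator; this supplies the C1 density that the lemmas on Cauchy
    integrals assume.\<close>
  have m_eq: "m = (\<lambda>t. - integral {0..2 * pi} (\<lambda>s. dkernel \<xi> t s * m s))" using eq by (simp add: fun_eq_iff eq_neg_iff_add_eq_0)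
  have dm: "(m has_real_derivative - M1 t) (at t)" for t
    by (subst m_eq) (rule DERIV_minus[OF M(1)])
  have cM1: "continuous_on UNIV M1"
    by (rule DERIV_continuous_on) (rule has_field_derivative_at_within[OF M(2)])
  define \<nu> where "\<nu> s = complex_of_real (m s)" for s
  have d\<nu>: "(\<nu> has_vector_derivative of_real (- M1 s)) (at s)" for s
    unfolding \<nu>_def by (rule has_vector_derivative_of_real[OF dm])
  have c\<nu>': "continuous_on UNIV (\<lambda>s. complex_of_real (- M1 s))" by (intro continuous_intros cM1)
  have c\<nu>: "continuous_on UNIV \<nu>" unfolding \<nu>_def by (intro continuous_intros m)
  have p\<nu>: "\<nu> (s + 2 * pi) = \<nu> s" for s using m(2) by (simp add: \<nu>_def periodic_def)
  obtain C where C: "C > 0" "\<And>s t. norm (\<nu> s - \<nu> t) \<le> C * \<bar>sin ((s - t) / 2)\<bar>"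
    using periodic_lipschitz_sin[OF d\<nu> c\<nu>' p\<nu>] by blast
  note creg = reg_continuous[OF \<xi> c\<nu> C]
  define A where "A = cauchy \<xi> \<nu>"
  have holA: "A holomorphic_on - range (bdry \<xi>)"
    unfolding A_def by (rule holomorphic_cauchy[OF d\<nu> c\<nu>' p\<nu>])
  have Aexp: "A (exp (Complex \<rho> \<theta>)) = reg \<xi> \<nu> (exp (\<rho> - \<xi> \<theta>), \<theta>) + (if \<rho> < \<xi> \<theta> then \<nu> \<theta> else 0)"
    if "\<rho> \<noteq> \<xi> \<theta>" for \<rho> \<theta>
    using cauchy_reg[OF \<xi> c\<nu>, of "exp (\<rho> - \<xi> \<theta>)" \<theta>] that by (simp add: A_def bdry_scaled)
  have reg1: "Re (reg \<xi> \<nu> (1, \<theta>)) + m \<theta> = 0" for \<theta>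
    using Re_reg[OF \<xi> m C(1) C(2)[unfolded \<nu>_def], of \<theta>] eq[of \<theta>] by (simp add: \<nu>_def[abs_def])
  \<comment> \<open>Inside, this is A(exp w); written by means of \<open>reg\<close> it is also
    continuous up to the surface.\<close>
  define U where "U p = reg \<xi> \<nu> (exp (fst p - \<xi> (snd p)), snd p) + \<nu> (snd p)" for p
  have cU: "continuous_on S U" for S
    unfolding U_def
    by (intro continuous_intros continuous_on_compose2[OF creg] continuous_on_compose2[OF c\<nu>] continuous_on_compose2[OF \<xi>f(3)[of UNIV]]) auto
  have UA: "U p = A (exp (Complex (fst p) (snd p)))" if "p \<in> fluid \<xi>" for p
    using Aexp[of "fst p" "snd p"] that by (auto simp: U_def fluid_def)
  have hol1: "(\<lambda>w. A (exp w)) holomorphic_on cfluid \<xi>"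
  proof (rule holomorphic_on_compose_gen[OF _ holA, unfolded o_def])
    show "exp ` cfluid \<xi> \<subseteq> - range (bdry \<xi>)"
    proof
      fix z assume "z \<in> exp ` cfluid \<xi>"
      then obtain w where w: "w \<in> cfluid \<xi>" "z = exp w" by auto
      have "exp w \<notin> range (bdry \<xi>)" by (rule exp_off_curve) (use w(1) in \<open>simp add: cfluid_def\<close>)
      then show "z \<in> - range (bdry \<xi>)" using w(2) by simp
    qed
  qed (intro holomorphic_intros)
  \<comment> \<open>Since \<open>exp\<close> sends \<rho> \<rightarrow> -\<infinity> to the origin,
    continuity of \<open>A\<close> there bounds the function far down.\<close>
  have "isCont A 0"
  proof -
    have "0 \<in> - range (bdry \<xi>)" by auto
    then show ?thesis
      using holomorphic_on_imp_continuous_on[OF holA] closed_curve[OF \<xi>]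
      by (simp add: continuous_on_eq_continuous_at open_Compl)
  qed
  then obtain d where d: "d > 0" "\<And>z. dist z 0 < d \<Longrightarrow> dist (A z) (A 0) < 1"
    unfolding continuous_at_eps_delta using zero_less_one by blast
  obtain K where K: "K > 0" "\<And>x. \<bar>\<xi> x\<bar> \<le> K" using periodic_bounded[OF \<xi>f(4,3)] by blast
  have bd1: "\<forall>\<rho>\<le>min (ln d - 1) (- K - 1). \<forall>\<theta>. \<bar>Re (U (\<rho>, \<theta>))\<bar> \<le> norm (A 0) + 1"
  proof (intro allI impI)
    fix \<rho> \<theta> assume that: "\<rho> \<le> min (ln d - 1) (- K - 1)"
    have "\<rho> < \<xi> \<theta>" using that K(2)[of \<theta>] by (auto simp: abs_le_iff)
    then have "U (\<rho>, \<theta>) = A (exp (Complex \<rho> \<theta>))" using UA[of "(\<rho>, \<theta>)"] by (simp add: fluid_def)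
    moreover have "exp \<rho> < d"
    proof -
      have "exp \<rho> < exp (ln d)" using that by simp
      then show ?thesis using d(1) by simp
    qed
    ultimately have "dist (U (\<rho>, \<theta>)) (A 0) < 1" using d(2)[of "exp (Complex \<rho> \<theta>)"] by simp
    then have "norm (U (\<rho>, \<theta>)) \<le> norm (A 0) + 1"
      using norm_triangle_ineq2[of "U (\<rho>, \<theta>)" "A 0"] by (simp add: dist_norm)
    then show "\<bar>Re (U (\<rho>, \<theta>))\<bar> \<le> norm (A 0) + 1" using abs_Re_le_cmod[of "U (\<rho>, \<theta>)"] by linarith
  qed
  have perU: "U (\<rho>, \<theta> + 2 * pi) = U (\<rho>, \<theta>)" for \<rho> \<theta>
    using \<xi>f(4) by (simp add: U_def reg_periodic[of \<xi> \<nu>, OF \<xi> p\<nu>] p\<nu> periodic_def)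
  note inside = holomorphic_zero_boundary[where u = "\<lambda>p. Re (U p)", OF \<xi>f(4) \<xi>f(3) hol1 _ _ _ _ bd1]
  have prems: "continuous_on (fluid_closed \<xi>) (\<lambda>p. Re (U p))"
    "\<forall>p\<in>fluid \<xi>. Re (U p) = Re (A (exp (Complex (fst p) (snd p))))"
    "\<And>\<rho> \<theta>. Re (U (\<rho>, \<theta> + 2 * pi)) = Re (U (\<rho>, \<theta>))" "\<And>\<theta>. Re (U (\<xi> \<theta>, \<theta>)) = 0"
    using reg1 by (auto intro!: continuous_intros cU simp: UA perU) (simp add: U_def \<nu>_def)
  define w0 where "w0 = Complex (\<xi> 0 - 1) 0"
  have w0: "w0 \<in> cfluid \<xi>" by (simp add: w0_def cfluid_def)
  define c0 where "c0 = A (exp w0)"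
  have Re0: "Re c0 = 0" unfolding c0_def by (rule inside(1)[OF prems w0])
  have const1: "A (exp w) = c0" if "w \<in> cfluid \<xi>" for w
    unfolding c0_def by (rule inside(2)[OF prems that w0])
  have U1: "U (\<xi> \<theta>, \<theta>) = c0" for \<theta>
    by (rule boundary_limit[of \<xi> U "\<lambda>p. c0"]) (auto intro: cU continuous_on_const simp: UA const1)
  have regc0: "reg \<xi> \<nu> (1, \<theta>) + \<nu> \<theta> = c0" for \<theta> using U1[of \<theta>] by (simp add: U_def)
  define \<zeta> where "\<zeta> \<theta> = - \<xi> (- \<theta>)" for \<theta>
  have \<zeta>c: "continuous_on UNIV \<zeta>" unfolding \<zeta>_def
    by (intro continuous_intros continuous_on_compose2[OF \<xi>f(3)[of UNIV]]) auto
  have \<xi>m: "\<xi> (- \<theta> - 2 * pi) = \<xi> (- \<theta>)" for \<theta>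
    using periodic_int[OF \<xi>f(4), of "- \<theta>" "- 1"] by simp
  have \<zeta>p: "periodic \<zeta>" by (simp add: periodic_def \<zeta>_def \<xi>m)
  define V where "V p = reg \<xi> \<nu> (exp (- fst p - \<xi> (- snd p)), - snd p)" for p
  have cV: "continuous_on S V" for S
    unfolding V_def
    by (intro continuous_intros continuous_on_compose2[OF creg] continuous_on_compose2[OF \<xi>f(3)[of UNIV]]) auto
  have VA: "V p = A (exp (- Complex (fst p) (snd p)))" if "p \<in> fluid \<zeta>" for p
  proof -
    have "- Complex (fst p) (snd p) = Complex (- fst p) (- snd p)" by (simp add: complex_eq_iff)
    then show ?thesis using Aexp[of "- fst p" "- snd p"] that by (auto simp: V_def fluid_def \<zeta>_def)
  qed
  obtain C' M' where CM: "C' > 0" "M' > 0" "\<And>z. norm z \<ge> M' \<Longrightarrow> norm (A z) \<le> C' / norm z"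
    using cauchy_bound[OF \<xi> c\<nu>] unfolding A_def by blast
  have smallA: "norm (A (exp (- w))) \<le> C' * exp (Re w)" if "Re w \<le> - ln M'" for w
  proof -
    have "exp (ln M') \<le> exp (- Re w)" using that by simp
    then have "norm (exp (- w)) \<ge> M'" using CM(2) by simp
    from CM(3)[OF this] have "norm (A (exp (- w))) \<le> C' / exp (- Re w)"
      by (simp only: norm_exp_eq_Re uminus_complex.sel)
    also have "\<dots> = C' * exp (Re w)" by (simp add: exp_minus divide_inverse)
    finally show ?thesis .
  qed
  \<comment> \<open>The factor \<open>- \<i>\<close> makes Im A a real part, as
    \<open>holomorphic_zero_boundary\<close> requires, and subtracting \<open>Im c0\<close> makes
    its boundary values zero.\<close>
  have hol2: "(\<lambda>w. - \<i> * A (exp (- w)) - of_real (Im c0)) holomorphic_on cfluid \<zeta>"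
  proof (intro holomorphic_intros holomorphic_on_compose_gen[OF _ holA, unfolded o_def])
    show "(\<lambda>w. exp (- w)) ` cfluid \<zeta> \<subseteq> - range (bdry \<xi>)"
    proof
      fix z assume "z \<in> (\<lambda>w. exp (- w)) ` cfluid \<zeta>"
      then obtain w where w: "w \<in> cfluid \<zeta>" "z = exp (- w)" by auto
      have "exp (- w) \<notin> range (bdry \<xi>)" by (rule exp_off_curve) (use w(1) in \<open>simp add: cfluid_def \<zeta>_def\<close>)
      then show "z \<in> - range (bdry \<xi>)" using w(2) by simp
    qed
  qed
  have bd2: "\<forall>\<rho>\<le>min (- ln M') (min 0 (- K - 1)). \<forall>\<theta>. \<bar>Im (V (\<rho>, \<theta>)) - Im c0\<bar> \<le> C' + \<bar>Im c0\<bar>"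
  proof (intro allI impI)
    fix \<rho> \<theta> assume that: "\<rho> \<le> min (- ln M') (min 0 (- K - 1))"
    have "\<rho> < \<zeta> \<theta>" using that K(2)[of "- \<theta>"] by (auto simp: abs_le_iff \<zeta>_def)
    then have "V (\<rho>, \<theta>) = A (exp (- Complex \<rho> \<theta>))" using VA[of "(\<rho>, \<theta>)"] by (simp add: fluid_def)
    then have "norm (V (\<rho>, \<theta>)) \<le> C' * exp \<rho>" using smallA[of "Complex \<rho> \<theta>"] that by simp
    also have "\<dots> \<le> C' * 1" using CM(1) that by (intro mult_left_mono) auto
    finally have "\<bar>Im (V (\<rho>, \<theta>))\<bar> \<le> C'" using abs_Im_le_cmod[of "V (\<rho>, \<theta>)"] by linarith
    then show "\<bar>Im (V (\<rho>, \<theta>)) - Im c0\<bar> \<le> C' + \<bar>Im c0\<bar>" by linarith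
  qed
  note outside = holomorphic_zero_boundary[where u = "\<lambda>p. Im (V p) - Im c0", OF \<zeta>p \<zeta>c hol2 _ _ _ _ bd2]
  \<comment> \<open>The outer boundary value is the inner one minus the jump. As \<nu> is real, the
    imaginary parts agree.\<close>
  have V1: "V (\<zeta> \<theta>, \<theta>) = c0 - \<nu> (- \<theta>)" for \<theta>
    using regc0[of "- \<theta>"] by (simp add: V_def \<zeta>_def eq_diff_eq)
  have p2: "reg \<xi> \<nu> (r, - \<theta> - 2 * pi) = reg \<xi> \<nu> (r, - \<theta>)" for r \<theta>
    using reg_periodic[of \<xi> \<nu> r "- \<theta> - 2 * pi", OF \<xi> p\<nu>] by simp
  have prems2: "continuous_on (fluid_closed \<zeta>) (\<lambda>p. Im (V p) - Im c0)"
    "\<forall>p\<in>fluid \<zeta>. Im (V p) - Im c0 = Re (- \<i> * A (exp (- Complex (fst p) (snd p))) - of_real (Im c0))"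
    "\<And>\<rho> \<theta>. Im (V (\<rho>, \<theta> + 2 * pi)) - Im c0 = Im (V (\<rho>, \<theta>)) - Im c0" "\<And>\<theta>. Im (V (\<zeta> \<theta>, \<theta>)) - Im c0 = 0"
    by (auto intro!: continuous_intros cV simp: VA V1) (simp_all add: V_def \<xi>m p2 \<nu>_def)
  \<comment> \<open>The exterior function along the real axis. It is constant, while A(exp (-
    \<rho>)) tends to 0 as \<rho> \<rightarrow> -\<infinity>; so the constant is
    \<open>- Im c0\<close>. Its real part vanishes as well, which leaves
    \<open>Im c0 = 0\<close>.\<close>
  define k where "k \<rho> = - \<i> * A (exp (- of_real \<rho>)) - of_real (Im c0)" for \<rho>
  define \<rho>0 where "\<rho>0 = \<zeta> 0 - 1"
  have mem: "complex_of_real \<rho> \<in> cfluid \<zeta>" if "\<rho> \<le> \<rho>0" for \<rho> using that by (simp add: cfluid_def \<rho>0_def)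
  have kconst: "k \<rho> = k \<rho>0" if "\<rho> \<le> \<rho>0" for \<rho>
    unfolding k_def by (rule outside(2)[OF prems2 mem[OF that] mem]) simp
  have "(k \<longlongrightarrow> - \<i> * 0 - of_real (Im c0)) at_bot"
    unfolding k_def
  proof (intro tendsto_intros)
    show "((\<lambda>\<rho>. A (exp (- of_real \<rho>))) \<longlongrightarrow> 0) at_bot"
    proof (rule Lim_null_comparison)
      have "\<forall>\<^sub>F \<rho> in at_bot. \<rho> \<le> - ln M'" by (rule eventually_le_at_bot)
      then show "\<forall>\<^sub>F \<rho> in at_bot. norm (A (exp (- complex_of_real \<rho>))) \<le> C' * exp \<rho>"
        by (rule eventually_mono) (use smallA[of "of_real _"] in simp)
      have "((\<lambda>\<rho>. C' * exp \<rho>) \<longlongrightarrow> C' * 0) at_bot" by (intro tendsto_intros exp_at_bot)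
      then show "((\<lambda>\<rho>. C' * exp \<rho>) \<longlongrightarrow> 0) at_bot" by simp
    qed
  qed
  moreover have "(k \<longlongrightarrow> k \<rho>0) at_bot"
    by (rule tendsto_eventually[OF eventually_mono[OF eventually_le_at_bot kconst]])
  ultimately have "- \<i> * 0 - of_real (Im c0) = k \<rho>0"
    by (rule tendsto_unique[OF trivial_limit_at_bot_linorder])
  then have k0: "k \<rho>0 = - of_real (Im c0)" by simp
  have "Re (k \<rho>0) = 0" unfolding k_def by (rule outside(1)[OF prems2 mem]) simp
  then have Im0: "Im c0 = 0" using k0 by simp
  then have c0: "c0 = 0" using Re0 by (simp add: complex_eq_iff)
  have A0: "A (exp (- w)) = 0" if "w \<in> cfluid \<zeta>" for w
  proof -
    have "- \<i> * A (exp (- w)) - of_real (Im c0) = k \<rho>0"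
      unfolding k_def by (rule outside(2)[OF prems2 that mem]) simp
    then show ?thesis using k0 Im0 by simp
  qed
  have "V (\<zeta> (- t), - t) = 0"
    by (rule boundary_limit[of \<zeta> V "\<lambda>p. 0"]) (auto intro: cV continuous_on_const simp: VA A0)
  then show "m t = 0" using V1[of "- t"] c0 by (simp add: \<nu>_def)
qed


text \<open>The Fredholm alternative works on one period. The solution is extended to the line by
  the right side of m = f - T m, with T the kernel operator: this depends only on values over one
  period and is automatically continuous and periodic.\<close>

lemma dkernel_solve:
  fixes f :: "real \<Rightarrow> real"
  assumes f: "continuous_on UNIV f" "periodic f"
  shows "\<exists>m. continuous_on UNIV m \<and> periodic m \<and> (\<forall>t. m t + integral {0..2 * pi} (\<lambda>s. dkernel \<xi> t s * m s) = f t)"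
proof -
  let ?T = "\<lambda>m t. integral {0..2 * pi} (\<lambda>s. dkernel \<xi> t s * m s)"
  have cT: "continuous_on UNIV (?T m)" if m: "continuous_on {0..2 * pi} m" for m :: "real \<Rightarrow> real"
    unfolding cbox_interval[symmetric]
  proof (rule integral_continuous_on_param)
    show "continuous_on (UNIV \<times> cbox 0 (2 * pi)) (\<lambda>(t, s). dkernel \<xi> t s * m s)"
      unfolding case_prod_unfold cbox_interval
      by (intro continuous_on_mult continuous_on_subset[OF continuous_dkernel[OF \<xi>]]
          continuous_on_compose2[OF m] continuous_on_snd continuous_on_id) auto
  qed
  have pT: "periodic (?T m)" for m by (simp add: periodic_def dkernel_periodic[OF \<xi>])
  have extend: "continuous_on UNIV (\<lambda>t. g t - ?T m t) \<and> periodic (\<lambda>t. g t - ?T m t) \<and>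
      (\<forall>t. (g t - ?T m t) + ?T (\<lambda>t. g t - ?T m t) t = g t)"
    if g: "continuous_on UNIV g" "periodic g" and m: "continuous_on {0..2 * pi} m"
      and eq: "\<forall>t\<in>{0..2 * pi}. m t + ?T m t = g t" for g m :: "real \<Rightarrow> real"
  proof (intro conjI allI)
    show "continuous_on UNIV (\<lambda>t. g t - ?T m t)" by (intro continuous_on_diff g cT m)
    show "periodic (\<lambda>t. g t - ?T m t)" using g(2) pT[of m] by (simp add: periodic_def)
    fix t
    have "?T (\<lambda>t. g t - ?T m t) t = ?T m t"
    proof (rule integral_cong)
      fix s assume "s \<in> {0..2 * pi}"
      then have "g s - ?T m s = m s" using eq by (simp add: eq_diff_eq diff_eq_eq)
      then show "dkernel \<xi> t s * (g s - ?T m s) = dkernel \<xi> t s * m s" by simp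
    qed
    then show "(g t - ?T m t) + ?T (\<lambda>t. g t - ?T m t) t = g t" by simp
  qed
  have "\<exists>m. continuous_on {0..2 * pi} m \<and> (\<forall>t\<in>{0..2 * pi}. m t + ?T m t = f t)"
  proof (rule fredholm_kernel)
    show "continuous_on ({0..2 * pi} \<times> {0..2 * pi}) (\<lambda>p. dkernel \<xi> (fst p) (snd p))"
      by (rule continuous_on_subset[OF continuous_dkernel[OF \<xi>]]) simp
    show "continuous_on {0..2 * pi} f" by (rule continuous_on_subset[OF f(1)]) simp
    fix m :: "real \<Rightarrow> real" and t
    assume m: "continuous_on {0..2 * pi} m" and eq: "\<And>t. t \<in> {0..2 * pi} \<Longrightarrow> m t + ?T m t = 0" and t: "t \<in> {0..2 * pi}"
    have 0: "continuous_on UNIV (\<lambda>t. 0 - ?T m t) \<and> periodic (\<lambda>t. 0 - ?T m t) \<and>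
      (\<forall>t. (0 - ?T m t) + ?T (\<lambda>t. 0 - ?T m t) t = 0)"
      by (rule extend[of "\<lambda>t. 0"]) (use m eq in \<open>auto simp: periodic_def intro: continuous_on_const\<close>)
    have "0 - ?T m t = 0"
      by (rule dkernel_injective[of "\<lambda>t. 0 - ?T m t"]) (use 0 in blast)+
    then show "m t = 0" using eq[OF t] by simp
  qed simp
  then obtain m where m: "continuous_on {0..2 * pi} m" "\<forall>t\<in>{0..2 * pi}. m t + ?T m t = f t" by blast
  from extend[OF f m] show ?thesis by (intro exI[of _ "\<lambda>t. f t - ?T m t"])
qed

text \<open>The bound behind \<open>reg_continuous\<close> degenerates at \<open>r = 0\<close>, hence the case distinction.\<close>

definition cauchy_ext :: "(real \<Rightarrow> complex) \<Rightarrow> real \<times> real \<Rightarrow> complex" where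
  "cauchy_ext \<nu> p = (if fst p \<le> 1 / 2 then cauchy \<xi> \<nu> (of_real (fst p) * bdry \<xi> (snd p)) else reg \<xi> \<nu> p + \<nu> (snd p))"

lemma cauchy_ext:
  assumes d: "\<And>s. (\<nu> has_vector_derivative \<nu>' s) (at s)" and c: "continuous_on UNIV \<nu>'"
    and per: "\<And>s. \<nu> (s + 2 * pi) = \<nu> s"
  shows "continuous_on ({0..1} \<times> UNIV) (cauchy_ext \<nu>)"
    and "0 \<le> r \<Longrightarrow> r < 1 \<Longrightarrow> cauchy_ext \<nu> (r, \<theta>) = cauchy \<xi> \<nu> (of_real r * bdry \<xi> \<theta>)"
    and "cauchy_ext \<nu> (r, \<theta> + 2 * pi) = cauchy_ext \<nu> (r, \<theta>)"
    and "cauchy_ext \<nu> (1, \<theta>) = reg \<xi> \<nu> (1, \<theta>) + \<nu> \<theta>"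
proof -
  note \<xi>f = curve_facts[OF \<xi>]
  have c\<nu>: "continuous_on S \<nu>" for S
    by (rule continuous_on_vector_derivative) (rule has_vector_derivative_at_within[OF d])
  obtain C where C: "C > 0" "\<And>s t. norm (\<nu> s - \<nu> t) \<le> C * \<bar>sin ((s - t) / 2)\<bar>"
    using periodic_lipschitz_sin[OF d c per] by blast
  have eq: "cauchy \<xi> \<nu> (of_real r * bdry \<xi> \<theta>) = reg \<xi> \<nu> (r, \<theta>) + \<nu> \<theta>" if "0 \<le> r" "r < 1" for r \<theta>
    using cauchy_reg[OF \<xi> c\<nu>, of r \<theta>] that by simp
  show "0 \<le> r \<Longrightarrow> r < 1 \<Longrightarrow> cauchy_ext \<nu> (r, \<theta>) = cauchy \<xi> \<nu> (of_real r * bdry \<xi> \<theta>)"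
    by (simp add: cauchy_ext_def eq)
  show "cauchy_ext \<nu> (r, \<theta> + 2 * pi) = cauchy_ext \<nu> (r, \<theta>)"
    by (simp add: cauchy_ext_def per periodic_bdry[OF \<xi>] reg_periodic[of \<xi> \<nu>, OF \<xi> per])
  show "cauchy_ext \<nu> (1, \<theta>) = reg \<xi> \<nu> (1, \<theta>) + \<nu> \<theta>" by (simp add: cauchy_ext_def)
  have "continuous_on ({0..1 / 2} \<times> UNIV \<union> {1 / 2..1} \<times> UNIV) (cauchy_ext \<nu>)"
    unfolding cauchy_ext_def
  proof (rule continuous_on_cases)
    show "continuous_on ({0..1 / 2} \<times> UNIV) (\<lambda>p. cauchy \<xi> \<nu> (of_real (fst p) * bdry \<xi> (snd p)))"
    proof (rule continuous_on_compose2[OF holomorphic_on_imp_continuous_on[OF holomorphic_cauchy[OF d c per]]])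
      show "continuous_on ({0..1 / 2} \<times> UNIV) (\<lambda>p. of_real (fst p) * bdry \<xi> (snd p))"
        by (intro continuous_intros continuous_on_compose2[OF \<xi>f(1)[of UNIV]]) auto
      show "(\<lambda>p. of_real (fst p) * bdry \<xi> (snd p)) ` ({0..1 / 2} \<times> UNIV) \<subseteq> - range (bdry \<xi>)"
      proof
        fix z assume "z \<in> (\<lambda>p. of_real (fst p) * bdry \<xi> (snd p)) ` ({0..1 / 2} \<times> UNIV)"
        then obtain x where x: "x \<in> {0..1 / 2} \<times> UNIV" "z = of_real (fst x) * bdry \<xi> (snd x)" by blast
        then show "z \<in> - range (bdry \<xi>)" using off_curve[OF \<xi>, of "fst x" "snd x"] by auto
      qed
    qed
    show "continuous_on ({1 / 2..1} \<times> UNIV) (\<lambda>p. reg \<xi> \<nu> p + \<nu> (snd p))"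
      by (intro continuous_on_add continuous_on_subset[OF reg_continuous[OF \<xi> c\<nu> C]]
          continuous_on_compose2[OF c\<nu>[of UNIV]] continuous_on_snd continuous_on_id) auto
    show "\<forall>x. x \<in> {0..1 / 2} \<times> UNIV \<and> \<not> fst x \<le> 1 / 2 \<or> x \<in> {1 / 2..1} \<times> UNIV \<and> fst x \<le> 1 / 2 \<longrightarrow>
       cauchy \<xi> \<nu> (of_real (fst x) * bdry \<xi> (snd x)) = reg \<xi> \<nu> x + \<nu> (snd x)"
    proof (intro allI impI)
      fix x :: "real \<times> real"
      assume "x \<in> {0..1 / 2} \<times> UNIV \<and> \<not> fst x \<le> 1 / 2 \<or> x \<in> {1 / 2..1} \<times> UNIV \<and> fst x \<le> 1 / 2"
      then have "0 \<le> fst x" "fst x < 1" by auto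
      from eq[OF this, of "snd x"] show "cauchy \<xi> \<nu> (of_real (fst x) * bdry \<xi> (snd x)) = reg \<xi> \<nu> x + \<nu> (snd x)" by simp
    qed
  qed (intro closed_Times closed_atLeastAtMost closed_UNIV)+
  moreover have "{0..1 / 2} \<times> UNIV \<union> {1 / 2..1} \<times> UNIV = {0..1::real} \<times> (UNIV :: real set)" by auto
  ultimately show "continuous_on ({0..1} \<times> UNIV) (cauchy_ext \<nu>)" by simp
qed

text \<open>\<open>A\<close> is the Cauchy integral of the solution \<open>m\<close> for the datum 2
  \<psi>. From m = 2 \<psi> - T m, with T the kernel operator, it follows that \<open>m\<close> is
  C2, which is what the extension of A' to the boundary uses.\<close>

lemma conj_potential_exists:
  assumes \<psi>: "\<psi> \<in> smooth_circle"
  shows "\<exists>A a b. conj_potential \<xi> \<psi> A a b"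
proof -
  note D\<psi> = smooth_circleD[OF \<psi>]
  have "continuous_on UNIV (\<lambda>t. 2 * \<psi> t)" "periodic (\<lambda>t. 2 * \<psi> t)"
    using D\<psi>(2)[of UNIV 0] D\<psi>(3)[of 0] by (auto intro!: continuous_intros simp: periodic_def)
  from dkernel_solve[OF this] obtain m where m: "continuous_on UNIV m" "periodic m"
    "\<And>t. m t + integral {0..2 * pi} (\<lambda>s. dkernel \<xi> t s * m s) = 2 * \<psi> t" by blast
  obtain M1 M2 where M: "\<And>t. ((\<lambda>t. integral {0..2 * pi} (\<lambda>s. dkernel \<xi> t s * m s)) has_real_derivative M1 t) (at t)"
     "\<And>t. (M1 has_real_derivative M2 t) (at t)" "continuous_on UNIV M2"
    using dkernel_operator_C2[OF \<xi> m(1,2)] by blast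
  have m_eq: "m = (\<lambda>t. 2 * \<psi> t - integral {0..2 * pi} (\<lambda>s. dkernel \<xi> t s * m s))" using m(3) by (simp add: fun_eq_iff eq_diff_eq)
  define m1 where "m1 t = 2 * deriv \<psi> t - M1 t" for t
  define m2 where "m2 t = 2 * (deriv ^^ 2) \<psi> t - M2 t" for t
  have dm: "(m has_real_derivative m1 t) (at t)" for t
    unfolding m1_def using D\<psi>(1)[of 0 t]
    by (subst m_eq) (intro DERIV_diff DERIV_cmult M, simp)
  have dm1: "(m1 has_real_derivative m2 t) (at t)" for t
    unfolding m1_def[abs_def] m2_def using D\<psi>(1)[of 1 t]
    by (intro DERIV_diff DERIV_cmult M) (simp add: numeral_2_eq_2)
  have cm2: "continuous_on UNIV m2"
    unfolding m2_def by (intro continuous_intros M D\<psi>)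
  have cm1: "continuous_on UNIV m1"
    by (rule DERIV_continuous_on) (rule has_field_derivative_at_within[OF dm1])
  have pm1: "periodic m1" by (rule periodic_deriv[OF m(2) dm])
  define \<nu> where "\<nu> s = complex_of_real (m s)" for s
  have d\<nu>: "(\<nu> has_vector_derivative of_real (m1 s)) (at s)" for s
    unfolding \<nu>_def by (rule has_vector_derivative_of_real[OF dm])
  have c\<nu>': "continuous_on UNIV (\<lambda>s. complex_of_real (m1 s))" by (intro continuous_intros cm1)
  have p\<nu>: "\<nu> (s + 2 * pi) = \<nu> s" for s using m(2) by (simp add: \<nu>_def periodic_def)
  \<comment> \<open>The density of A' according to \<open>cauchy_deriv\<close>. Its own derivative
    involves m'', the highest one available.\<close>
  define \<beta> where "\<beta> s = of_real (m1 s) / bdry1 \<xi> s" for s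
  define \<beta>' where "\<beta>' s = (of_real (m2 s) * bdry1 \<xi> s - of_real (m1 s) * bdry2 \<xi> s) / (bdry1 \<xi> s)\<^sup>2" for s
  have d\<beta>: "(\<beta> has_vector_derivative \<beta>' s) (at s)" for s
    unfolding \<beta>_def[abs_def] \<beta>'_def
    by (rule has_vector_derivative_divide[OF has_vector_derivative_of_real[OF dm1] bdry_derivs(2)[OF \<xi>]]) simp
  have c\<beta>': "continuous_on UNIV \<beta>'"
    unfolding \<beta>'_def by (intro continuous_intros cm1 cm2 bdry_continuous[OF \<xi>]) simp
  have p\<beta>: "\<beta> (s + 2 * pi) = \<beta> s" for s using pm1 by (simp add: \<beta>_def periodic_def periodic_bdry[OF \<xi>])
  note ext\<nu> = cauchy_ext[OF d\<nu> c\<nu>' p\<nu>] and ext\<beta> = cauchy_ext[OF d\<beta> c\<beta>' p\<beta>]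
  obtain C where C: "C > 0" "\<And>s t. norm (\<nu> s - \<nu> t) \<le> C * \<bar>sin ((s - t) / 2)\<bar>"
    using periodic_lipschitz_sin[OF d\<nu> c\<nu>' p\<nu>] by blast
  have op: "open (- range (bdry \<xi>))" using closed_curve[OF \<xi>] by (simp add: open_Compl)
  have "conj_potential \<xi> \<psi> (cauchy \<xi> \<nu>) (cauchy_ext \<nu>) (cauchy_ext \<beta>)"
    unfolding conj_potential_def
  proof (intro conjI allI impI)
    fix r \<theta> :: real assume r: "0 \<le> r" "r < 1"
    have off: "of_real r * bdry \<xi> \<theta> \<notin> range (bdry \<xi>)" using off_curve[OF \<xi>] r by simp
    show "cauchy \<xi> \<nu> analytic_on {of_real r * bdry \<xi> \<theta>}"
      unfolding analytic_at using op off holomorphic_cauchy[OF d\<nu> c\<nu>' p\<nu>] by blast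
    show "cauchy_ext \<nu> (r, \<theta>) = cauchy \<xi> \<nu> (of_real r * bdry \<xi> \<theta>)" by (rule ext\<nu>(2)[OF r])
    have "deriv (cauchy \<xi> \<nu>) (of_real r * bdry \<xi> \<theta>) = cauchy \<xi> \<beta> (of_real r * bdry \<xi> \<theta>)"
      using DERIV_imp_deriv[OF cauchy_deriv[OF \<xi> d\<nu> c\<nu>' p\<nu> off]] by (simp add: \<beta>_def[abs_def])
    then show "cauchy_ext \<beta> (r, \<theta>) = deriv (cauchy \<xi> \<nu>) (of_real r * bdry \<xi> \<theta>)"
      using ext\<beta>(2)[OF r] by simp
  next
    fix \<theta>
    show "Re (cauchy_ext \<nu> (1, \<theta>)) = \<psi> \<theta>"
      unfolding ext\<nu>(4) using Re_reg[OF \<xi> m(1,2) C(1) C(2)[unfolded \<nu>_def], of \<theta>] m(3)[of \<theta>]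
      by (simp add: \<nu>_def[abs_def])
  qed (rule ext\<nu>(1) ext\<nu>(3) ext\<beta>(1) ext\<beta>(3))+
  then show ?thesis by blast
qed

end


section \<open>Dirichlet energy in coordinates adapted to the boundary\<close>

definition strip_integral :: "(real \<times> real \<Rightarrow> real) \<Rightarrow> real" where
  "strip_integral f = integral (cbox (0, 0) (1, 2 * pi)) f"

text \<open>
  For a function \<open>P\<close> of \<open>(r, \<theta>)\<close> the arguments are \<open>x = \<partial>\<^sub>r P\<close> and \<open>y = \<partial>\<^sub>\<theta> P / r\<close>, both of which are
  continuous up to \<open>r = 0\<close>.
\<close>

definition energy :: "(real \<Rightarrow> real) \<Rightarrow> (real \<times> real \<Rightarrow> real) \<Rightarrow> (real \<times> real \<Rightarrow> real) \<Rightarrow> real" where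
  "energy \<eta> x y = strip_integral (\<lambda>p. fst p * ((x p)\<^sup>2 + (y p - \<eta> (snd p) * x p)\<^sup>2)) / 2"

definition trial :: "(real \<times> real \<Rightarrow> real) \<Rightarrow> (real \<times> real \<Rightarrow> real) \<Rightarrow> (real \<times> real \<Rightarrow> real) \<Rightarrow> bool" where
  "trial P x y \<longleftrightarrow> continuous_on ({0..1} \<times> UNIV) P \<and> continuous_on ({0..1} \<times> UNIV) x \<and> continuous_on ({0..1} \<times> UNIV) y \<and>
     (\<forall>r \<theta>. P (r, \<theta> + 2 * pi) = P (r, \<theta>)) \<and>
     (\<forall>r \<theta>. 0 < r \<longrightarrow> r < 1 \<longrightarrow> ((\<lambda>r. P (r, \<theta>)) has_real_derivative x (r, \<theta>)) (at r) \<and>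
        ((\<lambda>\<theta>. P (r, \<theta>)) has_real_derivative r * y (r, \<theta>)) (at \<theta>))"

lemma strip_box: "cbox (0, 0) (1, 2 * pi) = {0..1::real} \<times> {0..2 * pi}"
  unfolding cbox_Pair_eq by (simp add: cbox_interval)

lemma continuous_strip:
  assumes "continuous_on ({0..1} \<times> UNIV) f"
  shows "continuous_on (cbox (0, 0) (1::real, 2 * pi)) f"
  unfolding strip_box by (rule continuous_on_subset[OF assms]) auto

lemma strip_integrable:
  fixes f :: "real \<times> real \<Rightarrow> real"
  assumes "continuous_on ({0..1} \<times> UNIV) f"
  shows "f integrable_on cbox (0, 0) (1, 2 * pi)"
  by (rule integrable_continuous[OF continuous_strip[OF assms]])

lemma strip_integral_iterated:
  assumes "continuous_on ({0..1} \<times> UNIV) f"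
  shows "strip_integral f = integral {0..1} (\<lambda>r. integral {0..2 * pi} (\<lambda>\<theta>. f (r, \<theta>)))"
  unfolding strip_integral_def by (subst integral_prod_continuous[OF continuous_strip[OF assms]]) (simp add: cbox_interval)

lemma continuous_angular:
  fixes f :: "real \<times> real \<Rightarrow> 'a::topological_space"
  assumes "continuous_on ({0..1} \<times> UNIV) f" "0 \<le> r" "r \<le> 1"
  shows "continuous_on S (\<lambda>\<theta>. f (r, \<theta>))"
  by (rule continuous_on_compose2[OF assms(1)]) (use assms in \<open>auto intro!: continuous_intros\<close>)

lemma circle_parts:
  fixes f g :: "real \<Rightarrow> real"
  assumes f: "\<And>\<theta>. (f has_real_derivative f' \<theta>) (at \<theta>)" "continuous_on UNIV f'" "f (2 * pi) = f 0"
    and g: "\<And>\<theta>. (g has_real_derivative g' \<theta>) (at \<theta>)" "continuous_on UNIV g'" "g (2 * pi) = g 0"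
  shows "integral {0..2 * pi} (\<lambda>\<theta>. f \<theta> * g' \<theta>) = - integral {0..2 * pi} (\<lambda>\<theta>. f' \<theta> * g \<theta>)"
proof -
  have c: "continuous_on S f" "continuous_on S g" for S
    by (rule DERIV_continuous_on, rule has_field_derivative_at_within, rule f g)+
  have c': "continuous_on S f'" "continuous_on S g'" for S
    by (rule continuous_on_subset[OF f(2)] continuous_on_subset[OF g(2)], simp)+
  have "((\<lambda>\<theta>. f \<theta> * g' \<theta> + f' \<theta> * g \<theta>) has_integral f (2 * pi) * g (2 * pi) - f 0 * g 0) {0..2 * pi}"
  proof (rule fundamental_theorem_of_calculus)
    fix \<theta>
    have "((\<lambda>\<theta>. f \<theta> * g \<theta>) has_real_derivative f \<theta> * g' \<theta> + f' \<theta> * g \<theta>) (at \<theta>)"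
      by (rule DERIV_cong[OF DERIV_mult[OF f(1) g(1)]]) simp
    then show "((\<lambda>\<theta>. f \<theta> * g \<theta>) has_vector_derivative f \<theta> * g' \<theta> + f' \<theta> * g \<theta>) (at \<theta> within {0..2 * pi})"
      by (simp add: has_real_derivative_iff_has_vector_derivative has_vector_derivative_at_within)
  qed simp
  then have "integral {0..2 * pi} (\<lambda>\<theta>. f \<theta> * g' \<theta> + f' \<theta> * g \<theta>) = 0"
    using f(3) g(3) by (simp add: integral_unique)
  moreover have "integral {0..2 * pi} (\<lambda>\<theta>. f \<theta> * g' \<theta> + f' \<theta> * g \<theta>) =
      integral {0..2 * pi} (\<lambda>\<theta>. f \<theta> * g' \<theta>) + integral {0..2 * pi} (\<lambda>\<theta>. f' \<theta> * g \<theta>)"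
    by (intro integral_add integrable_continuous_interval continuous_intros c c')
  ultimately show ?thesis by simp
qed

text \<open>\<open>slope\<close> is \<open>\<partial>\<^sub>r a\<close>, where \<open>a (r, \<theta>) = A (r \<gamma>(\<theta>))\<close>.\<close>

definition slope :: "(real \<Rightarrow> real) \<Rightarrow> (real \<times> real \<Rightarrow> complex) \<Rightarrow> real \<times> real \<Rightarrow> complex" where
  "slope \<xi> b p = b p * bdry \<xi> (snd p)"

text \<open>The logarithmic derivative \<gamma>'/\<gamma> of the curve.\<close>

definition tangent :: "(real \<Rightarrow> real) \<Rightarrow> real \<Rightarrow> complex" where
  "tangent \<xi> \<theta> = Complex (deriv \<xi> \<theta>) 1"

context
  fixes \<xi> \<psi> A a b
  assumes \<xi>: "\<xi> \<in> smooth_circle" and cp: "conj_potential \<xi> \<psi> A a b"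
begin

text \<open>The second r-derivative of \<open>a\<close> in the interior. It need not extend to the
  boundary.\<close>

abbreviation "curv p \<equiv> deriv (deriv A) (of_real (fst p) * bdry \<xi> (snd p)) * (bdry \<xi> (snd p))\<^sup>2"

lemma curve_tangent: "bdry1 \<xi> \<theta> = bdry \<xi> \<theta> * tangent \<xi> \<theta>"
  by (simp add: bdry1_def tangent_def)

lemma continuous_tangent: "continuous_on S (tangent \<xi>)"
  using smooth_circleD(2)[OF \<xi>, of S 1] unfolding tangent_def Complex_eq by (auto intro!: continuous_intros)

lemma analytic_inside: "0 \<le> r \<Longrightarrow> r < 1 \<Longrightarrow> A analytic_on {of_real r * bdry \<xi> \<theta>}"
  using cp by (simp add: conj_potential_def)

lemma continuous_slope: "continuous_on ({0..1} \<times> UNIV) (slope \<xi> b)"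
  unfolding slope_def using cp
  by (auto simp: conj_potential_def intro!: continuous_intros continuous_on_compose2[OF bdry_continuous(1)[OF \<xi>, of UNIV]])

lemma continuous_a: "continuous_on ({0..1} \<times> UNIV) a"
  using cp by (simp add: conj_potential_def)

lemma slope_periodic: "slope \<xi> b (r, \<theta> + 2 * pi) = slope \<xi> b (r, \<theta>)"
  using cp by (simp add: slope_def conj_potential_def periodic_bdry[OF \<xi>])

lemma a_periodic: "a (r, \<theta> + 2 * pi) = a (r, \<theta>)"
  using cp by (simp add: conj_potential_def)

lemma tangent_periodic: "tangent \<xi> (\<theta> + 2 * pi) = tangent \<xi> \<theta>"
  using smooth_circleD(3)[OF \<xi>, of 1] by (simp add: tangent_def periodic_def)

lemma ray_deriv: "((\<lambda>r. of_real r * bdry \<xi> \<theta>) has_vector_derivative bdry \<xi> \<theta>) (at r)"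
  by (rule has_vector_derivative_eq_rhs[OF has_vector_derivative_mult_left[OF has_vector_derivative_of_real[of _ 1]]])
    (auto intro!: derivative_eq_intros)

lemma arc_deriv: "((\<lambda>\<theta>. of_real r * bdry \<xi> \<theta>) has_vector_derivative of_real r * (bdry \<xi> \<theta> * tangent \<xi> \<theta>)) (at \<theta>)"
  unfolding curve_tangent[symmetric] by (rule has_vector_derivative_mult_right[OF bdry_derivs(1)[OF \<xi>]])

lemma A_deriv:
  assumes r: "0 \<le> r" "r < 1"
  shows "(A has_field_derivative deriv A (of_real r * bdry \<xi> \<theta>)) (at (of_real r * bdry \<xi> \<theta>))"
    and "(deriv A has_field_derivative deriv (deriv A) (of_real r * bdry \<xi> \<theta>)) (at (of_real r * bdry \<xi> \<theta>))"
    and "isCont (deriv (deriv A)) (of_real r * bdry \<xi> \<theta>)"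
proof -
  note an = analytic_inside[OF r, of \<theta>]
  have d: "(f has_field_derivative deriv f z) (at z)" if "f analytic_on {z}" for f and z :: complex
    using analytic_on_imp_differentiable_at[OF that] by (simp add: DERIV_deriv_iff_field_differentiable)
  show "(A has_field_derivative deriv A (of_real r * bdry \<xi> \<theta>)) (at (of_real r * bdry \<xi> \<theta>))" by (rule d[OF an])
  have an': "deriv A analytic_on {of_real r * bdry \<xi> \<theta>}" by (rule analytic_deriv[OF an])
  show "(deriv A has_field_derivative deriv (deriv A) (of_real r * bdry \<xi> \<theta>)) (at (of_real r * bdry \<xi> \<theta>))" by (rule d[OF an'])
  show "isCont (deriv (deriv A)) (of_real r * bdry \<xi> \<theta>)"
    by (rule DERIV_isCont[OF d[OF analytic_deriv[OF an']]])
qed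

lemma a_inside: "0 \<le> r \<Longrightarrow> r < 1 \<Longrightarrow> a (r, \<theta>) = A (of_real r * bdry \<xi> \<theta>)"
  and slope_inside: "0 \<le> r \<Longrightarrow> r < 1 \<Longrightarrow> slope \<xi> b (r, \<theta>) = deriv A (of_real r * bdry \<xi> \<theta>) * bdry \<xi> \<theta>"
  using cp by (simp_all add: conj_potential_def slope_def)

lemma a_deriv_r:
  assumes r: "0 < r" "r < 1"
  shows "((\<lambda>r. a (r, \<theta>)) has_vector_derivative slope \<xi> b (r, \<theta>)) (at r)"
proof -
  have "((\<lambda>r. A (of_real r * bdry \<xi> \<theta>)) has_vector_derivative bdry \<xi> \<theta> * deriv A (of_real r * bdry \<xi> \<theta>)) (at r)"
    using field_vector_diff_chain_at[OF ray_deriv A_deriv(1)] r by (simp add: o_def)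
  then have "((\<lambda>r. A (of_real r * bdry \<xi> \<theta>)) has_vector_derivative slope \<xi> b (r, \<theta>)) (at r)"
    using r by (simp add: slope_inside mult.commute)
  then show ?thesis
    by (rule has_vector_derivative_transform_within_open[of _ _ _ "{0<..<1}"]) (use r in \<open>auto simp: a_inside\<close>)
qed

lemma a_deriv_angle:
  assumes r: "0 \<le> r" "r < 1"
  shows "((\<lambda>\<theta>. a (r, \<theta>)) has_vector_derivative of_real r * (slope \<xi> b (r, \<theta>) * tangent \<xi> \<theta>)) (at \<theta>)"
proof -
  have "((\<lambda>\<theta>. A (of_real r * bdry \<xi> \<theta>)) has_vector_derivative of_real r * (bdry \<xi> \<theta> * tangent \<xi> \<theta>) * deriv A (of_real r * bdry \<xi> \<theta>)) (at \<theta>)"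
    using field_vector_diff_chain_at[OF arc_deriv A_deriv(1)[OF r]] by (simp add: o_def)
  then show ?thesis using r by (simp add: slope_inside a_inside mult_ac)
qed

lemma slope_deriv_r:
  assumes r: "0 < r" "r < 1"
  shows "((\<lambda>r. slope \<xi> b (r, \<theta>)) has_vector_derivative curv (r, \<theta>)) (at r)"
proof -
  have "((\<lambda>r. deriv A (of_real r * bdry \<xi> \<theta>)) has_vector_derivative bdry \<xi> \<theta> * deriv (deriv A) (of_real r * bdry \<xi> \<theta>)) (at r)"
    using field_vector_diff_chain_at[OF ray_deriv A_deriv(2)] r by (simp add: o_def)
  from has_vector_derivative_mult_left[OF this, of "bdry \<xi> \<theta>"]
  have "((\<lambda>r. deriv A (of_real r * bdry \<xi> \<theta>) * bdry \<xi> \<theta>) has_vector_derivative curv (r, \<theta>)) (at r)"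
    by (simp add: power2_eq_square mult_ac)
  then show ?thesis
    by (rule has_vector_derivative_transform_within_open[of _ _ _ "{0<..<1}"]) (use r in \<open>auto simp: slope_inside\<close>)
qed

lemma slope_deriv_angle:
  assumes r: "0 \<le> r" "r < 1"
  shows "((\<lambda>\<theta>. slope \<xi> b (r, \<theta>)) has_vector_derivative (of_real r * curv (r, \<theta>) + slope \<xi> b (r, \<theta>)) * tangent \<xi> \<theta>) (at \<theta>)"
proof -
  have "((\<lambda>\<theta>. deriv A (of_real r * bdry \<xi> \<theta>)) has_vector_derivative of_real r * (bdry \<xi> \<theta> * tangent \<xi> \<theta>) * deriv (deriv A) (of_real r * bdry \<xi> \<theta>)) (at \<theta>)"
    using field_vector_diff_chain_at[OF arc_deriv A_deriv(2)[OF r]] by (simp add: o_def)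
  from has_vector_derivative_mult[OF this bdry_derivs(1)[OF \<xi>]]
  show ?thesis using r by (simp add: slope_inside curve_tangent power2_eq_square algebra_simps)
qed

lemma continuous_curv: "continuous_on ({0<..<1} \<times> UNIV) (\<lambda>p. curv p)"
proof -
  have "continuous_on ({0<..<1} \<times> UNIV) (\<lambda>p. deriv (deriv A) (of_real (fst p) * bdry \<xi> (snd p)))"
  proof (rule continuous_at_imp_continuous_on, rule ballI)
    fix p :: "real \<times> real" assume p: "p \<in> {0<..<1} \<times> UNIV"
    have "isCont (\<lambda>p. of_real (fst p) * bdry \<xi> (snd p)) p"
    proof -
      have "continuous_on UNIV (\<lambda>p. of_real (fst p) * bdry \<xi> (snd p))"
        by (intro continuous_intros continuous_on_compose2[OF bdry_continuous(1)[OF \<xi>, of UNIV]]) auto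
      then show ?thesis unfolding continuous_on_eq_continuous_at[OF open_UNIV] by blast
    qed
    then show "isCont (\<lambda>p. deriv (deriv A) (of_real (fst p) * bdry \<xi> (snd p))) p"
      by (rule isCont_o2) (use A_deriv(3)[of "fst p" "snd p"] p in auto)
  qed
  then show ?thesis
    by (intro continuous_intros continuous_on_compose2[OF bdry_continuous(1)[OF \<xi>, of UNIV]]) auto
qed

section \<open>Trial functions and energy identities\<close>

lemma trial_parts:
  shows "trial (\<lambda>p. Re (a p)) (\<lambda>p. Re (slope \<xi> b p)) (\<lambda>p. Re (slope \<xi> b p * tangent \<xi> (snd p)))"
    and "trial (\<lambda>p. Im (a p)) (\<lambda>p. Im (slope \<xi> b p)) (\<lambda>p. Im (slope \<xi> b p * tangent \<xi> (snd p)))"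
  unfolding trial_def
  using a_deriv_r a_deriv_angle
  by (auto simp: a_periodic has_vector_derivative_complex_iff
      intro!: continuous_intros continuous_a continuous_slope continuous_on_compose2[OF continuous_tangent[of UNIV]])

text \<open>The integrand on the left is the Jacobian of (P, Im a) in r and \<theta>, hence a
  divergence. \<open>P\<close> has only first derivatives, so all second derivatives are put on Im
  a: \<open>M\<close> is differentiated in r, and one integration by parts in \<theta> moves the
  angular derivative back to \<open>P\<close>. The factor r makes \<open>M\<close> vanish at r =
  0.\<close>

lemma null_lagrangian:
  assumes t: "trial P x y"
  shows "strip_integral (\<lambda>p. fst p * (x p * Im (slope \<xi> b p * tangent \<xi> (snd p)) - y p * Im (slope \<xi> b p))) =
     integral {0..2 * pi} (\<lambda>\<theta>. P (1, \<theta>) * Im (slope \<xi> b (1, \<theta>) * tangent \<xi> \<theta>))"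
proof -
  let ?s = "slope \<xi> b"
  have cP: "continuous_on ({0..1} \<times> UNIV) P" and cx: "continuous_on ({0..1} \<times> UNIV) x" and cy: "continuous_on ({0..1} \<times> UNIV) y"
    and pP: "\<And>r \<theta>. P (r, \<theta> + 2 * pi) = P (r, \<theta>)"
    and dP: "\<And>r \<theta>. 0 < r \<Longrightarrow> r < 1 \<Longrightarrow> ((\<lambda>r. P (r, \<theta>)) has_real_derivative x (r, \<theta>)) (at r)"
      "\<And>r \<theta>. 0 < r \<Longrightarrow> r < 1 \<Longrightarrow> ((\<lambda>\<theta>. P (r, \<theta>)) has_real_derivative r * y (r, \<theta>)) (at \<theta>)"
    using t by (auto simp: trial_def)
  define qy where "qy p = Im (?s p * tangent \<xi> (snd p))" for p
  have cqy: "continuous_on ({0..1} \<times> UNIV) qy"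
    unfolding qy_def by (intro continuous_intros continuous_slope continuous_on_compose2[OF continuous_tangent[of UNIV]]) auto
  have cqx: "continuous_on ({0..1} \<times> UNIV) (\<lambda>p. Im (?s p))" by (intro continuous_intros continuous_slope)
  \<comment> \<open>The mixed second derivative of Im a, reached in both orders by \<open>dr\<close>
    and \<open>d\<theta>\<close>.\<close>
  define D where "D p = Im ((of_real (fst p) * curv p + ?s p) * tangent \<xi> (snd p))" for p
  have cD: "continuous_on ({0<..<1} \<times> UNIV) D"
    unfolding D_def
    by (intro continuous_intros continuous_curv continuous_on_subset[OF continuous_slope] continuous_on_compose2[OF continuous_tangent[of UNIV]]) auto
  have dr: "((\<lambda>r. r * qy (r, \<theta>)) has_real_derivative D (r, \<theta>)) (at r)" if "0 < r" "r < 1" for r \<theta>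
  proof -
    have o: "((\<lambda>r. complex_of_real r) has_vector_derivative of_real 1) (at r)"
      by (rule has_vector_derivative_of_real) (auto intro!: derivative_eq_intros)
    have "((\<lambda>r. of_real r * (?s (r, \<theta>) * tangent \<xi> \<theta>)) has_vector_derivative
       of_real r * (curv (r, \<theta>) * tangent \<xi> \<theta>) + of_real 1 * (?s (r, \<theta>) * tangent \<xi> \<theta>)) (at r)"
      by (rule has_vector_derivative_mult[OF o has_vector_derivative_mult_left[OF slope_deriv_r[OF that]]])
    then show ?thesis by (simp add: has_vector_derivative_complex_iff D_def qy_def algebra_simps)
  qed
  have d\<theta>: "((\<lambda>\<theta>. Im (?s (r, \<theta>))) has_real_derivative D (r, \<theta>)) (at \<theta>)" if "0 < r" "r < 1" for r \<theta>
    using slope_deriv_angle[of r \<theta>] that by (simp add: has_vector_derivative_complex_iff D_def)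
  define M where "M r = integral {0..2 * pi} (\<lambda>\<theta>. P (r, \<theta>) * (r * qy (r, \<theta>)))" for r
  define N where "N r = integral {0..2 * pi} (\<lambda>\<theta>. r * (x (r, \<theta>) * qy (r, \<theta>) - y (r, \<theta>) * Im (?s (r, \<theta>))))" for r
  have "(N has_integral M 1 - M 0) {0..1}"
  \<comment> \<open>\<open>D\<close> is continuous only in the open strip; at r = 0 and r = 1
    continuity of \<open>M\<close> suffices.\<close>
  proof (rule fundamental_theorem_of_calculus_interior)
    show "continuous_on {0..1} M"
      unfolding M_def cbox_interval[of 0 "2 * pi", symmetric]
    proof (rule integral_continuous_on_param)
      have "continuous_on ({0..1} \<times> UNIV) (\<lambda>p. P p * (fst p * qy p))" by (intro continuous_intros cP cqy)
      then have "continuous_on ({0..1} \<times> cbox 0 (2 * pi)) (\<lambda>p. P p * (fst p * qy p))" by (rule continuous_on_subset) auto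
      then show "continuous_on ({0..1} \<times> cbox 0 (2 * pi)) (\<lambda>(r, \<theta>). P (r, \<theta>) * (r * qy (r, \<theta>)))"
        by (simp add: case_prod_unfold)
    qed
    fix r :: real assume "r \<in> {0<..<1}"
    then have r: "0 < r" "r < 1" by auto
    have "((\<lambda>r. integral (cbox 0 (2 * pi)) (\<lambda>\<theta>. P (r, \<theta>) * (r * qy (r, \<theta>)))) has_real_derivative
        integral (cbox 0 (2 * pi)) (\<lambda>\<theta>. P (r, \<theta>) * D (r, \<theta>) + x (r, \<theta>) * (r * qy (r, \<theta>)))) (at r within {0<..<1})"
    proof (rule leibniz_rule_field_derivative)
      fix r' \<theta> :: real assume "r' \<in> {0<..<1}"
      then have r': "0 < r'" "r' < 1" by auto
      have "((\<lambda>r. P (r, \<theta>) * (r * qy (r, \<theta>))) has_real_derivative P (r', \<theta>) * D (r', \<theta>) + x (r', \<theta>) * (r' * qy (r', \<theta>))) (at r')"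
        by (rule DERIV_mult'[OF dP(1)[OF r'] dr[OF r']])
      then show "((\<lambda>r. P (r, \<theta>) * (r * qy (r, \<theta>))) has_real_derivative P (r', \<theta>) * D (r', \<theta>) + x (r', \<theta>) * (r' * qy (r', \<theta>))) (at r' within {0<..<1})"
        by (rule has_field_derivative_at_within)
    next
      fix r' :: real assume "r' \<in> {0<..<1}"
      then show "(\<lambda>\<theta>. P (r', \<theta>) * (r' * qy (r', \<theta>))) integrable_on cbox 0 (2 * pi)"
        unfolding cbox_interval
        by (intro integrable_continuous_interval continuous_intros continuous_angular[OF cP] continuous_angular[OF cqy]) auto
    next
      have "continuous_on ({0<..<1} \<times> UNIV) (\<lambda>p. P p * D p + x p * (fst p * qy p))"
        by (intro continuous_intros cD continuous_on_subset[OF cP] continuous_on_subset[OF cx] continuous_on_subset[OF cqy]) auto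
      then have "continuous_on ({0<..<1} \<times> cbox 0 (2 * pi)) (\<lambda>p. P p * D p + x p * (fst p * qy p))" by (rule continuous_on_subset) auto
      then show "continuous_on ({0<..<1} \<times> cbox 0 (2 * pi)) (\<lambda>(r, \<theta>). P (r, \<theta>) * D (r, \<theta>) + x (r, \<theta>) * (r * qy (r, \<theta>)))"
        by (simp add: case_prod_unfold)
    qed (use r in auto)
    moreover have "at r within {0<..<1} = at r" by (rule at_within_open) (use r in auto)
    ultimately have dM: "(M has_real_derivative integral {0..2 * pi} (\<lambda>\<theta>. P (r, \<theta>) * D (r, \<theta>) + x (r, \<theta>) * (r * qy (r, \<theta>)))) (at r)"
      by (simp add: M_def[abs_def] cbox_interval)
    have cDr: "continuous_on S (\<lambda>\<theta>. D (r, \<theta>))" for S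
      by (rule continuous_on_compose2[OF cD]) (use r in \<open>auto intro!: continuous_intros\<close>)
    have r01: "0 \<le> r" "r \<le> 1" using r by auto
    note cont = cDr continuous_angular[OF cP r01] continuous_angular[OF cx r01] continuous_angular[OF cy r01]
      continuous_angular[OF cqy r01] continuous_angular[OF cqx r01]
    have per: "P (r, 2 * pi) = P (r, 0)" "Im (?s (r, 2 * pi)) = Im (?s (r, 0))"
      using pP[of r 0] slope_periodic[of r 0] by simp_all
    have "integral {0..2 * pi} (\<lambda>\<theta>. P (r, \<theta>) * D (r, \<theta>)) = - integral {0..2 * pi} (\<lambda>\<theta>. (r * y (r, \<theta>)) * Im (?s (r, \<theta>)))"
      by (rule circle_parts[OF dP(2)[OF r] _ per(1) d\<theta>[OF r] _ per(2)]) (intro continuous_intros cont)+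
    moreover have "(\<lambda>\<theta>. P (r, \<theta>) * D (r, \<theta>)) integrable_on {0..2 * pi}"
      "(\<lambda>\<theta>. x (r, \<theta>) * (r * qy (r, \<theta>))) integrable_on {0..2 * pi}"
      by (intro integrable_continuous_interval continuous_intros cont)+
    ultimately have "integral {0..2 * pi} (\<lambda>\<theta>. P (r, \<theta>) * D (r, \<theta>) + x (r, \<theta>) * (r * qy (r, \<theta>))) =
       - integral {0..2 * pi} (\<lambda>\<theta>. (r * y (r, \<theta>)) * Im (?s (r, \<theta>))) + integral {0..2 * pi} (\<lambda>\<theta>. x (r, \<theta>) * (r * qy (r, \<theta>)))"
      by (simp only: integral_add)
    also have "\<dots> = integral {0..2 * pi} (\<lambda>\<theta>. x (r, \<theta>) * (r * qy (r, \<theta>))) - integral {0..2 * pi} (\<lambda>\<theta>. (r * y (r, \<theta>)) * Im (?s (r, \<theta>)))"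
      by simp
    also have "\<dots> = integral {0..2 * pi} (\<lambda>\<theta>. x (r, \<theta>) * (r * qy (r, \<theta>)) - (r * y (r, \<theta>)) * Im (?s (r, \<theta>)))"
      by (rule integral_diff[symmetric]) (intro integrable_continuous_interval continuous_intros cont)+
    also have "\<dots> = N r" unfolding N_def by (rule integral_cong) (simp add: algebra_simps)
    finally show "(M has_vector_derivative N r) (at r)"
      using dM by (simp add: has_real_derivative_iff_has_vector_derivative)
  qed simp
  then have "integral {0..1} N = M 1" by (simp add: integral_unique M_def)
  moreover have "strip_integral (\<lambda>p. fst p * (x p * qy p - y p * Im (?s p))) = integral {0..1} N"
    unfolding N_def by (subst strip_integral_iterated) (intro continuous_intros cx cy cqy cqx, simp)
  ultimately show ?thesis by (simp add: qy_def M_def)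
qed


lemma Dirichlet_G: "G_op \<xi> \<psi> = (\<lambda>\<theta>. Im (slope \<xi> b (1, \<theta>) * tangent \<xi> \<theta>))"
proof -
  have "periodic \<xi>" "continuous_on UNIV \<xi>" using smooth_circleD(2)[OF \<xi>, of UNIV 0] smooth_circleD(3)[OF \<xi>, of 0] by auto
  from G_op_eq[OF this cp] show ?thesis by (simp add: slope_def tangent_def)
qed

lemma Re_boundary: "Re (a (1, \<theta>)) = \<psi> \<theta>"
  using cp by (simp add: conj_potential_def)

text \<open>
  Applied to the perturbed potential and the unperturbed stream function, or the other way round,
  this yields the lower and the upper bound for the perturbed energy.
\<close>

lemma energy_dual:
  assumes t: "trial P x y" and \<eta>: "continuous_on UNIV \<eta>"
  shows "integral {0..2 * pi} (\<lambda>\<theta>. P (1, \<theta>) * G_op \<xi> \<psi> \<theta>) \<le>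
    energy \<eta> x y + energy \<eta> (\<lambda>p. Im (slope \<xi> b p)) (\<lambda>p. Im (slope \<xi> b p * tangent \<xi> (snd p)))"
proof -
  let ?X = "\<lambda>p. Im (slope \<xi> b p)" and ?Y = "\<lambda>p. Im (slope \<xi> b p * tangent \<xi> (snd p))"
  have c: "continuous_on ({0..1} \<times> UNIV) x" "continuous_on ({0..1} \<times> UNIV) y"
    "continuous_on ({0..1} \<times> UNIV) ?X" "continuous_on ({0..1} \<times> UNIV) ?Y"
    using t trial_parts(2) by (auto simp: trial_def)
  have c\<eta>: "continuous_on ({0..1::real} \<times> UNIV) (\<lambda>p. \<eta> (snd p))"
    by (rule continuous_on_compose2[OF \<eta>]) (auto intro!: continuous_intros)
  have "integral {0..2 * pi} (\<lambda>\<theta>. P (1, \<theta>) * G_op \<xi> \<psi> \<theta>) = strip_integral (\<lambda>p. fst p * (x p * ?Y p - y p * ?X p))"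
    unfolding Dirichlet_G by (rule null_lagrangian[OF t, symmetric])
  also have "\<dots> \<le> strip_integral (\<lambda>p. fst p * ((x p)\<^sup>2 + (y p - \<eta> (snd p) * x p)\<^sup>2) / 2 +
      fst p * ((?X p)\<^sup>2 + (?Y p - \<eta> (snd p) * ?X p)\<^sup>2) / 2)"
    unfolding strip_integral_def
  proof (rule integral_le)
    show "(\<lambda>p. fst p * (x p * ?Y p - y p * ?X p)) integrable_on cbox (0, 0) (1, 2 * pi)"
      by (intro strip_integrable continuous_intros c)
    show "(\<lambda>p. fst p * ((x p)\<^sup>2 + (y p - \<eta> (snd p) * x p)\<^sup>2) / 2 +
      fst p * ((?X p)\<^sup>2 + (?Y p - \<eta> (snd p) * ?X p)\<^sup>2) / 2) integrable_on cbox (0, 0) (1, 2 * pi)"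
      by (intro strip_integrable continuous_intros c c\<eta>) auto
    fix p assume "p \<in> cbox (0, 0) (1::real, 2 * pi)"
    then have p: "0 \<le> fst p" unfolding strip_box by auto
    \<comment> \<open>Subtracting \<eta> x from y is a shear and leaves the determinant unchanged,
      so the same inequality holds for every slope \<eta>. Equality requires u = V and v = - U, the
      Cauchy-Riemann equations.\<close>
    define u v U V where "u = x p" and "v = y p - \<eta> (snd p) * x p" and "U = ?X p" and "V = ?Y p - \<eta> (snd p) * ?X p"
    have "x p * ?Y p - y p * ?X p = u * V - v * U" by (simp add: u_def v_def U_def V_def algebra_simps)
    moreover have "u * V - v * U \<le> (u\<^sup>2 + v\<^sup>2) / 2 + (U\<^sup>2 + V\<^sup>2) / 2"
    proof -
      have "0 \<le> (u - V)\<^sup>2 + (v + U)\<^sup>2" by simp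
      then show ?thesis by (simp add: power2_eq_square field_simps)
    qed
    ultimately have "x p * ?Y p - y p * ?X p \<le> (u\<^sup>2 + v\<^sup>2) / 2 + (U\<^sup>2 + V\<^sup>2) / 2" by linarith
    from mult_left_mono[OF this p]
    show "fst p * (x p * ?Y p - y p * ?X p) \<le> fst p * ((x p)\<^sup>2 + (y p - \<eta> (snd p) * x p)\<^sup>2) / 2 +
      fst p * ((?X p)\<^sup>2 + (?Y p - \<eta> (snd p) * ?X p)\<^sup>2) / 2"
      by (simp add: u_def v_def U_def V_def algebra_simps)
  qed
  also have "\<dots> = strip_integral (\<lambda>p. fst p * ((x p)\<^sup>2 + (y p - \<eta> (snd p) * x p)\<^sup>2) / 2) +
      strip_integral (\<lambda>p. fst p * ((?X p)\<^sup>2 + (?Y p - \<eta> (snd p) * ?X p)\<^sup>2) / 2)"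
    unfolding strip_integral_def
    by (intro integral_add strip_integrable continuous_intros c c\<eta>) auto
  also have "\<dots> = energy \<eta> x y + energy \<eta> ?X ?Y"
    by (simp add: energy_def strip_integral_def)
  finally show ?thesis .
qed

text \<open>For the true slope \<xi>' the sheared pairs are (Re s, - Im s) and (Im s, Re s) with s =
  dA/dr. Potential and stream function thus have the same energy density r |s|^2 / 2, and
  \<open>energy_dual\<close> becomes an equality.\<close>

lemma energy_eq:
  shows "energy (deriv \<xi>) (\<lambda>p. Im (slope \<xi> b p)) (\<lambda>p. Im (slope \<xi> b p * tangent \<xi> (snd p))) =
      integral {0..2 * pi} (\<lambda>\<theta>. \<psi> \<theta> * G_op \<xi> \<psi> \<theta>) / 2"
    and "energy (deriv \<xi>) (\<lambda>p. Re (slope \<xi> b p)) (\<lambda>p. Re (slope \<xi> b p * tangent \<xi> (snd p))) =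
      integral {0..2 * pi} (\<lambda>\<theta>. \<psi> \<theta> * G_op \<xi> \<psi> \<theta>) / 2"
proof -
  have "integral {0..2 * pi} (\<lambda>\<theta>. \<psi> \<theta> * G_op \<xi> \<psi> \<theta>) =
     strip_integral (\<lambda>p. fst p * (Re (slope \<xi> b p) * Im (slope \<xi> b p * tangent \<xi> (snd p)) -
        Re (slope \<xi> b p * tangent \<xi> (snd p)) * Im (slope \<xi> b p)))"
    using null_lagrangian[OF trial_parts(1)] by (simp add: Dirichlet_G Re_boundary)
  also have "\<dots> = strip_integral (\<lambda>p. fst p * ((Re (slope \<xi> b p))\<^sup>2 + (Im (slope \<xi> b p))\<^sup>2))"
    by (simp add: tangent_def power2_eq_square algebra_simps)
  finally have "integral {0..2 * pi} (\<lambda>\<theta>. \<psi> \<theta> * G_op \<xi> \<psi> \<theta>) =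
     strip_integral (\<lambda>p. fst p * ((Re (slope \<xi> b p))\<^sup>2 + (Im (slope \<xi> b p))\<^sup>2))" .
  then show "energy (deriv \<xi>) (\<lambda>p. Im (slope \<xi> b p)) (\<lambda>p. Im (slope \<xi> b p * tangent \<xi> (snd p))) =
      integral {0..2 * pi} (\<lambda>\<theta>. \<psi> \<theta> * G_op \<xi> \<psi> \<theta>) / 2"
    and "energy (deriv \<xi>) (\<lambda>p. Re (slope \<xi> b p)) (\<lambda>p. Re (slope \<xi> b p * tangent \<xi> (snd p))) =
      integral {0..2 * pi} (\<lambda>\<theta>. \<psi> \<theta> * G_op \<xi> \<psi> \<theta>) / 2"
    by (simp_all add: energy_def tangent_def algebra_simps)
qed

lemma boundary_derivative:
  "((\<lambda>\<theta>. a (1, \<theta>)) has_vector_derivative slope \<xi> b (1, \<theta>) * tangent \<xi> \<theta>) (at \<theta>)"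
proof -
  let ?s = "\<lambda>r \<theta>. of_real r * (slope \<xi> b (r, \<theta>) * tangent \<xi> \<theta>)"
  define L where "L = \<bar>\<theta>\<bar> + 1"
  have cs: "continuous_on ({0..1} \<times> UNIV) (\<lambda>p. ?s (fst p) (snd p))"
    by (intro continuous_intros continuous_slope[unfolded prod.collapse] continuous_on_compose2[OF continuous_tangent[of UNIV]])
      (use continuous_slope in auto)
  have eq: "a (1, x) = a (1, -L) + integral {-L..x} (?s 1)" if x: "-L \<le> x" for x
  proof -
    have inner: "a (r, x) = a (r, -L) + integral {-L..x} (?s r)" if r: "0 \<le> r" "r < 1" for r
    proof -
      have I: "(?s r has_integral a (r, x) - a (r, -L)) {-L..x}"
        by (rule fundamental_theorem_of_calculus[OF x])
          (rule has_vector_derivative_at_within[OF a_deriv_angle[OF r]])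
      show ?thesis by (simp only: integral_unique[OF I]) simp
    qed
    have ca: "continuous_on {0..1} (\<lambda>r. a (r, x))" for x
      by (rule continuous_on_compose2[OF continuous_a]) (auto intro!: continuous_intros)
    have cI: "continuous_on {0..1} (\<lambda>r. integral {-L..x} (?s r))"
      unfolding cbox_interval[of "-L", symmetric]
      by (rule integral_continuous_on_param)
        (use continuous_on_subset[OF cs, of "{0..1} \<times> cbox (-L) x"] in \<open>auto simp: case_prod_unfold\<close>)
    have ev: "\<forall>\<^sub>F r in at_left 1. r \<in> {0::real..<1}"
      using eventually_at_left[of 0 "1::real"] by (auto intro!: exI[of _ 0])
    have lim: "((\<lambda>r. f r) \<longlongrightarrow> f 1) (at_left 1)" if "continuous_on {0..1} f" for f :: "real \<Rightarrow> complex"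
    proof -
      have "(f \<longlongrightarrow> f 1) (at 1 within {0..1})" using that by (simp add: continuous_on_def)
      then show ?thesis by (simp add: at_within_Icc_at_left)
    qed
    have "((\<lambda>r. a (r, x)) \<longlongrightarrow> a (1, x)) (at_left 1)" by (rule lim[OF ca])
    moreover have "((\<lambda>r. a (r, x)) \<longlongrightarrow> a (1, -L) + integral {-L..x} (?s 1)) (at_left 1)"
      by (rule Lim_transform_eventually[OF tendsto_add[OF lim[OF ca] lim[OF cI]]])
        (use ev in \<open>auto elim!: eventually_mono simp: inner\<close>)
    ultimately show ?thesis by (rule tendsto_unique[OF trivial_limit_at_left_real])
  qed
  have c1: "continuous_on {-L..L} (?s 1)"
    by (rule continuous_on_compose2[OF cs, of _ "\<lambda>\<theta>. (1, \<theta>)", unfolded fst_conv snd_conv]) (auto intro!: continuous_intros)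
  have "((\<lambda>x. integral {-L..x} (?s 1)) has_vector_derivative ?s 1 \<theta>) (at \<theta> within {-L..L})"
    by (rule integral_has_vector_derivative[OF c1]) (auto simp: L_def)
  moreover have "at \<theta> within {-L..L} = at \<theta>"
    by (rule at_within_Icc_at) (auto simp: L_def)
  ultimately have "((\<lambda>x. integral {-L..x} (?s 1)) has_vector_derivative ?s 1 \<theta>) (at \<theta>)" by simp
  from has_vector_derivative_add[OF has_vector_derivative_const[of "a (1, -L)"] this]
  have "((\<lambda>x. a (1, -L) + integral {-L..x} (?s 1)) has_vector_derivative ?s 1 \<theta>) (at \<theta>)" by simp
  then have "((\<lambda>x. a (1, x)) has_vector_derivative ?s 1 \<theta>) (at \<theta>)"
  proof (rule has_vector_derivative_transform_within_open)
    show "open {-L<..}" by simp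
    show "\<theta> \<in> {-L<..}" by (auto simp: L_def)
    show "a (1, -L) + integral {-L..x} (?s 1) = a (1, x)" if "x \<in> {-L<..}" for x
      using eq[of x] that by simp
  qed
  then show ?thesis by simp
qed

text \<open>The left side is the tangential derivative of \<open>a\<close> along the curve, whose
  real part is \<psi> and whose imaginary part is the stream function. This determines the boundary
  gradient from \<psi>' and G alone.\<close>

lemma slope_boundary: "slope \<xi> b (1, \<theta>) * tangent \<xi> \<theta> = Complex (deriv \<psi> \<theta>) (G_op \<xi> \<psi> \<theta>)"
proof -
  have "((\<lambda>\<theta>. Re (a (1, \<theta>))) has_real_derivative Re (slope \<xi> b (1, \<theta>) * tangent \<xi> \<theta>)) (at \<theta>)"
    using boundary_derivative[of \<theta>] unfolding has_vector_derivative_complex_iff by blast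
  then have "deriv \<psi> \<theta> = Re (slope \<xi> b (1, \<theta>) * tangent \<xi> \<theta>)"
    by (intro DERIV_imp_deriv) (simp add: Re_boundary)
  then show ?thesis by (simp only: complex_eq_iff complex.sel Dirichlet_G simp_thms)
qed

lemma Im_a_deriv: "((\<lambda>\<theta>. Im (a (1, \<theta>))) has_real_derivative G_op \<xi> \<psi> \<theta>) (at \<theta>)"
  using boundary_derivative[of \<theta>] unfolding has_vector_derivative_complex_iff Dirichlet_G by blast


text \<open>
  The integrand on the left is half of \<open>r h' Im ((\<partial>\<^sub>r a)\<^sup>2)\<close>, and \<open>(r \<partial>\<^sub>r a)\<^sup>2\<close> is an analytic function of
  \<open>r \<gamma>(\<theta>)\<close>: this is the conservation law of the stress tensor.
\<close>

lemma stress_identity: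
  assumes h: "h \<in> smooth_circle"
  shows "strip_integral (\<lambda>p. fst p * (deriv h (snd p) * (Re (slope \<xi> b p) * Im (slope \<xi> b p)))) =
    - integral {0..2 * pi} (\<lambda>\<theta>. h \<theta> * Im ((slope \<xi> b (1, \<theta>))\<^sup>2 * tangent \<xi> \<theta>)) / 2"
proof -
  let ?s = "slope \<xi> b"
  have dh: "(h has_real_derivative deriv h \<theta>) (at \<theta>)" for \<theta> using smooth_circleD(1)[OF h, of 0] by simp
  have ch: "continuous_on S h" and ch': "continuous_on S (deriv h)" for S
    using smooth_circleD(2)[OF h, of S 0] smooth_circleD(2)[OF h, of S 1] by simp_all
  have perh: "h (2 * pi) = h 0" using smooth_circleD(3)[OF h, of 0] unfolding periodic_def by (metis add_0 funpow_0)
  note cs = continuous_slope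
  have ct: "continuous_on S (\<lambda>p. tangent \<xi> (snd p))" for S :: "(real \<times> real) set"
    by (rule continuous_on_compose2[OF continuous_tangent[of UNIV]]) (auto intro!: continuous_intros)
  have chp: "continuous_on S (\<lambda>p. h (snd p))" "continuous_on S (\<lambda>p. deriv h (snd p))" for S :: "(real \<times> real) set"
    by (rule continuous_on_compose2[OF ch[of UNIV]] continuous_on_compose2[OF ch'[of UNIV]]; auto intro!: continuous_intros)+
  \<comment> \<open>An analytic function of z = r \<gamma>(\<theta>) satisfies d/d\<theta> =
    \<omega> r d/dr, where \<omega> is \<open>tangent\<close>. For (r s)^2 with s =
    \<open>slope\<close> this says that \<open>q\<close> has r-derivative r \<open>D\<close>, where
    \<open>D\<close> is the \<theta>-derivative of Im (s^2).\<close>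
  define D where "D p = Im (2 * (?s p * ((of_real (fst p) * curv p + ?s p) * tangent \<xi> (snd p))))" for p
  have cD: "continuous_on ({0<..<1} \<times> UNIV) D"
    unfolding D_def
    by (intro continuous_intros continuous_curv continuous_on_subset[OF cs] ct) auto
  define q where "q p = (fst p)\<^sup>2 * Im ((?s p)\<^sup>2 * tangent \<xi> (snd p))" for p
  have cq: "continuous_on ({0..1} \<times> UNIV) q"
    unfolding q_def by (intro continuous_intros cs ct)
  have dr: "((\<lambda>r. q (r, \<theta>)) has_real_derivative r * D (r, \<theta>)) (at r)" if "0 < r" "r < 1" for r \<theta>
  proof -
    have o: "((\<lambda>r. complex_of_real r) has_vector_derivative of_real 1) (at r)"
      by (rule has_vector_derivative_of_real) (auto intro!: derivative_eq_intros)
    have f: "((\<lambda>r. of_real r * ?s (r, \<theta>)) has_vector_derivative of_real r * curv (r, \<theta>) + of_real 1 * ?s (r, \<theta>)) (at r)"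
      by (rule has_vector_derivative_mult[OF o slope_deriv_r[OF that]])
    from has_vector_derivative_mult_left[OF has_vector_derivative_mult[OF f f], of "tangent \<xi> \<theta>"]
    have "((\<lambda>r. Im (of_real r * ?s (r, \<theta>) * (of_real r * ?s (r, \<theta>)) * tangent \<xi> \<theta>)) has_real_derivative
       Im ((of_real r * ?s (r, \<theta>) * (of_real r * curv (r, \<theta>) + of_real 1 * ?s (r, \<theta>)) +
         (of_real r * curv (r, \<theta>) + of_real 1 * ?s (r, \<theta>)) * (of_real r * ?s (r, \<theta>))) * tangent \<xi> \<theta>)) (at r)"
      unfolding has_vector_derivative_complex_iff by blast
    moreover have "Im (of_real r * ?s (r, \<theta>) * (of_real r * ?s (r, \<theta>)) * tangent \<xi> \<theta>) = q (r, \<theta>)" for r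
    proof -
      have "of_real r * ?s (r, \<theta>) * (of_real r * ?s (r, \<theta>)) * tangent \<xi> \<theta> = of_real (r\<^sup>2) * ((?s (r, \<theta>))\<^sup>2 * tangent \<xi> \<theta>)"
        by (simp add: power2_eq_square)
      then show ?thesis by (simp only: q_def fst_conv snd_conv times_complex.sel Re_complex_of_real Im_complex_of_real)
    qed
    moreover have "Im ((of_real r * ?s (r, \<theta>) * (of_real r * curv (r, \<theta>) + of_real 1 * ?s (r, \<theta>)) +
         (of_real r * curv (r, \<theta>) + of_real 1 * ?s (r, \<theta>)) * (of_real r * ?s (r, \<theta>))) * tangent \<xi> \<theta>) = r * D (r, \<theta>)"
    proof -
      have "(of_real r * ?s (r, \<theta>) * (of_real r * curv (r, \<theta>) + of_real 1 * ?s (r, \<theta>)) +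
         (of_real r * curv (r, \<theta>) + of_real 1 * ?s (r, \<theta>)) * (of_real r * ?s (r, \<theta>))) * tangent \<xi> \<theta> =
         of_real r * (2 * (?s (r, \<theta>) * ((of_real r * curv (r, \<theta>) + ?s (r, \<theta>)) * tangent \<xi> \<theta>)))"
        by (simp add: algebra_simps)
      then show ?thesis by (simp only: D_def fst_conv snd_conv times_complex.sel Re_complex_of_real Im_complex_of_real)
    qed
    ultimately show ?thesis by simp
  qed
  have d\<theta>: "((\<lambda>\<theta>. Im ((?s (r, \<theta>))\<^sup>2)) has_real_derivative D (r, \<theta>)) (at \<theta>)" if "0 < r" "r < 1" for r \<theta>
  proof -
    have "0 \<le> r" using that by simp
    note d = slope_deriv_angle[OF this that(2), of \<theta>]
    from has_vector_derivative_mult[OF d d]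
    have "((\<lambda>\<theta>. Im (?s (r, \<theta>) * ?s (r, \<theta>))) has_real_derivative
       Im (?s (r, \<theta>) * ((of_real r * curv (r, \<theta>) + ?s (r, \<theta>)) * tangent \<xi> \<theta>) + ((of_real r * curv (r, \<theta>) + ?s (r, \<theta>)) * tangent \<xi> \<theta>) * ?s (r, \<theta>))) (at \<theta>)"
      unfolding has_vector_derivative_complex_iff by blast
    moreover have "?s (r, \<theta>) * ((of_real r * curv (r, \<theta>) + ?s (r, \<theta>)) * tangent \<xi> \<theta>) + ((of_real r * curv (r, \<theta>) + ?s (r, \<theta>)) * tangent \<xi> \<theta>) * ?s (r, \<theta>) =
        2 * (?s (r, \<theta>) * ((of_real r * curv (r, \<theta>) + ?s (r, \<theta>)) * tangent \<xi> \<theta>))" by simp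
    ultimately show ?thesis unfolding D_def power2_eq_square fst_conv snd_conv by metis
  qed
  define M where "M r = integral {0..2 * pi} (\<lambda>\<theta>. h \<theta> * q (r, \<theta>))" for r
  define N where "N r = integral {0..2 * pi} (\<lambda>\<theta>. (- 2) * (r * (deriv h \<theta> * (Re (?s (r, \<theta>)) * Im (?s (r, \<theta>))))))" for r
  have "(N has_integral M 1 - M 0) {0..1}"
  proof (rule fundamental_theorem_of_calculus_interior)
    show "continuous_on {0..1} M"
      unfolding M_def cbox_interval[of 0 "2 * pi", symmetric]
    proof (rule integral_continuous_on_param)
      have "continuous_on ({0..1} \<times> UNIV) (\<lambda>p. h (snd p) * q p)" by (intro continuous_intros chp cq)
      then have "continuous_on ({0..1} \<times> cbox 0 (2 * pi)) (\<lambda>p. h (snd p) * q p)" by (rule continuous_on_subset) auto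
      then show "continuous_on ({0..1} \<times> cbox 0 (2 * pi)) (\<lambda>(r, \<theta>). h \<theta> * q (r, \<theta>))"
        by (simp add: case_prod_unfold)
    qed
    fix r :: real assume "r \<in> {0<..<1}"
    then have r: "0 < r" "r < 1" by auto
    have "((\<lambda>r. integral (cbox 0 (2 * pi)) (\<lambda>\<theta>. h \<theta> * q (r, \<theta>))) has_real_derivative
        integral (cbox 0 (2 * pi)) (\<lambda>\<theta>. h \<theta> * (r * D (r, \<theta>)))) (at r within {0<..<1})"
    proof (rule leibniz_rule_field_derivative)
      fix r' \<theta> :: real assume "r' \<in> {0<..<1}"
      then have r': "0 < r'" "r' < 1" by auto
      show "((\<lambda>r. h \<theta> * q (r, \<theta>)) has_real_derivative h \<theta> * (r' * D (r', \<theta>))) (at r' within {0<..<1})"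
        by (rule has_field_derivative_at_within[OF DERIV_cmult[OF dr[OF r']]])
    next
      fix r' :: real assume "r' \<in> {0<..<1}"
      then show "(\<lambda>\<theta>. h \<theta> * q (r', \<theta>)) integrable_on cbox 0 (2 * pi)"
        unfolding cbox_interval
        by (intro integrable_continuous_interval continuous_intros ch continuous_angular[OF cq]) auto
    next
      have "continuous_on ({0<..<1} \<times> UNIV) (\<lambda>p. h (snd p) * (fst p * D p))"
        by (intro continuous_intros cD chp)
      then have "continuous_on ({0<..<1} \<times> cbox 0 (2 * pi)) (\<lambda>p. h (snd p) * (fst p * D p))" by (rule continuous_on_subset) auto
      then show "continuous_on ({0<..<1} \<times> cbox 0 (2 * pi)) (\<lambda>(r, \<theta>). h \<theta> * (r * D (r, \<theta>)))"
        by (simp add: case_prod_unfold)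
    qed (use r in auto)
    moreover have "at r within {0<..<1} = at r" by (rule at_within_open) (use r in auto)
    ultimately have dM: "(M has_real_derivative integral {0..2 * pi} (\<lambda>\<theta>. h \<theta> * (r * D (r, \<theta>)))) (at r)"
      by (simp add: M_def[abs_def] cbox_interval)
    have r01: "0 \<le> r" "r \<le> 1" using r by auto
    have cDr: "continuous_on S (\<lambda>\<theta>. D (r, \<theta>))" for S
      by (rule continuous_on_compose2[OF cD]) (use r in \<open>auto intro!: continuous_intros\<close>)
    have per: "Im ((?s (r, 2 * pi))\<^sup>2) = Im ((?s (r, 0))\<^sup>2)"
      using slope_periodic[of r 0] by simp
    have "integral {0..2 * pi} (\<lambda>\<theta>. h \<theta> * D (r, \<theta>)) = - integral {0..2 * pi} (\<lambda>\<theta>. deriv h \<theta> * Im ((?s (r, \<theta>))\<^sup>2))"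
      by (rule circle_parts[OF dh ch' perh d\<theta>[OF r] cDr per])
    then have "r * integral {0..2 * pi} (\<lambda>\<theta>. h \<theta> * D (r, \<theta>)) = (- r) * integral {0..2 * pi} (\<lambda>\<theta>. deriv h \<theta> * Im ((?s (r, \<theta>))\<^sup>2))"
      by simp
    then have "integral {0..2 * pi} (\<lambda>\<theta>. r * (h \<theta> * D (r, \<theta>))) = integral {0..2 * pi} (\<lambda>\<theta>. (- r) * (deriv h \<theta> * Im ((?s (r, \<theta>))\<^sup>2)))"
      unfolding integral_mult_right .
    also have "\<dots> = N r"
      unfolding N_def by (rule integral_cong) (simp add: power2_eq_square algebra_simps)
    finally have "integral {0..2 * pi} (\<lambda>\<theta>. h \<theta> * (r * D (r, \<theta>))) = N r" by (simp only: mult.left_commute)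
    then show "(M has_vector_derivative N r) (at r)"
      using dM by (simp add: has_real_derivative_iff_has_vector_derivative)
  qed simp
  then have "integral {0..1} N = M 1" by (simp add: integral_unique M_def q_def)
  moreover have "strip_integral (\<lambda>p. (- 2) * (fst p * (deriv h (snd p) * (Re (?s p) * Im (?s p))))) = integral {0..1} N"
    unfolding N_def by (subst strip_integral_iterated) (intro continuous_intros cs chp, simp)
  ultimately have "(- 2) * strip_integral (\<lambda>p. fst p * (deriv h (snd p) * (Re (?s p) * Im (?s p)))) = M 1"
    unfolding strip_integral_def integral_mult_right by simp
  then show ?thesis by (simp add: M_def q_def)
qed

end


section \<open>The derivative of the kinetic energy\<close>

lemma smooth_circle_combination:
  assumes f: "f \<in> smooth_circle" and g: "g \<in> smooth_circle"
  shows "(\<lambda>\<theta>. f \<theta> + \<epsilon> * g \<theta>) \<in> smooth_circle"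
    and "deriv (\<lambda>\<theta>. f \<theta> + \<epsilon> * g \<theta>) = (\<lambda>\<theta>. deriv f \<theta> + \<epsilon> * deriv g \<theta>)"
proof -
  have D: "((\<lambda>\<theta>. (deriv ^^ n) f \<theta> + \<epsilon> * (deriv ^^ n) g \<theta>) has_real_derivative
      (deriv ^^ Suc n) f x + \<epsilon> * (deriv ^^ Suc n) g x) (at x)" for n x
    by (intro DERIV_add DERIV_cmult smooth_circleD f g)
  have eq: "(deriv ^^ n) (\<lambda>\<theta>. f \<theta> + \<epsilon> * g \<theta>) = (\<lambda>\<theta>. (deriv ^^ n) f \<theta> + \<epsilon> * (deriv ^^ n) g \<theta>)" for n
  proof (induction n)
    case (Suc n)
    have "(deriv ^^ Suc n) (\<lambda>\<theta>. f \<theta> + \<epsilon> * g \<theta>) = deriv ((deriv ^^ n) (\<lambda>\<theta>. f \<theta> + \<epsilon> * g \<theta>))" by simp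
    also have "\<dots> = deriv (\<lambda>\<theta>. (deriv ^^ n) f \<theta> + \<epsilon> * (deriv ^^ n) g \<theta>)" by (simp only: Suc)
    also have "\<dots> = (\<lambda>\<theta>. (deriv ^^ Suc n) f \<theta> + \<epsilon> * (deriv ^^ Suc n) g \<theta>)"
      by (intro ext DERIV_imp_deriv D)
    finally show ?case .
  qed simp
  show "(\<lambda>\<theta>. f \<theta> + \<epsilon> * g \<theta>) \<in> smooth_circle"
    unfolding smooth_circle_def mem_Collect_eq eq
  proof (intro conjI allI)
    show "periodic (\<lambda>\<theta>. f \<theta> + \<epsilon> * g \<theta>)"
      using smooth_circleD(3)[OF f, of 0] smooth_circleD(3)[OF g, of 0] by (simp add: periodic_def)
    show "(\<lambda>\<theta>. (deriv ^^ n) f \<theta> + \<epsilon> * (deriv ^^ n) g \<theta>) differentiable at \<theta>" for n \<theta>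
      using D real_differentiable_def by blast
  qed
  show "deriv (\<lambda>\<theta>. f \<theta> + \<epsilon> * g \<theta>) = (\<lambda>\<theta>. deriv f \<theta> + \<epsilon> * deriv g \<theta>)"
    using eq[of 1] by simp
qed

lemma smooth_circle_facts:
  assumes "f \<in> smooth_circle"
  shows "(f has_real_derivative deriv f x) (at x)" "continuous_on S f" "continuous_on S (deriv f)"
    "f (x + 2 * pi) = f x" "deriv f (x + 2 * pi) = deriv f x"
    "(deriv f has_real_derivative deriv (deriv f) x) (at x)" "continuous_on S (deriv (deriv f))" "deriv (deriv f) (x + 2 * pi) = deriv (deriv f) x"
  using smooth_circleD(1)[OF assms, of 0 x] smooth_circleD(2)[OF assms, of S 0] smooth_circleD(2)[OF assms, of S 1]
    smooth_circleD(3)[OF assms, of 0] smooth_circleD(3)[OF assms, of 1] smooth_circleD(1)[OF assms, of 1 x]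
    smooth_circleD(2)[OF assms, of S 2] smooth_circleD(3)[OF assms, of 2]
  by (simp_all add: periodic_def numeral_2_eq_2)

text \<open>\<open>U - L\<close> is nonnegative with minimum 0 at the origin, so its derivative
  there vanishes and the gap is of lower order than x. Hence only the derivative of the lower bound
  has to be computed.\<close>

lemma squeeze_derivative:
  fixes K :: "real \<Rightarrow> real"
  assumes low: "\<And>x. L x \<le> K x" and up: "\<And>x. K x \<le> U x" and eq: "L 0 = K 0" "U 0 = K 0"
    and L: "(L has_real_derivative l) (at 0)" and U: "(U has_real_derivative u) (at 0)"
  shows "(K has_real_derivative l) (at 0)"
proof -
  have D: "((\<lambda>x. U x - L x) has_real_derivative u - l) (at 0)" by (rule DERIV_diff[OF U L])
  have nonneg: "0 \<le> U x - L x" for x using low[of x] up[of x] by linarith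
  have "u - l = 0"
    by (rule DERIV_local_min[OF D zero_less_one]) (use nonneg eq in auto)
  with D have "((\<lambda>x. U x - L x) has_real_derivative 0) (at 0)" by simp
  then have lim: "((\<lambda>h. (U h - L h) / h) \<longlongrightarrow> 0) (at 0)"
    using eq by (simp add: DERIV_def)
  have "((\<lambda>h. (K h - L h) / h) \<longlongrightarrow> 0) (at 0)"
  proof (rule Lim_null_comparison[OF always_eventually])
    show "((\<lambda>h. norm ((U h - L h) / h)) \<longlongrightarrow> 0) (at 0)" by (rule tendsto_norm_zero[OF lim])
    show "\<forall>h. norm ((K h - L h) / h) \<le> norm ((U h - L h) / h)"
      using low up by (auto simp: abs_divide intro!: divide_right_mono) (smt (verit, best))
  qed
  then have "((\<lambda>x. K x - L x) has_real_derivative 0) (at 0)" using eq by (simp add: DERIV_def)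
  from DERIV_add[OF this L] show ?thesis by simp
qed

lemma strip_leibniz:
  fixes f :: "real \<Rightarrow> real \<times> real \<Rightarrow> real"
  assumes d: "\<And>\<epsilon> p. ((\<lambda>\<epsilon>. f \<epsilon> p) has_real_derivative f' \<epsilon> p) (at \<epsilon>)"
    and c: "\<And>\<epsilon>. continuous_on ({0..1} \<times> UNIV) (f \<epsilon>)"
    and c': "continuous_on (UNIV \<times> ({0..1} \<times> UNIV)) (\<lambda>q. f' (fst q) (snd q))"
  shows "((\<lambda>\<epsilon>. strip_integral (f \<epsilon>)) has_real_derivative strip_integral (f' \<epsilon>)) (at \<epsilon>)"
proof -
  have "((\<lambda>\<epsilon>. integral (cbox (0, 0) (1, 2 * pi)) (f \<epsilon>)) has_real_derivative integral (cbox (0, 0) (1, 2 * pi)) (f' \<epsilon>)) (at \<epsilon> within UNIV)"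
  proof (rule leibniz_rule_field_derivative)
    show "f \<epsilon> integrable_on cbox (0, 0) (1, 2 * pi)" for \<epsilon> by (rule strip_integrable[OF c])
    have "continuous_on (UNIV \<times> cbox (0, 0) (1, 2 * pi)) (\<lambda>q. f' (fst q) (snd q))"
      by (rule continuous_on_subset[OF c']) (auto simp: strip_box)
    then show "continuous_on (UNIV \<times> cbox (0, 0) (1, 2 * pi)) (\<lambda>(\<epsilon>, p). f' \<epsilon> p)" by (simp add: case_prod_unfold)
  qed (use d in auto)
  then show ?thesis by (simp add: strip_integral_def)
qed

text \<open>Boundary data \<open>k\<close> is extended as r k(\<theta>): the r-derivative k and the
  angular derivative divided by r, which is k', are continuous at r = 0.\<close>

lemma trial_add_ray:
  assumes t: "trial P x y" and k: "k \<in> smooth_circle"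
  shows "trial (\<lambda>p. P p + \<epsilon> * (fst p * k (snd p))) (\<lambda>p. x p + \<epsilon> * k (snd p)) (\<lambda>p. y p + \<epsilon> * deriv k (snd p))"
proof -
  note kf = smooth_circle_facts[OF k]
  have ck: "continuous_on S (\<lambda>p. k (snd p))" "continuous_on S (\<lambda>p. deriv k (snd p))" for S :: "(real \<times> real) set"
    by (rule continuous_on_compose2[OF kf(2)[of UNIV]] continuous_on_compose2[OF kf(3)[of UNIV]]; auto intro!: continuous_intros)+
  show ?thesis
    unfolding trial_def
  proof (intro conjI allI impI)
    show "continuous_on ({0..1} \<times> UNIV) (\<lambda>p. P p + \<epsilon> * (fst p * k (snd p)))"
      "continuous_on ({0..1} \<times> UNIV) (\<lambda>p. x p + \<epsilon> * k (snd p))"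
      "continuous_on ({0..1} \<times> UNIV) (\<lambda>p. y p + \<epsilon> * deriv k (snd p))"
      using t by (auto simp: trial_def intro!: continuous_intros ck)
    show "P (r, \<theta> + 2 * pi) + \<epsilon> * (fst (r, \<theta> + 2 * pi) * k (snd (r, \<theta> + 2 * pi))) = P (r, \<theta>) + \<epsilon> * (fst (r, \<theta>) * k (snd (r, \<theta>)))" for r \<theta>
      using t by (simp add: trial_def kf)
    fix r \<theta> :: real assume r: "0 < r" "r < 1"
    have "((\<lambda>r. P (r, \<theta>)) has_real_derivative x (r, \<theta>)) (at r)" "((\<lambda>\<theta>. P (r, \<theta>)) has_real_derivative r * y (r, \<theta>)) (at \<theta>)"
      using t r by (auto simp: trial_def)
    then show "((\<lambda>r. P (r, \<theta>) + \<epsilon> * (fst (r, \<theta>) * k (snd (r, \<theta>)))) has_real_derivative x (r, \<theta>) + \<epsilon> * k (snd (r, \<theta>))) (at r)"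
      "((\<lambda>\<theta>. P (r, \<theta>) + \<epsilon> * (fst (r, \<theta>) * k (snd (r, \<theta>)))) has_real_derivative r * (y (r, \<theta>) + \<epsilon> * deriv k (snd (r, \<theta>)))) (at \<theta>)"
      by (auto intro!: derivative_eq_intros kf(1) simp: algebra_simps)
  qed
qed

text \<open>With s = u + i v the hypothesis reads P = u x - v and G = u + v x, so G + x P = u (1 +
  x^2). This recognises the boundary stress as the Bernoulli terms of the drop equation.\<close>

lemma boundary_quadratic:
  fixes P G x :: real and s :: complex
  assumes "s * Complex x 1 = Complex P G"
  shows "- Im (s\<^sup>2 * Complex x 1) / 2 = P\<^sup>2 / 2 - ((G + x * P) / sqrt (1 + x\<^sup>2))\<^sup>2 / 2"
proof -
  have pos: "1 + x\<^sup>2 > 0" by (simp add: add_pos_nonneg)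
  have nz: "Complex x 1 \<noteq> 0" by (simp add: complex_eq_iff)
  obtain u v where s: "s = Complex u v" by (cases s)
  have P: "P = u * x - v" and G: "G = u + v * x" using assms by (simp_all add: s complex_eq_iff)
  have "G + x * P = u * (1 + x\<^sup>2)" by (simp add: P G power2_eq_square algebra_simps)
  then have "((G + x * P) / sqrt (1 + x\<^sup>2))\<^sup>2 = u\<^sup>2 * (1 + x\<^sup>2)"
    using pos by (simp add: power_divide power_mult_distrib) (simp add: power2_eq_square)
  then show ?thesis by (simp add: s P power2_eq_square algebra_simps add_divide_distrib diff_divide_distrib)
qed

text \<open>Two uses of \<open>energy_dual\<close> with the perturbed slope. The unperturbed stream
  function tested with the perturbed potential gives \<open>L\<close>; the trial potential Re a +
  \<epsilon> r k tested with the perturbed stream function gives 2 K \<le> U + K. Equality at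
  \<epsilon> = 0 is \<open>energy_eq\<close>.\<close>

lemma kinetic_derivative:
  assumes \<xi>: "\<xi> \<in> smooth_circle" and \<psi>: "\<psi> \<in> smooth_circle" and h: "h \<in> smooth_circle" and k: "k \<in> smooth_circle"
  shows "((\<lambda>\<epsilon>. integral {0..2 * pi} (\<lambda>\<theta>. (\<psi> \<theta> + \<epsilon> * k \<theta>) * G_op (\<lambda>\<theta>. \<xi> \<theta> + \<epsilon> * h \<theta>) (\<lambda>\<theta>. \<psi> \<theta> + \<epsilon> * k \<theta>) \<theta>) / 2)
     has_real_derivative
       integral {0..2 * pi} (\<lambda>\<theta>. k \<theta> * G_op \<xi> \<psi> \<theta>) +
       integral {0..2 * pi} (\<lambda>\<theta>. h \<theta> * ((deriv \<psi> \<theta>)\<^sup>2 / 2 - ((G_op \<xi> \<psi> \<theta> + deriv \<xi> \<theta> * deriv \<psi> \<theta>) / sqrt (1 + (deriv \<xi> \<theta>)\<^sup>2))\<^sup>2 / 2))) (at 0)"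
proof -
  obtain A a b where cp: "conj_potential \<xi> \<psi> A a b" using conj_potential_exists[OF \<xi> \<psi>] by blast
  define x\<^sub>e where "x\<^sub>e \<epsilon> \<theta> = \<xi> \<theta> + \<epsilon> * h \<theta>" for \<epsilon> \<theta>
  define p\<^sub>e where "p\<^sub>e \<epsilon> \<theta> = \<psi> \<theta> + \<epsilon> * k \<theta>" for \<epsilon> \<theta>
  have xe: "x\<^sub>e \<epsilon> \<in> smooth_circle" "deriv (x\<^sub>e \<epsilon>) = (\<lambda>\<theta>. deriv \<xi> \<theta> + \<epsilon> * deriv h \<theta>)" for \<epsilon>
    unfolding x\<^sub>e_def by (rule smooth_circle_combination[OF \<xi> h])+
  have pe: "p\<^sub>e \<epsilon> \<in> smooth_circle" for \<epsilon>
    unfolding p\<^sub>e_def by (rule smooth_circle_combination[OF \<psi> k])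
  define K where "K \<epsilon> = integral {0..2 * pi} (\<lambda>\<theta>. p\<^sub>e \<epsilon> \<theta> * G_op (x\<^sub>e \<epsilon>) (p\<^sub>e \<epsilon>) \<theta>) / 2" for \<epsilon>
  note kf = smooth_circle_facts[OF k] and hf = smooth_circle_facts[OF h] and \<xi>f = smooth_circle_facts[OF \<xi>] and \<psi>f = smooth_circle_facts[OF \<psi>]
  define s where "s = slope \<xi> b"
  define \<omega> where "\<omega> = tangent \<xi>"
  have cs: "continuous_on ({0..1} \<times> UNIV) s" unfolding s_def by (rule continuous_slope[OF \<xi> cp])
  have c\<omega>: "continuous_on S \<omega>" for S unfolding \<omega>_def by (rule continuous_tangent[OF \<xi> cp])
  define g where "g = G_op \<xi> \<psi>"
  have g: "g = (\<lambda>\<theta>. Im (s (1, \<theta>) * \<omega> \<theta>))" unfolding g_def s_def \<omega>_def by (rule Dirichlet_G[OF \<xi> cp])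
  have cg: "continuous_on S g" for S
    unfolding g by (intro continuous_intros continuous_angular[OF cs] c\<omega>) auto
  define X where "X p = Im (s p)" for p
  define Y where "Y p = Im (s p * \<omega> (snd p))" for p
  define x where "x p = Re (s p)" for p
  define y where "y p = Re (s p * \<omega> (snd p))" for p
  have cXY: "continuous_on ({0..1} \<times> UNIV) X" "continuous_on ({0..1} \<times> UNIV) Y" "continuous_on ({0..1} \<times> UNIV) x" "continuous_on ({0..1} \<times> UNIV) y"
    unfolding X_def Y_def x_def y_def by (intro continuous_intros cs continuous_on_compose2[OF c\<omega>[of UNIV]]; auto)+
  define E where "E \<epsilon> = (\<lambda>\<theta>. deriv \<xi> \<theta> + \<epsilon> * deriv h \<theta>)" for \<epsilon>
  have cE: "continuous_on UNIV (E \<epsilon>)" for \<epsilon> unfolding E_def by (intro continuous_intros \<xi>f hf)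
  \<comment> \<open>In \<open>L\<close> and \<open>U\<close> the functions of the perturbed problem
    no longer occur; \<epsilon> enters only through the slope and the boundary data,
    polynomially.\<close>
  define L where "L \<epsilon> = integral {0..2 * pi} (\<lambda>\<theta>. p\<^sub>e \<epsilon> \<theta> * g \<theta>) - energy (E \<epsilon>) X Y" for \<epsilon>
  define U where "U \<epsilon> = energy (E \<epsilon>) (\<lambda>p. x p + \<epsilon> * k (snd p)) (\<lambda>p. y p + \<epsilon> * deriv k (snd p))" for \<epsilon>
  have low: "L \<epsilon> \<le> K \<epsilon>" and up: "K \<epsilon> \<le> U \<epsilon>" for \<epsilon>
  proof -
    obtain A' a' b' where cp': "conj_potential (x\<^sub>e \<epsilon>) (p\<^sub>e \<epsilon>) A' a' b'" using conj_potential_exists[OF xe(1) pe] by blast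
    have de: "deriv (x\<^sub>e \<epsilon>) = E \<epsilon>" by (simp add: xe E_def)
    show "L \<epsilon> \<le> K \<epsilon>"
      using energy_dual[OF \<xi> cp trial_parts(1)[OF xe(1) cp'] cE[of \<epsilon>]] energy_eq(2)[OF xe(1) cp']
      by (simp add: Re_boundary[OF xe(1) cp'] L_def K_def X_def[abs_def] Y_def[abs_def] s_def \<omega>_def g_def de)
    have tr: "trial (\<lambda>p. Re (a p) + \<epsilon> * (fst p * k (snd p))) (\<lambda>p. x p + \<epsilon> * k (snd p)) (\<lambda>p. y p + \<epsilon> * deriv k (snd p))"
      using trial_add_ray[OF trial_parts(1)[OF \<xi> cp] k] by (simp add: x_def[abs_def] y_def[abs_def] s_def \<omega>_def)
    have "(\<lambda>\<theta>. Re (a (1, \<theta>)) + \<epsilon> * (fst (1::real, \<theta>) * k (snd (1::real, \<theta>)))) = p\<^sub>e \<epsilon>"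
      by (simp add: fun_eq_iff p\<^sub>e_def Re_boundary[OF \<xi> cp])
    then show "K \<epsilon> \<le> U \<epsilon>"
      using energy_dual[OF xe(1) cp' tr cE[of \<epsilon>]] energy_eq(1)[OF xe(1) cp']
      by (simp add: U_def K_def de fun_eq_iff)
  qed
  have E0: "E 0 = deriv \<xi>" "x\<^sub>e 0 = \<xi>" "p\<^sub>e 0 = \<psi>" by (simp_all add: E_def x\<^sub>e_def[abs_def] p\<^sub>e_def[abs_def] fun_eq_iff)
  have L0: "L 0 = K 0"
    using energy_eq(1)[OF \<xi> cp] by (simp add: L_def K_def E0 X_def[abs_def] Y_def[abs_def] s_def \<omega>_def g_def)
  have U0: "U 0 = K 0"
    using energy_eq(2)[OF \<xi> cp] by (simp add: U_def K_def E0 x_def[abs_def] y_def[abs_def] s_def \<omega>_def)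
  have snd_c: "continuous_on S (\<lambda>q. f (snd (snd q)))" if "continuous_on UNIV f" for f :: "real \<Rightarrow> real" and S :: "(real \<times> real \<times> real) set"
    by (rule continuous_on_compose2[OF that]) (auto intro!: continuous_intros)
  have snd_s: "continuous_on (UNIV \<times> ({0..1} \<times> UNIV)) (\<lambda>q. f (snd q))" if "continuous_on ({0..1} \<times> UNIV) f" for f :: "real \<times> real \<Rightarrow> real"
    by (rule continuous_on_compose2[OF that]) (auto intro!: continuous_intros)
  have snd_1: "continuous_on S (\<lambda>p. f (snd p))" if "continuous_on UNIV f" for f :: "real \<Rightarrow> real" and S :: "(real \<times> real) set"
    by (rule continuous_on_compose2[OF that]) (auto intro!: continuous_intros)
  \<comment> \<open>Mere differentiability: \<open>squeeze_derivative\<close> forces the value to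
    coincide with that for \<open>L\<close>.\<close>
  have dU: "\<exists>u. (U has_real_derivative u) (at 0)"
  proof -
    define f where "f \<epsilon> p = fst p * ((x p + \<epsilon> * k (snd p))\<^sup>2 + (y p + \<epsilon> * deriv k (snd p) - (deriv \<xi> (snd p) + \<epsilon> * deriv h (snd p)) * (x p + \<epsilon> * k (snd p)))\<^sup>2)" for \<epsilon> p
    define f' where "f' \<epsilon> p = fst p * (2 * (x p + \<epsilon> * k (snd p)) * k (snd p) +
        2 * (y p + \<epsilon> * deriv k (snd p) - (deriv \<xi> (snd p) + \<epsilon> * deriv h (snd p)) * (x p + \<epsilon> * k (snd p))) *
         (deriv k (snd p) - (deriv h (snd p) * (x p + \<epsilon> * k (snd p)) + (deriv \<xi> (snd p) + \<epsilon> * deriv h (snd p)) * k (snd p))))" for \<epsilon> p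
    have "((\<lambda>\<epsilon>. strip_integral (f \<epsilon>)) has_real_derivative strip_integral (f' 0)) (at 0)"
    proof (rule strip_leibniz)
      show "((\<lambda>\<epsilon>. f \<epsilon> p) has_real_derivative f' \<epsilon> p) (at \<epsilon>)" for \<epsilon> p
        unfolding f_def f'_def
        by (intro DERIV_cmult, rule DERIV_cong[OF DERIV_add[OF DERIV_power DERIV_power]])
          (auto intro!: derivative_eq_intros simp: algebra_simps)
      show "continuous_on ({0..1} \<times> UNIV) (f \<epsilon>)" for \<epsilon>
        unfolding f_def by (intro continuous_intros cXY snd_1 kf hf \<xi>f)
      show "continuous_on (UNIV \<times> ({0..1} \<times> UNIV)) (\<lambda>q. f' (fst q) (snd q))"
        unfolding f'_def by (intro continuous_intros snd_s[OF cXY(3)] snd_s[OF cXY(4)] snd_c kf hf \<xi>f)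
    qed
    from DERIV_cdivide[OF this, of 2] show ?thesis
      by (auto simp: U_def[abs_def] energy_def E_def f_def[abs_def])
  qed
  then obtain u where u: "(U has_real_derivative u) (at 0)" by blast
  have Yx: "Y p - deriv \<xi> (snd p) * X p = Re (s p)" for p
    by (simp add: Y_def X_def \<omega>_def tangent_def)
  have dL: "(L has_real_derivative integral {0..2 * pi} (\<lambda>\<theta>. k \<theta> * g \<theta>) +
      strip_integral (\<lambda>p. fst p * (deriv h (snd p) * (Re (s p) * Im (s p))))) (at 0)"
  proof -
    define f where "f \<epsilon> p = fst p * ((X p)\<^sup>2 + (Y p - (deriv \<xi> (snd p) + \<epsilon> * deriv h (snd p)) * X p)\<^sup>2)" for \<epsilon> p
    define f' where "f' \<epsilon> p = fst p * (2 * (Y p - (deriv \<xi> (snd p) + \<epsilon> * deriv h (snd p)) * X p) * (- (deriv h (snd p) * X p)))" for \<epsilon> p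
    have 1: "((\<lambda>\<epsilon>. strip_integral (f \<epsilon>)) has_real_derivative strip_integral (f' 0)) (at 0)"
    proof (rule strip_leibniz)
      show "((\<lambda>\<epsilon>. f \<epsilon> p) has_real_derivative f' \<epsilon> p) (at \<epsilon>)" for \<epsilon> p
        unfolding f_def f'_def by (auto intro!: derivative_eq_intros)
      show "continuous_on ({0..1} \<times> UNIV) (f \<epsilon>)" for \<epsilon>
        unfolding f_def by (intro continuous_intros cXY snd_1 kf hf \<xi>f)
      show "continuous_on (UNIV \<times> ({0..1} \<times> UNIV)) (\<lambda>q. f' (fst q) (snd q))"
        unfolding f'_def by (intro continuous_intros snd_s[OF cXY(1)] snd_s[OF cXY(2)] snd_c kf hf \<xi>f)
    qed
    have f0: "f' 0 = (\<lambda>p. (- 2) * (fst p * (deriv h (snd p) * (Re (s p) * Im (s p)))))"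
    proof
      fix p
      have "f' 0 p = fst p * (2 * (Y p - deriv \<xi> (snd p) * X p) * (- (deriv h (snd p) * X p)))"
        by (simp add: f'_def)
      then show "f' 0 p = (- 2) * (fst p * (deriv h (snd p) * (Re (s p) * Im (s p))))"
        unfolding Yx by (simp add: X_def)
    qed
    have "strip_integral (f' 0) / 2 = - strip_integral (\<lambda>p. fst p * (deriv h (snd p) * (Re (s p) * Im (s p))))"
      unfolding f0 strip_integral_def integral_mult_right by simp
    with DERIV_cdivide[OF 1, of 2]
    have 2: "((\<lambda>\<epsilon>. energy (E \<epsilon>) X Y) has_real_derivative - strip_integral (\<lambda>p. fst p * (deriv h (snd p) * (Re (s p) * Im (s p))))) (at 0)"
      by (simp add: energy_def E_def f_def[abs_def])
    have "integral {0..2 * pi} (\<lambda>\<theta>. p\<^sub>e \<epsilon> \<theta> * g \<theta>) = integral {0..2 * pi} (\<lambda>\<theta>. \<psi> \<theta> * g \<theta>) + \<epsilon> * integral {0..2 * pi} (\<lambda>\<theta>. k \<theta> * g \<theta>)" for \<epsilon>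
    proof -
      have i: "(\<lambda>\<theta>. \<psi> \<theta> * g \<theta>) integrable_on {0..2 * pi}" "(\<lambda>\<theta>. \<epsilon> * (k \<theta> * g \<theta>)) integrable_on {0..2 * pi}"
        by (intro integrable_continuous_interval continuous_intros \<psi>f kf cg)+
      have "(\<lambda>\<theta>. p\<^sub>e \<epsilon> \<theta> * g \<theta>) = (\<lambda>\<theta>. \<psi> \<theta> * g \<theta> + \<epsilon> * (k \<theta> * g \<theta>))"
        by (simp add: fun_eq_iff p\<^sub>e_def algebra_simps)
      then show ?thesis using integral_add[OF i] by simp
    qed
    then have "((\<lambda>\<epsilon>. integral {0..2 * pi} (\<lambda>\<theta>. p\<^sub>e \<epsilon> \<theta> * g \<theta>)) has_real_derivative integral {0..2 * pi} (\<lambda>\<theta>. k \<theta> * g \<theta>)) (at 0)"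
      by (auto intro!: derivative_eq_intros)
    from DERIV_diff[OF this 2] show ?thesis by (simp add: L_def[abs_def])
  qed
  have "(K has_real_derivative integral {0..2 * pi} (\<lambda>\<theta>. k \<theta> * g \<theta>) +
      strip_integral (\<lambda>p. fst p * (deriv h (snd p) * (Re (s p) * Im (s p))))) (at 0)"
    by (rule squeeze_derivative[OF low up L0 U0 dL u])
  also have "strip_integral (\<lambda>p. fst p * (deriv h (snd p) * (Re (s p) * Im (s p)))) =
      - integral {0..2 * pi} (\<lambda>\<theta>. h \<theta> * Im ((s (1, \<theta>))\<^sup>2 * \<omega> \<theta>)) / 2"
    unfolding s_def \<omega>_def by (rule stress_identity[OF \<xi> cp h])
  also have "\<dots> = integral {0..2 * pi} (\<lambda>\<theta>. (- 1 / 2) * (h \<theta> * Im ((s (1, \<theta>))\<^sup>2 * \<omega> \<theta>)))"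
    unfolding integral_mult_right by simp
  also have "\<dots> = integral {0..2 * pi} (\<lambda>\<theta>. h \<theta> * ((deriv \<psi> \<theta>)\<^sup>2 / 2 - ((G_op \<xi> \<psi> \<theta> + deriv \<xi> \<theta> * deriv \<psi> \<theta>) / sqrt (1 + (deriv \<xi> \<theta>)\<^sup>2))\<^sup>2 / 2))"
  proof (rule integral_cong)
    fix \<theta>
    have "- Im ((s (1, \<theta>))\<^sup>2 * \<omega> \<theta>) / 2 = (deriv \<psi> \<theta>)\<^sup>2 / 2 - ((G_op \<xi> \<psi> \<theta> + deriv \<xi> \<theta> * deriv \<psi> \<theta>) / sqrt (1 + (deriv \<xi> \<theta>)\<^sup>2))\<^sup>2 / 2"
      unfolding \<omega>_def tangent_def
      by (rule boundary_quadratic) (use slope_boundary[OF \<xi> cp, of \<theta>] in \<open>simp add: s_def tangent_def\<close>)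
    then show "(- 1 / 2) * (h \<theta> * Im ((s (1, \<theta>))\<^sup>2 * \<omega> \<theta>)) = h \<theta> * ((deriv \<psi> \<theta>)\<^sup>2 / 2 - ((G_op \<xi> \<psi> \<theta> + deriv \<xi> \<theta> * deriv \<psi> \<theta>) / sqrt (1 + (deriv \<xi> \<theta>)\<^sup>2))\<^sup>2 / 2)"
      by (metis (no_types, lifting) divide_minus_left mult.left_commute mult_minus1 times_divide_eq_left mult_1)
  qed
  finally show ?thesis by (simp add: K_def[abs_def] x\<^sub>e_def[abs_def] p\<^sub>e_def[abs_def] g_def)
qed


section \<open>Test functions on the circle\<close>

lemma circle_leibniz:
  fixes f :: "real \<Rightarrow> real \<Rightarrow> real"
  assumes d: "\<And>\<epsilon> \<theta>. ((\<lambda>\<epsilon>. f \<epsilon> \<theta>) has_real_derivative f' \<epsilon> \<theta>) (at \<epsilon>)"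
    and c: "\<And>\<epsilon>. continuous_on UNIV (f \<epsilon>)"
    and c': "continuous_on UNIV (\<lambda>p. f' (fst p) (snd p))"
  shows "((\<lambda>\<epsilon>. circle_integral (f \<epsilon>)) has_real_derivative circle_integral (f' \<epsilon>)) (at \<epsilon>)"
proof -
  have "((\<lambda>\<epsilon>. integral (cbox 0 (2 * pi)) (f \<epsilon>)) has_real_derivative integral (cbox 0 (2 * pi)) (f' \<epsilon>)) (at \<epsilon> within UNIV)"
  proof (rule leibniz_rule_field_derivative)
    show "f \<epsilon> integrable_on cbox 0 (2 * pi)" for \<epsilon>
      unfolding cbox_interval by (intro integrable_continuous_interval continuous_on_subset[OF c]) simp
    have "continuous_on (UNIV \<times> cbox 0 (2 * pi)) (\<lambda>p. f' (fst p) (snd p))"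
      by (rule continuous_on_subset[OF c']) simp
    then show "continuous_on (UNIV \<times> cbox 0 (2 * pi)) (\<lambda>(\<epsilon>, \<theta>). f' \<epsilon> \<theta>)" by (simp add: case_prod_unfold)
  qed (use d in auto)
  then show ?thesis by (simp add: circle_integral_def[abs_def] cbox_interval)
qed

lemma circle_integral_has:
  assumes "continuous_on UNIV f"
  shows "(f has_integral circle_integral f) {0..2 * pi}"
  unfolding circle_integral_def
  by (intro integrable_integral integrable_continuous_interval continuous_on_subset[OF assms]) simp

text \<open>The derivative of \<open>cis \<theta>\<close> is \<open>\<i> * cis \<theta>\<close>,
  linear in \<open>cis \<theta>\<close>. So trigonometric polynomials are closed under
  differentiation, which makes them smooth test functions.\<close>

lemma polynomial_on_circle:
  assumes "real_polynomial_function (g :: complex \<Rightarrow> real)"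
  shows "\<exists>g'. real_polynomial_function g' \<and> (\<forall>\<theta>. ((\<lambda>\<theta>. g (cis \<theta>)) has_real_derivative g' (cis \<theta>)) (at \<theta>))"
  using assms
proof induction
  case (linear f)
  have "bounded_linear (\<lambda>z. f (\<i> * z))"
    by (rule bounded_linear_compose[OF linear bounded_linear_mult_right])
  moreover have "((\<lambda>\<theta>. f (cis \<theta>)) has_real_derivative f (\<i> * cis \<theta>)) (at \<theta>)" for \<theta>
  proof -
    have "(cis has_vector_derivative \<i> * cis \<theta>) (at \<theta>)"
      unfolding has_vector_derivative_complex_iff by (auto intro!: derivative_eq_intros)
    from bounded_linear.has_vector_derivative[OF linear this]
    show ?thesis by (simp add: has_real_derivative_iff_has_vector_derivative)
  qed
  ultimately show ?case using real_polynomial_function.intros(1) by blast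
next
  case (const c)
  have "((\<lambda>\<theta>. c) has_real_derivative 0) (at \<theta>)" for \<theta> by simp
  then show ?case using real_polynomial_function.intros(2)[of 0] by blast
next
  case (add f g)
  then obtain f' g' where "real_polynomial_function f'" "real_polynomial_function g'"
    and d: "\<And>\<theta>. ((\<lambda>\<theta>. f (cis \<theta>)) has_real_derivative f' (cis \<theta>)) (at \<theta>)"
      "\<And>\<theta>. ((\<lambda>\<theta>. g (cis \<theta>)) has_real_derivative g' (cis \<theta>)) (at \<theta>)" by blast
  then have "real_polynomial_function (\<lambda>z. f' z + g' z)" by (intro real_polynomial_function.intros(3))
  with DERIV_add[OF d] show ?case by blast
next
  case (mult f g)
  then obtain f' g' where r: "real_polynomial_function f'" "real_polynomial_function g'"
    and d: "\<And>\<theta>. ((\<lambda>\<theta>. f (cis \<theta>)) has_real_derivative f' (cis \<theta>)) (at \<theta>)"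
      "\<And>\<theta>. ((\<lambda>\<theta>. g (cis \<theta>)) has_real_derivative g' (cis \<theta>)) (at \<theta>)" by blast
  have "real_polynomial_function (\<lambda>z. f z * g' z + f' z * g z)"
    by (intro real_polynomial_function.intros(3) real_polynomial_function.intros(4) r mult(1,2))
  with DERIV_mult'[OF d] show ?case by blast
qed

lemma polynomial_smooth_circle:
  assumes "real_polynomial_function (g :: complex \<Rightarrow> real)"
  shows "(\<lambda>\<theta>. g (cis \<theta>)) \<in> smooth_circle"
proof -
  have ex: "\<exists>g'. real_polynomial_function g' \<and> (deriv ^^ n) (\<lambda>\<theta>. g (cis \<theta>)) = (\<lambda>\<theta>. g' (cis \<theta>))" for n
  proof (induction n)
    case 0
    show ?case using assms by (intro exI[of _ g]) simp
  next
    case (Suc n)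
    then obtain f where f: "real_polynomial_function f" "(deriv ^^ n) (\<lambda>\<theta>. g (cis \<theta>)) = (\<lambda>\<theta>. f (cis \<theta>))" by blast
    obtain f' where f': "real_polynomial_function f'" "\<And>\<theta>. ((\<lambda>\<theta>. f (cis \<theta>)) has_real_derivative f' (cis \<theta>)) (at \<theta>)"
      using polynomial_on_circle[OF f(1)] by blast
    have "(deriv ^^ Suc n) (\<lambda>\<theta>. g (cis \<theta>)) = deriv (\<lambda>\<theta>. f (cis \<theta>))" using f(2) by simp
    also have "\<dots> = (\<lambda>\<theta>. f' (cis \<theta>))" by (intro ext DERIV_imp_deriv f')
    finally show ?case using f'(1) by blast
  qed
  show ?thesis
    unfolding smooth_circle_def
  proof (intro CollectI conjI allI)
    show "periodic (\<lambda>\<theta>. g (cis \<theta>))" by (simp add: periodic_def cis.ctr)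
    fix n \<theta>
    obtain f where f: "real_polynomial_function f" "(deriv ^^ n) (\<lambda>\<theta>. g (cis \<theta>)) = (\<lambda>\<theta>. f (cis \<theta>))" using ex by blast
    show "(deriv ^^ n) (\<lambda>\<theta>. g (cis \<theta>)) differentiable at \<theta>"
      unfolding f(2) using polynomial_on_circle[OF f(1)] real_differentiable_def by blast
  qed
qed

text \<open>Stone-Weierstrass on the unit circle: composition with \<open>Arg\<close> turns a
  periodic function into a continuous function on the circle, and restrictions of polynomials are
  trigonometric polynomials.\<close>

lemma smooth_circle_dense:
  assumes f: "continuous_on UNIV f" "periodic f" and e: "e > 0"
  shows "\<exists>h\<in>smooth_circle. \<forall>\<theta>. \<bar>f \<theta> - h \<theta>\<bar> < e"
proof -
  have "continuous_on (sphere 0 1) (\<lambda>z. f (Arg z))"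
    using continuous_on_angle[of UNIV "\<lambda>p. f (snd p)" "sphere 0 1" "\<lambda>z. 0"] f(2)
    by (simp add: periodic_def continuous_on_compose2[OF f(1)] continuous_intros)
  then obtain g where g: "real_polynomial_function g" "\<And>z. z \<in> sphere 0 1 \<Longrightarrow> \<bar>f (Arg z) - g z\<bar> < e"
    using Stone_Weierstrass_real_polynomial_function[OF compact_sphere _ e] by blast
  have "\<bar>f \<theta> - g (cis \<theta>)\<bar> < e" for \<theta>
  proof -
    have "exp (Ln (cis \<theta>)) = exp (\<i> * of_real \<theta>)" by (simp add: cis_conv_exp)
    then obtain n :: int where "Ln (cis \<theta>) = \<i> * of_real \<theta> + (of_int (2 * n) * pi) * \<i>"
      unfolding exp_eq by blast
    then have "Arg (cis \<theta>) = \<theta> + 2 * pi * of_int n" by (simp add: Arg_def)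
    then have "f (Arg (cis \<theta>)) = f \<theta>" using periodic_int[OF f(2)] by simp
    then show ?thesis using g(2)[of "cis \<theta>"] by simp
  qed
  then show ?thesis
    by (intro bexI[of _ "\<lambda>\<theta>. g (cis \<theta>)"] polynomial_smooth_circle[OF g(1)]) simp
qed

text \<open>\<open>f\<close> itself is only continuous and cannot serve as a test function. A smooth
  h close to it can, and then the integral of f^2 equals that of f (f - h), which is arbitrarily
  small.\<close>

lemma circle_fundamental_lemma:
  assumes f: "continuous_on UNIV f" "periodic f"
    and zero: "\<And>h. h \<in> smooth_circle \<Longrightarrow> circle_integral (\<lambda>\<theta>. f \<theta> * h \<theta>) = 0"
  shows "f \<theta> = 0"
proof -
  obtain M where M: "M > 0" "\<And>x. \<bar>f x\<bar> \<le> M" using periodic_bounded[OF f(2,1)] by blast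
  have cf: "continuous_on S f" for S by (rule continuous_on_subset[OF f(1)]) simp
  have le: "circle_integral (\<lambda>\<theta>. f \<theta> * f \<theta>) \<le> 0 + e" if e: "e > 0" for e
  proof -
    \<comment> \<open>Chosen so that the bound \<open>M * d\<close> over a period of length 2 pi
      integrates to \<open>e\<close>.\<close>
    define d where "d = e / (M * (2 * pi))"
    have "d > 0" using e M by (simp add: d_def)
    then obtain h where h: "h \<in> smooth_circle" "\<And>\<theta>. \<bar>f \<theta> - h \<theta>\<bar> < d" using smooth_circle_dense[OF f] by blast
    note ch = smooth_circle_facts(2)[OF h(1)]
    have "circle_integral (\<lambda>\<theta>. f \<theta> * f \<theta>) = circle_integral (\<lambda>\<theta>. f \<theta> * h \<theta> + f \<theta> * (f \<theta> - h \<theta>))"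
      by (simp add: algebra_simps)
    also have "\<dots> = circle_integral (\<lambda>\<theta>. f \<theta> * h \<theta>) + circle_integral (\<lambda>\<theta>. f \<theta> * (f \<theta> - h \<theta>))"
      unfolding circle_integral_def by (intro integral_add integrable_continuous_interval continuous_intros cf ch)
    also have "\<dots> = circle_integral (\<lambda>\<theta>. f \<theta> * (f \<theta> - h \<theta>))" using zero[OF h(1)] by simp
    also have "\<dots> \<le> norm (circle_integral (\<lambda>\<theta>. f \<theta> * (f \<theta> - h \<theta>)))" by simp
    also have "\<dots> \<le> (M * d) * (2 * pi - 0)"
      unfolding circle_integral_def
    proof (rule integral_bound)
      show "continuous_on {0..2 * pi} (\<lambda>\<theta>. f \<theta> * (f \<theta> - h \<theta>))" by (intro continuous_intros cf ch)
      show "norm (f \<theta> * (f \<theta> - h \<theta>)) \<le> M * d" for \<theta>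
        unfolding real_norm_def abs_mult using M h(2)[of \<theta>] by (intro mult_mono) auto
    qed simp
    also have "\<dots> = e" using M by (simp add: d_def)
    finally show ?thesis by simp
  qed
  have "circle_integral (\<lambda>\<theta>. f \<theta> * f \<theta>) \<le> 0" by (rule field_le_epsilon) (rule le)
  moreover have "circle_integral (\<lambda>\<theta>. f \<theta> * f \<theta>) \<ge> 0"
    unfolding circle_integral_def by (rule integral_nonneg) (auto intro!: integrable_continuous_interval continuous_intros cf)
  ultimately have I: "integral {0..2 * pi} (\<lambda>\<theta>. f \<theta> * f \<theta>) = 0" by (simp add: circle_integral_def)
  have z: "f x = 0" if "x \<in> {0..2 * pi}" for x
  proof -
    have c: "continuous_on {0..2 * pi} (\<lambda>\<theta>. f \<theta> * f \<theta>)" by (intro continuous_intros cf)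
    have "(integral {0..2 * pi} (\<lambda>\<theta>. f \<theta> * f \<theta>) = 0) = (\<forall>x\<in>{0..2 * pi}. f x * f x = 0)"
      by (rule integral_eq_0_iff[OF c]) simp_all
    then have "\<forall>x\<in>{0..2 * pi}. f x * f x = 0" using I by blast
    then show ?thesis using that by auto
  qed
  obtain n where n: "\<bar>(\<theta> - pi) - 2 * pi * of_int n\<bar> \<le> pi" by (rule angle_reduce)
  have "f (\<theta> - 2 * pi * of_int n) = 0" by (rule z) (use n in \<open>simp add: abs_le_iff\<close>)
  then show ?thesis using periodic_int[OF f(2), of \<theta> "- n"] by simp
qed

text \<open>Test pairs with one component zero separate the two components of a competing gradient;
  continuity upgrades equality of integrals to equality of functions.\<close>

lemma L2_gradient_eq:
  assumes "has_L2_gradient H \<xi> \<psi> (u, v)"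
  shows "L2_gradient H \<xi> \<psi> = (u, v)"
  unfolding L2_gradient_def
proof (rule the_equality[where P = "has_L2_gradient H \<xi> \<psi>", OF assms])
  fix w assume w: "has_L2_gradient H \<xi> \<psi> w"
  obtain u' v' where uv: "w = (u', v')" by (cases w)
  have "continuous_on UNIV u" "continuous_on UNIV v" "continuous_on UNIV u'" "continuous_on UNIV v'"
    using assms w unfolding uv has_L2_gradient_def by auto
  note c = this[THEN continuous_on_subset, OF subset_UNIV]
  have p: "periodic u" "periodic v" "periodic u'" "periodic v'"
    using assms w unfolding uv has_L2_gradient_def by auto
  have zero: "(\<lambda>\<theta>. 0) \<in> smooth_circle" using polynomial_smooth_circle[OF real_polynomial_function.intros(2)[of 0]] by simp
  have eq: "circle_integral (\<lambda>\<theta>. u \<theta> * h \<theta> + v \<theta> * k \<theta>) = circle_integral (\<lambda>\<theta>. u' \<theta> * h \<theta> + v' \<theta> * k \<theta>)"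
    if "h \<in> smooth_circle" "k \<in> smooth_circle" for h k
  proof (rule DERIV_unique)
    show "((\<lambda>\<epsilon>. H (\<lambda>\<theta>. \<xi> \<theta> + \<epsilon> * h \<theta>) (\<lambda>\<theta>. \<psi> \<theta> + \<epsilon> * k \<theta>)) has_real_derivative circle_integral (\<lambda>\<theta>. u \<theta> * h \<theta> + v \<theta> * k \<theta>)) (at 0)"
      using assms that unfolding has_L2_gradient_def by auto
    show "((\<lambda>\<epsilon>. H (\<lambda>\<theta>. \<xi> \<theta> + \<epsilon> * h \<theta>) (\<lambda>\<theta>. \<psi> \<theta> + \<epsilon> * k \<theta>)) has_real_derivative circle_integral (\<lambda>\<theta>. u' \<theta> * h \<theta> + v' \<theta> * k \<theta>)) (at 0)"
      using w that unfolding uv has_L2_gradient_def by auto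
  qed
  have "u \<theta> - u' \<theta> = 0" for \<theta>
  proof (rule circle_fundamental_lemma[of "\<lambda>\<theta>. u \<theta> - u' \<theta>"])
    show "continuous_on UNIV (\<lambda>\<theta>. u \<theta> - u' \<theta>)" by (intro continuous_intros c)
    show "periodic (\<lambda>\<theta>. u \<theta> - u' \<theta>)" using p by (simp add: periodic_def)
    fix h assume h: "h \<in> smooth_circle"
    have "circle_integral (\<lambda>\<theta>. u \<theta> * h \<theta> - u' \<theta> * h \<theta>) = circle_integral (\<lambda>\<theta>. u \<theta> * h \<theta>) - circle_integral (\<lambda>\<theta>. u' \<theta> * h \<theta>)"
      unfolding circle_integral_def
      by (intro integral_diff integrable_continuous_interval continuous_intros c smooth_circle_facts(2)[OF h])
    then show "circle_integral (\<lambda>\<theta>. (u \<theta> - u' \<theta>) * h \<theta>) = 0" using eq[OF h zero] by (simp add: left_diff_distrib)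
  qed
  moreover have "v \<theta> - v' \<theta> = 0" for \<theta>
  proof (rule circle_fundamental_lemma[of "\<lambda>\<theta>. v \<theta> - v' \<theta>"])
    show "continuous_on UNIV (\<lambda>\<theta>. v \<theta> - v' \<theta>)" by (intro continuous_intros c)
    show "periodic (\<lambda>\<theta>. v \<theta> - v' \<theta>)" using p by (simp add: periodic_def)
    fix h assume h: "h \<in> smooth_circle"
    have "circle_integral (\<lambda>\<theta>. v \<theta> * h \<theta> - v' \<theta> * h \<theta>) = circle_integral (\<lambda>\<theta>. v \<theta> * h \<theta>) - circle_integral (\<lambda>\<theta>. v' \<theta> * h \<theta>)"
      unfolding circle_integral_def
      by (intro integral_diff integrable_continuous_interval continuous_intros c smooth_circle_facts(2)[OF h])
    then show "circle_integral (\<lambda>\<theta>. (v \<theta> - v' \<theta>) * h \<theta>) = 0" using eq[OF zero h] by (simp add: left_diff_distrib)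
  qed
  ultimately show "w = (u, v)" unfolding uv by (simp add: fun_eq_iff)
qed

lemma inv_deriv_eq:
  assumes "periodic F" "\<And>\<theta>. (F has_real_derivative f \<theta>) (at \<theta>)" "circle_integral F = 0"
  shows "inv_deriv f = F"
  unfolding inv_deriv_def
proof (rule the_equality)
  show "periodic F \<and> (\<forall>\<theta>. (F has_real_derivative f \<theta>) (at \<theta>)) \<and> circle_integral F = 0" using assms by simp
  fix E assume E: "periodic E \<and> (\<forall>\<theta>. (E has_real_derivative f \<theta>) (at \<theta>)) \<and> circle_integral E = 0"
  have c: "continuous_on S F" "continuous_on S E" for S
    using DERIV_continuous_on[of S F f] DERIV_continuous_on[of S E f] assms(2) E
    by (auto simp: has_field_derivative_at_within)
  have "((\<lambda>\<theta>. E \<theta> - F \<theta>) has_real_derivative 0) (at \<theta>)" for \<theta>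
    using DERIV_diff[of E "f \<theta>" \<theta> UNIV F "f \<theta>"] E assms(2) by simp
  then have const: "E \<theta> - F \<theta> = E 0 - F 0" for \<theta>
    using DERIV_isconst_all[of "\<lambda>\<theta>. E \<theta> - F \<theta>" \<theta> 0] by simp
  have "circle_integral (\<lambda>\<theta>. E \<theta> - F \<theta>) = circle_integral E - circle_integral F"
    unfolding circle_integral_def by (intro integral_diff integrable_continuous_interval c)
  moreover have "circle_integral (\<lambda>\<theta>. E \<theta> - F \<theta>) = circle_integral (\<lambda>\<theta>. E 0 - F 0)"
    by (rule arg_cong[of _ _ circle_integral]) (intro ext const)
  ultimately have "2 * pi * (E 0 - F 0) = 0" using E assms(3) by (simp add: circle_integral_def)
  then have "E 0 - F 0 = 0" by simp
  then have "E \<theta> = F \<theta>" for \<theta> using const[of \<theta>] by simp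
  then show "E = F" by (rule ext)
qed


section \<open>The Hamiltonian structure\<close>

definition arclen :: "(real \<Rightarrow> real) \<Rightarrow> real \<Rightarrow> real" where
  "arclen \<xi> \<theta> = sqrt (1 + (deriv \<xi> \<theta>)\<^sup>2)"

text \<open>The derivative of the sine of the angle arctan \<xi>', in the form in which it occurs in
  \<open>drop_field\<close>. The geometric curvature of the drop is \<open>exp (- \<xi> \<theta>) *
  (1 / arclen \<xi> \<theta> - curvature \<xi> \<theta>)\<close>.\<close>

definition curvature :: "(real \<Rightarrow> real) \<Rightarrow> real \<Rightarrow> real" where
  "curvature \<xi> \<theta> = deriv (\<lambda>\<phi>. deriv \<xi> \<phi> / sqrt (1 + (deriv \<xi> \<phi>)\<^sup>2)) \<theta>"

definition grad_\<xi> :: "real \<Rightarrow> real \<Rightarrow> (real \<Rightarrow> real) \<Rightarrow> (real \<Rightarrow> real) \<Rightarrow> real \<Rightarrow> real" where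
  "grad_\<xi> \<sigma> \<alpha> \<xi> \<psi> \<theta> =
     (deriv \<psi> \<theta>)\<^sup>2 / 2 - ((G_op \<xi> \<psi> \<theta> + deriv \<xi> \<theta> * deriv \<psi> \<theta>) / sqrt (1 + (deriv \<xi> \<theta>)\<^sup>2))\<^sup>2 / 2
     + \<sigma> * (exp (\<xi> \<theta>) * (1 / arclen \<xi> \<theta> - curvature \<xi> \<theta>)) - (\<sigma> - \<alpha>\<^sup>2 / 8) * exp (2 * \<xi> \<theta>)
     - \<alpha> / 2 * (exp (2 * \<xi> \<theta>) * deriv \<psi> \<theta>) + \<alpha>\<^sup>2 / 8 * exp (4 * \<xi> \<theta>)"

definition grad_\<psi> :: "real \<Rightarrow> (real \<Rightarrow> real) \<Rightarrow> (real \<Rightarrow> real) \<Rightarrow> real \<Rightarrow> real" where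
  "grad_\<psi> \<alpha> \<xi> \<psi> \<theta> = G_op \<xi> \<psi> \<theta> + \<alpha> / 2 * (exp (2 * \<xi> \<theta>) * deriv \<xi> \<theta>)"

lemma arclen_pos: "arclen \<xi> \<theta> > 0"
  by (simp add: arclen_def add_pos_nonneg)

lemma arclen_square: "arclen \<xi> \<theta> * arclen \<xi> \<theta> = 1 + (deriv \<xi> \<theta>)\<^sup>2"
  by (simp add: arclen_def)

context
  fixes \<xi> assumes \<xi>: "\<xi> \<in> smooth_circle"
begin

lemma continuous_arclen: "continuous_on S (arclen \<xi>)"
  unfolding arclen_def by (intro continuous_intros smooth_circle_facts[OF \<xi>])

lemma slope_over_arclen_deriv:
  "((\<lambda>\<phi>. deriv \<xi> \<phi> / arclen \<xi> \<phi>) has_real_derivative deriv (deriv \<xi>) \<theta> / (arclen \<xi> \<theta>) ^ 3) (at \<theta>)"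
proof -
  note f = smooth_circle_facts[OF \<xi>]
  have pos: "1 + (deriv \<xi> \<theta>)\<^sup>2 > 0" by (simp add: add_pos_nonneg)
  have S: "(arclen \<xi> has_real_derivative deriv \<xi> \<theta> * deriv (deriv \<xi>) \<theta> / arclen \<xi> \<theta>) (at \<theta>)"
    unfolding arclen_def using pos
    by (auto intro!: derivative_eq_intros f(6) simp: field_simps)
  have nz: "arclen \<xi> \<theta> \<noteq> 0" using arclen_pos[of \<xi> \<theta>] by simp
  have "(deriv (deriv \<xi>) \<theta> * arclen \<xi> \<theta> - deriv \<xi> \<theta> * (deriv \<xi> \<theta> * deriv (deriv \<xi>) \<theta> / arclen \<xi> \<theta>)) / (arclen \<xi> \<theta> * arclen \<xi> \<theta>)
     = deriv (deriv \<xi>) \<theta> * (arclen \<xi> \<theta> * arclen \<xi> \<theta> - (deriv \<xi> \<theta>)\<^sup>2) / (arclen \<xi> \<theta>) ^ 3"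
    using nz by (simp add: field_simps power2_eq_square power3_eq_cube)
  also have "\<dots> = deriv (deriv \<xi>) \<theta> / (arclen \<xi> \<theta>) ^ 3" by (simp add: arclen_square)
  finally show ?thesis using DERIV_divide[OF f(6) S nz] by simp
qed

lemma curvature_eq: "curvature \<xi> \<theta> = deriv (deriv \<xi>) \<theta> / (arclen \<xi> \<theta>) ^ 3"
  unfolding curvature_def using DERIV_imp_deriv[OF slope_over_arclen_deriv] by (simp add: arclen_def)

lemma continuous_curvature: "continuous_on S (curvature \<xi>)"
proof -
  have "continuous_on S (\<lambda>\<theta>. deriv (deriv \<xi>) \<theta> / (arclen \<xi> \<theta>) ^ 3)"
    using less_imp_neq[OF arclen_pos, of \<xi>]
    by (intro continuous_intros smooth_circle_facts(7)[OF \<xi>] continuous_arclen) (metis power_not_zero)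
  then show ?thesis by (simp add: curvature_eq cong: continuous_on_cong)
qed

text \<open>First variation of the perimeter. Integrating by parts moves the derivative from h to
  exp \<xi> times \<xi>' / \<open>arclen\<close>; the terms without \<xi>'' combine to
  \<open>1 / arclen\<close>, since the square of \<open>arclen\<close> is 1 + \<xi>'^2.\<close>

lemma capillary_derivative:
  assumes h: "h \<in> smooth_circle"
  shows "((\<lambda>\<epsilon>. circle_integral (\<lambda>\<theta>. exp (\<xi> \<theta> + \<epsilon> * h \<theta>) * sqrt (1 + (deriv \<xi> \<theta> + \<epsilon> * deriv h \<theta>)\<^sup>2))) has_real_derivative
     circle_integral (\<lambda>\<theta>. exp (\<xi> \<theta>) * (1 / arclen \<xi> \<theta> - curvature \<xi> \<theta>) * h \<theta>)) (at 0)"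
proof -
  note f = smooth_circle_facts[OF \<xi>] and hf = smooth_circle_facts[OF h]
  let ?S = "\<lambda>\<epsilon> \<theta>. sqrt (1 + (deriv \<xi> \<theta> + \<epsilon> * deriv h \<theta>)\<^sup>2)"
  have pos: "1 + x\<^sup>2 > (0::real)" for x by (simp add: add_pos_nonneg)
  define f' where "f' \<epsilon> \<theta> = exp (\<xi> \<theta> + \<epsilon> * h \<theta>) * h \<theta> * ?S \<epsilon> \<theta> +
     exp (\<xi> \<theta> + \<epsilon> * h \<theta>) * ((deriv \<xi> \<theta> + \<epsilon> * deriv h \<theta>) * deriv h \<theta> / ?S \<epsilon> \<theta>)" for \<epsilon> \<theta>
  have fst_c: "continuous_on UNIV (\<lambda>p. g (snd p))" if "continuous_on UNIV g" for g :: "real \<Rightarrow> real"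
    by (rule continuous_on_compose2[OF that]) (auto intro!: continuous_intros)
  have Snz: "?S \<epsilon> \<theta> \<noteq> 0" for \<epsilon> \<theta> using pos[of "deriv \<xi> \<theta> + \<epsilon> * deriv h \<theta>"] by simp
  have "((\<lambda>\<epsilon>. circle_integral (\<lambda>\<theta>. exp (\<xi> \<theta> + \<epsilon> * h \<theta>) * ?S \<epsilon> \<theta>)) has_real_derivative circle_integral (f' 0)) (at 0)"
  proof (rule circle_leibniz)
    fix \<epsilon> \<theta>
    have q: "((\<lambda>\<epsilon>. 1 + (deriv \<xi> \<theta> + \<epsilon> * deriv h \<theta>)\<^sup>2) has_real_derivative 2 * (deriv \<xi> \<theta> + \<epsilon> * deriv h \<theta>) * deriv h \<theta>) (at \<epsilon>)"
      by (auto intro!: derivative_eq_intros)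
    have dS: "((\<lambda>\<epsilon>. ?S \<epsilon> \<theta>) has_real_derivative (deriv \<xi> \<theta> + \<epsilon> * deriv h \<theta>) * deriv h \<theta> / ?S \<epsilon> \<theta>) (at \<epsilon>)"
    proof -
      have "(sqrt has_real_derivative inverse (?S \<epsilon> \<theta>) / 2) (at (1 + (deriv \<xi> \<theta> + \<epsilon> * deriv h \<theta>)\<^sup>2))"
        by (rule DERIV_real_sqrt[OF pos])
      note d = DERIV_chain2[OF this q]
      have "inverse s / 2 * (2 * a * b) = a * b / s" for s a b :: real
        by (cases "s = 0") (simp_all add: field_simps)
      from d[unfolded this] show ?thesis .
    qed
    have dE: "((\<lambda>\<epsilon>. exp (\<xi> \<theta> + \<epsilon> * h \<theta>)) has_real_derivative exp (\<xi> \<theta> + \<epsilon> * h \<theta>) * h \<theta>) (at \<epsilon>)"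
      by (auto intro!: derivative_eq_intros)
    show "((\<lambda>\<epsilon>. exp (\<xi> \<theta> + \<epsilon> * h \<theta>) * ?S \<epsilon> \<theta>) has_real_derivative f' \<epsilon> \<theta>) (at \<epsilon>)"
      unfolding f'_def by (rule DERIV_cong[OF DERIV_mult'[OF dE dS]]) (rule add.commute)
  next
    show "continuous_on UNIV (\<lambda>\<theta>. exp (\<xi> \<theta> + \<epsilon> * h \<theta>) * ?S \<epsilon> \<theta>)" for \<epsilon> by (intro continuous_intros f hf)
    show "continuous_on UNIV (\<lambda>p. f' (fst p) (snd p))"
      unfolding f'_def by (intro continuous_intros fst_c f hf ballI Snz)
  qed
  moreover have "circle_integral (f' 0) = circle_integral (\<lambda>\<theta>. exp (\<xi> \<theta>) * (1 / arclen \<xi> \<theta> - curvature \<xi> \<theta>) * h \<theta>)"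
  proof -
    define w where "w \<theta> = exp (\<xi> \<theta>) * (deriv \<xi> \<theta> / arclen \<xi> \<theta>)" for \<theta>
    define w' where "w' \<theta> = exp (\<xi> \<theta>) * curvature \<xi> \<theta> + exp (\<xi> \<theta>) * deriv \<xi> \<theta> * (deriv \<xi> \<theta> / arclen \<xi> \<theta>)" for \<theta>
    have nz: "arclen \<xi> \<theta> \<noteq> 0" for \<theta> using arclen_pos[of \<xi> \<theta>] by simp
    have dw: "(w has_real_derivative w' \<theta>) (at \<theta>)" for \<theta>
      unfolding w_def[abs_def] w'_def curvature_eq
      by (rule DERIV_mult'[OF DERIV_chain2[OF DERIV_exp f(1)] slope_over_arclen_deriv])
    have cw': "continuous_on UNIV w'"
      unfolding w'_def by (intro continuous_intros f continuous_curvature continuous_arclen ballI nz)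
    have cw: "continuous_on UNIV w"
      unfolding w_def by (intro continuous_intros f continuous_arclen ballI nz)
    have perw: "w (2 * pi) = w 0" "h (2 * pi) = h 0"
      using f(4)[of 0] f(5)[of 0] hf(4)[of 0] by (simp_all add: w_def arclen_def)
    have cu: "continuous_on S w" "continuous_on S w'" for S using cw cw' continuous_on_subset by blast+
    have "circle_integral (f' 0) = integral {0..2 * pi} (\<lambda>\<theta>. exp (\<xi> \<theta>) * arclen \<xi> \<theta> * h \<theta> + w \<theta> * deriv h \<theta>)"
      unfolding circle_integral_def by (rule integral_cong) (simp add: f'_def w_def arclen_def)
    also have "\<dots> = integral {0..2 * pi} (\<lambda>\<theta>. exp (\<xi> \<theta>) * arclen \<xi> \<theta> * h \<theta>) + integral {0..2 * pi} (\<lambda>\<theta>. w \<theta> * deriv h \<theta>)"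
      by (intro integral_add integrable_continuous_interval continuous_intros f hf cu continuous_arclen)
    also have "integral {0..2 * pi} (\<lambda>\<theta>. w \<theta> * deriv h \<theta>) = - integral {0..2 * pi} (\<lambda>\<theta>. w' \<theta> * h \<theta>)"
      by (rule circle_parts[OF dw cw' perw(1) hf(1) hf(3) perw(2)])
    also have "integral {0..2 * pi} (\<lambda>\<theta>. exp (\<xi> \<theta>) * arclen \<xi> \<theta> * h \<theta>) + - integral {0..2 * pi} (\<lambda>\<theta>. w' \<theta> * h \<theta>) =
       integral {0..2 * pi} (\<lambda>\<theta>. exp (\<xi> \<theta>) * arclen \<xi> \<theta> * h \<theta>) - integral {0..2 * pi} (\<lambda>\<theta>. w' \<theta> * h \<theta>)" by simp
    also have "\<dots> = integral {0..2 * pi} (\<lambda>\<theta>. exp (\<xi> \<theta>) * arclen \<xi> \<theta> * h \<theta> - w' \<theta> * h \<theta>)"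
      by (rule integral_diff[symmetric]) (intro integrable_continuous_interval continuous_intros f hf cu continuous_arclen)+
    also have "\<dots> = integral {0..2 * pi} (\<lambda>\<theta>. exp (\<xi> \<theta>) * (1 / arclen \<xi> \<theta> - curvature \<xi> \<theta>) * h \<theta>)"
    proof (rule integral_cong)
      fix \<theta>
      have "arclen \<xi> \<theta> - deriv \<xi> \<theta> * (deriv \<xi> \<theta> / arclen \<xi> \<theta>) = (arclen \<xi> \<theta> * arclen \<xi> \<theta> - (deriv \<xi> \<theta>)\<^sup>2) / arclen \<xi> \<theta>"
        using nz[of \<theta>] by (simp add: field_simps power2_eq_square)
      also have "\<dots> = 1 / arclen \<xi> \<theta>" by (simp add: arclen_square)
      finally have e: "1 / arclen \<xi> \<theta> = arclen \<xi> \<theta> - deriv \<xi> \<theta> * (deriv \<xi> \<theta> / arclen \<xi> \<theta>)" ..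
      show "exp (\<xi> \<theta>) * arclen \<xi> \<theta> * h \<theta> - w' \<theta> * h \<theta> = exp (\<xi> \<theta>) * (1 / arclen \<xi> \<theta> - curvature \<xi> \<theta>) * h \<theta>"
        unfolding e w'_def by (simp only: algebra_simps)
    qed
    finally show ?thesis by (simp add: circle_integral_def)
  qed
  ultimately show ?thesis by simp
qed

lemma exponential_derivative:
  assumes h: "h \<in> smooth_circle"
  shows "((\<lambda>\<epsilon>. circle_integral (\<lambda>\<theta>. exp (c * (\<xi> \<theta> + \<epsilon> * h \<theta>)))) has_real_derivative
     circle_integral (\<lambda>\<theta>. c * (exp (c * \<xi> \<theta>) * h \<theta>))) (at 0)"
proof -
  note f = smooth_circle_facts[OF \<xi>] and hf = smooth_circle_facts[OF h]
  have fst_c: "continuous_on UNIV (\<lambda>p. g (snd p))" if "continuous_on UNIV g" for g :: "real \<Rightarrow> real"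
    by (rule continuous_on_compose2[OF that]) (auto intro!: continuous_intros)
  have "((\<lambda>\<epsilon>. circle_integral (\<lambda>\<theta>. exp (c * (\<xi> \<theta> + \<epsilon> * h \<theta>)))) has_real_derivative
     circle_integral (\<lambda>\<theta>. c * (exp (c * (\<xi> \<theta> + 0 * h \<theta>)) * h \<theta>))) (at 0)"
  proof (rule circle_leibniz[where f' = "\<lambda>\<epsilon> \<theta>. c * (exp (c * (\<xi> \<theta> + \<epsilon> * h \<theta>)) * h \<theta>)"])
    show "((\<lambda>\<epsilon>. exp (c * (\<xi> \<theta> + \<epsilon> * h \<theta>))) has_real_derivative c * (exp (c * (\<xi> \<theta> + \<epsilon> * h \<theta>)) * h \<theta>)) (at \<epsilon>)" for \<epsilon> \<theta>
      by (auto intro!: derivative_eq_intros)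
    show "continuous_on UNIV (\<lambda>\<theta>. exp (c * (\<xi> \<theta> + \<epsilon> * h \<theta>)))" for \<epsilon> by (intro continuous_intros f hf)
    show "continuous_on UNIV (\<lambda>p. c * (exp (c * (\<xi> (snd p) + fst p * h (snd p))) * h (snd p)))"
      by (intro continuous_intros fst_c f hf)
  qed
  then show ?thesis by simp
qed

text \<open>The direction k enters through k', and integration by parts shifts the derivative to exp
  (2 \<xi>). Multiplied by - \<alpha>/4 this becomes the transport term \<alpha>/2 exp (2 \<xi>)
  \<xi>' of \<open>grad_\<psi>\<close>.\<close>

lemma vorticity_derivative:
  assumes \<psi>: "\<psi> \<in> smooth_circle" and h: "h \<in> smooth_circle" and k: "k \<in> smooth_circle"
  shows "((\<lambda>\<epsilon>. circle_integral (\<lambda>\<theta>. exp (2 * (\<xi> \<theta> + \<epsilon> * h \<theta>)) * (deriv \<psi> \<theta> + \<epsilon> * deriv k \<theta>))) has_real_derivative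
     circle_integral (\<lambda>\<theta>. 2 * (exp (2 * \<xi> \<theta>) * deriv \<psi> \<theta> * h \<theta>) - 2 * (exp (2 * \<xi> \<theta>) * deriv \<xi> \<theta> * k \<theta>))) (at 0)"
proof -
  note f = smooth_circle_facts[OF \<xi>] and hf = smooth_circle_facts[OF h] and kf = smooth_circle_facts[OF k] and \<psi>f = smooth_circle_facts[OF \<psi>]
  have fst_c: "continuous_on UNIV (\<lambda>p. g (snd p))" if "continuous_on UNIV g" for g :: "real \<Rightarrow> real"
    by (rule continuous_on_compose2[OF that]) (auto intro!: continuous_intros)
  define f' where "f' \<epsilon> \<theta> = 2 * (exp (2 * (\<xi> \<theta> + \<epsilon> * h \<theta>)) * (deriv \<psi> \<theta> + \<epsilon> * deriv k \<theta>) * h \<theta>) +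
     exp (2 * (\<xi> \<theta> + \<epsilon> * h \<theta>)) * deriv k \<theta>" for \<epsilon> \<theta>
  have "((\<lambda>\<epsilon>. circle_integral (\<lambda>\<theta>. exp (2 * (\<xi> \<theta> + \<epsilon> * h \<theta>)) * (deriv \<psi> \<theta> + \<epsilon> * deriv k \<theta>))) has_real_derivative circle_integral (f' 0)) (at 0)"
  proof (rule circle_leibniz)
    show "((\<lambda>\<epsilon>. exp (2 * (\<xi> \<theta> + \<epsilon> * h \<theta>)) * (deriv \<psi> \<theta> + \<epsilon> * deriv k \<theta>)) has_real_derivative f' \<epsilon> \<theta>) (at \<epsilon>)" for \<epsilon> \<theta>
      unfolding f'_def by (auto intro!: derivative_eq_intros simp: algebra_simps)
    show "continuous_on UNIV (\<lambda>\<theta>. exp (2 * (\<xi> \<theta> + \<epsilon> * h \<theta>)) * (deriv \<psi> \<theta> + \<epsilon> * deriv k \<theta>))" for \<epsilon>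
      by (intro continuous_intros f hf kf \<psi>f)
    show "continuous_on UNIV (\<lambda>p. f' (fst p) (snd p))"
      unfolding f'_def by (intro continuous_intros fst_c f hf kf \<psi>f)
  qed
  moreover have "circle_integral (f' 0) = circle_integral (\<lambda>\<theta>. 2 * (exp (2 * \<xi> \<theta>) * deriv \<psi> \<theta> * h \<theta>) - 2 * (exp (2 * \<xi> \<theta>) * deriv \<xi> \<theta> * k \<theta>))"
  proof -
    have d: "((\<lambda>\<theta>. exp (2 * \<xi> \<theta>)) has_real_derivative 2 * (exp (2 * \<xi> \<theta>) * deriv \<xi> \<theta>)) (at \<theta>)" for \<theta>
      by (auto intro!: derivative_eq_intros f(1))
    have per: "exp (2 * \<xi> (2 * pi)) = exp (2 * \<xi> 0)" "k (2 * pi) = k 0" using f(4)[of 0] kf(4)[of 0] by simp_all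
    have c: "continuous_on UNIV (\<lambda>\<theta>. 2 * (exp (2 * \<xi> \<theta>) * deriv \<xi> \<theta>))" by (intro continuous_intros f)
    have "circle_integral (f' 0) = integral {0..2 * pi} (\<lambda>\<theta>. 2 * (exp (2 * \<xi> \<theta>) * deriv \<psi> \<theta> * h \<theta>)) + integral {0..2 * pi} (\<lambda>\<theta>. exp (2 * \<xi> \<theta>) * deriv k \<theta>)"
      unfolding circle_integral_def f'_def mult_zero_left add_0_right
      by (intro integral_add integrable_continuous_interval continuous_intros f hf kf \<psi>f)
    also have "integral {0..2 * pi} (\<lambda>\<theta>. exp (2 * \<xi> \<theta>) * deriv k \<theta>) = - integral {0..2 * pi} (\<lambda>\<theta>. 2 * (exp (2 * \<xi> \<theta>) * deriv \<xi> \<theta>) * k \<theta>)"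
      by (rule circle_parts[OF d c per(1) kf(1) kf(3) per(2)])
    also have "integral {0..2 * pi} (\<lambda>\<theta>. 2 * (exp (2 * \<xi> \<theta>) * deriv \<psi> \<theta> * h \<theta>)) + - integral {0..2 * pi} (\<lambda>\<theta>. 2 * (exp (2 * \<xi> \<theta>) * deriv \<xi> \<theta>) * k \<theta>) =
       integral {0..2 * pi} (\<lambda>\<theta>. 2 * (exp (2 * \<xi> \<theta>) * deriv \<psi> \<theta> * h \<theta>)) - integral {0..2 * pi} (\<lambda>\<theta>. 2 * (exp (2 * \<xi> \<theta>) * deriv \<xi> \<theta>) * k \<theta>)" by simp
    also have "\<dots> = integral {0..2 * pi} (\<lambda>\<theta>. 2 * (exp (2 * \<xi> \<theta>) * deriv \<psi> \<theta> * h \<theta>) - 2 * (exp (2 * \<xi> \<theta>) * deriv \<xi> \<theta>) * k \<theta>)"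
      by (rule integral_diff[symmetric]) (intro integrable_continuous_interval continuous_intros f hf kf \<psi>f)+
    finally show ?thesis by (simp add: circle_integral_def mult.assoc)
  qed
  ultimately show ?thesis by simp
qed

end

section \<open>The gradient of the Hamiltonian and the drop equations\<close>

context
  fixes \<xi> \<psi> assumes \<xi>: "\<xi> \<in> smooth_circle" and \<psi>: "\<psi> \<in> smooth_circle"
begin

lemma G_op_continuous_periodic: "continuous_on S (G_op \<xi> \<psi>)" "G_op \<xi> \<psi> (\<theta> + 2 * pi) = G_op \<xi> \<psi> \<theta>"
proof -
  obtain A a b where cp: "conj_potential \<xi> \<psi> A a b" using conj_potential_exists[OF \<xi> \<psi>] by blast
  note G = Dirichlet_G[OF \<xi> cp]
  show "continuous_on S (G_op \<xi> \<psi>)"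
    unfolding G by (intro continuous_intros continuous_angular[OF continuous_slope[OF \<xi> cp]] continuous_tangent[OF \<xi> cp]) auto
  show "G_op \<xi> \<psi> (\<theta> + 2 * pi) = G_op \<xi> \<psi> \<theta>"
    unfolding G by (simp add: slope_periodic[OF \<xi> cp] tangent_periodic[OF \<xi> cp])
qed

lemma grad_continuous_periodic:
  "continuous_on S (grad_\<xi> \<sigma> \<alpha> \<xi> \<psi>)" "continuous_on S (grad_\<psi> \<alpha> \<xi> \<psi>)"
  "periodic (grad_\<xi> \<sigma> \<alpha> \<xi> \<psi>)" "periodic (grad_\<psi> \<alpha> \<xi> \<psi>)"
proof -
  note f = smooth_circle_facts[OF \<xi>] and \<psi>f = smooth_circle_facts[OF \<psi>]
  have nz: "arclen \<xi> \<theta> \<noteq> 0" "sqrt (1 + (deriv \<xi> \<theta>)\<^sup>2) \<noteq> 0" for \<theta> using arclen_pos[of \<xi> \<theta>] by (simp_all add: arclen_def)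
  show "continuous_on S (grad_\<xi> \<sigma> \<alpha> \<xi> \<psi>)"
    unfolding grad_\<xi>_def
    by (intro continuous_intros f(2,3) \<psi>f(3) G_op_continuous_periodic(1) continuous_arclen[OF \<xi>] continuous_curvature[OF \<xi>] ballI nz; simp)
  show "continuous_on S (grad_\<psi> \<alpha> \<xi> \<psi>)"
    unfolding grad_\<psi>_def by (intro continuous_intros f(2,3) G_op_continuous_periodic(1))
  show "periodic (grad_\<xi> \<sigma> \<alpha> \<xi> \<psi>)" "periodic (grad_\<psi> \<alpha> \<xi> \<psi>)"
    by (simp_all add: periodic_def grad_\<xi>_def grad_\<psi>_def f \<psi>f G_op_continuous_periodic arclen_def curvature_eq[OF \<xi>])
qed

lemma hamiltonian_gradient:
  "has_L2_gradient (hamiltonian \<sigma> \<alpha>) \<xi> \<psi> (grad_\<xi> \<sigma> \<alpha> \<xi> \<psi>, grad_\<psi> \<alpha> \<xi> \<psi>)"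
  unfolding has_L2_gradient_def case_prod_conv
proof (intro conjI grad_continuous_periodic ballI)
  fix h k assume h: "h \<in> smooth_circle" and k: "k \<in> smooth_circle"
  note f = smooth_circle_facts[OF \<xi>] and hf = smooth_circle_facts[OF h] and kf = smooth_circle_facts[OF k] and \<psi>f = smooth_circle_facts[OF \<psi>]
  have nz: "arclen \<xi> \<theta> \<noteq> 0" "sqrt (1 + (deriv \<xi> \<theta>)\<^sup>2) \<noteq> 0" for \<theta> using arclen_pos[of \<xi> \<theta>] by (simp_all add: arclen_def)
  let ?w = "\<lambda>\<theta>. (deriv \<psi> \<theta>)\<^sup>2 / 2 - ((G_op \<xi> \<psi> \<theta> + deriv \<xi> \<theta> * deriv \<psi> \<theta>) / sqrt (1 + (deriv \<xi> \<theta>)\<^sup>2))\<^sup>2 / 2"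
  let ?D1 = "circle_integral (\<lambda>\<theta>. k \<theta> * G_op \<xi> \<psi> \<theta>) + circle_integral (\<lambda>\<theta>. h \<theta> * ?w \<theta>)"
  let ?D2 = "circle_integral (\<lambda>\<theta>. exp (\<xi> \<theta>) * (1 / arclen \<xi> \<theta> - curvature \<xi> \<theta>) * h \<theta>)"
  let ?D3 = "circle_integral (\<lambda>\<theta>. 2 * (exp (2 * \<xi> \<theta>) * h \<theta>))"
  let ?D4 = "circle_integral (\<lambda>\<theta>. 2 * (exp (2 * \<xi> \<theta>) * deriv \<psi> \<theta> * h \<theta>) - 2 * (exp (2 * \<xi> \<theta>) * deriv \<xi> \<theta> * k \<theta>))"
  let ?D5 = "circle_integral (\<lambda>\<theta>. 4 * (exp (4 * \<xi> \<theta>) * h \<theta>))"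
  let ?D = "?D1 + \<sigma> * ?D2 - (\<sigma> - \<alpha>\<^sup>2 / 8) * (1 / 2) * ?D3 - \<alpha> / 4 * ?D4 + \<alpha>\<^sup>2 / 32 * ?D5"
  have K: "((\<lambda>\<epsilon>. 1 / 2 * circle_integral (\<lambda>\<theta>. (\<psi> \<theta> + \<epsilon> * k \<theta>) * G_op (\<lambda>\<theta>. \<xi> \<theta> + \<epsilon> * h \<theta>) (\<lambda>\<theta>. \<psi> \<theta> + \<epsilon> * k \<theta>) \<theta>))
      has_real_derivative ?D1) (at 0)"
    using kinetic_derivative[OF \<xi> \<psi> h k] by (simp add: circle_integral_def)
  have "((\<lambda>\<epsilon>. hamiltonian \<sigma> \<alpha> (\<lambda>\<theta>. \<xi> \<theta> + \<epsilon> * h \<theta>) (\<lambda>\<theta>. \<psi> \<theta> + \<epsilon> * k \<theta>)) has_real_derivative ?D) (at 0)"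
    unfolding hamiltonian_def smooth_circle_combination(2)[OF \<xi> h] smooth_circle_combination(2)[OF \<psi> k]
    by (intro DERIV_add DERIV_diff DERIV_cmult K capillary_derivative exponential_derivative vorticity_derivative \<xi> \<psi> h k)
  moreover have "?D = circle_integral (\<lambda>\<theta>. grad_\<xi> \<sigma> \<alpha> \<xi> \<psi> \<theta> * h \<theta> + grad_\<psi> \<alpha> \<xi> \<psi> \<theta> * k \<theta>)"
  proof -
    note cont = f(2,3) \<psi>f(3) hf(2) kf(2) G_op_continuous_periodic(1) continuous_arclen[OF \<xi>] continuous_curvature[OF \<xi>]
    have i: "continuous_on UNIV (\<lambda>\<theta>. k \<theta> * G_op \<xi> \<psi> \<theta>)" "continuous_on UNIV (\<lambda>\<theta>. h \<theta> * ?w \<theta>)"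
      "continuous_on UNIV (\<lambda>\<theta>. exp (\<xi> \<theta>) * (1 / arclen \<xi> \<theta> - curvature \<xi> \<theta>) * h \<theta>)"
      "continuous_on UNIV (\<lambda>\<theta>. 2 * (exp (2 * \<xi> \<theta>) * h \<theta>))"
      "continuous_on UNIV (\<lambda>\<theta>. 2 * (exp (2 * \<xi> \<theta>) * deriv \<psi> \<theta> * h \<theta>) - 2 * (exp (2 * \<xi> \<theta>) * deriv \<xi> \<theta> * k \<theta>))"
      "continuous_on UNIV (\<lambda>\<theta>. 4 * (exp (4 * \<xi> \<theta>) * h \<theta>))"
      by (intro continuous_intros cont ballI nz; simp)+
    note i = i[THEN circle_integral_has]
    have "((\<lambda>\<theta>. k \<theta> * G_op \<xi> \<psi> \<theta> + h \<theta> * ?w \<theta> + \<sigma> * (exp (\<xi> \<theta>) * (1 / arclen \<xi> \<theta> - curvature \<xi> \<theta>) * h \<theta>)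
        - (\<sigma> - \<alpha>\<^sup>2 / 8) * (1 / 2) * (2 * (exp (2 * \<xi> \<theta>) * h \<theta>))
        - \<alpha> / 4 * (2 * (exp (2 * \<xi> \<theta>) * deriv \<psi> \<theta> * h \<theta>) - 2 * (exp (2 * \<xi> \<theta>) * deriv \<xi> \<theta> * k \<theta>))
        + \<alpha>\<^sup>2 / 32 * (4 * (exp (4 * \<xi> \<theta>) * h \<theta>))) has_integral ?D) {0..2 * pi}"
      by (rule has_integral_add[OF has_integral_diff[OF has_integral_diff[OF has_integral_add[OF has_integral_add[OF i(1,2)]
           has_integral_mult_right[OF i(3)]] has_integral_mult_right[OF i(4)]] has_integral_mult_right[OF i(5)]] has_integral_mult_right[OF i(6)]])
    then have "integral {0..2 * pi} (\<lambda>\<theta>. k \<theta> * G_op \<xi> \<psi> \<theta> + h \<theta> * ?w \<theta> + \<sigma> * (exp (\<xi> \<theta>) * (1 / arclen \<xi> \<theta> - curvature \<xi> \<theta>) * h \<theta>)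
        - (\<sigma> - \<alpha>\<^sup>2 / 8) * (1 / 2) * (2 * (exp (2 * \<xi> \<theta>) * h \<theta>))
        - \<alpha> / 4 * (2 * (exp (2 * \<xi> \<theta>) * deriv \<psi> \<theta> * h \<theta>) - 2 * (exp (2 * \<xi> \<theta>) * deriv \<xi> \<theta> * k \<theta>))
        + \<alpha>\<^sup>2 / 32 * (4 * (exp (4 * \<xi> \<theta>) * h \<theta>))) = ?D" by (rule integral_unique)
    then show ?thesis
      unfolding circle_integral_def[of "\<lambda>\<theta>. grad_\<xi> \<sigma> \<alpha> \<xi> \<psi> \<theta> * h \<theta> + grad_\<psi> \<alpha> \<xi> \<psi> \<theta> * k \<theta>"]
      by (subst (asm) eq_commute) (erule trans, rule integral_cong, simp add: grad_\<xi>_def grad_\<psi>_def algebra_simps)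
  qed
  ultimately show "((\<lambda>\<epsilon>. hamiltonian \<sigma> \<alpha> (\<lambda>\<theta>. \<xi> \<theta> + \<epsilon> * h \<theta>) (\<lambda>\<theta>. \<psi> \<theta> + \<epsilon> * k \<theta>)) has_real_derivative
      circle_integral (\<lambda>\<theta>. grad_\<xi> \<sigma> \<alpha> \<xi> \<psi> \<theta> * h \<theta> + grad_\<psi> \<alpha> \<xi> \<psi> \<theta> * k \<theta>)) (at 0)"
    by simp
qed

lemma hamiltonian_L2_gradient: "L2_gradient (hamiltonian \<sigma> \<alpha>) \<xi> \<psi> = (grad_\<xi> \<sigma> \<alpha> \<xi> \<psi>, grad_\<psi> \<alpha> \<xi> \<psi>)"
  by (rule L2_gradient_eq[OF hamiltonian_gradient])

text \<open>Im a + \<alpha>/4 exp (2 \<xi>) is a periodic primitive of \<open>grad_\<psi>\<close>;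
  in particular the gradient has zero mean and the projector leaves it unchanged.
  \<open>K_op\<close> is Im a with only its own mean removed, so m is the mean of the exponential
  term.\<close>

lemma inv_deriv_grad_\<psi>:
  "\<exists>m. \<forall>\<theta>. inv_deriv (zero_mean_proj (grad_\<psi> \<alpha> \<xi> \<psi>)) \<theta> = K_op \<xi> \<psi> \<theta> + \<alpha> / 4 * exp (2 * \<xi> \<theta>) - m"
proof -
  note f = smooth_circle_facts[OF \<xi>]
  obtain A a b where cp: "conj_potential \<xi> \<psi> A a b" using conj_potential_exists[OF \<xi> \<psi>] by blast
  have p: "periodic \<xi>" "continuous_on UNIV \<xi>" using f by (simp_all add: periodic_def)
  define P where "P \<theta> = Im (a (1, \<theta>)) + \<alpha> / 4 * exp (2 * \<xi> \<theta>)" for \<theta>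
  have dP: "(P has_real_derivative grad_\<psi> \<alpha> \<xi> \<psi> \<theta>) (at \<theta>)" for \<theta>
    unfolding P_def[abs_def] grad_\<psi>_def
    by (rule DERIV_add[OF Im_a_deriv[OF \<xi> cp]]) (auto intro!: derivative_eq_intros f(1))
  have perP: "P (\<theta> + 2 * pi) = P \<theta>" for \<theta> by (simp add: P_def a_periodic[OF \<xi> cp] f)
  have cP: "continuous_on S P" for S
    by (rule DERIV_continuous_on) (rule has_field_derivative_at_within[OF dP])
  have "(grad_\<psi> \<alpha> \<xi> \<psi> has_integral P (2 * pi) - P 0) {0..2 * pi}"
    by (rule fundamental_theorem_of_calculus)
      (use dP in \<open>auto simp: has_real_derivative_iff_has_vector_derivative intro: has_vector_derivative_at_within\<close>)
  then have "circle_integral (grad_\<psi> \<alpha> \<xi> \<psi>) = 0" using perP[of 0] by (simp add: circle_integral_def integral_unique)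
  then have z: "zero_mean_proj (grad_\<psi> \<alpha> \<xi> \<psi>) = grad_\<psi> \<alpha> \<xi> \<psi>" by (simp add: zero_mean_proj_def)
  define m where "m = circle_integral P / (2 * pi)"
  have "inv_deriv (zero_mean_proj (grad_\<psi> \<alpha> \<xi> \<psi>)) = (\<lambda>\<theta>. P \<theta> - m)"
    unfolding z
  proof (rule inv_deriv_eq)
    show "periodic (\<lambda>\<theta>. P \<theta> - m)" by (simp add: periodic_def perP)
    show "((\<lambda>\<theta>. P \<theta> - m) has_real_derivative grad_\<psi> \<alpha> \<xi> \<psi> \<theta>) (at \<theta>)" for \<theta>
      using DERIV_diff[OF dP DERIV_const[of m]] by simp
    have "circle_integral (\<lambda>\<theta>. P \<theta> - m) = circle_integral P - circle_integral (\<lambda>\<theta>. m)"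
      unfolding circle_integral_def by (intro integral_diff integrable_continuous_interval cP continuous_on_const)
    then show "circle_integral (\<lambda>\<theta>. P \<theta> - m) = 0" by (simp add: m_def circle_integral_def)
  qed
  then have "inv_deriv (zero_mean_proj (grad_\<psi> \<alpha> \<xi> \<psi>)) \<theta> =
      K_op \<xi> \<psi> \<theta> + \<alpha> / 4 * exp (2 * \<xi> \<theta>) - (m - circle_integral (\<lambda>\<theta>. Im (a (1, \<theta>))) / (2 * pi))" for \<theta>
    by (simp add: K_op_eq[OF p cp] P_def)
  then show ?thesis by blast
qed

text \<open>The constant is \<alpha> m with m from \<open>inv_deriv_grad_\<psi>\<close>. The
  coefficient alpha^2/8 of exp (2 \<xi>) arises as alpha^2/4 from the nonlocal entry of J minus
  alpha^2/8 from the quartic exponential in the Hamiltonian.\<close>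

lemma drop_field_hamiltonian:
  "eq_mod_const (drop_field \<sigma> \<alpha> \<xi> \<psi>) (J_op \<alpha> \<xi> (L2_gradient (hamiltonian \<sigma> \<alpha>) \<xi> \<psi>))"
proof -
  obtain m where m: "\<And>\<theta>. inv_deriv (zero_mean_proj (grad_\<psi> \<alpha> \<xi> \<psi>)) \<theta> = K_op \<xi> \<psi> \<theta> + \<alpha> / 4 * exp (2 * \<xi> \<theta>) - m"
    using inv_deriv_grad_\<psi> by blast
  have e: "exp (- 2 * \<xi> \<theta>) * exp (2 * \<xi> \<theta>) = 1" "exp (- 2 * \<xi> \<theta>) * exp (4 * \<xi> \<theta>) = exp (2 * \<xi> \<theta>)" for \<theta>
    by (simp_all add: exp_add[symmetric])
  have "snd (drop_field \<sigma> \<alpha> \<xi> \<psi>) \<theta> = snd (J_op \<alpha> \<xi> (grad_\<xi> \<sigma> \<alpha> \<xi> \<psi>, grad_\<psi> \<alpha> \<xi> \<psi>)) \<theta> + \<alpha> * m" for \<theta>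
  proof -
    define E where "E = exp (- 2 * \<xi> \<theta>)"
    define E2 where "E2 = exp (2 * \<xi> \<theta>)"
    define E4 where "E4 = exp (4 * \<xi> \<theta>)"
    define W where "W = ((G_op \<xi> \<psi> \<theta> + deriv \<xi> \<theta> * deriv \<psi> \<theta>) / sqrt (1 + (deriv \<xi> \<theta>)\<^sup>2))\<^sup>2"
    define C where "C = exp (\<xi> \<theta>) * (1 / arclen \<xi> \<theta> - curvature \<xi> \<theta>)"
    have "snd (J_op \<alpha> \<xi> (grad_\<xi> \<sigma> \<alpha> \<xi> \<psi>, grad_\<psi> \<alpha> \<xi> \<psi>)) \<theta> + \<alpha> * m =
       - E * ((deriv \<psi> \<theta>)\<^sup>2 / 2 - W / 2 + \<sigma> * C - (\<sigma> - \<alpha>\<^sup>2 / 8) * E2 - \<alpha> / 2 * (E2 * deriv \<psi> \<theta>) + \<alpha>\<^sup>2 / 8 * E4)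
       + \<alpha> * (K_op \<xi> \<psi> \<theta> + \<alpha> / 4 * E2)"
      by (simp add: J_op_def m grad_\<xi>_def E_def E2_def E4_def W_def C_def algebra_simps)
    also have "\<dots> = E * (W / 2 - (deriv \<psi> \<theta>)\<^sup>2 / 2 - \<sigma> * C) + (\<sigma> - \<alpha>\<^sup>2 / 8) * (E * E2) + \<alpha> / 2 * deriv \<psi> \<theta> * (E * E2) - \<alpha>\<^sup>2 / 8 * (E * E4)
       + \<alpha> * K_op \<xi> \<psi> \<theta> + \<alpha>\<^sup>2 / 4 * E2"
      by (simp add: algebra_simps power2_eq_square)
    also have "\<dots> = E * (W / 2 - (deriv \<psi> \<theta>)\<^sup>2 / 2 - \<sigma> * C) + (\<sigma> - \<alpha>\<^sup>2 / 8) + \<alpha> / 2 * deriv \<psi> \<theta> + \<alpha>\<^sup>2 / 8 * E2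
       + \<alpha> * K_op \<xi> \<psi> \<theta>"
      unfolding E_def E2_def E4_def e by (simp add: algebra_simps)
    also have "\<dots> = snd (drop_field \<sigma> \<alpha> \<xi> \<psi>) \<theta>"
      by (simp add: drop_field_def E_def E2_def W_def C_def curvature_def arclen_def algebra_simps)
    finally show ?thesis by simp
  qed
  moreover have "fst (drop_field \<sigma> \<alpha> \<xi> \<psi>) \<theta> = fst (J_op \<alpha> \<xi> (grad_\<xi> \<sigma> \<alpha> \<xi> \<psi>, grad_\<psi> \<alpha> \<xi> \<psi>)) \<theta>" for \<theta>
    by (simp add: drop_field_def J_op_def grad_\<psi>_def)
  ultimately show ?thesis
    unfolding eq_mod_const_def hamiltonian_L2_gradient by blast
qed

end

text \<open>The constants at the individual times form a function of t by choice.
  \<open>evolves_by\<close> asks for no regularity of this function, so it can simply be added to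
  the given one.\<close>

lemma evolves_by_mod_const:
  assumes eq: "\<And>t. \<exists>c. (\<forall>\<theta>. fst (X (\<xi> t) (\<psi> t)) \<theta> = fst (Y (\<xi> t) (\<psi> t)) \<theta>) \<and> (\<forall>\<theta>. snd (X (\<xi> t) (\<psi> t)) \<theta> = snd (Y (\<xi> t) (\<psi> t)) \<theta> + c)"
    and X: "evolves_by X \<xi> \<psi>"
  shows "evolves_by Y \<xi> \<psi>"
proof -
  obtain d where d: "\<And>t \<theta>. fst (X (\<xi> t) (\<psi> t)) \<theta> = fst (Y (\<xi> t) (\<psi> t)) \<theta>"
    "\<And>t \<theta>. snd (X (\<xi> t) (\<psi> t)) \<theta> = snd (Y (\<xi> t) (\<psi> t)) \<theta> + d t"
    using eq by metis
  from X obtain c where c: "\<And>t \<theta>. ((\<lambda>s. \<xi> s \<theta>) has_real_derivative fst (X (\<xi> t) (\<psi> t)) \<theta>) (at t)"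
    "\<And>t \<theta>. ((\<lambda>s. \<psi> s \<theta>) has_real_derivative snd (X (\<xi> t) (\<psi> t)) \<theta> + c t) (at t)"
    unfolding evolves_by_def by blast
  show ?thesis
    unfolding evolves_by_def
  proof (intro exI allI conjI)
    fix t \<theta>
    show "((\<lambda>s. \<xi> s \<theta>) has_real_derivative fst (Y (\<xi> t) (\<psi> t)) \<theta>) (at t)"
      using c(1)[where t = t and \<theta> = \<theta>] by (simp add: d)
    show "((\<lambda>s. \<psi> s \<theta>) has_real_derivative snd (Y (\<xi> t) (\<psi> t)) \<theta> + (d t + c t)) (at t)"
      using c(2)[where t = t and \<theta> = \<theta>] by (simp add: d add.assoc)
  qed
qed

text \<open>The first conjunct certifies that the definite description \<open>L2_gradient\<close>
  denotes an actual gradient, so that the Hamiltonian form is not a statement about an unspecified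
  value.\<close>

theorem theorem3p5:
  fixes \<sigma>\<^sub>0 \<alpha>\<^sub>0 :: real
  assumes "\<sigma>\<^sub>0 > 0"
  shows
    "(\<forall>\<xi>\<in>smooth_circle. \<forall>\<psi>\<in>smooth_circle.
        has_L2_gradient (hamiltonian \<sigma>\<^sub>0 \<alpha>\<^sub>0) \<xi> \<psi> (L2_gradient (hamiltonian \<sigma>\<^sub>0 \<alpha>\<^sub>0) \<xi> \<psi>) \<and>
        eq_mod_const (drop_field \<sigma>\<^sub>0 \<alpha>\<^sub>0 \<xi> \<psi>)
          (J_op \<alpha>\<^sub>0 \<xi> (L2_gradient (hamiltonian \<sigma>\<^sub>0 \<alpha>\<^sub>0) \<xi> \<psi>))) \<and>
     (\<forall>\<xi> \<psi> :: real \<Rightarrow> real \<Rightarrow> real.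
        (\<forall>t. \<xi> t \<in> smooth_circle \<and> \<psi> t \<in> smooth_circle) \<longrightarrow>
        (evolves_by (drop_field \<sigma>\<^sub>0 \<alpha>\<^sub>0) \<xi> \<psi> \<longleftrightarrow>
         evolves_by (\<lambda>\<eta> \<zeta>. J_op \<alpha>\<^sub>0 \<eta> (L2_gradient (hamiltonian \<sigma>\<^sub>0 \<alpha>\<^sub>0) \<eta> \<zeta>)) \<xi> \<psi>))"
proof (intro conjI ballI allI impI)
  fix \<xi> \<psi> assume "\<xi> \<in> smooth_circle" "\<psi> \<in> smooth_circle"
  then show "has_L2_gradient (hamiltonian \<sigma>\<^sub>0 \<alpha>\<^sub>0) \<xi> \<psi> (L2_gradient (hamiltonian \<sigma>\<^sub>0 \<alpha>\<^sub>0) \<xi> \<psi>)"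
    by (simp add: hamiltonian_L2_gradient hamiltonian_gradient)
next
  fix \<xi> \<psi> assume "\<xi> \<in> smooth_circle" "\<psi> \<in> smooth_circle"
  then show "eq_mod_const (drop_field \<sigma>\<^sub>0 \<alpha>\<^sub>0 \<xi> \<psi>) (J_op \<alpha>\<^sub>0 \<xi> (L2_gradient (hamiltonian \<sigma>\<^sub>0 \<alpha>\<^sub>0) \<xi> \<psi>))"
    by (rule drop_field_hamiltonian)
next
  fix \<xi> \<psi> :: "real \<Rightarrow> real \<Rightarrow> real"
  assume "\<forall>t. \<xi> t \<in> smooth_circle \<and> \<psi> t \<in> smooth_circle"
  then have s: "\<xi> t \<in> smooth_circle" "\<psi> t \<in> smooth_circle" for t by blast+
  let ?X = "drop_field \<sigma>\<^sub>0 \<alpha>\<^sub>0" and ?Y = "\<lambda>\<eta> \<zeta>. J_op \<alpha>\<^sub>0 \<eta> (L2_gradient (hamiltonian \<sigma>\<^sub>0 \<alpha>\<^sub>0) \<eta> \<zeta>)"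
  have eq: "\<exists>c. (\<forall>\<theta>. fst (?X (\<xi> t) (\<psi> t)) \<theta> = fst (?Y (\<xi> t) (\<psi> t)) \<theta>) \<and> (\<forall>\<theta>. snd (?X (\<xi> t) (\<psi> t)) \<theta> = snd (?Y (\<xi> t) (\<psi> t)) \<theta> + c)" for t
    using drop_field_hamiltonian[OF s(1)[of t] s(2)[of t], of \<sigma>\<^sub>0 \<alpha>\<^sub>0] unfolding eq_mod_const_def by blast
  have eq': "\<exists>c. (\<forall>\<theta>. fst (?Y (\<xi> t) (\<psi> t)) \<theta> = fst (?X (\<xi> t) (\<psi> t)) \<theta>) \<and> (\<forall>\<theta>. snd (?Y (\<xi> t) (\<psi> t)) \<theta> = snd (?X (\<xi> t) (\<psi> t)) \<theta> + c)" for t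
  proof -
    obtain c where c: "\<forall>\<theta>. fst (?X (\<xi> t) (\<psi> t)) \<theta> = fst (?Y (\<xi> t) (\<psi> t)) \<theta>" "\<forall>\<theta>. snd (?X (\<xi> t) (\<psi> t)) \<theta> = snd (?Y (\<xi> t) (\<psi> t)) \<theta> + c"
      using eq by blast
    then show ?thesis by (intro exI[of _ "- c"]) simp
  qed
  show "evolves_by ?X \<xi> \<psi> \<longleftrightarrow> evolves_by ?Y \<xi> \<psi>"
    using evolves_by_mod_const[of ?X \<xi> \<psi> ?Y, OF eq] evolves_by_mod_const[of ?Y \<xi> \<psi> ?X, OF eq'] by blast
qed

end
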